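(* Let $\mathcal{A}$ be an AB4-category and let $F:\Box^{op}\to\mathcal{A}$ be an arbitrary cubical object in $\mathcal{A}$. Then the homology objects $H_k(C^N_*(F))$ of the normalized complex of $F$ are isomorphic to $\varinjlim^{\Box^{op}}_kF$, for all $k\ge 0$.
   Context: **AB4-category.** An Abelian category with all small coproducts in which coproducts are exact (Grothendieck's axioms AB3, AB4). **Satellites of the colimit.** For a small category $\mathscr{C}$ and an AB4-category $\mathcal{A}$, $\varinjlim^{\mathscr{C}}_n:\mathcal{A}^{\mathscr{C}}\to\mathcal{A}$, $n\ge 0$, denote the left satellites (universal homological $\partial$-functor) of $\varinjlim^{\mathscr{C}}$. It is known that they exist and that $\varinjlim^{\mathscr{C}}_nF$ is naturally isomorphic to the $n$-th homology of the chain complex $C_n(\mathscr{C},F)=\bigoplus_{c_0\to\cdots\to c_n}F(c_0)$ with $d_n=\sum_{i=0}^n(-1)^id_n^i$, where $d_n^i$ omits $c_i$ from the sequence (composing morphisms when $0<i<n$), with $F(c_0\to c_1)$ applied for $i=0$. **Cube category.** $\Box$ has objects $\mathbb{I}^n=\{0,1\}^n$, $n\ge 0$ (with the product order); its morphisms are all compositions of the maps $\delta_i^{k,\varepsilon}:\mathbb{I}^{k-1}\to\mathbb{I}^k$, $\delta_i^{k,\varepsilon}(x_1,\dots,x_{k-1})=(x_1,\dots,x_{i-1},\varepsilon,x_i,\dots,x_{k-1})$ and $\sigma_i^k:\mathbb{I}^k\to\mathbb{I}^{k-1}$, $\sigma^k_i(x_1,\dots,x_k)=(x_1,\dots,x_{i-1},x_{i+1},\dots,x_k)$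 ($k\ge1$, $1\le i\le k$, $\varepsilon\in\{0,1\}$) (and identities). **Normalized complex.** For a cubical object $F:\Box^{op}\to\mathcal{A}$, let $$C^N_k(F)=\mathrm{Coker}\big(F(\mathbb{I}^{k-1})^{\oplus k}\xrightarrow{(F(\sigma^k_1),\dots,F(\sigma^k_k))}F(\mathbb{I}^k)\big),\quad k\ge0$$ (so $C^N_0(F)=F(\mathbb{I}^0)$), with differentials $d_k:C^N_k(F)\to C^N_{k-1}(F)$, $k\ge1$, induced on the cokernels by $\sum_{i=1}^k(-1)^i\big(F(\delta^{k,0}_i)-F(\delta^{k,1}_i)\big):F(\mathbb{I}^k)\to F(\mathbb{I}^{k-1})$, and $d_0=0$. *)

theory Defs
  imports "HOL-Library.FuncSet" "HOL-Algebra.FiniteProduct"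
begin

section \<open>Categories, functors and natural transformations\<close>

record ('o, 'm) cat =
  Ob  :: "'o set"
  Ar  :: "'m set"
  Dom :: "'m \<Rightarrow> 'o"
  Cod :: "'m \<Rightarrow> 'o"
  Idn :: "'o \<Rightarrow> 'm"
  Cmp :: "'m \<Rightarrow> 'm \<Rightarrow> 'm"  (infixr "\<cdot>\<index>" 70)

definition Hom :: "('o, 'm, 'x) cat_scheme \<Rightarrow> 'o \<Rightarrow> 'o \<Rightarrow> 'm set" where
  "Hom C x y = {f \<in> Ar C. Dom C f = x \<and> Cod C f = y}"

locale category =
  fixes C :: "('o, 'm, 'x) cat_scheme" (structure)
  assumes Dom_Ob: "f \<in> Ar C \<Longrightarrow> Dom C f \<in> Ob C"
    and Cod_Ob: "f \<in> Ar C \<Longrightarrow> Cod C f \<in> Ob C"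
    and Idn_Hom: "x \<in> Ob C \<Longrightarrow> Idn C x \<in> Hom C x x"
    and Cmp_Hom: "\<lbrakk>f \<in> Hom C x y; g \<in> Hom C y z\<rbrakk> \<Longrightarrow> g \<cdot> f \<in> Hom C x z"
    and Cmp_Idn_right: "f \<in> Hom C x y \<Longrightarrow> f \<cdot> Idn C x = f"
    and Cmp_Idn_left: "f \<in> Hom C x y \<Longrightarrow> Idn C y \<cdot> f = f"
    and Cmp_assoc: "\<lbrakk>f \<in> Hom C w x; g \<in> Hom C x y; h \<in> Hom C y z\<rbrakk>
                      \<Longrightarrow> (h \<cdot> g) \<cdot> f = h \<cdot> (g \<cdot> f)"

definition op_cat :: "('o, 'm) cat \<Rightarrow> ('o, 'm) cat" where
  "op_cat C = \<lparr>Ob = Ob C, Ar = Ar C, Dom = Cod C, Cod = Dom C, Idn = Idn C,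
               Cmp = (\<lambda>g f. Cmp C f g)\<rparr>"

definition isomorphic :: "('o, 'm, 'x) cat_scheme \<Rightarrow> 'o \<Rightarrow> 'o \<Rightarrow> bool" where
  "isomorphic C x y \<longleftrightarrow>
     (\<exists>f \<in> Hom C x y. \<exists>g \<in> Hom C y x. g \<cdot>\<^bsub>C\<^esub> f = Idn C x \<and> f \<cdot>\<^bsub>C\<^esub> g = Idn C y)"

definition mono_ar :: "('o, 'm, 'x) cat_scheme \<Rightarrow> 'm \<Rightarrow> bool" where
  "mono_ar C f \<longleftrightarrow> f \<in> Ar C \<and>
     (\<forall>w. \<forall>g \<in> Hom C w (Dom C f). \<forall>h \<in> Hom C w (Dom C f).
        f \<cdot>\<^bsub>C\<^esub> g = f \<cdot>\<^bsub>C\<^esub> h \<longrightarrow> g = h)"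

definition epi_ar :: "('o, 'm, 'x) cat_scheme \<Rightarrow> 'm \<Rightarrow> bool" where
  "epi_ar C f \<longleftrightarrow> f \<in> Ar C \<and>
     (\<forall>w. \<forall>g \<in> Hom C (Cod C f) w. \<forall>h \<in> Hom C (Cod C f) w.
        g \<cdot>\<^bsub>C\<^esub> f = h \<cdot>\<^bsub>C\<^esub> f \<longrightarrow> g = h)"

text \<open>Functors and natural transformations are required to be extensional (\<open>undefined\<close> outside
  the source category), so that equality in HOL is equality of functors, respectively of natural
  transformations.\<close>

datatype ('c, 'k, 'o, 'm) fctr = Fctr (on_ob: "'c \<Rightarrow> 'o") (on_ar: "'k \<Rightarrow> 'm")

definition is_functor ::
  "('c, 'k, 'x) cat_scheme \<Rightarrow> ('o, 'm, 'y) cat_scheme \<Rightarrow> ('c, 'k, 'o, 'm) fctr \<Rightarrow> bool" where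
  "is_functor C D F \<longleftrightarrow>
     on_ob F \<in> Ob C \<rightarrow>\<^sub>E Ob D \<and> on_ar F \<in> extensional (Ar C) \<and>
     (\<forall>f \<in> Ar C. on_ar F f \<in> Hom D (on_ob F (Dom C f)) (on_ob F (Cod C f))) \<and>
     (\<forall>x \<in> Ob C. on_ar F (Idn C x) = Idn D (on_ob F x)) \<and>
     (\<forall>f \<in> Ar C. \<forall>g \<in> Ar C. Cod C f = Dom C g \<longrightarrow>
        on_ar F (g \<cdot>\<^bsub>C\<^esub> f) = on_ar F g \<cdot>\<^bsub>D\<^esub> on_ar F f)"

datatype ('c, 'k, 'o, 'm) ntrans =
  NTrans (nt_dom: "('c, 'k, 'o, 'm) fctr") (nt_cod: "('c, 'k, 'o, 'm) fctr") (nt_at: "'c \<Rightarrow> 'm")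

definition is_ntrans ::
  "('c, 'k, 'x) cat_scheme \<Rightarrow> ('o, 'm, 'y) cat_scheme \<Rightarrow> ('c, 'k, 'o, 'm) ntrans \<Rightarrow> bool" where
  "is_ntrans C D \<eta> \<longleftrightarrow>
     is_functor C D (nt_dom \<eta>) \<and> is_functor C D (nt_cod \<eta>) \<and>
     nt_at \<eta> \<in> (\<Pi>\<^sub>E x \<in> Ob C. Hom D (on_ob (nt_dom \<eta>) x) (on_ob (nt_cod \<eta>) x)) \<and>
     (\<forall>f \<in> Ar C. nt_at \<eta> (Cod C f) \<cdot>\<^bsub>D\<^esub> on_ar (nt_dom \<eta>) f
                 = on_ar (nt_cod \<eta>) f \<cdot>\<^bsub>D\<^esub> nt_at \<eta> (Dom C f))"


section \<open>Abelian categories\<close>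

record ('o, 'm) addcat = "('o, 'm) cat" +
  Plus :: "'m \<Rightarrow> 'm \<Rightarrow> 'm"
  Null :: "'o \<Rightarrow> 'o \<Rightarrow> 'm"

text \<open>The hom-groups are additive groups, but HOL-Algebra groups are written multiplicatively:
  in \<open>hom_grp\<close>, \<open>\<otimes>\<close> is the sum of arrows, \<open>inv\<close> the negative, \<open>[^]\<close> the integer multiple and
  \<open>finprod\<close> the finite sum.\<close>

definition hom_grp :: "('o, 'm, 'x) addcat_scheme \<Rightarrow> 'o \<Rightarrow> 'o \<Rightarrow> 'm monoid" where
  "hom_grp A x y = \<lparr>carrier = Hom A x y, mult = Plus A, one = Null A x y\<rparr>"

definition is_zero_ob :: "('o, 'm, 'x) cat_scheme \<Rightarrow> 'o \<Rightarrow> bool" where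
  "is_zero_ob A z \<longleftrightarrow> z \<in> Ob A \<and>
     (\<forall>x \<in> Ob A. (\<exists>!f. f \<in> Hom A z x) \<and> (\<exists>!f. f \<in> Hom A x z))"

definition is_kernel :: "('o, 'm, 'x) addcat_scheme \<Rightarrow> 'm \<Rightarrow> 'm \<Rightarrow> bool" where
  "is_kernel A f k \<longleftrightarrow> f \<in> Ar A \<and> k \<in> Ar A \<and> Cod A k = Dom A f \<and>
     f \<cdot>\<^bsub>A\<^esub> k = Null A (Dom A k) (Cod A f) \<and>
     (\<forall>h \<in> Ar A. Cod A h = Dom A f \<and> f \<cdot>\<^bsub>A\<^esub> h = Null A (Dom A h) (Cod A f) \<longrightarrow>
        (\<exists>!u. u \<in> Hom A (Dom A h) (Dom A k) \<and> k \<cdot>\<^bsub>A\<^esub> u = h))"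

definition is_cokernel :: "('o, 'm, 'x) addcat_scheme \<Rightarrow> 'm \<Rightarrow> 'm \<Rightarrow> bool" where
  "is_cokernel A f q \<longleftrightarrow> f \<in> Ar A \<and> q \<in> Ar A \<and> Dom A q = Cod A f \<and>
     q \<cdot>\<^bsub>A\<^esub> f = Null A (Dom A f) (Cod A q) \<and>
     (\<forall>h \<in> Ar A. Dom A h = Cod A f \<and> h \<cdot>\<^bsub>A\<^esub> f = Null A (Dom A f) (Cod A h) \<longrightarrow>
        (\<exists>!u. u \<in> Hom A (Cod A q) (Cod A h) \<and> u \<cdot>\<^bsub>A\<^esub> q = h))"

definition is_biproduct :: "('o, 'm, 'x) addcat_scheme \<Rightarrow> 'o \<Rightarrow> 'o \<Rightarrow> 'o \<Rightarrow> bool" where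
  "is_biproduct A x y b \<longleftrightarrow> b \<in> Ob A \<and>
     (\<exists>i \<in> Hom A x b. \<exists>j \<in> Hom A y b. \<exists>p \<in> Hom A b x. \<exists>q \<in> Hom A b y.
        p \<cdot>\<^bsub>A\<^esub> i = Idn A x \<and> q \<cdot>\<^bsub>A\<^esub> j = Idn A y \<and>
        Plus A (i \<cdot>\<^bsub>A\<^esub> p) (j \<cdot>\<^bsub>A\<^esub> q) = Idn A b)"

definition is_coproduct ::
  "('o, 'm, 'x) cat_scheme \<Rightarrow> 'i set \<Rightarrow> ('i \<Rightarrow> 'o) \<Rightarrow> 'o \<Rightarrow> ('i \<Rightarrow> 'm) \<Rightarrow> bool" where
  "is_coproduct A I X c \<iota> \<longleftrightarrow> c \<in> Ob A \<and> (\<forall>i \<in> I. \<iota> i \<in> Hom A (X i) c) \<and>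
     (\<forall>y \<in> Ob A. \<forall>g. (\<forall>i \<in> I. g i \<in> Hom A (X i) y) \<longrightarrow>
        (\<exists>!h. h \<in> Hom A c y \<and> (\<forall>i \<in> I. h \<cdot>\<^bsub>A\<^esub> \<iota> i = g i)))"

locale preadditive_category = category A
  for A :: "('o, 'm, 'x) addcat_scheme" (structure) +
  assumes hom_grp_comm_group: "\<lbrakk>x \<in> Ob A; y \<in> Ob A\<rbrakk> \<Longrightarrow> comm_group (hom_grp A x y)"
    and Plus_Cmp_distrib: "\<lbrakk>f \<in> Hom A x y; g \<in> Hom A x y; h \<in> Hom A y z\<rbrakk>
                             \<Longrightarrow> h \<cdot> Plus A f g = Plus A (h \<cdot> f) (h \<cdot> g)"
    and Cmp_Plus_distrib: "\<lbrakk>f \<in> Hom A y z; g \<in> Hom A y z; h \<in> Hom A x y\<rbrakk>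
                             \<Longrightarrow> Plus A f g \<cdot> h = Plus A (f \<cdot> h) (g \<cdot> h)"

locale abelian_category = preadditive_category A
  for A :: "('o, 'm, 'x) addcat_scheme" (structure) +
  assumes ex_zero_ob: "\<exists>z. is_zero_ob A z"
    and ex_biproduct: "\<lbrakk>x \<in> Ob A; y \<in> Ob A\<rbrakk> \<Longrightarrow> \<exists>b. is_biproduct A x y b"
    and ex_kernel: "f \<in> Ar A \<Longrightarrow> \<exists>k. is_kernel A f k"
    and ex_cokernel: "f \<in> Ar A \<Longrightarrow> \<exists>q. is_cokernel A f q"
    and mono_normal: "mono_ar A f \<Longrightarrow> \<exists>g. is_kernel A g f"
    and epi_normal: "epi_ar A f \<Longrightarrow> \<exists>g. is_cokernel A g f"

definition short_exact :: "('o, 'm, 'x) addcat_scheme \<Rightarrow> 'm \<Rightarrow> 'm \<Rightarrow> bool" where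
  "short_exact A f g \<longleftrightarrow> is_kernel A g f \<and> is_cokernel A f g"

text \<open>Exactness of \<open>X \<rightarrow> Y \<rightarrow> Z\<close> at \<open>Y\<close>: the image of \<open>f\<close>, i.e. the kernel of its cokernel,
  is the kernel of \<open>g\<close>.\<close>

definition exact_at :: "('o, 'm, 'x) addcat_scheme \<Rightarrow> 'm \<Rightarrow> 'm \<Rightarrow> bool" where
  "exact_at A f g \<longleftrightarrow> Cod A f = Dom A g \<and>
     (\<exists>q k. is_cokernel A f q \<and> is_kernel A q k \<and> is_kernel A g k)"

text \<open>HOL has no universe of small sets. The small index sets are taken to be the sets over a
  type \<open>'i\<close>, which should be infinite in order to play that role. (Coproducts indexed
  by \<^emph>\<open>all\<close> sets over \<open>'m\<close> would force the category to be trivial.)\<close>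

definition AB4_category :: "('o, 'm, 'x) addcat_scheme \<Rightarrow> 'i itself \<Rightarrow> bool" where
  "AB4_category A TYPE('i) \<longleftrightarrow> abelian_category A \<and>
     (\<forall>(I :: 'i set) X. X ` I \<subseteq> Ob A \<longrightarrow> (\<exists>c \<iota>. is_coproduct A I X c \<iota>)) \<and>
     (\<forall>(I :: 'i set) X Y Z f g c\<^sub>X \<iota>\<^sub>X c\<^sub>Y \<iota>\<^sub>Y c\<^sub>Z \<iota>\<^sub>Z. \<forall>u \<in> Hom A c\<^sub>X c\<^sub>Y. \<forall>v \<in> Hom A c\<^sub>Y c\<^sub>Z.
        (\<forall>i \<in> I. f i \<in> Hom A (X i) (Y i) \<and> g i \<in> Hom A (Y i) (Z i) \<and> short_exact A (f i) (g i)) \<and>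
        is_coproduct A I X c\<^sub>X \<iota>\<^sub>X \<and> is_coproduct A I Y c\<^sub>Y \<iota>\<^sub>Y \<and> is_coproduct A I Z c\<^sub>Z \<iota>\<^sub>Z \<and>
        (\<forall>i \<in> I. u \<cdot>\<^bsub>A\<^esub> \<iota>\<^sub>X i = \<iota>\<^sub>Y i \<cdot>\<^bsub>A\<^esub> f i \<and> v \<cdot>\<^bsub>A\<^esub> \<iota>\<^sub>Y i = \<iota>\<^sub>Z i \<cdot>\<^bsub>A\<^esub> g i) \<longrightarrow>
        short_exact A u v)"


section \<open>Functor categories and satellites of the colimit\<close>

definition fun_cat :: "('c, 'k, 'x) cat_scheme \<Rightarrow> ('o, 'm, 'y) addcat_scheme \<Rightarrow>
    (('c, 'k, 'o, 'm) fctr, ('c, 'k, 'o, 'm) ntrans) addcat" where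
  "fun_cat C A =
    \<lparr>Ob = {F. is_functor C A F}, Ar = {\<eta>. is_ntrans C A \<eta>}, Dom = nt_dom, Cod = nt_cod,
     Idn = (\<lambda>F. NTrans F F (\<lambda>x \<in> Ob C. Idn A (on_ob F x))),
     Cmp = (\<lambda>\<theta> \<eta>. NTrans (nt_dom \<eta>) (nt_cod \<theta>) (\<lambda>x \<in> Ob C. nt_at \<theta> x \<cdot>\<^bsub>A\<^esub> nt_at \<eta> x)),
     Plus = (\<lambda>\<theta> \<eta>. NTrans (nt_dom \<eta>) (nt_cod \<eta>) (\<lambda>x \<in> Ob C. Plus A (nt_at \<theta> x) (nt_at \<eta> x))),
     Null = (\<lambda>F G. NTrans F G (\<lambda>x \<in> Ob C. Null A (on_ob F x) (on_ob G x)))\<rparr>"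

definition is_additive_functor :: "('c, 'k, 'x) addcat_scheme \<Rightarrow> ('o, 'm, 'y) addcat_scheme \<Rightarrow>
    ('c, 'k, 'o, 'm) fctr \<Rightarrow> bool" where
  "is_additive_functor B A T \<longleftrightarrow> is_functor B A T \<and>
     (\<forall>x y. \<forall>f \<in> Hom B x y. \<forall>g \<in> Hom B x y.
        on_ar T (Plus B f g) = Plus A (on_ar T f) (on_ar T g))"

text \<open>The connecting arrow \<open>bd n f g : T\<^sub>n\<^sub>+\<^sub>1 Z \<rightarrow> T\<^sub>n X\<close> belongs to the short exact sequence
  \<open>0 \<rightarrow> X \<rightarrow> Y \<rightarrow> Z \<rightarrow> 0\<close> with arrows \<open>f\<close> and \<open>g\<close>.\<close>

definition homological_delta_functor :: "('c, 'k, 'x) addcat_scheme \<Rightarrow> ('o, 'm, 'y) addcat_scheme \<Rightarrow>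
    (nat \<Rightarrow> ('c, 'k, 'o, 'm) fctr) \<Rightarrow> (nat \<Rightarrow> 'k \<Rightarrow> 'k \<Rightarrow> 'm) \<Rightarrow> bool" where
  "homological_delta_functor B A T bd \<longleftrightarrow>
     (\<forall>n. is_additive_functor B A (T n)) \<and>
     (\<forall>n f g. short_exact B f g \<longrightarrow>
        bd n f g \<in> Hom A (on_ob (T (Suc n)) (Cod B g)) (on_ob (T n) (Dom B f))) \<and>
     (\<forall>n f g f' g' a b c. short_exact B f g \<and> short_exact B f' g' \<and>
        a \<in> Hom B (Dom B f) (Dom B f') \<and> b \<in> Hom B (Cod B f) (Cod B f') \<and>
        c \<in> Hom B (Cod B g) (Cod B g') \<and>
        b \<cdot>\<^bsub>B\<^esub> f = f' \<cdot>\<^bsub>B\<^esub> a \<and> c \<cdot>\<^bsub>B\<^esub> g = g' \<cdot>\<^bsub>B\<^esub> b \<longrightarrow>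
        on_ar (T n) a \<cdot>\<^bsub>A\<^esub> bd n f g = bd n f' g' \<cdot>\<^bsub>A\<^esub> on_ar (T (Suc n)) c) \<and>
     (\<forall>n f g. short_exact B f g \<longrightarrow>
        exact_at A (on_ar (T n) f) (on_ar (T n) g) \<and>
        exact_at A (on_ar (T (Suc n)) g) (bd n f g) \<and>
        exact_at A (bd n f g) (on_ar (T n) f)) \<and>
     (\<forall>f g. short_exact B f g \<longrightarrow> epi_ar A (on_ar (T 0) g))"

definition delta_morphism :: "('c, 'k, 'x) addcat_scheme \<Rightarrow> ('o, 'm, 'y) addcat_scheme \<Rightarrow>
    (nat \<Rightarrow> ('c, 'k, 'o, 'm) fctr) \<Rightarrow> (nat \<Rightarrow> 'k \<Rightarrow> 'k \<Rightarrow> 'm) \<Rightarrow>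
    (nat \<Rightarrow> ('c, 'k, 'o, 'm) fctr) \<Rightarrow> (nat \<Rightarrow> 'k \<Rightarrow> 'k \<Rightarrow> 'm) \<Rightarrow>
    (nat \<Rightarrow> ('c, 'k, 'o, 'm) ntrans) \<Rightarrow> bool" where
  "delta_morphism B A S bdS T bdT \<phi> \<longleftrightarrow>
     (\<forall>n. \<phi> n \<in> Hom (fun_cat B A) (S n) (T n)) \<and>
     (\<forall>n f g. short_exact B f g \<longrightarrow>
        nt_at (\<phi> n) (Dom B f) \<cdot>\<^bsub>A\<^esub> bdS n f g = bdT n f g \<cdot>\<^bsub>A\<^esub> nt_at (\<phi> (Suc n)) (Cod B g))"

definition universal_delta_functor :: "('c, 'k, 'x) addcat_scheme \<Rightarrow> ('o, 'm, 'y) addcat_scheme \<Rightarrow>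
    (nat \<Rightarrow> ('c, 'k, 'o, 'm) fctr) \<Rightarrow> (nat \<Rightarrow> 'k \<Rightarrow> 'k \<Rightarrow> 'm) \<Rightarrow> bool" where
  "universal_delta_functor B A T bd \<longleftrightarrow> homological_delta_functor B A T bd \<and>
     (\<forall>S bdS. homological_delta_functor B A S bdS \<longrightarrow>
        (\<forall>\<phi>\<^sub>0 \<in> Hom (fun_cat B A) (S 0) (T 0).
           \<exists>!\<phi>. \<phi> 0 = \<phi>\<^sub>0 \<and> delta_morphism B A S bdS T bd \<phi>))"

definition is_cocone :: "('c, 'k, 'x) cat_scheme \<Rightarrow> ('o, 'm, 'y) cat_scheme \<Rightarrow>
    ('c, 'k, 'o, 'm) fctr \<Rightarrow> 'o \<Rightarrow> ('c \<Rightarrow> 'm) \<Rightarrow> bool" where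
  "is_cocone C A F c \<iota> \<longleftrightarrow> c \<in> Ob A \<and> (\<forall>x \<in> Ob C. \<iota> x \<in> Hom A (on_ob F x) c) \<and>
     (\<forall>f \<in> Ar C. \<iota> (Cod C f) \<cdot>\<^bsub>A\<^esub> on_ar F f = \<iota> (Dom C f))"

definition is_colimit :: "('c, 'k, 'x) cat_scheme \<Rightarrow> ('o, 'm, 'y) cat_scheme \<Rightarrow>
    ('c, 'k, 'o, 'm) fctr \<Rightarrow> 'o \<Rightarrow> ('c \<Rightarrow> 'm) \<Rightarrow> bool" where
  "is_colimit C A F c \<iota> \<longleftrightarrow> is_cocone C A F c \<iota> \<and>
     (\<forall>y g. is_cocone C A F y g \<longrightarrow>
        (\<exists>!h. h \<in> Hom A c y \<and> (\<forall>x \<in> Ob C. h \<cdot>\<^bsub>A\<^esub> \<iota> x = g x)))"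

definition is_colimit_functor :: "('c, 'k, 'x) cat_scheme \<Rightarrow> ('o, 'm, 'y) addcat_scheme \<Rightarrow>
    (('c, 'k, 'o, 'm) fctr, ('c, 'k, 'o, 'm) ntrans, 'o, 'm) fctr \<Rightarrow> bool" where
  "is_colimit_functor C A L \<longleftrightarrow> is_functor (fun_cat C A) A L \<and>
     (\<exists>\<iota>. (\<forall>F. is_functor C A F \<longrightarrow> is_colimit C A F (on_ob L F) (\<iota> F)) \<and>
          (\<forall>\<eta>. is_ntrans C A \<eta> \<longrightarrow>
             (\<forall>x \<in> Ob C. on_ar L \<eta> \<cdot>\<^bsub>A\<^esub> \<iota> (nt_dom \<eta>) x = \<iota> (nt_cod \<eta>) x \<cdot>\<^bsub>A\<^esub> nt_at \<eta> x)))"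

definition left_satellites_of_colimit :: "('c, 'k, 'x) cat_scheme \<Rightarrow> ('o, 'm, 'y) addcat_scheme \<Rightarrow>
    (nat \<Rightarrow> (('c, 'k, 'o, 'm) fctr, ('c, 'k, 'o, 'm) ntrans, 'o, 'm) fctr) \<Rightarrow>
    (nat \<Rightarrow> ('c, 'k, 'o, 'm) ntrans \<Rightarrow> ('c, 'k, 'o, 'm) ntrans \<Rightarrow> 'm) \<Rightarrow> bool" where
  "left_satellites_of_colimit C A T bd \<longleftrightarrow>
     is_colimit_functor C A (T 0) \<and> universal_delta_functor (fun_cat C A) A T bd"


section \<open>The cube category\<close>

definition cube :: "nat \<Rightarrow> bool list set" where
  "cube n = {x. length x = n}"

text \<open>An arrow \<open>(m, n, f)\<close> is a map \<open>f\<close> from \<open>cube m\<close> to \<open>cube n\<close>, extensional on \<open>cube m\<close>; the object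
  \<open>cube n\<close> is encoded by \<open>n\<close>.\<close>

type_synonym box_ar = "nat \<times> nat \<times> (bool list \<Rightarrow> bool list)"

definition box_cmp :: "box_ar \<Rightarrow> box_ar \<Rightarrow> box_ar" where
  "box_cmp g f = (fst f, fst (snd g), compose (cube (fst f)) (snd (snd g)) (snd (snd f)))"

definition box_id :: "nat \<Rightarrow> box_ar" where
  "box_id n = (n, n, \<lambda>x \<in> cube n. x)"

definition face :: "nat \<Rightarrow> nat \<Rightarrow> bool \<Rightarrow> box_ar" where
  "face k i \<epsilon> = (k - 1, k, \<lambda>x \<in> cube (k - 1). take (i - 1) x @ \<epsilon> # drop (i - 1) x)"

definition degen :: "nat \<Rightarrow> nat \<Rightarrow> box_ar" where
  "degen k i = (k, k - 1, \<lambda>x \<in> cube k. take (i - 1) x @ drop i x)"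

inductive_set box_arrows :: "box_ar set" where
  box_id: "box_id n \<in> box_arrows"
| face: "\<lbrakk>1 \<le> i; i \<le> k\<rbrakk> \<Longrightarrow> face k i \<epsilon> \<in> box_arrows"
| degen: "\<lbrakk>1 \<le> i; i \<le> k\<rbrakk> \<Longrightarrow> degen k i \<in> box_arrows"
| cmp: "\<lbrakk>f \<in> box_arrows; g \<in> box_arrows; fst (snd f) = fst g\<rbrakk> \<Longrightarrow> box_cmp g f \<in> box_arrows"

definition Box :: "(nat, box_ar) cat" where
  "Box = \<lparr>Ob = UNIV, Ar = box_arrows, Dom = fst, Cod = (\<lambda>f. fst (snd f)),
          Idn = box_id, Cmp = box_cmp\<rparr>"

lemma box_arrows_funcset:
  "f \<in> box_arrows \<Longrightarrow> snd (snd f) \<in> cube (fst f) \<rightarrow>\<^sub>E cube (fst (snd f))"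
proof (induction rule: box_arrows.induct)
  case (cmp f g)
  then show ?case by (auto simp: box_cmp_def compose_def PiE_def Pi_def extensional_def)
qed (auto simp: box_id_def face_def degen_def cube_def split: if_splits)

lemma category_Box: "category Box"
proof
  fix f x y assume f: "f \<in> Hom Box x y"
  then have F: "snd (snd f) \<in> cube x \<rightarrow>\<^sub>E cube y" and e: "f = (x, y, snd (snd f))"
    using box_arrows_funcset[of f] by (auto simp: Hom_def Box_def)
  have "compose (cube x) (snd (snd f)) (\<lambda>z \<in> cube x. z) = snd (snd f)"
    using F by (auto simp: compose_def PiE_def extensional_def fun_eq_iff restrict_def)
  then show "f \<cdot>\<^bsub>Box\<^esub> Idn Box x = f"
    using e by (auto simp: Box_def box_cmp_def box_id_def prod_eq_iff)
  have "compose (cube x) (\<lambda>z \<in> cube y. z) (snd (snd f)) = snd (snd f)"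
    using F by (auto simp: compose_def PiE_def extensional_def fun_eq_iff restrict_def Pi_def)
  then show "Idn Box y \<cdot>\<^bsub>Box\<^esub> f = f"
    using e by (auto simp: Box_def box_cmp_def box_id_def prod_eq_iff)
next
  fix f w x g y h z
  assume "f \<in> Hom Box w x" "g \<in> Hom Box x y" "h \<in> Hom Box y z"
  then show "(h \<cdot>\<^bsub>Box\<^esub> g) \<cdot>\<^bsub>Box\<^esub> f = h \<cdot>\<^bsub>Box\<^esub> g \<cdot>\<^bsub>Box\<^esub> f"
    using box_arrows_funcset[of f]
    by (auto simp: Hom_def Box_def box_cmp_def compose_def fun_eq_iff PiE_def Pi_def)
qed (auto simp: Hom_def Box_def box_cmp_def box_id_def
       intro: box_arrows.box_id[unfolded box_id_def] box_arrows.cmp[unfolded box_cmp_def])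

section \<open>The normalized complex of a cubical object and its homology\<close>

text \<open>Kernels, cokernels and direct sums are only determined up to isomorphism; fixed choices
  are made.\<close>

definition ker_ar :: "('o, 'm, 'x) addcat_scheme \<Rightarrow> 'm \<Rightarrow> 'm" where
  "ker_ar A f = (SOME k. is_kernel A f k)"

definition coker_ar :: "('o, 'm, 'x) addcat_scheme \<Rightarrow> 'm \<Rightarrow> 'm" where
  "coker_ar A f = (SOME q. is_cokernel A f q)"

text \<open>For \<open>f : X \<rightarrow> Y\<close> and \<open>g : Y \<rightarrow> Z\<close> with zero composite: the cokernel of the arrow from \<open>X\<close>
  to the kernel of \<open>g\<close> induced by \<open>f\<close>.\<close>

definition homology_ob :: "('o, 'm, 'x) addcat_scheme \<Rightarrow> 'm \<Rightarrow> 'm \<Rightarrow> 'o" where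
  "homology_ob A f g =
     Cod A (coker_ar A (THE u. u \<in> Hom A (Dom A f) (Dom A (ker_ar A g)) \<and> ker_ar A g \<cdot>\<^bsub>A\<^esub> u = f))"

context
  fixes A :: "('o, 'm, 'x) addcat_scheme" and F :: "(nat, box_ar, 'o, 'm) fctr"
begin

definition degen_sum :: "nat \<Rightarrow> 'o \<times> (nat \<Rightarrow> 'm)" where
  "degen_sum k = (SOME (c, \<iota>). is_coproduct A {1..k} (\<lambda>i. on_ob F (k - 1)) c \<iota>)"

definition degen_ar :: "nat \<Rightarrow> 'm" where
  "degen_ar k = (THE h. h \<in> Hom A (fst (degen_sum k)) (on_ob F k) \<and>
                   (\<forall>i \<in> {1..k}. h \<cdot>\<^bsub>A\<^esub> snd (degen_sum k) i = on_ar F (degen k i)))"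

text \<open>The projection of \<open>F(cube k)\<close> onto the \<open>k\<close>-th normalized object; for \<open>k = 0\<close> the direct sum is
  empty, so that it is an isomorphism.\<close>

definition norm_proj :: "nat \<Rightarrow> 'm" where
  "norm_proj k = coker_ar A (degen_ar k)"

definition norm_ob :: "nat \<Rightarrow> 'o" where
  "norm_ob k = Cod A (norm_proj k)"

definition cube_diff :: "nat \<Rightarrow> 'm" where
  "cube_diff k =
     (let G = hom_grp A (on_ob F k) (on_ob F (k - 1))
      in finprod G (\<lambda>i. (on_ar F (face k i False) \<otimes>\<^bsub>G\<^esub> inv\<^bsub>G\<^esub> on_ar F (face k i True))
                          [^]\<^bsub>G\<^esub> ((-1) ^ i :: int)) {1..k})"

definition norm_diff :: "nat \<Rightarrow> 'm" where
  "norm_diff k =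
     (if k = 0 then Null A (norm_ob 0) (SOME z. is_zero_ob A z)
      else (THE d. d \<in> Hom A (norm_ob k) (norm_ob (k - 1)) \<and>
                   d \<cdot>\<^bsub>A\<^esub> norm_proj k = norm_proj (k - 1) \<cdot>\<^bsub>A\<^esub> cube_diff k))"

definition norm_homology :: "nat \<Rightarrow> 'o" where
  "norm_homology k = homology_ob A (norm_diff (Suc k)) (norm_diff k)"

end

end

theory Submission
  imports Defs "HOL-Algebra.Free_Abelian_Groups" "HOL-Library.Countable_Set"
begin

text \<open>
  The normalized object of degree \<open>k\<close> is a natural direct summand of \<open>F(cube k)\<close>: the product of the
  idempotents \<open>1 - F(\<delta>\<^sub>i \<sigma>\<^sub>i)\<close>, with \<open>\<delta>\<^sub>i\<close> the face at \<open>False\<close>, is a natural idempotent whose kernel is the degenerate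
  part. Hence the normalized complex is exact in \<open>F\<close>, and its homology is a homological delta functor; in
  degree zero it is the coequalizer of the two faces of \<open>cube 1\<close>, which is the colimit because any two vertices
  of a cube are joined by edges. The canonical epimorphism onto \<open>F\<close> from the cubical object
  \<open>cube k \<mapsto> \<Oplus> F(Cod f)\<close>, with \<open>f\<close> running over all arrows out of \<open>cube k\<close>, effaces this delta functor in
  positive degrees: nondegenerate arrows into \<open>cube n\<close> are words in \<open>0\<close>, \<open>1\<close>, \<open>*\<close>, and the word complex
  has an explicit contraction to the word \<open>0...0\<close>. An effaceable delta functor receives a morphism from every
  delta functor extending a given transformation in degree zero, so it is isomorphic to the universal one.
\<close>

section \<open>Abelian categories\<close>

text \<open>Two weaker facts take its place: arrows lift between the chosen covers, and covers are
  acyclic. For a short exact sequence whose middle term is a cover, the connecting arrow is then a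
  monomorphism and the homology of the quotient is a kernel; transformations are constructed and
  compared by cancelling this monomorphism.

  The words have a geometric origin. The summands of the free object with target
  \<open>cube n\<close> that survive normalization are indexed by the faces of the
  \<open>n\<close>-cube, and the differential on them is the cellular boundary with constant
  coefficients \<open>F(cube n)\<close>. Acyclicity is therefore the contractibility of a cube. It
  is proved for formal integer sums of words, before any arrow of \<open>A\<close> enters, and only
  then transported.\<close>

lemma Hom_iff [simp]: "f \<in> Hom C x y \<longleftrightarrow> f \<in> Ar C \<and> Dom C f = x \<and> Cod C f = y"
  by (auto simp: Hom_def)

context category
begin

lemma Cmp_Ar [simp]:
  assumes "f \<in> Ar C" "g \<in> Ar C" "Cod C f = Dom C g"
  shows "g \<cdot> f \<in> Ar C" "Dom C (g \<cdot> f) = Dom C f" "Cod C (g \<cdot> f) = Cod C g"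
  using Cmp_Hom[of f "Dom C f" "Dom C g" g "Cod C g"] assms by auto

lemma Idn_Ar [simp]:
  assumes "x \<in> Ob C"
  shows "Idn C x \<in> Ar C" "Dom C (Idn C x) = x" "Cod C (Idn C x) = x"
  using Idn_Hom[OF assms] by auto

lemma Cmp_Idn [simp]:
  "\<lbrakk>f \<in> Ar C; Dom C f = x\<rbrakk> \<Longrightarrow> f \<cdot> Idn C x = f"
  "\<lbrakk>f \<in> Ar C; Cod C f = x\<rbrakk> \<Longrightarrow> Idn C x \<cdot> f = f"
  using Cmp_Idn_right[of f "Dom C f" "Cod C f"] Cmp_Idn_left[of f "Dom C f" "Cod C f"] by auto

lemma Dom_Cod_Ob [simp]: "f \<in> Ar C \<Longrightarrow> Dom C f \<in> Ob C" "f \<in> Ar C \<Longrightarrow> Cod C f \<in> Ob C"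
  by (rule Dom_Ob Cod_Ob; assumption)+

lemma Cmp_assoc' [simp]:
  "\<lbrakk>f \<in> Ar C; g \<in> Ar C; h \<in> Ar C; Cod C f = Dom C g; Cod C g = Dom C h\<rbrakk>
    \<Longrightarrow> (h \<cdot> g) \<cdot> f = h \<cdot> (g \<cdot> f)"
  using Cmp_assoc[of f "Dom C f" "Dom C g" g "Dom C h" h "Cod C h"] by simp

text \<open>The simplifier nests composites to the right, so an equation for a composite of two
  arrows has to be applicable in front of a further factor \<open>t\<close>.\<close>

lemma Cmp_extend:
  "\<lbrakk>g \<cdot> f = h; t \<in> Ar C; f \<in> Ar C; g \<in> Ar C; Cod C t = Dom C f; Cod C f = Dom C g\<rbrakk>
    \<Longrightarrow> g \<cdot> (f \<cdot> t) = h \<cdot> t"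
  by (metis Cmp_assoc')

end

text \<open>\<open>lift_ar\<close> is literally the inner description in \<open>homology_ob\<close>,
  and \<open>desc_ar\<close> has the shape of the one in \<open>norm_diff\<close>; facts about
  kernels and cokernels thus apply to those definitions after unfolding.\<close>

definition lift_ar :: "('o, 'm, 'x) cat_scheme \<Rightarrow> 'm \<Rightarrow> 'm \<Rightarrow> 'm" where
  "lift_ar A k h = (THE u. u \<in> Hom A (Dom A h) (Dom A k) \<and> k \<cdot>\<^bsub>A\<^esub> u = h)"

definition desc_ar :: "('o, 'm, 'x) cat_scheme \<Rightarrow> 'm \<Rightarrow> 'm \<Rightarrow> 'm" where
  "desc_ar A q h = (THE u. u \<in> Hom A (Cod A q) (Cod A h) \<and> u \<cdot>\<^bsub>A\<^esub> q = h)"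

section \<open>Sums, differences and zero arrows\<close>

context preadditive_category
begin

abbreviation plus (infixl "\<boxplus>" 65) where "f \<boxplus> g \<equiv> Plus A f g"

text \<open>The endpoints are read off the arrow, so that sums and differences can be calculated
  with as in a ring, without naming the hom-group each time.\<close>

definition neg :: "'m \<Rightarrow> 'm" where
  "neg f = inv\<^bsub>hom_grp A (Dom A f) (Cod A f)\<^esub> f"

definition dif :: "'m \<Rightarrow> 'm \<Rightarrow> 'm" (infixl "\<boxminus>" 65) where
  "f \<boxminus> g = f \<boxplus> neg g"

lemma hom_grp_sel [simp]:
  "carrier (hom_grp A x y) = Hom A x y" "f \<otimes>\<^bsub>hom_grp A x y\<^esub> g = f \<boxplus> g"
  "\<one>\<^bsub>hom_grp A x y\<^esub> = Null A x y"
  by (auto simp: hom_grp_def)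

lemma Null_Ar [simp]:
  assumes "x \<in> Ob A" "y \<in> Ob A"
  shows "Null A x y \<in> Ar A" "Dom A (Null A x y) = x" "Cod A (Null A x y) = y"
proof -
  interpret G: comm_group "hom_grp A x y" using hom_grp_comm_group assms by blast
  show "Null A x y \<in> Ar A" "Dom A (Null A x y) = x" "Cod A (Null A x y) = y"
    using G.one_closed by auto
qed

lemma Plus_Ar [simp]:
  assumes "f \<in> Ar A" "g \<in> Ar A" "Dom A f = Dom A g" "Cod A f = Cod A g"
  shows "f \<boxplus> g \<in> Ar A" "Dom A (f \<boxplus> g) = Dom A g" "Cod A (f \<boxplus> g) = Cod A g"
proof -
  interpret G: comm_group "hom_grp A (Dom A f) (Cod A f)" using hom_grp_comm_group assms by simp
  show "f \<boxplus> g \<in> Ar A" "Dom A (f \<boxplus> g) = Dom A g" "Cod A (f \<boxplus> g) = Cod A g"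
    using G.m_closed[of f g] assms by auto
qed

lemma neg_Ar [simp]:
  assumes "f \<in> Ar A"
  shows "neg f \<in> Ar A" "Dom A (neg f) = Dom A f" "Cod A (neg f) = Cod A f"
proof -
  interpret G: comm_group "hom_grp A (Dom A f) (Cod A f)" using hom_grp_comm_group assms by simp
  show "neg f \<in> Ar A" "Dom A (neg f) = Dom A f" "Cod A (neg f) = Cod A f"
    using G.inv_closed[of f] assms by (auto simp: neg_def)
qed

lemma dif_Ar [simp]:
  assumes "f \<in> Ar A" "g \<in> Ar A" "Dom A f = Dom A g" "Cod A f = Cod A g"
  shows "f \<boxminus> g \<in> Ar A" "Dom A (f \<boxminus> g) = Dom A g" "Cod A (f \<boxminus> g) = Cod A g"
  using assms by (simp_all add: dif_def)

lemma Plus_Null [simp]: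
  assumes "f \<in> Ar A" "Dom A f = x" "Cod A f = y"
  shows "Null A x y \<boxplus> f = f" "f \<boxplus> Null A x y = f"
    "f \<boxplus> neg f = Null A x y" "neg f \<boxplus> f = Null A x y"
proof -
  interpret G: comm_group "hom_grp A x y" using hom_grp_comm_group assms by auto
  show "Null A x y \<boxplus> f = f" "f \<boxplus> Null A x y = f"
    "f \<boxplus> neg f = Null A x y" "neg f \<boxplus> f = Null A x y"
    using G.l_one[of f] G.r_one[of f] G.l_inv[of f] G.r_inv[of f] assms by (auto simp: neg_def)
qed

lemma Plus_commute:
  assumes "f \<in> Ar A" "g \<in> Ar A" "Dom A f = Dom A g" "Cod A f = Cod A g"
  shows "f \<boxplus> g = g \<boxplus> f"
proof -
  interpret G: comm_group "hom_grp A (Dom A f) (Cod A f)" using hom_grp_comm_group assms by auto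
  show ?thesis using G.m_comm[of f g] assms by auto
qed

lemma Plus_assoc:
  assumes "f \<in> Ar A" "g \<in> Ar A" "h \<in> Ar A" "Dom A f = Dom A g" "Cod A f = Cod A g"
    "Dom A h = Dom A g" "Cod A h = Cod A g"
  shows "(f \<boxplus> g) \<boxplus> h = f \<boxplus> (g \<boxplus> h)"
proof -
  interpret G: comm_group "hom_grp A (Dom A f) (Cod A f)" using hom_grp_comm_group assms by auto
  show ?thesis using G.m_assoc[of f g h] assms by auto
qed

lemma Cmp_Plus:
  "\<lbrakk>f \<in> Ar A; g \<in> Ar A; h \<in> Ar A; Dom A f = Dom A g; Cod A f = Cod A g; Cod A g = Dom A h\<rbrakk>
    \<Longrightarrow> h \<cdot> (f \<boxplus> g) = h \<cdot> f \<boxplus> h \<cdot> g"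
  "\<lbrakk>f \<in> Ar A; g \<in> Ar A; h \<in> Ar A; Dom A f = Dom A g; Cod A f = Cod A g; Cod A h = Dom A g\<rbrakk>
    \<Longrightarrow> (f \<boxplus> g) \<cdot> h = f \<cdot> h \<boxplus> g \<cdot> h"
  by (rule Plus_Cmp_distrib[of _ "Dom A g" "Cod A g"] Cmp_Plus_distrib[of _ "Dom A g" "Cod A g"]; auto)+

lemma Plus_self_eq_Null:
  assumes "f \<in> Ar A" "f \<boxplus> f = f"
  shows "f = Null A (Dom A f) (Cod A f)"
proof -
  interpret G: comm_group "hom_grp A (Dom A f) (Cod A f)" using hom_grp_comm_group assms by auto
  show ?thesis using G.l_cancel_one[of f f] assms by auto
qed

text \<open>Composition with \<open>f\<close> is additive, hence sends a zero arrow to an arrow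
  \<open>x\<close> with \<open>x + x = x\<close>, and such an arrow vanishes by
  cancellation.\<close>

lemma Cmp_Null [simp]:
  assumes "f \<in> Ar A"
  shows "\<lbrakk>Dom A f = y; x \<in> Ob A\<rbrakk> \<Longrightarrow> f \<cdot> Null A x y = Null A x (Cod A f)"
    "\<lbrakk>Cod A f = x; y \<in> Ob A\<rbrakk> \<Longrightarrow> Null A x y \<cdot> f = Null A (Dom A f) y"
proof -
  assume h: "Dom A f = y" "x \<in> Ob A"
  then have n: "Null A x y \<in> Ar A" "Dom A (Null A x y) = x" "Cod A (Null A x y) = y"
    using assms by auto
  then have "Null A x y \<boxplus> Null A x y = Null A x y" by simp
  then have "f \<cdot> Null A x y \<boxplus> f \<cdot> Null A x y = f \<cdot> Null A x y"
    using Cmp_Plus(1)[of "Null A x y" "Null A x y" f] h n assms by simp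
  from Plus_self_eq_Null[OF _ this] show "f \<cdot> Null A x y = Null A x (Cod A f)"
    using h n assms by simp
next
  assume h: "Cod A f = x" "y \<in> Ob A"
  then have n: "Null A x y \<in> Ar A" "Dom A (Null A x y) = x" "Cod A (Null A x y) = y"
    using assms by auto
  then have "Null A x y \<boxplus> Null A x y = Null A x y" by simp
  then have "Null A x y \<cdot> f \<boxplus> Null A x y \<cdot> f = Null A x y \<cdot> f"
    using Cmp_Plus(2)[of "Null A x y" "Null A x y" f] h n assms by simp
  from Plus_self_eq_Null[OF _ this] show "Null A x y \<cdot> f = Null A (Dom A f) y"
    using h n assms by simp
qed

lemma Cmp_extend_Null:
  "\<lbrakk>g \<cdot> f = Null A (Dom A f) (Cod A g); t \<in> Ar A; f \<in> Ar A; g \<in> Ar A; Cod A t = Dom A f; Cod A f = Dom A g\<rbrakk>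
    \<Longrightarrow> g \<cdot> (f \<cdot> t) = Null A (Dom A t) (Cod A g)"
  "\<lbrakk>g \<cdot> f = Null A (Dom A f) (Cod A g); t \<in> Ar A; f \<in> Ar A; g \<in> Ar A; Dom A t = Cod A g; Cod A f = Dom A g\<rbrakk>
    \<Longrightarrow> (t \<cdot> g) \<cdot> f = Null A (Dom A f) (Cod A t)"
  by (simp_all add: Cmp_extend)

lemma neg_unique:
  assumes "f \<in> Ar A" "g \<in> Ar A" "Dom A f = Dom A g" "Cod A f = Cod A g"
    and "f \<boxplus> g = Null A (Dom A g) (Cod A g)"
  shows "g = neg f"
proof -
  interpret G: comm_group "hom_grp A (Dom A f) (Cod A f)" using hom_grp_comm_group assms by auto
  show ?thesis using G.inv_unique'[of f g] assms Plus_commute[of f g] by (auto simp: neg_def)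
qed

lemma Cmp_neg:
  "\<lbrakk>f \<in> Ar A; h \<in> Ar A; Cod A f = Dom A h\<rbrakk> \<Longrightarrow> h \<cdot> neg f = neg (h \<cdot> f)"
  "\<lbrakk>f \<in> Ar A; h \<in> Ar A; Cod A h = Dom A f\<rbrakk> \<Longrightarrow> neg f \<cdot> h = neg (f \<cdot> h)"
  by (rule neg_unique; simp flip: Cmp_Plus)+

lemma Cmp_dif:
  "\<lbrakk>f \<in> Ar A; g \<in> Ar A; h \<in> Ar A; Dom A f = Dom A g; Cod A f = Cod A g; Cod A g = Dom A h\<rbrakk>
    \<Longrightarrow> h \<cdot> (f \<boxminus> g) = h \<cdot> f \<boxminus> h \<cdot> g"
  "\<lbrakk>f \<in> Ar A; g \<in> Ar A; h \<in> Ar A; Dom A f = Dom A g; Cod A f = Cod A g; Cod A h = Dom A g\<rbrakk>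
    \<Longrightarrow> (f \<boxminus> g) \<cdot> h = f \<cdot> h \<boxminus> g \<cdot> h"
  by (simp_all add: dif_def Cmp_Plus Cmp_neg)

lemma neg_Null [simp]: "\<lbrakk>x \<in> Ob A; y \<in> Ob A\<rbrakk> \<Longrightarrow> neg (Null A x y) = Null A x y"
  by (rule neg_unique[symmetric]) auto

lemma neg_neg [simp]: "f \<in> Ar A \<Longrightarrow> neg (neg f) = f"
  by (rule neg_unique[symmetric]) auto

lemma dif_Null [simp]:
  assumes "f \<in> Ar A" "Dom A f = x" "Cod A f = y"
  shows "f \<boxminus> Null A x y = f" "f \<boxminus> f = Null A x y"
  using assms by (auto simp: dif_def)

lemma dif_eq_Null [simp]:
  assumes "f \<in> Ar A" "g \<in> Ar A" "Dom A f = x" "Dom A g = x" "Cod A f = y" "Cod A g = y"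
  shows "f \<boxminus> g = Null A x y \<longleftrightarrow> f = g"
proof
  assume "f \<boxminus> g = Null A x y"
  then have "neg g \<boxplus> f = Null A x y" using assms by (simp add: dif_def Plus_commute[of f])
  then show "f = g" using neg_unique[of "neg g" f] assms by simp
qed (use assms in simp)

lemma Plus_dif [simp]:
  assumes "f \<in> Ar A" "g \<in> Ar A" "Dom A f = Dom A g" "Cod A f = Cod A g"
  shows "g \<boxplus> (f \<boxminus> g) = f" "(f \<boxminus> g) \<boxplus> g = f" "(f \<boxplus> g) \<boxminus> g = f"
proof -
  show 2: "(f \<boxminus> g) \<boxplus> g = f" "(f \<boxplus> g) \<boxminus> g = f" using assms by (simp_all add: dif_def Plus_assoc)
  show "g \<boxplus> (f \<boxminus> g) = f" using assms 2 by (subst Plus_commute) auto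
qed

lemma mono_iff:
  "mono_ar A f \<longleftrightarrow> f \<in> Ar A \<and>
    (\<forall>t \<in> Ar A. Cod A t = Dom A f \<and> f \<cdot> t = Null A (Dom A t) (Cod A f) \<longrightarrow> t = Null A (Dom A t) (Dom A f))"
  (is "_ \<longleftrightarrow> ?r")
proof
  assume m: "mono_ar A f"
  show ?r
  proof (intro conjI ballI impI)
    show f: "f \<in> Ar A" using m by (simp add: mono_ar_def)
    fix t assume t: "t \<in> Ar A" "Cod A t = Dom A f \<and> f \<cdot> t = Null A (Dom A t) (Cod A f)"
    have "f \<cdot> t = f \<cdot> Null A (Dom A t) (Dom A f)" using f t by simp
    moreover have "t \<in> Hom A (Dom A t) (Dom A f)" "Null A (Dom A t) (Dom A f) \<in> Hom A (Dom A t) (Dom A f)"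
      using t f by auto
    ultimately show "t = Null A (Dom A t) (Dom A f)" using m unfolding mono_ar_def by blast
  qed
next
  assume r: ?r
  show "mono_ar A f" unfolding mono_ar_def
  proof (intro conjI allI ballI impI)
    fix w g h assume "g \<in> Hom A w (Dom A f)" "h \<in> Hom A w (Dom A f)" "f \<cdot> g = f \<cdot> h"
    then have "f \<cdot> (g \<boxminus> h) = Null A w (Cod A f)" using r by (simp add: Cmp_dif)
    with \<open>g \<in> _\<close> \<open>h \<in> _\<close> have "g \<boxminus> h = Null A w (Dom A f)"
      using r[THEN conjunct2, rule_format, of "g \<boxminus> h"] by simp
    with \<open>g \<in> _\<close> \<open>h \<in> _\<close> show "g = h" by simp
  qed (use r in auto)
qed

lemma epi_iff:
  "epi_ar A f \<longleftrightarrow> f \<in> Ar A \<and>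
    (\<forall>t \<in> Ar A. Dom A t = Cod A f \<and> t \<cdot> f = Null A (Dom A f) (Cod A t) \<longrightarrow> t = Null A (Cod A f) (Cod A t))"
  (is "_ \<longleftrightarrow> ?r")
proof
  assume m: "epi_ar A f"
  show ?r
  proof (intro conjI ballI impI)
    show f: "f \<in> Ar A" using m by (simp add: epi_ar_def)
    fix t assume t: "t \<in> Ar A" "Dom A t = Cod A f \<and> t \<cdot> f = Null A (Dom A f) (Cod A t)"
    have "t \<cdot> f = Null A (Cod A f) (Cod A t) \<cdot> f" using f t by simp
    moreover have "t \<in> Hom A (Cod A f) (Cod A t)" "Null A (Cod A f) (Cod A t) \<in> Hom A (Cod A f) (Cod A t)"
      using t f by auto
    ultimately show "t = Null A (Cod A f) (Cod A t)" using m unfolding epi_ar_def by blast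
  qed
next
  assume r: ?r
  show "epi_ar A f" unfolding epi_ar_def
  proof (intro conjI allI ballI impI)
    fix w g h assume "g \<in> Hom A (Cod A f) w" "h \<in> Hom A (Cod A f) w" "g \<cdot> f = h \<cdot> f"
    then have "(g \<boxminus> h) \<cdot> f = Null A (Dom A f) w" using r by (simp add: Cmp_dif)
    with \<open>g \<in> _\<close> \<open>h \<in> _\<close> have "g \<boxminus> h = Null A (Cod A f) w"
      using r[THEN conjunct2, rule_format, of "g \<boxminus> h"] by simp
    with \<open>g \<in> _\<close> \<open>h \<in> _\<close> show "g = h" by simp
  qed (use r in auto)
qed

lemma mono_arI:
  assumes "f \<in> Ar A" "\<And>t. \<lbrakk>t \<in> Ar A; Cod A t = Dom A f; f \<cdot> t = Null A (Dom A t) (Cod A f)\<rbrakk> \<Longrightarrow> t = Null A (Dom A t) (Dom A f)"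
  shows "mono_ar A f"
  using assms by (auto simp: mono_iff)

lemma epi_arI:
  assumes "f \<in> Ar A" "\<And>t. \<lbrakk>t \<in> Ar A; Dom A t = Cod A f; t \<cdot> f = Null A (Dom A f) (Cod A t)\<rbrakk> \<Longrightarrow> t = Null A (Cod A f) (Cod A t)"
  shows "epi_ar A f"
  using assms by (auto simp: epi_iff)

lemma mono_cancel:
  "\<lbrakk>mono_ar A f; g \<in> Ar A; h \<in> Ar A; Cod A g = Dom A f; Cod A h = Dom A f; Dom A g = Dom A h; f \<cdot> g = f \<cdot> h\<rbrakk> \<Longrightarrow> g = h"
  by (auto simp: mono_ar_def)

lemma epi_cancel:
  "\<lbrakk>epi_ar A f; g \<in> Ar A; h \<in> Ar A; Dom A g = Cod A f; Dom A h = Cod A f; Cod A g = Cod A h; g \<cdot> f = h \<cdot> f\<rbrakk> \<Longrightarrow> g = h"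
  by (auto simp: epi_ar_def)

lemma epi_Null:
  "\<lbrakk>epi_ar A f; g \<in> Ar A; Dom A g = Cod A f; g \<cdot> f = Null A (Dom A f) (Cod A g)\<rbrakk> \<Longrightarrow> g = Null A (Cod A f) (Cod A g)"
  by (auto simp: epi_iff)

lemma mono_Null:
  "\<lbrakk>mono_ar A f; g \<in> Ar A; Cod A g = Dom A f; f \<cdot> g = Null A (Dom A g) (Cod A f)\<rbrakk> \<Longrightarrow> g = Null A (Dom A g) (Dom A f)"
  by (auto simp: mono_iff)

lemma epi_Cmp:
  assumes "epi_ar A f" "epi_ar A g" "Cod A f = Dom A g"
  shows "epi_ar A (g \<cdot> f)"
proof -
  have a: "f \<in> Ar A" "g \<in> Ar A" using assms by (auto simp: epi_ar_def)
  show ?thesis unfolding epi_ar_def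
  proof (intro conjI allI ballI impI)
    fix w u v assume uv: "u \<in> Hom A (Cod A (g \<cdot> f)) w" "v \<in> Hom A (Cod A (g \<cdot> f)) w" "u \<cdot> g \<cdot> f = v \<cdot> g \<cdot> f"
    then have "(u \<cdot> g) \<cdot> f = (v \<cdot> g) \<cdot> f" using a assms(3) by simp
    then have "u \<cdot> g = v \<cdot> g" using epi_cancel[OF assms(1), of "u \<cdot> g" "v \<cdot> g"] uv a assms(3) by simp
    then show "u = v" using epi_cancel[OF assms(2), of u v] uv a assms(3) by simp
  qed (use a assms in simp)
qed

lemma epi_Idn [simp]: "x \<in> Ob A \<Longrightarrow> epi_ar A (Idn A x)"
  by (auto simp: epi_ar_def)

lemma epi_cancel_right:
  assumes "epi_ar A (g \<cdot> f)" "f \<in> Ar A" "g \<in> Ar A" "Cod A f = Dom A g"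
  shows "epi_ar A g"
  unfolding epi_ar_def
proof (intro conjI allI ballI impI)
  fix w u v assume uv: "u \<in> Hom A (Cod A g) w" "v \<in> Hom A (Cod A g) w" "u \<cdot> g = v \<cdot> g"
  then have "u \<cdot> (g \<cdot> f) = v \<cdot> (g \<cdot> f)" using assms by (simp flip: Cmp_assoc')
  then show "u = v" using epi_cancel[OF assms(1), of u v] uv assms by simp
qed (use assms in simp_all)

lemma kernel_Ar:
  assumes "is_kernel A f k"
  shows "f \<in> Ar A" "k \<in> Ar A" "Cod A k = Dom A f" "f \<cdot> k = Null A (Dom A k) (Cod A f)"
  using assms by (auto simp: is_kernel_def)

lemma cokernel_Ar:
  assumes "is_cokernel A f q"
  shows "f \<in> Ar A" "q \<in> Ar A" "Dom A q = Cod A f" "q \<cdot> f = Null A (Dom A f) (Cod A q)"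
  using assms by (auto simp: is_cokernel_def)

lemma kernel_mono: "is_kernel A f k \<Longrightarrow> mono_ar A k"
  unfolding mono_ar_def
proof (intro conjI allI ballI impI)
  fix w g h assume k: "is_kernel A f k" and h: "g \<in> Hom A w (Dom A k)" "h \<in> Hom A w (Dom A k)" "k \<cdot> g = k \<cdot> h"
  note ka = kernel_Ar[OF k]
  have "f \<cdot> (k \<cdot> g) = Null A w (Cod A f)" using ka(1-3) h Cmp_extend[OF ka(4), of g] by simp
  then have "\<exists>!u. u \<in> Hom A (Dom A (k \<cdot> g)) (Dom A k) \<and> k \<cdot> u = k \<cdot> g"
    using k[unfolded is_kernel_def, THEN conjunct2, THEN conjunct2, THEN conjunct2, THEN conjunct2,
        rule_format, of "k \<cdot> g"] h(1,2) ka(1-3) by simp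
  then show "g = h" using h ka by auto
qed (simp add: is_kernel_def)

lemma cokernel_epi: "is_cokernel A f q \<Longrightarrow> epi_ar A q"
  unfolding epi_ar_def
proof (intro conjI allI ballI impI)
  fix w g h assume k: "is_cokernel A f q" and h: "g \<in> Hom A (Cod A q) w" "h \<in> Hom A (Cod A q) w" "g \<cdot> q = h \<cdot> q"
  note ka = cokernel_Ar[OF k]
  have "(g \<cdot> q) \<cdot> f = Null A (Dom A f) w" using ka h by simp
  then have "\<exists>!u. u \<in> Hom A (Cod A q) (Cod A (g \<cdot> q)) \<and> u \<cdot> q = g \<cdot> q"
    using k[unfolded is_cokernel_def, THEN conjunct2, THEN conjunct2, THEN conjunct2, THEN conjunct2,
        rule_format, of "g \<cdot> q"] h(1,2) ka(1-3) by simp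
  then show "g = h" using h ka by auto
qed (simp add: is_cokernel_def)

lemma lift_ar:
  assumes "is_kernel A f k" "h \<in> Ar A" "Cod A h = Dom A f" "f \<cdot> h = Null A (Dom A h) (Cod A f)"
  shows "lift_ar A k h \<in> Ar A" "Dom A (lift_ar A k h) = Dom A h" "Cod A (lift_ar A k h) = Dom A k"
    "k \<cdot> lift_ar A k h = h"
proof -
  have "\<exists>!u. u \<in> Hom A (Dom A h) (Dom A k) \<and> k \<cdot> u = h"
    using assms unfolding is_kernel_def by blast
  from theI'[OF this] show "lift_ar A k h \<in> Ar A" "Dom A (lift_ar A k h) = Dom A h"
    "Cod A (lift_ar A k h) = Dom A k" "k \<cdot> lift_ar A k h = h"
    unfolding lift_ar_def by auto
qed

lemma desc_ar:
  assumes "is_cokernel A f q" "h \<in> Ar A" "Dom A h = Cod A f" "h \<cdot> f = Null A (Dom A f) (Cod A h)"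
  shows "desc_ar A q h \<in> Ar A" "Cod A (desc_ar A q h) = Cod A h" "Dom A (desc_ar A q h) = Cod A q"
    "desc_ar A q h \<cdot> q = h"
proof -
  have "\<exists>!u. u \<in> Hom A (Cod A q) (Cod A h) \<and> u \<cdot> q = h"
    using assms unfolding is_cokernel_def by blast
  from theI'[OF this] show "desc_ar A q h \<in> Ar A" "Cod A (desc_ar A q h) = Cod A h"
    "Dom A (desc_ar A q h) = Cod A q" "desc_ar A q h \<cdot> q = h"
    unfolding desc_ar_def by auto
qed

lemma is_kernelI:
  assumes "f \<in> Ar A" "mono_ar A k" "Cod A k = Dom A f" "f \<cdot> k = Null A (Dom A k) (Cod A f)"
    and "\<And>h. \<lbrakk>h \<in> Ar A; Cod A h = Dom A f; f \<cdot> h = Null A (Dom A h) (Cod A f)\<rbrakk>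
           \<Longrightarrow> \<exists>u. u \<in> Hom A (Dom A h) (Dom A k) \<and> k \<cdot> u = h"
  shows "is_kernel A f k"
  unfolding is_kernel_def
proof (intro conjI ballI impI)
  fix h assume "h \<in> Ar A" "Cod A h = Dom A f \<and> f \<cdot> h = Null A (Dom A h) (Cod A f)"
  then obtain u where "u \<in> Hom A (Dom A h) (Dom A k) \<and> k \<cdot> u = h" using assms(5) by blast
  then show "\<exists>!u. u \<in> Hom A (Dom A h) (Dom A k) \<and> k \<cdot> u = h"
    using mono_cancel[OF assms(2)] by fastforce
qed (use assms in \<open>auto simp: mono_ar_def\<close>)

lemma is_cokernelI:
  assumes "f \<in> Ar A" "epi_ar A k" "Dom A k = Cod A f" "k \<cdot> f = Null A (Dom A f) (Cod A k)"
    and "\<And>h. \<lbrakk>h \<in> Ar A; Dom A h = Cod A f; h \<cdot> f = Null A (Dom A f) (Cod A h)\<rbrakk>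
           \<Longrightarrow> \<exists>u. u \<in> Hom A (Cod A k) (Cod A h) \<and> u \<cdot> k = h"
  shows "is_cokernel A f k"
  unfolding is_cokernel_def
proof (intro conjI ballI impI)
  fix h assume "h \<in> Ar A" "Dom A h = Cod A f \<and> h \<cdot> f = Null A (Dom A f) (Cod A h)"
  then obtain u where "u \<in> Hom A (Cod A k) (Cod A h) \<and> u \<cdot> k = h" using assms(5) by blast
  then show "\<exists>!u. u \<in> Hom A (Cod A k) (Cod A h) \<and> u \<cdot> k = h"
    using epi_cancel[OF assms(2)] by fastforce
qed (use assms in \<open>auto simp: epi_ar_def\<close>)

end

section \<open>Epimorphisms, images and exactness\<close>

context abelian_category
begin

lemma ker_ar: "f \<in> Ar A \<Longrightarrow> is_kernel A f (ker_ar A f)"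
  unfolding ker_ar_def by (rule someI_ex[OF ex_kernel])

lemma coker_ar: "f \<in> Ar A \<Longrightarrow> is_cokernel A f (coker_ar A f)"
  unfolding coker_ar_def by (rule someI_ex[OF ex_cokernel])

text \<open>Normality gives some \<open>g\<close> of which \<open>e\<close> is the cokernel. Since
  \<open>e\<close> kills \<open>g\<close>, that \<open>g\<close> factors through the kernel
  \<open>k\<close>; whatever kills \<open>k\<close> therefore kills \<open>g\<close> and descends
  along \<open>e\<close>.\<close>

lemma epi_cokernel_of_kernel:
  assumes "epi_ar A e" "is_kernel A e k"
  shows "is_cokernel A k e"
proof -
  obtain g where g: "is_cokernel A g e" using epi_normal assms by blast
  note ga = cokernel_Ar[OF g] and ka = kernel_Ar[OF assms(2)]
  show ?thesis
  proof (rule is_cokernelI)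
    fix h assume h: "h \<in> Ar A" "Dom A h = Cod A k" "h \<cdot> k = Null A (Dom A k) (Cod A h)"
    note l = lift_ar[OF assms(2), of g, simplified ga ka, simplified]
    have "h \<cdot> g = h \<cdot> (k \<cdot> lift_ar A k g)" using l ga by simp
    also have "\<dots> = Null A (Dom A g) (Cod A h)"
      using Cmp_extend_Null(1)[OF h(3), of "lift_ar A k g"] l ga ka h by simp
    finally show "\<exists>u. u \<in> Hom A (Cod A e) (Cod A h) \<and> u \<cdot> e = h"
      using desc_ar[OF g, of h] h ga ka by (intro exI[of _ "desc_ar A e h"]) auto
  qed (use ka assms in \<open>auto simp: epi_ar_def\<close>)
qed

text \<open>The hypothesis asks that \<open>h\<close> kill every arrow killed by \<open>e\<close>,
  instead of one chosen kernel; this is the form in which diagram chases deliver it.\<close>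

lemma epi_desc:
  assumes "epi_ar A e" "h \<in> Ar A" "Dom A h = Dom A e"
    and "\<And>t. \<lbrakk>t \<in> Ar A; Cod A t = Dom A e; e \<cdot> t = Null A (Dom A t) (Cod A e)\<rbrakk>
      \<Longrightarrow> h \<cdot> t = Null A (Dom A t) (Cod A h)"
  obtains u where "u \<in> Ar A" "Dom A u = Cod A e" "Cod A u = Cod A h" "u \<cdot> e = h"
proof -
  have e: "e \<in> Ar A" using assms by (simp add: epi_ar_def)
  note ck = epi_cokernel_of_kernel[OF assms(1) ker_ar[OF e]]
  note ka = kernel_Ar[OF ker_ar[OF e]]
  show ?thesis
    using desc_ar[OF ck, of h] assms(2,3) assms(4)[of "ker_ar A e"] ka that[of "desc_ar A e h"] by auto
qed

text \<open>The pullback is the kernel \<open>k\<close> of \<open>ph = e q - a p\<close> on the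
  biproduct of the two sources. This difference is an epimorphism because it restricts to
  \<open>e\<close> on the second summand, so it is the cokernel of \<open>k\<close>, and this makes
  the projection \<open>p k\<close> an epimorphism.\<close>

lemma pullback_epi:
  assumes "epi_ar A e" "a \<in> Ar A" "Cod A a = Cod A e"
  obtains s t where "epi_ar A s" "t \<in> Ar A" "Cod A s = Dom A a" "Cod A t = Dom A e"
    "Dom A s = Dom A t" "e \<cdot> t = a \<cdot> s"
proof -
  have e: "e \<in> Ar A" using assms by (simp add: epi_ar_def)
  obtain b where "is_biproduct A (Dom A a) (Dom A e) b" using ex_biproduct[of "Dom A a" "Dom A e"] e assms by auto
  then obtain i j p q where b: "b \<in> Ob A" and ij:
    "i \<in> Ar A" "Dom A i = Dom A a" "Cod A i = b" "j \<in> Ar A" "Dom A j = Dom A e" "Cod A j = b"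
    "p \<in> Ar A" "Dom A p = b" "Cod A p = Dom A a" "q \<in> Ar A" "Dom A q = b" "Cod A q = Dom A e"
    and pi: "p \<cdot> i = Idn A (Dom A a)" and qj: "q \<cdot> j = Idn A (Dom A e)"
    and sum: "i \<cdot> p \<boxplus> j \<cdot> q = Idn A b"
    unfolding is_biproduct_def by auto
  \<comment> \<open>\<open>is_biproduct\<close> only demands \<open>p i = 1\<close>,
    \<open>q j = 1\<close> and the sum formula. The mixed composites vanish by composing the sum
    formula with \<open>p\<close> or \<open>q\<close> and cancelling.\<close>
  have pj: "p \<cdot> j = Null A (Dom A e) (Dom A a)"
  proof -
    have "p \<cdot> (i \<cdot> p \<boxplus> j \<cdot> q) = p" unfolding sum using ij b by simp
    then have "p \<cdot> i \<cdot> p \<boxplus> p \<cdot> j \<cdot> q = p" using ij by (simp add: Cmp_Plus)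
    then have "p \<boxplus> p \<cdot> j \<cdot> q = p" using Cmp_extend[OF pi, of p] ij b assms by simp
    then have "(p \<cdot> j \<cdot> q \<boxplus> p) \<boxminus> p = p \<boxminus> p"
      using Plus_commute[of p "p \<cdot> j \<cdot> q"] ij by simp
    then have n: "p \<cdot> j \<cdot> q = Null A b (Dom A a)" using ij by simp
    have "(p \<cdot> j \<cdot> q) \<cdot> j = p \<cdot> j" using ij qj e by simp
    then show ?thesis using n ij assms by simp
  qed
  have qi: "q \<cdot> i = Null A (Dom A a) (Dom A e)"
  proof -
    have "q \<cdot> (i \<cdot> p \<boxplus> j \<cdot> q) = q" unfolding sum using ij b by simp
    then have "q \<cdot> i \<cdot> p \<boxplus> q \<cdot> j \<cdot> q = q" using ij by (simp add: Cmp_Plus)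
    then have "q \<cdot> i \<cdot> p \<boxplus> q = q" using Cmp_extend[OF qj, of q] ij b e by simp
    then have "(q \<cdot> i \<cdot> p \<boxplus> q) \<boxminus> q = q \<boxminus> q" by simp
    then have n: "q \<cdot> i \<cdot> p = Null A b (Dom A e)" using ij by simp
    have "(q \<cdot> i \<cdot> p) \<cdot> i = q \<cdot> i" using ij pi assms by simp
    then show ?thesis using n ij e by simp
  qed
  define ph where "ph = e \<cdot> q \<boxminus> a \<cdot> p"
  have ph: "ph \<in> Ar A" "Dom A ph = b" "Cod A ph = Cod A e" using ij e assms by (auto simp: ph_def)
  have phj: "ph \<cdot> j = e" using ij e assms qj pj by (simp add: ph_def Cmp_dif)
  have "epi_ar A ph" using epi_cancel_right[of ph j] phj assms(1) ij ph by simp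
  define k where "k = ker_ar A ph"
  have k: "is_kernel A ph k" using ker_ar ph by (simp add: k_def)
  note ka = kernel_Ar[OF k] and ck = epi_cokernel_of_kernel[OF \<open>epi_ar A ph\<close> k]
  have eq: "e \<cdot> (q \<cdot> k) = a \<cdot> (p \<cdot> k)"
  proof -
    have "e \<cdot> q \<cdot> k \<boxminus> a \<cdot> p \<cdot> k = Null A (Dom A k) (Cod A e)"
      using ka(4) ij e assms ka ph unfolding ph_def by (simp add: Cmp_dif)
    then show ?thesis using ij e assms ka ph by simp
  qed
  \<comment> \<open>An \<open>h\<close> killing \<open>p k\<close> makes \<open>h p\<close> descend
    along \<open>ph\<close> to some \<open>u\<close>. On the second summand this reads
    \<open>u e = 0\<close>, so \<open>u = 0\<close>, and then \<open>h p = 0\<close>.\<close>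
  have "epi_ar A (p \<cdot> k)" unfolding epi_iff
  proof (intro conjI ballI impI)
    fix h assume h: "h \<in> Ar A" "Dom A h = Cod A (p \<cdot> k) \<and> h \<cdot> (p \<cdot> k) = Null A (Dom A (p \<cdot> k)) (Cod A h)"
    have h2: "Dom A h = Dom A a" using h ij ka ph by simp
    define u where "u = desc_ar A ph (h \<cdot> p)"
    have u: "u \<in> Ar A" "Dom A u = Cod A e" "Cod A u = Cod A h" "u \<cdot> ph = h \<cdot> p"
      using desc_ar[OF ck, of "h \<cdot> p"] h h2 ij ka ph by (auto simp: u_def)
    have "u \<cdot> e = (u \<cdot> ph) \<cdot> j" using phj u(1-3) ph ij by simp
    also have "\<dots> = Null A (Dom A e) (Cod A h)" using u(4) pj h h2 ij e by simp
    finally have "u = Null A (Cod A e) (Cod A h)" using epi_Null[OF assms(1), of u] u by simp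
    then have "h \<cdot> p = Null A b (Cod A h)" using u(4) ph h by simp
    then have "(h \<cdot> p) \<cdot> i = Null A (Dom A a) (Cod A h)" using ij h by simp
    then have "h = Null A (Dom A a) (Cod A h)" using pi h h2 ij by simp
    then show "h = Null A (Cod A (p \<cdot> k)) (Cod A h)" using ij ka ph by simp
  qed (use ij ka ph in auto)
  then show ?thesis using that[of "p \<cdot> k" "q \<cdot> k"] ij ka ph eq by auto
qed

text \<open>Let \<open>h\<close> kill the corestriction of \<open>f\<close> and let \<open>m\<close>
  be the kernel of \<open>h\<close>. Then \<open>f\<close> factors through the monomorphism
  \<open>k m\<close>, which is a kernel of some \<open>r\<close>. This \<open>r\<close> kills
  \<open>f\<close>, hence factors through \<open>q\<close> and kills \<open>k\<close> as well, so
  \<open>k\<close> itself factors through \<open>k m\<close>. Thus \<open>m\<close> has a right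
  inverse, and \<open>h = 0\<close>.\<close>

lemma image_factor:
  assumes "f \<in> Ar A" "is_cokernel A f q" "is_kernel A q k"
  shows "epi_ar A (lift_ar A k f)"
  unfolding epi_iff
proof (intro conjI ballI impI)
  note qa = cokernel_Ar[OF assms(2)] and ka = kernel_Ar[OF assms(3)]
  note l = lift_ar[OF assms(3), of f, simplified qa, simplified]
  show "lift_ar A k f \<in> Ar A" using l qa by simp
  fix h assume h: "h \<in> Ar A" "Dom A h = Cod A (lift_ar A k f)
    \<and> h \<cdot> lift_ar A k f = Null A (Dom A (lift_ar A k f)) (Cod A h)"
  have h2: "Dom A h = Dom A k" using l h qa by simp
  define m where "m = ker_ar A h"
  have m: "is_kernel A h m" using ker_ar h by (simp add: m_def)
  note ma = kernel_Ar[OF m]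
  define f2 where "f2 = lift_ar A m (lift_ar A k f)"
  have f2: "f2 \<in> Ar A" "Dom A f2 = Dom A f" "Cod A f2 = Dom A m" "m \<cdot> f2 = lift_ar A k f"
    using lift_ar[OF m, of "lift_ar A k f"] l qa h by (auto simp: f2_def)
  have "mono_ar A (k \<cdot> m)" unfolding mono_iff
  proof (intro conjI ballI impI)
    fix t assume t: "t \<in> Ar A" "Cod A t = Dom A (k \<cdot> m) \<and> (k \<cdot> m) \<cdot> t = Null A (Dom A t) (Cod A (k \<cdot> m))"
    have "k \<cdot> (m \<cdot> t) = Null A (Dom A t) (Cod A k)"
      using t(1) t(2)[THEN conjunct1] t(2)[THEN conjunct2] ka ma h2 by simp
    then have "m \<cdot> t = Null A (Dom A t) (Dom A k)"
      using mono_Null[OF kernel_mono[OF assms(3)], of "m \<cdot> t"] t ka ma h2 by simp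
    then show "t = Null A (Dom A t) (Dom A (k \<cdot> m))"
      using mono_Null[OF kernel_mono[OF m], of t] t ka ma h2 by simp
  qed (use ka ma h2 in simp)
  then obtain r where r: "is_kernel A r (k \<cdot> m)" using mono_normal by blast
  note ra = kernel_Ar[OF r]
  have rd: "Dom A r = Cod A f" using ra(3) qa ka ma h2 by simp
  have "f = (k \<cdot> m) \<cdot> f2" using l f2 ka ma h2 qa by simp
  moreover have "r \<cdot> ((k \<cdot> m) \<cdot> f2) = Null A (Dom A f) (Cod A r)"
    using Cmp_extend_Null(1)[OF ra(4), of f2] f2 ka(1-3) ma(1-3) h2 ra(1) rd qa(3) by simp
  ultimately have rf: "r \<cdot> f = Null A (Dom A f) (Cod A r)" by metis
  have d: "desc_ar A q r \<in> Ar A" "Cod A (desc_ar A q r) = Cod A r" "Dom A (desc_ar A q r) = Cod A q"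
    "desc_ar A q r \<cdot> q = r"
    using desc_ar[OF assms(2), of r] ra rd rf by auto
  have "r \<cdot> k = desc_ar A q r \<cdot> (q \<cdot> k)" using d ka qa by (metis Cmp_assoc')
  also have "\<dots> = Null A (Dom A k) (Cod A r)" using ka d by simp
  finally have rk: "r \<cdot> k = Null A (Dom A k) (Cod A r)" .
  define v where "v = lift_ar A (k \<cdot> m) k"
  have v: "v \<in> Ar A" "Dom A v = Dom A k" "Cod A v = Dom A m" "(k \<cdot> m) \<cdot> v = k"
    using lift_ar[OF r, of k] rk ka ma h2 rd qa by (auto simp: v_def)
  have "m \<cdot> v = Idn A (Dom A k)"
    using mono_cancel[OF kernel_mono[OF assms(3)], of "m \<cdot> v" "Idn A (Dom A k)"] v ka ma h2 by simp
  then have "h = (h \<cdot> m) \<cdot> v" using h h2 v ma(1-3) by simp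
  also have "\<dots> = Null A (Dom A k) (Cod A h)" unfolding ma(4) using v ma(1-3) h h2 by simp
  finally show "h = Null A (Cod A (lift_ar A k f)) (Cod A h)" using h h2 by simp
qed

text \<open>An arrow into \<open>X\<close> plays the role of an element of \<open>X\<close>. Existence statements about such generalized
  elements hold only after precomposition with an epimorphism, which is harmless because
  epimorphisms are stable under pullback.\<close>

lemma exact_atI:
  assumes "f \<in> Ar A" "g \<in> Ar A" "Cod A f = Dom A g" "g \<cdot> f = Null A (Dom A f) (Cod A g)"
    and "\<And>y. \<lbrakk>y \<in> Ar A; Cod A y = Dom A g; g \<cdot> y = Null A (Dom A y) (Cod A g)\<rbrakk> \<Longrightarrow>
      \<exists>e x. epi_ar A e \<and> x \<in> Ar A \<and> Cod A e = Dom A y \<and> Dom A x = Dom A e \<and> Cod A x = Dom A f \<and> f \<cdot> x = y \<cdot> e"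
  shows "exact_at A f g"
proof -
  define q where "q = coker_ar A f"
  have q: "is_cokernel A f q" using coker_ar assms by (simp add: q_def)
  note qa = cokernel_Ar[OF q]
  define k where "k = ker_ar A q"
  have k: "is_kernel A q k" using ker_ar qa by (simp add: k_def)
  note ka = kernel_Ar[OF k]
  have d: "desc_ar A q g \<in> Ar A" "Cod A (desc_ar A q g) = Cod A g" "Dom A (desc_ar A q g) = Cod A q"
    "desc_ar A q g \<cdot> q = g"
    using desc_ar[OF q, of g] assms by auto
  have "is_kernel A g k"
  proof (rule is_kernelI)
    have "g \<cdot> k = desc_ar A q g \<cdot> (q \<cdot> k)" using d ka qa by (metis Cmp_assoc')
    then show "g \<cdot> k = Null A (Dom A k) (Cod A g)" using ka d by simp
    fix y assume y: "y \<in> Ar A" "Cod A y = Dom A g" "g \<cdot> y = Null A (Dom A y) (Cod A g)"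
    then obtain e x where ex: "epi_ar A e" "x \<in> Ar A" "Cod A e = Dom A y" "Dom A x = Dom A e"
      "Cod A x = Dom A f" "f \<cdot> x = y \<cdot> e" using assms(5) by blast
    have e: "e \<in> Ar A" using ex by (simp add: epi_ar_def)
    have "(q \<cdot> y) \<cdot> e = q \<cdot> (f \<cdot> x)" using ex e y qa assms by simp
    also have "\<dots> = Null A (Dom A e) (Cod A q)"
      using Cmp_extend[OF qa(4), of x] ex qa(1-3) e by simp
    finally have "q \<cdot> y = Null A (Dom A y) (Cod A q)"
      using epi_Null[OF ex(1), of "q \<cdot> y"] ex e y qa assms by simp
    then show "\<exists>u. u \<in> Hom A (Dom A y) (Dom A k) \<and> k \<cdot> u = y"
      using lift_ar[OF k, of y] y qa assms by auto
  qed (use assms ka qa kernel_mono[OF k] in auto)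
  with q k assms(3) show ?thesis unfolding exact_at_def by blast
qed

text \<open>For the last clause, \<open>y\<close> factors through the image \<open>k\<close>; the
  corestriction of \<open>f\<close> to \<open>k\<close> is an epimorphism, and pulling it back along
  that factor provides \<open>e\<close> and \<open>x\<close>.\<close>

lemma exact_atD:
  assumes "exact_at A f g"
  shows "f \<in> Ar A" "g \<in> Ar A" "Cod A f = Dom A g" "g \<cdot> f = Null A (Dom A f) (Cod A g)"
    and "\<And>y. \<lbrakk>y \<in> Ar A; Cod A y = Dom A g; g \<cdot> y = Null A (Dom A y) (Cod A g)\<rbrakk> \<Longrightarrow>
      \<exists>e x. epi_ar A e \<and> x \<in> Ar A \<and> Cod A e = Dom A y \<and> Dom A x = Dom A e \<and> Cod A x = Dom A f \<and> f \<cdot> x = y \<cdot> e"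
proof -
  obtain q k where q: "is_cokernel A f q" and k: "is_kernel A q k" and gk: "is_kernel A g k"
    and c: "Cod A f = Dom A g" using assms unfolding exact_at_def by blast
  note qa = cokernel_Ar[OF q] and ka = kernel_Ar[OF k] and ga = kernel_Ar[OF gk]
  show "f \<in> Ar A" "g \<in> Ar A" "Cod A f = Dom A g" using qa ga c by auto
  note l = lift_ar[OF k, of f, simplified qa, simplified]
  have "g \<cdot> f = (g \<cdot> k) \<cdot> lift_ar A k f" using l ga(1-3) qa c by simp
  then show "g \<cdot> f = Null A (Dom A f) (Cod A g)" unfolding ga(4) using l qa ga by simp
  fix y assume y: "y \<in> Ar A" "Cod A y = Dom A g" "g \<cdot> y = Null A (Dom A y) (Cod A g)"
  note ly = lift_ar[OF gk, of y, simplified y, simplified]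
  have "epi_ar A (lift_ar A k f)" using image_factor[OF qa(1) q k] .
  then obtain s t where st: "epi_ar A s" "t \<in> Ar A" "Cod A s = Dom A y" "Cod A t = Dom A f"
    "Dom A s = Dom A t" "lift_ar A k f \<cdot> t = lift_ar A k y \<cdot> s"
    using pullback_epi[of "lift_ar A k f" "lift_ar A k y"] l qa ly by auto
  have s: "s \<in> Ar A" using st by (simp add: epi_ar_def)
  have "f \<cdot> t = k \<cdot> (lift_ar A k f \<cdot> t)" using l(4) st(2,4) l qa ka(2) Cmp_extend[OF l(4), of t] by simp
  also have "\<dots> = y \<cdot> s" unfolding st(6) using ly st s ka(2) Cmp_extend[OF ly(4), of s] by simp
  finally have "f \<cdot> t = y \<cdot> s" .
  then show "\<exists>e x. epi_ar A e \<and> x \<in> Ar A \<and> Cod A e = Dom A y \<and> Dom A x = Dom A e \<and> Cod A x = Dom A f \<and> f \<cdot> x = y \<cdot> e"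
    using st by (intro exI[of _ s] exI[of _ t]) auto
qed

end

section \<open>Functor categories\<close>

lemma functor_simps:
  assumes "is_functor C D F"
  shows "x \<in> Ob C \<Longrightarrow> on_ob F x \<in> Ob D"
    "f \<in> Ar C \<Longrightarrow> on_ar F f \<in> Ar D"
    "f \<in> Ar C \<Longrightarrow> Dom D (on_ar F f) = on_ob F (Dom C f)"
    "f \<in> Ar C \<Longrightarrow> Cod D (on_ar F f) = on_ob F (Cod C f)"
    "x \<in> Ob C \<Longrightarrow> on_ar F (Idn C x) = Idn D (on_ob F x)"
    "\<lbrakk>f \<in> Ar C; g \<in> Ar C; Cod C f = Dom C g\<rbrakk> \<Longrightarrow>
      on_ar F (g \<cdot>\<^bsub>C\<^esub> f) = on_ar F g \<cdot>\<^bsub>D\<^esub> on_ar F f"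
  using assms unfolding is_functor_def by (auto simp: PiE_def Pi_def)

lemma is_functorI:
  assumes "category C"
    and "\<And>x. x \<in> Ob C \<Longrightarrow> p x \<in> Ob D"
    and "\<And>f. f \<in> Ar C \<Longrightarrow> a f \<in> Ar D \<and> Dom D (a f) = p (Dom C f) \<and> Cod D (a f) = p (Cod C f)"
    and "\<And>x. x \<in> Ob C \<Longrightarrow> a (Idn C x) = Idn D (p x)"
    and "\<And>f g. \<lbrakk>f \<in> Ar C; g \<in> Ar C; Cod C f = Dom C g\<rbrakk> \<Longrightarrow> a (g \<cdot>\<^bsub>C\<^esub> f) = a g \<cdot>\<^bsub>D\<^esub> a f"
  shows "is_functor C D (Fctr (restrict p (Ob C)) (restrict a (Ar C)))"
proof -
  interpret category C by fact
  show ?thesis unfolding is_functor_def using assms(2-) by simp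
qed

lemma ntrans_simps:
  assumes "is_ntrans C D \<eta>"
  shows "is_functor C D (nt_dom \<eta>)" "is_functor C D (nt_cod \<eta>)"
    "x \<in> Ob C \<Longrightarrow> nt_at \<eta> x \<in> Ar D"
    "x \<in> Ob C \<Longrightarrow> Dom D (nt_at \<eta> x) = on_ob (nt_dom \<eta>) x"
    "x \<in> Ob C \<Longrightarrow> Cod D (nt_at \<eta> x) = on_ob (nt_cod \<eta>) x"
  using assms unfolding is_ntrans_def by (auto simp: PiE_def Pi_def)

lemma ntrans_natural:
  "\<lbrakk>is_ntrans C D \<eta>; f \<in> Ar C; Dom C f = x; Cod C f = y\<rbrakk> \<Longrightarrow>
    nt_at \<eta> y \<cdot>\<^bsub>D\<^esub> on_ar (nt_dom \<eta>) f = on_ar (nt_cod \<eta>) f \<cdot>\<^bsub>D\<^esub> nt_at \<eta> x"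
  unfolding is_ntrans_def by blast

lemma is_ntransI:
  assumes "category C" "is_functor C D F" "is_functor C D G"
    and "\<And>x. x \<in> Ob C \<Longrightarrow> t x \<in> Ar D \<and> Dom D (t x) = on_ob F x \<and> Cod D (t x) = on_ob G x"
    and "\<And>f. f \<in> Ar C \<Longrightarrow> t (Cod C f) \<cdot>\<^bsub>D\<^esub> on_ar F f = on_ar G f \<cdot>\<^bsub>D\<^esub> t (Dom C f)"
  shows "is_ntrans C D (NTrans F G (restrict t (Ob C)))"
proof -
  interpret category C by fact
  show ?thesis unfolding is_ntrans_def using assms(2-) by simp
qed

lemma ntrans_eqI:
  assumes "is_ntrans C D \<eta>" "is_ntrans C D \<theta>" "nt_dom \<eta> = nt_dom \<theta>" "nt_cod \<eta> = nt_cod \<theta>"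
    and "\<And>x. x \<in> Ob C \<Longrightarrow> nt_at \<eta> x = nt_at \<theta> x"
  shows "\<eta> = \<theta>"
proof (rule ntrans.expand, intro conjI)
  have "nt_at \<eta> \<in> extensional (Ob C)" "nt_at \<theta> \<in> extensional (Ob C)"
    using assms(1,2) unfolding is_ntrans_def PiE_def by blast+
  then show "nt_at \<eta> = nt_at \<theta>" using extensionalityI[of _ "Ob C"] assms(5) by blast
qed (rule assms)+

lemma fun_cat_sel [simp]:
  "Ob (fun_cat C A) = {F. is_functor C A F}" "Ar (fun_cat C A) = {\<eta>. is_ntrans C A \<eta>}"
  "Dom (fun_cat C A) = nt_dom" "Cod (fun_cat C A) = nt_cod"
  by (auto simp: fun_cat_def)

lemma fun_cat_at [simp]:
  "x \<in> Ob C \<Longrightarrow> nt_at (Idn (fun_cat C A) F) x = Idn A (on_ob F x)"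
  "x \<in> Ob C \<Longrightarrow> nt_at (\<theta> \<cdot>\<^bsub>fun_cat C A\<^esub> \<eta>) x = nt_at \<theta> x \<cdot>\<^bsub>A\<^esub> nt_at \<eta> x"
  "x \<in> Ob C \<Longrightarrow> nt_at (Plus (fun_cat C A) \<theta> \<eta>) x = Plus A (nt_at \<theta> x) (nt_at \<eta> x)"
  "x \<in> Ob C \<Longrightarrow> nt_at (Null (fun_cat C A) F G) x = Null A (on_ob F x) (on_ob G x)"
  by (auto simp: fun_cat_def)

lemma fun_cat_nt [simp]:
  "nt_dom (Idn (fun_cat C A) F) = F" "nt_cod (Idn (fun_cat C A) F) = F"
  "nt_dom (\<theta> \<cdot>\<^bsub>fun_cat C A\<^esub> \<eta>) = nt_dom \<eta>" "nt_cod (\<theta> \<cdot>\<^bsub>fun_cat C A\<^esub> \<eta>) = nt_cod \<theta>"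
  "nt_dom (Plus (fun_cat C A) \<theta> \<eta>) = nt_dom \<eta>" "nt_cod (Plus (fun_cat C A) \<theta> \<eta>) = nt_cod \<eta>"
  "nt_dom (Null (fun_cat C A) F G) = F" "nt_cod (Null (fun_cat C A) F G) = G"
  by (auto simp: fun_cat_def)

lemma is_kernelD:
  "\<lbrakk>is_kernel A f k; h \<in> Ar A; Cod A h = Dom A f; f \<cdot>\<^bsub>A\<^esub> h = Null A (Dom A h) (Cod A f)\<rbrakk> \<Longrightarrow>
    \<exists>!u. u \<in> Hom A (Dom A h) (Dom A k) \<and> k \<cdot>\<^bsub>A\<^esub> u = h"
  unfolding is_kernel_def by blast

lemma is_cokernelD:
  "\<lbrakk>is_cokernel A f q; h \<in> Ar A; Dom A h = Cod A f; h \<cdot>\<^bsub>A\<^esub> f = Null A (Dom A f) (Cod A h)\<rbrakk> \<Longrightarrow>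
    \<exists>!u. u \<in> Hom A (Cod A q) (Cod A h) \<and> u \<cdot>\<^bsub>A\<^esub> q = h"
  unfolding is_cokernel_def by blast

locale functor_category = abelian_category A + S: category S
  for A :: "('o, 'm, 'y) addcat_scheme" (structure) and S :: "('c, 'k, 'z) cat_scheme"
begin

abbreviation "B \<equiv> fun_cat S A"

lemmas S_functor_simps [simp] = functor_simps[where C = S and D = A]
lemmas S_ntrans_simps [simp] = ntrans_simps[where C = S and D = A]

lemma B_Cmp [simp]:
  assumes "is_ntrans S A \<eta>" "is_ntrans S A \<theta>" "nt_cod \<eta> = nt_dom \<theta>"
  shows "is_ntrans S A (\<theta> \<cdot>\<^bsub>B\<^esub> \<eta>)"
proof -
  have "is_ntrans S A (NTrans (nt_dom \<eta>) (nt_cod \<theta>) (\<lambda>x\<in>Ob S. nt_at \<theta> x \<cdot> nt_at \<eta> x))"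
  proof (rule is_ntransI)
    fix f assume f: "f \<in> Ar S"
    show "(nt_at \<theta> (Cod S f) \<cdot> nt_at \<eta> (Cod S f)) \<cdot> on_ar (nt_dom \<eta>) f
        = on_ar (nt_cod \<theta>) f \<cdot> nt_at \<theta> (Dom S f) \<cdot> nt_at \<eta> (Dom S f)"
      using assms f ntrans_natural[OF assms(1) f refl refl]
        Cmp_extend[OF ntrans_natural[OF assms(2) f refl refl], of "nt_at \<eta> (Dom S f)"] by simp
  qed (use assms S.category_axioms in simp_all)
  then show ?thesis by (simp add: fun_cat_def)
qed

lemma B_Idn [simp]:
  assumes "is_functor S A F"
  shows "is_ntrans S A (Idn B F)"
proof -
  have "is_ntrans S A (NTrans F F (\<lambda>x\<in>Ob S. Idn A (on_ob F x)))"
    by (rule is_ntransI) (use assms S.category_axioms in simp_all)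
  then show ?thesis by (simp add: fun_cat_def)
qed

lemma B_Plus [simp]:
  assumes "is_ntrans S A \<eta>" "is_ntrans S A \<theta>" "nt_dom \<eta> = nt_dom \<theta>" "nt_cod \<eta> = nt_cod \<theta>"
  shows "is_ntrans S A (Plus B \<theta> \<eta>)"
proof -
  have "is_ntrans S A (NTrans (nt_dom \<eta>) (nt_cod \<eta>) (\<lambda>x\<in>Ob S. nt_at \<theta> x \<boxplus> nt_at \<eta> x))"
  proof (rule is_ntransI)
    fix f assume f: "f \<in> Ar S"
    have "nt_at \<eta> (Cod S f) \<cdot> on_ar (nt_dom \<theta>) f = on_ar (nt_cod \<theta>) f \<cdot> nt_at \<eta> (Dom S f)"
      using ntrans_natural[OF assms(1) f refl refl] assms by simp
    then show "(nt_at \<theta> (Cod S f) \<boxplus> nt_at \<eta> (Cod S f)) \<cdot> on_ar (nt_dom \<eta>) f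
        = on_ar (nt_cod \<eta>) f \<cdot> (nt_at \<theta> (Dom S f) \<boxplus> nt_at \<eta> (Dom S f))"
      using assms f ntrans_natural[OF assms(2) f refl refl] by (simp add: Cmp_Plus)
  qed (use assms S.category_axioms in simp_all)
  then show ?thesis by (simp add: fun_cat_def)
qed

lemma B_Null [simp]:
  assumes "is_functor S A F" "is_functor S A G"
  shows "is_ntrans S A (Null B F G)"
proof -
  have "is_ntrans S A (NTrans F G (\<lambda>x\<in>Ob S. Null A (on_ob F x) (on_ob G x)))"
    by (rule is_ntransI) (use assms S.category_axioms in simp_all)
  then show ?thesis by (simp add: fun_cat_def)
qed

sublocale B: category B
proof
  fix f g h w x y z assume "f \<in> Hom B w x" "g \<in> Hom B x y" "h \<in> Hom B y z"
  then show "(h \<cdot>\<^bsub>B\<^esub> g) \<cdot>\<^bsub>B\<^esub> f = h \<cdot>\<^bsub>B\<^esub> g \<cdot>\<^bsub>B\<^esub> f"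
    by (intro ntrans_eqI[of S A]) auto
next
  fix f x y assume f: "f \<in> Hom B x y"
  then show "f \<cdot>\<^bsub>B\<^esub> Idn B x = f" by (intro ntrans_eqI[of S A]) auto
  from f show "Idn B y \<cdot>\<^bsub>B\<^esub> f = f" by (intro ntrans_eqI[of S A]) auto
qed auto

text \<open>The factorizations found at each object form a transformation, because naturality may be
  tested after the monic components of \<open>\<kappa>\<close>.\<close>

lemma kernel_pointwiseI:
  assumes "is_ntrans S A \<eta>" "is_ntrans S A \<kappa>" "nt_cod \<kappa> = nt_dom \<eta>"
    and k: "\<And>x. x \<in> Ob S \<Longrightarrow> is_kernel A (nt_at \<eta> x) (nt_at \<kappa> x)"
  shows "is_kernel B \<eta> \<kappa>"
  unfolding is_kernel_def
proof (intro conjI ballI impI)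
  show "\<eta> \<cdot>\<^bsub>B\<^esub> \<kappa> = Null B (Dom B \<kappa>) (Cod B \<eta>)"
    using assms kernel_Ar(4)[OF k] by (intro ntrans_eqI[of S A]) auto
  fix h assume h: "h \<in> Ar B" "Cod B h = Dom B \<eta> \<and> \<eta> \<cdot>\<^bsub>B\<^esub> h = Null B (Dom B h) (Cod B \<eta>)"
  then have hn: "is_ntrans S A h" "nt_cod h = nt_dom \<eta>" and h0: "\<eta> \<cdot>\<^bsub>B\<^esub> h = Null B (nt_dom h) (nt_cod \<eta>)"
    by auto
  have hx: "nt_at \<eta> x \<cdot> nt_at h x = Null A (on_ob (nt_dom h) x) (on_ob (nt_cod \<eta>) x)" if "x \<in> Ob S" for x
    using arg_cong[OF h0, of "\<lambda>t. nt_at t x"] that by simp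
  define u where "u x = lift_ar A (nt_at \<kappa> x) (nt_at h x)" for x
  have u: "u x \<in> Ar A" "Dom A (u x) = on_ob (nt_dom h) x" "Cod A (u x) = on_ob (nt_dom \<kappa>) x"
    "nt_at \<kappa> x \<cdot> u x = nt_at h x" if "x \<in> Ob S" for x
    unfolding u_def using lift_ar[OF k[OF that], of "nt_at h x"] hx[OF that] assms hn that by auto
  have U: "is_ntrans S A (NTrans (nt_dom h) (nt_dom \<kappa>) (restrict u (Ob S)))"
  proof (rule is_ntransI)
    fix f assume f: "f \<in> Ar S"
    let ?x = "Dom S f" and ?y = "Cod S f"
    have "nt_at \<kappa> ?y \<cdot> (u ?y \<cdot> on_ar (nt_dom h) f) = nt_at h ?y \<cdot> on_ar (nt_dom h) f"
      by (rule Cmp_extend) (use u f assms hn in simp_all)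
    also have "\<dots> = on_ar (nt_dom \<eta>) f \<cdot> nt_at \<kappa> ?x \<cdot> u ?x"
      using ntrans_natural[OF hn(1) f refl refl] hn u f by simp
    also have "\<dots> = nt_at \<kappa> ?y \<cdot> (on_ar (nt_dom \<kappa>) f \<cdot> u ?x)"
      using Cmp_extend[OF ntrans_natural[OF assms(2) f refl refl], of "u ?x"] assms u f by simp
    finally show "u ?y \<cdot> on_ar (nt_dom h) f = on_ar (nt_dom \<kappa>) f \<cdot> u ?x"
      using mono_cancel[OF kernel_mono[OF k[of ?y]], of "u ?y \<cdot> on_ar (nt_dom h) f" "on_ar (nt_dom \<kappa>) f \<cdot> u ?x"]
        assms u f hn by simp
  qed (use hn assms u S.category_axioms in simp_all)
  show "\<exists>!u. u \<in> Hom B (Dom B h) (Dom B \<kappa>) \<and> \<kappa> \<cdot>\<^bsub>B\<^esub> u = h"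
  proof (rule ex1I[of _ "NTrans (nt_dom h) (nt_dom \<kappa>) (restrict u (Ob S))"])
    show "NTrans (nt_dom h) (nt_dom \<kappa>) (restrict u (Ob S)) \<in> Hom B (Dom B h) (Dom B \<kappa>) \<and>
      \<kappa> \<cdot>\<^bsub>B\<^esub> NTrans (nt_dom h) (nt_dom \<kappa>) (restrict u (Ob S)) = h"
      using U hn assms u by (auto intro!: ntrans_eqI[of S A])
    fix v assume v: "v \<in> Hom B (Dom B h) (Dom B \<kappa>) \<and> \<kappa> \<cdot>\<^bsub>B\<^esub> v = h"
    then have vn: "is_ntrans S A v" "nt_dom v = nt_dom h" "nt_cod v = nt_dom \<kappa>" "\<kappa> \<cdot>\<^bsub>B\<^esub> v = h" by auto
    have "nt_at v x = u x" if "x \<in> Ob S" for x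
      by (rule mono_cancel[OF kernel_mono[OF k[OF that]]])
        (use arg_cong[OF vn(4), of "\<lambda>t. nt_at t x"] vn(1-3) u[OF that] that assms in simp_all)
    then show "v = NTrans (nt_dom h) (nt_dom \<kappa>) (restrict u (Ob S))"
      using U vn by (intro ntrans_eqI[of S A]) auto
  qed
qed (use assms in auto)

lemma cokernel_pointwiseI:
  assumes "is_ntrans S A \<eta>" "is_ntrans S A \<kappa>" "nt_dom \<kappa> = nt_cod \<eta>"
    and k: "\<And>x. x \<in> Ob S \<Longrightarrow> is_cokernel A (nt_at \<eta> x) (nt_at \<kappa> x)"
  shows "is_cokernel B \<eta> \<kappa>"
  unfolding is_cokernel_def
proof (intro conjI ballI impI)
  show "\<kappa> \<cdot>\<^bsub>B\<^esub> \<eta> = Null B (Dom B \<eta>) (Cod B \<kappa>)"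
    using assms cokernel_Ar(4)[OF k] by (intro ntrans_eqI[of S A]) auto
  fix h assume h: "h \<in> Ar B" "Dom B h = Cod B \<eta> \<and> h \<cdot>\<^bsub>B\<^esub> \<eta> = Null B (Dom B \<eta>) (Cod B h)"
  then have hn: "is_ntrans S A h" "nt_dom h = nt_cod \<eta>" and h0: "h \<cdot>\<^bsub>B\<^esub> \<eta> = Null B (nt_dom \<eta>) (nt_cod h)"
    by auto
  have hx: "nt_at h x \<cdot> nt_at \<eta> x = Null A (on_ob (nt_dom \<eta>) x) (on_ob (nt_cod h) x)" if "x \<in> Ob S" for x
    using arg_cong[OF h0, of "\<lambda>t. nt_at t x"] that by simp
  define u where "u x = desc_ar A (nt_at \<kappa> x) (nt_at h x)" for x
  have u: "u x \<in> Ar A" "Cod A (u x) = on_ob (nt_cod h) x" "Dom A (u x) = on_ob (nt_cod \<kappa>) x"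
    "u x \<cdot> nt_at \<kappa> x = nt_at h x" if "x \<in> Ob S" for x
    unfolding u_def using desc_ar[OF k[OF that], of "nt_at h x"] hx[OF that] assms hn that by auto
  have U: "is_ntrans S A (NTrans (nt_cod \<kappa>) (nt_cod h) (restrict u (Ob S)))"
  proof (rule is_ntransI)
    fix f assume f: "f \<in> Ar S"
    let ?x = "Dom S f" and ?y = "Cod S f"
    have "(on_ar (nt_cod h) f \<cdot> u ?x) \<cdot> nt_at \<kappa> ?x = nt_at h ?y \<cdot> on_ar (nt_dom h) f"
      using ntrans_natural[OF hn(1) f refl refl] hn assms u f by simp
    also have "\<dots> = u ?y \<cdot> nt_at \<kappa> ?y \<cdot> on_ar (nt_dom \<kappa>) f"
      using Cmp_extend[OF u(4), of ?y "on_ar (nt_dom \<kappa>) f"] hn u f assms by simp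
    also have "\<dots> = (u ?y \<cdot> on_ar (nt_cod \<kappa>) f) \<cdot> nt_at \<kappa> ?x"
      using ntrans_natural[OF assms(2) f refl refl] assms u f by simp
    finally show "u ?y \<cdot> on_ar (nt_cod \<kappa>) f = on_ar (nt_cod h) f \<cdot> u ?x"
      using epi_cancel[OF cokernel_epi[OF k[of ?x]], of "u ?y \<cdot> on_ar (nt_cod \<kappa>) f" "on_ar (nt_cod h) f \<cdot> u ?x"]
        assms u f hn by simp
  qed (use hn assms u S.category_axioms in simp_all)
  show "\<exists>!u. u \<in> Hom B (Cod B \<kappa>) (Cod B h) \<and> u \<cdot>\<^bsub>B\<^esub> \<kappa> = h"
  proof (rule ex1I[of _ "NTrans (nt_cod \<kappa>) (nt_cod h) (restrict u (Ob S))"])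
    show "NTrans (nt_cod \<kappa>) (nt_cod h) (restrict u (Ob S)) \<in> Hom B (Cod B \<kappa>) (Cod B h) \<and>
      NTrans (nt_cod \<kappa>) (nt_cod h) (restrict u (Ob S)) \<cdot>\<^bsub>B\<^esub> \<kappa> = h"
      using U hn assms u by (auto intro!: ntrans_eqI[of S A])
    fix v assume v: "v \<in> Hom B (Cod B \<kappa>) (Cod B h) \<and> v \<cdot>\<^bsub>B\<^esub> \<kappa> = h"
    then have vn: "is_ntrans S A v" "nt_dom v = nt_cod \<kappa>" "nt_cod v = nt_cod h" "v \<cdot>\<^bsub>B\<^esub> \<kappa> = h" by auto
    have "nt_at v x = u x" if "x \<in> Ob S" for x
      by (rule epi_cancel[OF cokernel_epi[OF k[OF that]]])
        (use arg_cong[OF vn(4), of "\<lambda>t. nt_at t x"] vn(1-3) u[OF that] that assms in simp_all)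
    then show "v = NTrans (nt_cod \<kappa>) (nt_cod h) (restrict u (Ob S))"
      using U vn by (intro ntrans_eqI[of S A]) auto
  qed
qed (use assms in auto)

text \<open>A definition instead of an existence statement: the covering sequences need a kernel
  that is a function of the covered object, namely \<open>ker_nt (counit F)\<close>.\<close>

definition ker_nt :: "('c, 'k, 'o, 'm) ntrans \<Rightarrow> ('c, 'k, 'o, 'm) ntrans" where
  "ker_nt \<eta> = (let k = (\<lambda>x. ker_ar A (nt_at \<eta> x)) in
     NTrans (Fctr (\<lambda>x\<in>Ob S. Dom A (k x)) (\<lambda>f\<in>Ar S. lift_ar A (k (Cod S f)) (on_ar (nt_dom \<eta>) f \<cdot> k (Dom S f))))
       (nt_dom \<eta>) (restrict k (Ob S)))"

lemma ker_nt:
  assumes \<eta>: "is_ntrans S A \<eta>"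
  shows "is_ntrans S A (ker_nt \<eta>)" "nt_cod (ker_nt \<eta>) = nt_dom \<eta>"
    "\<And>x. x \<in> Ob S \<Longrightarrow> is_kernel A (nt_at \<eta> x) (nt_at (ker_nt \<eta>) x)"
proof -
  define k where "k x = ker_ar A (nt_at \<eta> x)" for x
  have k: "is_kernel A (nt_at \<eta> x) (k x)" if "x \<in> Ob S" for x
    using ker_ar \<eta> that by (simp add: k_def)
  have ka: "k x \<in> Ar A" "Cod A (k x) = on_ob (nt_dom \<eta>) x"
    "nt_at \<eta> x \<cdot> k x = Null A (Dom A (k x)) (on_ob (nt_cod \<eta>) x)" if "x \<in> Ob S" for x
    using kernel_Ar[OF k[OF that]] \<eta> that by auto
  define a where "a f = lift_ar A (k (Cod S f)) (on_ar (nt_dom \<eta>) f \<cdot> k (Dom S f))" for f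
  have a: "a f \<in> Ar A" "Dom A (a f) = Dom A (k (Dom S f))" "Cod A (a f) = Dom A (k (Cod S f))"
    "k (Cod S f) \<cdot> a f = on_ar (nt_dom \<eta>) f \<cdot> k (Dom S f)" if "f \<in> Ar S" for f
  proof -
    have "nt_at \<eta> (Cod S f) \<cdot> on_ar (nt_dom \<eta>) f \<cdot> k (Dom S f)
      = Null A (Dom A (k (Dom S f))) (on_ob (nt_cod \<eta>) (Cod S f))"
      using Cmp_extend[OF ntrans_natural[OF \<eta> that refl refl], of "k (Dom S f)"] \<eta> that ka by simp
    then show "a f \<in> Ar A" "Dom A (a f) = Dom A (k (Dom S f))" "Cod A (a f) = Dom A (k (Cod S f))"
      "k (Cod S f) \<cdot> a f = on_ar (nt_dom \<eta>) f \<cdot> k (Dom S f)"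
      unfolding a_def using lift_ar[OF k[of "Cod S f"], of "on_ar (nt_dom \<eta>) f \<cdot> k (Dom S f)"] \<eta> that ka
      by auto
  qed
  define K where "K = Fctr (\<lambda>x\<in>Ob S. Dom A (k x)) (restrict a (Ar S))"
  have K: "is_functor S A K" unfolding K_def
  proof (rule is_functorI)
    fix x assume x: "x \<in> Ob S"
    show "a (Idn S x) = Idn A (Dom A (k x))"
      using mono_cancel[OF kernel_mono[OF k[OF x]], of "a (Idn S x)" "Idn A (Dom A (k x))"]
        a[of "Idn S x"] ka[OF x] x \<eta> by simp
  next
    fix f g assume fg: "f \<in> Ar S" "g \<in> Ar S" "Cod S f = Dom S g"
    have "k (Cod S g) \<cdot> (a g \<cdot> a f) = k (Cod S g) \<cdot> a (g \<cdot>\<^bsub>S\<^esub> f)"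
      using Cmp_extend[OF a(4)[OF fg(2)], of "a f"] a[of "g \<cdot>\<^bsub>S\<^esub> f"] a[OF fg(1)] a(1-3)[OF fg(2)] fg ka \<eta> by simp
    then show "a (g \<cdot>\<^bsub>S\<^esub> f) = a g \<cdot> a f"
      using mono_cancel[OF kernel_mono[OF k[of "Cod S g"]], of "a (g \<cdot>\<^bsub>S\<^esub> f)" "a g \<cdot> a f"]
        a(1-3)[of "g \<cdot>\<^bsub>S\<^esub> f"] a(1-3)[OF fg(1)] a(1-3)[OF fg(2)] fg by simp
  qed (use a ka S.category_axioms in simp_all)
  have e: "ker_nt \<eta> = NTrans K (nt_dom \<eta>) (restrict k (Ob S))"
    by (simp add: ker_nt_def K_def k_def a_def Let_def cong: restrict_cong)
  show "is_ntrans S A (ker_nt \<eta>)" unfolding e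
    by (rule is_ntransI) (use K \<eta> ka a S.category_axioms in \<open>simp_all add: K_def\<close>)
  show "nt_cod (ker_nt \<eta>) = nt_dom \<eta>" "\<And>x. x \<in> Ob S \<Longrightarrow> is_kernel A (nt_at \<eta> x) (nt_at (ker_nt \<eta>) x)"
    using k by (simp_all add: e)
qed

lemma ex_coker_nt:
  assumes \<eta>: "is_ntrans S A \<eta>"
  obtains \<kappa> where "is_ntrans S A \<kappa>" "nt_dom \<kappa> = nt_cod \<eta>"
    "\<And>x. x \<in> Ob S \<Longrightarrow> is_cokernel A (nt_at \<eta> x) (nt_at \<kappa> x)"
proof -
  define k where "k x = coker_ar A (nt_at \<eta> x)" for x
  have k: "is_cokernel A (nt_at \<eta> x) (k x)" if "x \<in> Ob S" for x
    using coker_ar \<eta> that by (simp add: k_def)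
  have ka: "k x \<in> Ar A" "Dom A (k x) = on_ob (nt_cod \<eta>) x"
    "k x \<cdot> nt_at \<eta> x = Null A (on_ob (nt_dom \<eta>) x) (Cod A (k x))" if "x \<in> Ob S" for x
    using cokernel_Ar[OF k[OF that]] \<eta> that by auto
  define a where "a f = desc_ar A (k (Dom S f)) (k (Cod S f) \<cdot> on_ar (nt_cod \<eta>) f)" for f
  have a: "a f \<in> Ar A" "Dom A (a f) = Cod A (k (Dom S f))" "Cod A (a f) = Cod A (k (Cod S f))"
    "a f \<cdot> k (Dom S f) = k (Cod S f) \<cdot> on_ar (nt_cod \<eta>) f" if "f \<in> Ar S" for f
  proof -
    have "(k (Cod S f) \<cdot> on_ar (nt_cod \<eta>) f) \<cdot> nt_at \<eta> (Dom S f)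
      = (k (Cod S f) \<cdot> nt_at \<eta> (Cod S f)) \<cdot> on_ar (nt_dom \<eta>) f"
      using ntrans_natural[OF \<eta> that refl refl] \<eta> that ka(1,2) by simp
    also have "\<dots> = Null A (on_ob (nt_dom \<eta>) (Dom S f)) (Cod A (k (Cod S f)))"
      using ka[of "Cod S f"] \<eta> that by simp
    finally show "a f \<in> Ar A" "Dom A (a f) = Cod A (k (Dom S f))" "Cod A (a f) = Cod A (k (Cod S f))"
      "a f \<cdot> k (Dom S f) = k (Cod S f) \<cdot> on_ar (nt_cod \<eta>) f"
      unfolding a_def using desc_ar[OF k[of "Dom S f"], of "k (Cod S f) \<cdot> on_ar (nt_cod \<eta>) f"] \<eta> that ka
      by auto
  qed
  define K where "K = Fctr (\<lambda>x\<in>Ob S. Cod A (k x)) (restrict a (Ar S))"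
  have K: "is_functor S A K" unfolding K_def
  proof (rule is_functorI)
    fix x assume x: "x \<in> Ob S"
    show "a (Idn S x) = Idn A (Cod A (k x))"
      using epi_cancel[OF cokernel_epi[OF k[OF x]], of "a (Idn S x)" "Idn A (Cod A (k x))"]
        a[of "Idn S x"] ka[OF x] x \<eta> by simp
  next
    fix f g assume fg: "f \<in> Ar S" "g \<in> Ar S" "Cod S f = Dom S g"
    have "(a g \<cdot> a f) \<cdot> k (Dom S f) = a g \<cdot> (k (Dom S g) \<cdot> on_ar (nt_cod \<eta>) f)"
      using a(4)[OF fg(1)] a(1-3)[OF fg(1)] a(1-3)[OF fg(2)] fg ka \<eta> by simp
    also have "\<dots> = a (g \<cdot>\<^bsub>S\<^esub> f) \<cdot> k (Dom S f)"
      using Cmp_extend[OF a(4)[OF fg(2)], of "on_ar (nt_cod \<eta>) f"] a[of "g \<cdot>\<^bsub>S\<^esub> f"] a(1-3)[OF fg(2)] fg ka \<eta> by simp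
    finally show "a (g \<cdot>\<^bsub>S\<^esub> f) = a g \<cdot> a f"
      using epi_cancel[OF cokernel_epi[OF k[of "Dom S f"]], of "a (g \<cdot>\<^bsub>S\<^esub> f)" "a g \<cdot> a f"]
        a(1-3)[of "g \<cdot>\<^bsub>S\<^esub> f"] a(1-3)[OF fg(1)] a(1-3)[OF fg(2)] fg by simp
  qed (use a ka S.category_axioms in simp_all)
  have "is_ntrans S A (NTrans (nt_cod \<eta>) K (restrict k (Ob S)))"
    by (rule is_ntransI) (use K \<eta> ka a S.category_axioms in \<open>simp_all add: K_def\<close>)
  then show ?thesis using that k by fastforce
qed

text \<open>A kernel in the functor category is known only through its universal property, so it is
  compared with the kernel \<open>\<kappa>'\<close> built pointwise. The comparison arrows
  \<open>v\<close> and \<open>w\<close> carry the universal property at \<open>x\<close> from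
  \<open>\<kappa>'\<close> to \<open>\<kappa>\<close>.\<close>

lemma kernel_pointwiseD:
  assumes "is_kernel B \<eta> \<kappa>" "x \<in> Ob S"
  shows "is_kernel A (nt_at \<eta> x) (nt_at \<kappa> x)"
proof -
  have n: "is_ntrans S A \<eta>" "is_ntrans S A \<kappa>" "nt_cod \<kappa> = nt_dom \<eta>"
    and z: "\<eta> \<cdot>\<^bsub>B\<^esub> \<kappa> = Null B (nt_dom \<kappa>) (nt_cod \<eta>)"
    and u: "\<And>h. \<lbrakk>is_ntrans S A h; nt_cod h = nt_dom \<eta>; \<eta> \<cdot>\<^bsub>B\<^esub> h = Null B (nt_dom h) (nt_cod \<eta>)\<rbrakk> \<Longrightarrow>
        \<exists>!u. u \<in> Hom B (nt_dom h) (nt_dom \<kappa>) \<and> \<kappa> \<cdot>\<^bsub>B\<^esub> u = h"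
    using assms(1) unfolding is_kernel_def by auto
  define \<kappa>' where "\<kappa>' = ker_nt \<eta>"
  have n': "is_ntrans S A \<kappa>'" "nt_cod \<kappa>' = nt_dom \<eta>"
    and k': "\<And>x. x \<in> Ob S \<Longrightarrow> is_kernel A (nt_at \<eta> x) (nt_at \<kappa>' x)"
    using ker_nt[OF n(1)] by (auto simp: \<kappa>'_def)
  have K': "is_kernel B \<eta> \<kappa>'" using kernel_pointwiseI n n' k' by blast
  have z': "\<eta> \<cdot>\<^bsub>B\<^esub> \<kappa>' = Null B (nt_dom \<kappa>') (nt_cod \<eta>)" using K' by (simp add: is_kernel_def)
  have "\<exists>v. v \<in> Hom B (nt_dom \<kappa>) (nt_dom \<kappa>') \<and> \<kappa>' \<cdot>\<^bsub>B\<^esub> v = \<kappa>"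
    using ex1_implies_ex[OF is_kernelD[OF K', of \<kappa>]] n z by simp
  then obtain v where v: "is_ntrans S A v" "nt_dom v = nt_dom \<kappa>" "nt_cod v = nt_dom \<kappa>'" "\<kappa>' \<cdot>\<^bsub>B\<^esub> v = \<kappa>"
    by auto
  obtain w where w: "is_ntrans S A w" "nt_dom w = nt_dom \<kappa>'" "nt_cod w = nt_dom \<kappa>" "\<kappa> \<cdot>\<^bsub>B\<^esub> w = \<kappa>'"
    using ex1_implies_ex[OF u[OF n' z']] by auto
  have "\<kappa> \<cdot>\<^bsub>B\<^esub> (w \<cdot>\<^bsub>B\<^esub> v) = (\<kappa> \<cdot>\<^bsub>B\<^esub> w) \<cdot>\<^bsub>B\<^esub> v"
    by (rule B.Cmp_assoc'[symmetric]) (use n v(1-3) w(1-3) in simp_all)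
  also have "\<dots> = \<kappa>" unfolding w(4) by (rule v(4))
  finally have "\<kappa> \<cdot>\<^bsub>B\<^esub> (w \<cdot>\<^bsub>B\<^esub> v) = \<kappa>" .
  moreover have "w \<cdot>\<^bsub>B\<^esub> v \<in> Hom B (nt_dom \<kappa>) (nt_dom \<kappa>)" "Idn B (nt_dom \<kappa>) \<in> Hom B (nt_dom \<kappa>) (nt_dom \<kappa>)"
    "\<kappa> \<cdot>\<^bsub>B\<^esub> Idn B (nt_dom \<kappa>) = \<kappa>" using n v(1-3) w(1-3) by simp_all
  ultimately have wv: "w \<cdot>\<^bsub>B\<^esub> v = Idn B (nt_dom \<kappa>)" using u[OF n(2,3) z] by blast
  have wvx: "nt_at w x \<cdot> nt_at v x = Idn A (on_ob (nt_dom \<kappa>) x)"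
    using arg_cong[OF wv, of "\<lambda>t. nt_at t x"] assms(2) by simp
  have vx: "nt_at \<kappa>' x \<cdot> nt_at v x = nt_at \<kappa> x" using arg_cong[OF v(4), of "\<lambda>t. nt_at t x"] assms(2) by simp
  have wx: "nt_at \<kappa> x \<cdot> nt_at w x = nt_at \<kappa>' x" using arg_cong[OF w(4), of "\<lambda>t. nt_at t x"] assms(2) by simp
  show ?thesis
  proof (rule is_kernelI)
    show "mono_ar A (nt_at \<kappa> x)"
    proof (rule mono_arI)
      fix t assume t: "t \<in> Ar A" "Cod A t = Dom A (nt_at \<kappa> x)" "nt_at \<kappa> x \<cdot> t = Null A (Dom A t) (Cod A (nt_at \<kappa> x))"
      then have "nt_at \<kappa>' x \<cdot> (nt_at v x \<cdot> t) = Null A (Dom A t) (on_ob (nt_dom \<eta>) x)"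
        using Cmp_extend[OF vx, of t] n n' v assms(2) by simp
      then have "nt_at v x \<cdot> t = Null A (Dom A t) (on_ob (nt_dom \<kappa>') x)"
        using mono_Null[OF kernel_mono[OF k'[OF assms(2)]], of "nt_at v x \<cdot> t"] n n' v t assms(2) by simp
      then have "nt_at w x \<cdot> nt_at v x \<cdot> t = Null A (Dom A t) (on_ob (nt_dom \<kappa>) x)"
        using w v t assms(2) n n' by simp
      then show "t = Null A (Dom A t) (Dom A (nt_at \<kappa> x))"
        using Cmp_extend[OF wvx, of t] w v t n assms(2) by simp
    qed (use n assms in simp)
    show "nt_at \<eta> x \<cdot> nt_at \<kappa> x = Null A (Dom A (nt_at \<kappa> x)) (Cod A (nt_at \<eta> x))"
      using arg_cong[OF z, of "\<lambda>t. nt_at t x"] n assms(2) by simp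
    fix h assume h: "h \<in> Ar A" "Cod A h = Dom A (nt_at \<eta> x)" "nt_at \<eta> x \<cdot> h = Null A (Dom A h) (Cod A (nt_at \<eta> x))"
    note l = lift_ar[OF k'[OF assms(2)] h]
    have "nt_at \<kappa> x \<cdot> (nt_at w x \<cdot> lift_ar A (nt_at \<kappa>' x) h) = h"
      using Cmp_extend[OF wx, of "lift_ar A (nt_at \<kappa>' x) h"] l n n' w assms(2) by simp
    then show "\<exists>u. u \<in> Hom A (Dom A h) (Dom A (nt_at \<kappa> x)) \<and> nt_at \<kappa> x \<cdot> u = h"
      using l n n' w assms(2) by (intro exI[of _ "nt_at w x \<cdot> lift_ar A (nt_at \<kappa>' x) h"]) simp
  qed (use n assms in simp_all)
qed

lemma cokernel_pointwiseD:
  assumes "is_cokernel B \<eta> \<kappa>" "x \<in> Ob S"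
  shows "is_cokernel A (nt_at \<eta> x) (nt_at \<kappa> x)"
proof -
  have n: "is_ntrans S A \<eta>" "is_ntrans S A \<kappa>" "nt_dom \<kappa> = nt_cod \<eta>"
    and z: "\<kappa> \<cdot>\<^bsub>B\<^esub> \<eta> = Null B (nt_dom \<eta>) (nt_cod \<kappa>)"
    and u: "\<And>h. \<lbrakk>is_ntrans S A h; nt_dom h = nt_cod \<eta>; h \<cdot>\<^bsub>B\<^esub> \<eta> = Null B (nt_dom \<eta>) (nt_cod h)\<rbrakk> \<Longrightarrow>
        \<exists>!u. u \<in> Hom B (nt_cod \<kappa>) (nt_cod h) \<and> u \<cdot>\<^bsub>B\<^esub> \<kappa> = h"
    using assms(1) unfolding is_cokernel_def by auto
  obtain \<kappa>' where n': "is_ntrans S A \<kappa>'" "nt_dom \<kappa>' = nt_cod \<eta>"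
    and k': "\<And>x. x \<in> Ob S \<Longrightarrow> is_cokernel A (nt_at \<eta> x) (nt_at \<kappa>' x)"
    using ex_coker_nt[OF n(1)] by blast
  have K': "is_cokernel B \<eta> \<kappa>'" using cokernel_pointwiseI n n' k' by blast
  have z': "\<kappa>' \<cdot>\<^bsub>B\<^esub> \<eta> = Null B (nt_dom \<eta>) (nt_cod \<kappa>')" using K' by (simp add: is_cokernel_def)
  have "\<exists>v. v \<in> Hom B (nt_cod \<kappa>') (nt_cod \<kappa>) \<and> v \<cdot>\<^bsub>B\<^esub> \<kappa>' = \<kappa>"
    using ex1_implies_ex[OF is_cokernelD[OF K', of \<kappa>]] n z by simp
  then obtain v where v: "is_ntrans S A v" "nt_cod v = nt_cod \<kappa>" "nt_dom v = nt_cod \<kappa>'" "v \<cdot>\<^bsub>B\<^esub> \<kappa>' = \<kappa>"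
    by auto
  obtain w where w: "is_ntrans S A w" "nt_cod w = nt_cod \<kappa>'" "nt_dom w = nt_cod \<kappa>" "w \<cdot>\<^bsub>B\<^esub> \<kappa> = \<kappa>'"
    using ex1_implies_ex[OF u[OF n' z']] by auto
  have "(v \<cdot>\<^bsub>B\<^esub> w) \<cdot>\<^bsub>B\<^esub> \<kappa> = v \<cdot>\<^bsub>B\<^esub> (w \<cdot>\<^bsub>B\<^esub> \<kappa>)"
    by (rule B.Cmp_assoc') (use n v(1-3) w(1-3) in simp_all)
  also have "\<dots> = \<kappa>" unfolding w(4) by (rule v(4))
  finally have "(v \<cdot>\<^bsub>B\<^esub> w) \<cdot>\<^bsub>B\<^esub> \<kappa> = \<kappa>" .
  moreover have "v \<cdot>\<^bsub>B\<^esub> w \<in> Hom B (nt_cod \<kappa>) (nt_cod \<kappa>)" "Idn B (nt_cod \<kappa>) \<in> Hom B (nt_cod \<kappa>) (nt_cod \<kappa>)"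
    "Idn B (nt_cod \<kappa>) \<cdot>\<^bsub>B\<^esub> \<kappa> = \<kappa>" using n v(1-3) w(1-3) by simp_all
  ultimately have wv: "v \<cdot>\<^bsub>B\<^esub> w = Idn B (nt_cod \<kappa>)" using u[OF n(2,3) z] by blast
  have wvx: "nt_at v x \<cdot> nt_at w x = Idn A (on_ob (nt_cod \<kappa>) x)"
    using arg_cong[OF wv, of "\<lambda>t. nt_at t x"] assms(2) by simp
  have vx: "nt_at v x \<cdot> nt_at \<kappa>' x = nt_at \<kappa> x" using arg_cong[OF v(4), of "\<lambda>t. nt_at t x"] assms(2) by simp
  have wx: "nt_at w x \<cdot> nt_at \<kappa> x = nt_at \<kappa>' x" using arg_cong[OF w(4), of "\<lambda>t. nt_at t x"] assms(2) by simp
  show ?thesis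
  proof (rule is_cokernelI)
    show "epi_ar A (nt_at \<kappa> x)"
    proof (rule epi_arI)
      fix t assume t: "t \<in> Ar A" "Dom A t = Cod A (nt_at \<kappa> x)" "t \<cdot> nt_at \<kappa> x = Null A (Dom A (nt_at \<kappa> x)) (Cod A t)"
      then have "(t \<cdot> nt_at v x) \<cdot> nt_at \<kappa>' x = Null A (on_ob (nt_cod \<eta>) x) (Cod A t)"
        using vx n n' v assms(2) by simp
      then have "t \<cdot> nt_at v x = Null A (on_ob (nt_cod \<kappa>') x) (Cod A t)"
        using epi_Null[OF cokernel_epi[OF k'[OF assms(2)]], of "t \<cdot> nt_at v x"] n n' v t assms(2) by simp
      then have "(t \<cdot> nt_at v x) \<cdot> nt_at w x = Null A (on_ob (nt_cod \<kappa>) x) (Cod A t)"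
        using w v t assms(2) n n' by simp
      then show "t = Null A (Cod A (nt_at \<kappa> x)) (Cod A t)"
        using wvx w v t n assms(2) by simp
    qed (use n assms in simp)
    show "nt_at \<kappa> x \<cdot> nt_at \<eta> x = Null A (Dom A (nt_at \<eta> x)) (Cod A (nt_at \<kappa> x))"
      using arg_cong[OF z, of "\<lambda>t. nt_at t x"] n assms(2) by simp
    fix h assume h: "h \<in> Ar A" "Dom A h = Cod A (nt_at \<eta> x)" "h \<cdot> nt_at \<eta> x = Null A (Dom A (nt_at \<eta> x)) (Cod A h)"
    note l = desc_ar[OF k'[OF assms(2)] h]
    have "(desc_ar A (nt_at \<kappa>' x) h \<cdot> nt_at w x) \<cdot> nt_at \<kappa> x = h"
      using wx l n n' w assms(2) by simp
    then show "\<exists>u. u \<in> Hom A (Cod A (nt_at \<kappa> x)) (Cod A h) \<and> u \<cdot> nt_at \<kappa> x = h"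
      using l n n' w assms(2) by (intro exI[of _ "desc_ar A (nt_at \<kappa>' x) h \<cdot> nt_at w x"]) simp
  qed (use n assms in simp_all)
qed

lemma short_exact_pointwise:
  "short_exact B f g \<longleftrightarrow> is_ntrans S A f \<and> is_ntrans S A g \<and> nt_cod f = nt_dom g \<and>
     (\<forall>x \<in> Ob S. short_exact A (nt_at f x) (nt_at g x))" (is "?l \<longleftrightarrow> ?r")
proof
  assume l: ?l
  then have "is_ntrans S A f" "is_ntrans S A g" "nt_cod f = nt_dom g"
    by (auto simp: short_exact_def is_kernel_def)
  with l show ?r by (auto simp: short_exact_def kernel_pointwiseD cokernel_pointwiseD)
next
  assume ?r
  then show ?l unfolding short_exact_def by (auto intro!: kernel_pointwiseI cokernel_pointwiseI)
qed

end

section \<open>The homological delta functor of an exact complex of functors\<close>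

context abelian_category
begin

lemma epi_Ar: "epi_ar A e \<Longrightarrow> e \<in> Ar A"
  by (simp add: epi_ar_def)

lemma epi_lift:
  assumes "epi_ar A g" "y \<in> Ar A" "Cod A y = Cod A g"
  obtains e x where "epi_ar A e" "e \<in> Ar A" "x \<in> Ar A" "Cod A e = Dom A y" "Dom A x = Dom A e"
    "Cod A x = Dom A g" "g \<cdot> x = y \<cdot> e"
  using pullback_epi[OF assms] epi_Ar by metis

lemma exact_lift:
  assumes "exact_at A f g" "y \<in> Ar A" "Cod A y = Dom A g" "g \<cdot> y = Null A (Dom A y) (Cod A g)"
  obtains e x where "epi_ar A e" "e \<in> Ar A" "x \<in> Ar A" "Cod A e = Dom A y" "Dom A x = Dom A e"
    "Cod A x = Dom A f" "f \<cdot> x = y \<cdot> e"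
  using exact_atD(5)[OF assms] epi_Ar by metis

lemma exact_cokernel: "is_cokernel A f q \<Longrightarrow> exact_at A f q"
  unfolding exact_at_def using ker_ar cokernel_Ar by metis

text \<open>Homology classes of generalized elements are represented by cycles only locally, so an arrow out
  of a homology object is obtained by gluing: an additive relation between generalized elements of
  \<open>H\<close> and of \<open>Y\<close> which is single-valued at \<open>0\<close> and locally total is the graph of an arrow.\<close>

lemma descend_relation:
  assumes H: "H \<in> Ob A" "Y \<in> Ob A"
    and ty: "\<And>a y. R a y \<Longrightarrow> a \<in> Ar A \<and> y \<in> Ar A \<and> Dom A y = Dom A a \<and> Cod A a = H \<and> Cod A y = Y"
    and Cmp: "\<And>a y t. \<lbrakk>R a y; t \<in> Ar A; Cod A t = Dom A a\<rbrakk> \<Longrightarrow> R (a \<cdot> t) (y \<cdot> t)"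
    and dif: "\<And>a y a' y'. \<lbrakk>R a y; R a' y'; Dom A a = Dom A a'\<rbrakk> \<Longrightarrow> R (a \<boxminus> a') (y \<boxminus> y')"
    and zero: "\<And>w y. R (Null A w H) y \<Longrightarrow> w \<in> Ob A \<Longrightarrow> y = Null A w Y"
    and total: "epi_ar A e" "R e v"
  shows "\<exists>m. m \<in> Hom A H Y \<and> (\<forall>a y. R a y \<longrightarrow> m \<cdot> a = y)"
proof -
  note e = ty[OF total(2)]
  \<comment> \<open>\<open>v\<close> kills whatever \<open>e\<close> kills: if
    \<open>e t = 0\<close>, then \<open>v t\<close> is related to zero.\<close>
  have "v \<cdot> t = Null A (Dom A t) (Cod A v)" if t: "t \<in> Ar A" "Cod A t = Dom A e"
    "e \<cdot> t = Null A (Dom A t) (Cod A e)" for t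
  proof -
    have "R (Null A (Dom A t) H) (v \<cdot> t)" using Cmp[OF total(2), of t] t e by simp
    then show ?thesis using zero t e by simp
  qed
  then obtain m where m: "m \<in> Ar A" "Dom A m = H" "Cod A m = Y" "m \<cdot> e = v"
    using epi_desc[OF total(1), of v] e by metis
  have "m \<cdot> a = y" if r: "R a y" for a y
  proof -
    note a = ty[OF r]
    obtain s t where s: "epi_ar A s" "s \<in> Ar A" "t \<in> Ar A" "Cod A s = Dom A a" "Dom A t = Dom A s"
      "Cod A t = Dom A e" "e \<cdot> t = a \<cdot> s"
      using epi_lift[OF total(1), of a] a e by metis
    \<comment> \<open>On a common cover the pair \<open>(a, y)\<close> differs from the chosen pair
      \<open>(e, v)\<close> by a pair whose first entry is zero, so \<open>zero\<close> forces the
      second entry to vanish.\<close>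
    have "R (e \<cdot> t \<boxminus> a \<cdot> s) (v \<cdot> t \<boxminus> y \<cdot> s)"
      by (rule dif) (use Cmp[OF total(2), of t] Cmp[OF r, of s] s a e in simp_all)
    then have "R (Null A (Dom A s) H) (v \<cdot> t \<boxminus> y \<cdot> s)" using s a e by simp
    then have "v \<cdot> t \<boxminus> y \<cdot> s = Null A (Dom A s) Y" using zero s by simp
    then have vt: "v \<cdot> t = y \<cdot> s" using s a e by simp
    have "(m \<cdot> a) \<cdot> s = m \<cdot> (e \<cdot> t)" using s a e m by simp
    also have "\<dots> = y \<cdot> s" using Cmp_extend[OF m(4), of t] m s e vt by simp
    finally show "m \<cdot> a = y" using epi_cancel[OF s(1), of "m \<cdot> a" y] s a m by simp
  qed
  then show ?thesis using m by auto
qed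

section \<open>Homology classes of generalized cycles\<close>

definition cyc :: "'m \<Rightarrow> 'm \<Rightarrow> bool" where
  "cyc g z \<longleftrightarrow> z \<in> Ar A \<and> Cod A z = Dom A g \<and> g \<cdot> z = Null A (Dom A z) (Cod A g)"

text \<open>The homology class of a cycle \<open>z\<close>: lift it to the kernel of
  \<open>g\<close>, then project. The choices \<open>ker_ar\<close> and \<open>coker_ar\<close> are
  those made in \<open>homology_ob\<close>, so the class is an arrow into that very object.\<close>

definition cls :: "'m \<Rightarrow> 'm \<Rightarrow> 'm \<Rightarrow> 'm" where
  "cls f g z = coker_ar A (lift_ar A (ker_ar A g) f) \<cdot> lift_ar A (ker_ar A g) z"

context
  fixes f g
  assumes f: "f \<in> Ar A" and g: "g \<in> Ar A" and fg: "Cod A f = Dom A g" and gf: "g \<cdot> f = Null A (Dom A f) (Cod A g)"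
begin

private definition "k = ker_ar A g"
private definition "u = lift_ar A k f"
private definition "q = coker_ar A u"

private lemma k: "is_kernel A g k" using ker_ar g by (simp add: k_def)
private lemmas ka = kernel_Ar[OF k]
private lemma u: "u \<in> Ar A" "Dom A u = Dom A f" "Cod A u = Dom A k" "k \<cdot> u = f"
  using lift_ar[OF k f fg gf] by (auto simp: u_def)
private lemma q: "is_cokernel A u q" using coker_ar u by (simp add: q_def)
private lemma qa: "q \<in> Ar A" "Dom A q = Dom A k" "Cod A q = homology_ob A f g"
  using cokernel_Ar[OF q] u unfolding homology_ob_def q_def u_def lift_ar_def k_def by auto
private lemma cls_eq: "cls f g z = q \<cdot> lift_ar A k z"
  by (simp add: cls_def q_def u_def k_def)
private lemma l: "cyc g z \<Longrightarrow> lift_ar A k z \<in> Ar A \<and> Dom A (lift_ar A k z) = Dom A z \<and>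
    Cod A (lift_ar A k z) = Dom A k \<and> k \<cdot> lift_ar A k z = z"
  using lift_ar[OF k, of z] by (simp add: cyc_def)
private lemma l_unique: "\<lbrakk>cyc g z; t \<in> Ar A; Cod A t = Dom A k; k \<cdot> t = z\<rbrakk> \<Longrightarrow> lift_ar A k z = t"
  using mono_cancel[OF kernel_mono[OF k], of "lift_ar A k z" t] l[of z] ka(1-3) by auto

lemma homology_Ob: "homology_ob A f g \<in> Ob A"
  using Dom_Cod_Ob(2)[OF qa(1)] qa by simp

lemma cls_Ar:
  assumes "cyc g z"
  shows "cls f g z \<in> Ar A" "Dom A (cls f g z) = Dom A z" "Cod A (cls f g z) = homology_ob A f g"
  using l[OF assms] qa by (simp_all add: cls_eq)

lemma cls_Cmp:
  assumes "cyc g z" "t \<in> Ar A" "Cod A t = Dom A z"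
  shows "cls f g (z \<cdot> t) = cls f g z \<cdot> t"
proof -
  have z: "z \<in> Ar A" "Cod A z = Dom A g" "g \<cdot> z = Null A (Dom A z) (Cod A g)"
    using assms(1) by (auto simp: cyc_def)
  have "cyc g (z \<cdot> t)" using Cmp_extend_Null(1)[OF z(3), of t] z(1,2) assms g by (simp add: cyc_def)
  moreover have "k \<cdot> (lift_ar A k z \<cdot> t) = z \<cdot> t"
    using Cmp_extend[of k "lift_ar A k z" z t] l[OF assms(1)] assms(2,3) ka by simp
  ultimately have "lift_ar A k (z \<cdot> t) = lift_ar A k z \<cdot> t"
    using l_unique[of "z \<cdot> t" "lift_ar A k z \<cdot> t"] l[OF assms(1)] assms(2,3) by simp
  then show ?thesis using l[OF assms(1)] assms(2,3) qa by (simp add: cls_eq)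
qed

lemma cls_Plus:
  assumes "cyc g z" "cyc g z'" "Dom A z = Dom A z'"
  shows "cls f g (z \<boxplus> z') = cls f g z \<boxplus> cls f g z'"
proof -
  have "cyc g (z \<boxplus> z')" using assms g by (simp add: cyc_def Cmp_Plus)
  then have "lift_ar A k (z \<boxplus> z') = lift_ar A k z \<boxplus> lift_ar A k z'"
    using l_unique[of "z \<boxplus> z'" "lift_ar A k z \<boxplus> lift_ar A k z'"] l[OF assms(1)] l[OF assms(2)] assms(3) ka
    by (simp add: Cmp_Plus)
  then show ?thesis using l[OF assms(1)] l[OF assms(2)] assms(3) qa by (simp add: cls_eq Cmp_Plus)
qed

lemma cls_dif:
  assumes "cyc g z" "cyc g z'" "Dom A z = Dom A z'"
  shows "cls f g (z \<boxminus> z') = cls f g z \<boxminus> cls f g z'"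
proof -
  have "cyc g (z \<boxminus> z')" using assms g by (simp add: cyc_def Cmp_dif)
  then have "lift_ar A k (z \<boxminus> z') = lift_ar A k z \<boxminus> lift_ar A k z'"
    using l_unique[of "z \<boxminus> z'" "lift_ar A k z \<boxminus> lift_ar A k z'"] l[OF assms(1)] l[OF assms(2)] assms(3) ka
    by (simp add: Cmp_dif)
  then show ?thesis using l[OF assms(1)] l[OF assms(2)] assms(3) qa by (simp add: cls_eq Cmp_dif)
qed

text \<open>By exactness at the source of the projection \<open>q\<close>, the lifted cycle comes
  from the lifted boundary arrow \<open>u\<close> after passing to a cover.\<close>

lemma cls_NullD:
  assumes "cyc g z" "cls f g z = Null A (Dom A z) (homology_ob A f g)"
  obtains e x where "epi_ar A e" "e \<in> Ar A" "x \<in> Ar A" "Cod A e = Dom A z" "Dom A x = Dom A e"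
    "Cod A x = Dom A f" "f \<cdot> x = z \<cdot> e"
proof -
  obtain e x where ex: "epi_ar A e" "e \<in> Ar A" "x \<in> Ar A" "Cod A e = Dom A z" "Dom A x = Dom A e"
      "Cod A x = Dom A u" "u \<cdot> x = lift_ar A k z \<cdot> e"
    using exact_lift[OF exact_cokernel[OF q], of "lift_ar A k z"] l[OF assms(1)] assms(2) qa
    unfolding cls_eq by metis
  have "f \<cdot> x = k \<cdot> (u \<cdot> x)" using Cmp_extend[OF u(4), of x] ex u ka by simp
  also have "\<dots> = z \<cdot> e" unfolding ex(7) using l[OF assms(1)] ex(1-6) ka
    Cmp_extend[of k "lift_ar A k z" z e] by simp
  finally show ?thesis using that ex u by metis
qed

text \<open>It suffices that \<open>z\<close> become a boundary on some cover \<open>e\<close>,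
  because \<open>e\<close> can be cancelled on the right of the class.\<close>

lemma cls_NullI:
  assumes "cyc g z" "epi_ar A e" "Cod A e = Dom A z" "x \<in> Ar A" "Dom A x = Dom A e" "Cod A x = Dom A f"
    "f \<cdot> x = z \<cdot> e"
  shows "cls f g z = Null A (Dom A z) (homology_ob A f g)"
proof -
  note e = epi_Ar[OF assms(2)]
  have "k \<cdot> (u \<cdot> x) = k \<cdot> (lift_ar A k z \<cdot> e)"
    using Cmp_extend[OF u(4), of x] Cmp_extend[of k "lift_ar A k z" z e] l[OF assms(1)] assms e u ka by simp
  then have ux: "u \<cdot> x = lift_ar A k z \<cdot> e"
    using mono_cancel[OF kernel_mono[OF k], of "u \<cdot> x" "lift_ar A k z \<cdot> e"] l[OF assms(1)] assms(3-6) e u ka by simp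
  have "(q \<cdot> lift_ar A k z) \<cdot> e = q \<cdot> (u \<cdot> x)" unfolding ux using l[OF assms(1)] assms(3-6) e qa by simp
  also have "\<dots> = Null A (Dom A e) (homology_ob A f g)"
    using Cmp_extend_Null(1)[OF cokernel_Ar(4)[OF q], of x] qa u assms(3-6) by simp
  finally show ?thesis unfolding cls_eq
    using epi_Null[OF assms(2), of "q \<cdot> lift_ar A k z"] l[OF assms(1)] assms(3) qa by simp
qed

lemma cls_boundary:
  assumes "x \<in> Ar A" "Cod A x = Dom A f"
  shows "cyc g (f \<cdot> x)" "cls f g (f \<cdot> x) = Null A (Dom A x) (homology_ob A f g)"
proof -
  show c: "cyc g (f \<cdot> x)" using Cmp_extend_Null(1)[OF gf, of x] assms f g fg by (simp add: cyc_def)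
  then show "cls f g (f \<cdot> x) = Null A (Dom A x) (homology_ob A f g)"
    using cls_NullI[OF c, of "Idn A (Dom A x)" x] assms f by simp
qed

lemma cls_surj:
  assumes "a \<in> Ar A" "Cod A a = homology_ob A f g"
  obtains e z where "epi_ar A e" "e \<in> Ar A" "cyc g z" "Cod A e = Dom A a" "Dom A z = Dom A e"
    "cls f g z = a \<cdot> e"
proof -
  obtain e x where ex: "epi_ar A e" "e \<in> Ar A" "x \<in> Ar A" "Cod A e = Dom A a" "Dom A x = Dom A e"
    "Cod A x = Dom A q" "q \<cdot> x = a \<cdot> e"
    using epi_lift[OF cokernel_epi[OF q], of a] assms qa by metis
  have c: "cyc g (k \<cdot> x)" using Cmp_extend_Null(1)[OF ka(4), of x] ex ka(1-3) qa by (simp add: cyc_def)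
  moreover have "lift_ar A k (k \<cdot> x) = x" using l_unique[OF c, of x] ex qa by simp
  ultimately show ?thesis using that[of e "k \<cdot> x"] ex ka qa by (simp add: cls_eq)
qed

text \<open>The identity of the homology object is, after some epimorphism, itself a class; arrows
  out of this object are therefore determined on classes.\<close>

lemma homology_ext:
  assumes "m \<in> Ar A" "m' \<in> Ar A" "Dom A m = homology_ob A f g" "Dom A m' = homology_ob A f g" "Cod A m = Cod A m'"
    and "\<And>z. cyc g z \<Longrightarrow> m \<cdot> cls f g z = m' \<cdot> cls f g z"
  shows "m = m'"
proof -
  obtain e z where ez: "epi_ar A e" "e \<in> Ar A" "cyc g z" "Cod A e = homology_ob A f g"
    "cls f g z = Idn A (homology_ob A f g) \<cdot> e"
    using cls_surj[of "Idn A (homology_ob A f g)"] homology_Ob by (metis Idn_Ar)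
  then have "m \<cdot> e = m' \<cdot> e" using assms(6)[OF ez(3)] by simp
  then show ?thesis using epi_cancel[OF ez(1), of m m'] ez assms by simp
qed

end

end

text \<open>Degrees are shifted by one: \<open>X (Suc n)\<close> gives the chains of degree \<open>n\<close>, and \<open>X 0\<close> is the zero
  object in degree \<open>-1\<close>.\<close>

locale exact_complex = abelian_category A + B: category B
  for A :: "('o, 'm, 'y) addcat_scheme" (structure) and B :: "('c, 'k, 'z) addcat_scheme" +
  fixes X :: "nat \<Rightarrow> ('c, 'k, 'o, 'm) fctr" and d :: "nat \<Rightarrow> 'c \<Rightarrow> 'm"
  assumes X_additive: "\<And>n. is_additive_functor B A (X n)"
    and X_exact: "\<And>n f g. short_exact B f g \<Longrightarrow> short_exact A (on_ar (X n) f) (on_ar (X n) g)"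
    and d_Hom: "\<And>n F. F \<in> Ob B \<Longrightarrow> d n F \<in> Hom A (on_ob (X (Suc n)) F) (on_ob (X n) F)"
    and d_natural: "\<And>n \<eta>. \<eta> \<in> Ar B \<Longrightarrow> d n (Cod B \<eta>) \<cdot> on_ar (X (Suc n)) \<eta> = on_ar (X n) \<eta> \<cdot> d n (Dom B \<eta>)"
    and d_d: "\<And>n F. F \<in> Ob B \<Longrightarrow> d n F \<cdot> d (Suc n) F = Null A (on_ob (X (Suc (Suc n))) F) (on_ob (X n) F)"
    and Plus_B: "\<And>f g. \<lbrakk>f \<in> Ar B; g \<in> Ar B; Dom B f = Dom B g; Cod B f = Cod B g\<rbrakk> \<Longrightarrow>
      Plus B f g \<in> Hom B (Dom B g) (Cod B g)"
    and X_0: "\<And>F. F \<in> Ob B \<Longrightarrow> is_zero_ob A (on_ob (X 0) F)"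
begin

lemma X_functor: "is_functor B A (X n)"
  using X_additive by (simp add: is_additive_functor_def)

lemmas X_simps [simp] = functor_simps[OF X_functor]

lemma d_simps [simp]:
  assumes "F \<in> Ob B"
  shows "d n F \<in> Ar A" "Dom A (d n F) = on_ob (X (Suc n)) F" "Cod A (d n F) = on_ob (X n) F"
  using d_Hom[OF assms, of n] by auto

abbreviation "H n F \<equiv> homology_ob A (d (Suc n) F) (d n F)"
abbreviation "Z n F \<equiv> cyc (d n F)"
abbreviation "c n F \<equiv> cls (d (Suc n) F) (d n F)"

lemma Z_iff: "F \<in> Ob B \<Longrightarrow> Z n F z \<longleftrightarrow> z \<in> Ar A \<and> Cod A z = on_ob (X (Suc n)) F \<and>
    d n F \<cdot> z = Null A (Dom A z) (on_ob (X n) F)"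
  by (simp add: cyc_def)

lemma Z_Ar: "\<lbrakk>F \<in> Ob B; Z n F z\<rbrakk> \<Longrightarrow> z \<in> Ar A" "\<lbrakk>F \<in> Ob B; Z n F z\<rbrakk> \<Longrightarrow> Cod A z = on_ob (X (Suc n)) F"
  by (simp_all add: cyc_def)

lemma cpx:
  assumes "F \<in> Ob B"
  shows "d (Suc n) F \<in> Ar A" "d n F \<in> Ar A" "Cod A (d (Suc n) F) = Dom A (d n F)"
    "d n F \<cdot> d (Suc n) F = Null A (Dom A (d (Suc n) F)) (Cod A (d n F))"
  using assms d_d by auto

context
  fixes F
  assumes F: "F \<in> Ob B"
begin

lemmas H_Ob [simp] = homology_Ob[OF cpx[OF F]]
lemmas c_Ar [simp] = cls_Ar[OF cpx[OF F]]
lemmas c_Cmp = cls_Cmp[OF cpx[OF F]]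
lemmas c_Plus = cls_Plus[OF cpx[OF F]]
lemmas c_dif = cls_dif[OF cpx[OF F]]
lemmas c_NullD = cls_NullD[OF cpx[OF F]]
lemmas c_NullI = cls_NullI[OF cpx[OF F]]
lemmas c_boundary = cls_boundary[OF cpx[OF F]]
lemmas c_surj = cls_surj[OF cpx[OF F]]
lemmas H_ext = homology_ext[OF cpx[OF F]]

end

lemma Z_Cmp: "\<lbrakk>F \<in> Ob B; Z n F z; t \<in> Ar A; Cod A t = Dom A z\<rbrakk> \<Longrightarrow> Z n F (z \<cdot> t)"
  using Cmp_extend_Null(1)[of "d n F" z t] by (simp add: Z_iff)

lemma Z_dif: "\<lbrakk>F \<in> Ob B; Z n F z; Z n F z'; Dom A z = Dom A z'\<rbrakk> \<Longrightarrow> Z n F (z \<boxminus> z')"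
  by (simp add: Z_iff Cmp_dif)

lemma c_Null: "\<lbrakk>F \<in> Ob B; w \<in> Ob A\<rbrakk> \<Longrightarrow> c n F (Null A w (on_ob (X (Suc n)) F)) = Null A w (H n F)"
  using c_boundary(2)[of F "Null A w (on_ob (X (Suc (Suc n))) F)" n] by simp

lemma d_X:
  "\<lbrakk>\<eta> \<in> Ar B; Dom B \<eta> = F; Cod B \<eta> = G; t \<in> Ar A; Cod A t = on_ob (X (Suc n)) F\<rbrakk> \<Longrightarrow>
    d n G \<cdot> (on_ar (X (Suc n)) \<eta> \<cdot> t) = on_ar (X n) \<eta> \<cdot> (d n F \<cdot> t)"
  using Cmp_extend[OF d_natural[of \<eta> n], of t] by auto

lemma d_d_Cmp:
  "\<lbrakk>F \<in> Ob B; t \<in> Ar A; Cod A t = on_ob (X (Suc (Suc n))) F\<rbrakk> \<Longrightarrow>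
    d n F \<cdot> (d (Suc n) F \<cdot> t) = Null A (Dom A t) (on_ob (X n) F)"
  using Cmp_extend[OF d_d[of F n], of t] by simp

lemma Z_X:
  assumes "\<eta> \<in> Ar B" "Dom B \<eta> = F" "Cod B \<eta> = G" "Z n F z"
  shows "Z n G (on_ar (X (Suc n)) \<eta> \<cdot> z)"
proof -
  have "F \<in> Ob B" "G \<in> Ob B" using assms by auto
  then show ?thesis using assms d_X[OF assms(1-3), of z n] by (simp add: Z_iff)
qed

text \<open>Gluing is applied to the relation between the class of \<open>z\<close> and the class of
  its image. It is single-valued because chain maps send boundaries to boundaries.\<close>

lemma ex_H_map:
  assumes "\<eta> \<in> Ar B" "Dom B \<eta> = F" "Cod B \<eta> = G"
  shows "\<exists>m. m \<in> Hom A (H n F) (H n G) \<and> (\<forall>z. Z n F z \<longrightarrow> m \<cdot> c n F z = c n G (on_ar (X (Suc n)) \<eta> \<cdot> z))"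
proof -
  have F: "F \<in> Ob B" "G \<in> Ob B" using assms by auto
  let ?R = "\<lambda>a y. \<exists>z. Z n F z \<and> a = c n F z \<and> y = c n G (on_ar (X (Suc n)) \<eta> \<cdot> z)"
  note zx = Z_X[OF assms]
  \<comment> \<open>Representing the identity of \<open>H n F\<close> by a class on a cover makes
    the relation locally total.\<close>
  obtain e z where ez: "epi_ar A e" "e \<in> Ar A" "Z n F z" "Cod A e = H n F" "c n F z = Idn A (H n F) \<cdot> e"
    using c_surj[OF F(1), of "Idn A (H n F)" n] F by (metis Idn_Ar H_Ob)
  have "\<exists>m. m \<in> Hom A (H n F) (H n G) \<and> (\<forall>a y. ?R a y \<longrightarrow> m \<cdot> a = y)"
  proof (rule descend_relation)
    show "H n F \<in> Ob A" "H n G \<in> Ob A" using F by simp_all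
    show "a \<in> Ar A \<and> y \<in> Ar A \<and> Dom A y = Dom A a \<and> Cod A a = H n F \<and> Cod A y = H n G" if "?R a y" for a y
      using that zx F assms Z_Ar[OF F(1)] by auto
    show "?R (a \<cdot> t) (y \<cdot> t)" if R: "?R a y" and t: "t \<in> Ar A" "Cod A t = Dom A a" for a y t
    proof -
      obtain z where z: "Z n F z" "a = c n F z" "y = c n G (on_ar (X (Suc n)) \<eta> \<cdot> z)" using R by blast
      then show ?thesis using t F assms Z_Ar[OF F(1) z(1)] Z_Cmp[OF F(1) z(1)] zx[OF z(1)]
          c_Cmp[OF F(1) z(1)] c_Cmp[OF F(2) zx[OF z(1)], of t]
        by (intro exI[of _ "z \<cdot> t"]) auto
    qed
    show "?R (a \<boxminus> a') (y \<boxminus> y')" if R: "?R a y" "?R a' y'" and D: "Dom A a = Dom A a'" for a y a' y'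
    proof -
      obtain z where z: "Z n F z" "a = c n F z" "y = c n G (on_ar (X (Suc n)) \<eta> \<cdot> z)" using R by blast
      obtain z' where z': "Z n F z'" "a' = c n F z'" "y' = c n G (on_ar (X (Suc n)) \<eta> \<cdot> z')" using R by blast
      have "Dom A z = Dom A z'" using D z z' F by simp
      then show ?thesis using F assms z z' Z_Ar[OF F(1) z(1)] Z_Ar[OF F(1) z'(1)] Z_dif[OF F(1) z(1) z'(1)]
          c_dif[OF F(1) z(1) z'(1)] c_dif[OF F(2) zx[OF z(1)] zx[OF z'(1)]]
        by (intro exI[of _ "z \<boxminus> z'"]) (auto simp: Cmp_dif)
    qed
    show "y = Null A w (H n G)" if R: "?R (Null A w (H n F)) y" and w: "w \<in> Ob A" for w y
    proof -
      obtain z where z: "Z n F z" "Null A w (H n F) = c n F z" "y = c n G (on_ar (X (Suc n)) \<eta> \<cdot> z)" using R by blast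
      note za = Z_Ar[OF F(1) z(1)]
      have Dz: "Dom A z = w" using z(2) c_Ar(2)[OF F(1) z(1)] w F by (metis H_Ob Null_Ar(2))
      obtain e x where ex: "epi_ar A e" "e \<in> Ar A" "x \<in> Ar A" "Cod A e = Dom A z" "Dom A x = Dom A e"
        "Cod A x = Dom A (d (Suc n) F)" "d (Suc n) F \<cdot> x = z \<cdot> e"
        using c_NullD[OF F(1) z(1)] z(2) Dz by metis
      have "d (Suc n) G \<cdot> (on_ar (X (Suc (Suc n))) \<eta> \<cdot> x) = (on_ar (X (Suc n)) \<eta> \<cdot> z) \<cdot> e"
        using d_X[OF assms, of x "Suc n"] ex F za assms by simp
      then have "c n G (on_ar (X (Suc n)) \<eta> \<cdot> z) = Null A (Dom A (on_ar (X (Suc n)) \<eta> \<cdot> z)) (H n G)"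
        using ex(1-6) F za assms by (intro c_NullI[OF F(2) zx[OF z(1)] ex(1)]) auto
      then show ?thesis using z(3) za assms Dz by simp
    qed
    show "epi_ar A e" by fact
    show "?R e (c n G (on_ar (X (Suc n)) \<eta> \<cdot> z))" using ez F by auto
  qed
  then show ?thesis by blast
qed

definition H_map :: "nat \<Rightarrow> 'k \<Rightarrow> 'm" where
  "H_map n \<eta> = (SOME m. m \<in> Hom A (H n (Dom B \<eta>)) (H n (Cod B \<eta>)) \<and>
    (\<forall>z. Z n (Dom B \<eta>) z \<longrightarrow> m \<cdot> c n (Dom B \<eta>) z = c n (Cod B \<eta>) (on_ar (X (Suc n)) \<eta> \<cdot> z)))"

lemma H_map:
  assumes "\<eta> \<in> Ar B"
  shows "H_map n \<eta> \<in> Ar A" "Dom A (H_map n \<eta>) = H n (Dom B \<eta>)" "Cod A (H_map n \<eta>) = H n (Cod B \<eta>)"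
    "Z n (Dom B \<eta>) z \<Longrightarrow> H_map n \<eta> \<cdot> c n (Dom B \<eta>) z = c n (Cod B \<eta>) (on_ar (X (Suc n)) \<eta> \<cdot> z)"
  using someI_ex[OF ex_H_map[OF assms refl refl, of n]] unfolding H_map_def[symmetric] by auto

definition HF :: "nat \<Rightarrow> ('c, 'k, 'o, 'm) fctr" where
  "HF n = Fctr (restrict (H n) (Ob B)) (restrict (H_map n) (Ar B))"

lemma HF_functor: "is_functor B A (HF n)"
  unfolding HF_def
proof (rule is_functorI)
  fix F assume F: "F \<in> Ob B"
  show "H_map n (Idn B F) = Idn A (H n F)"
    by (rule H_ext[OF F]) (use F H_map[of "Idn B F" n] Z_Ar in auto)
next
  fix \<eta> \<theta> assume e: "\<eta> \<in> Ar B" "\<theta> \<in> Ar B" "Cod B \<eta> = Dom B \<theta>"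
  have F: "Dom B \<eta> \<in> Ob B" "Cod B \<eta> \<in> Ob B" "Cod B \<theta> \<in> Ob B" using e by auto
  show "H_map n (\<theta> \<cdot>\<^bsub>B\<^esub> \<eta>) = H_map n \<theta> \<cdot> H_map n \<eta>"
  proof (rule H_ext[OF F(1)])
    fix z assume z: "Z n (Dom B \<eta>) z"
    have "H_map n \<theta> \<cdot> (H_map n \<eta> \<cdot> c n (Dom B \<eta>) z) = c n (Cod B \<theta>) (on_ar (X (Suc n)) \<theta> \<cdot> on_ar (X (Suc n)) \<eta> \<cdot> z)"
      using H_map(4)[OF e(1) z] H_map(4)[OF e(2), of n "on_ar (X (Suc n)) \<eta> \<cdot> z"] Z_X[OF e(1) refl refl z] e by simp
    then show "H_map n (\<theta> \<cdot>\<^bsub>B\<^esub> \<eta>) \<cdot> c n (Dom B \<eta>) z = (H_map n \<theta> \<cdot> H_map n \<eta>) \<cdot> c n (Dom B \<eta>) z"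
      using H_map(1-3)[of "\<theta> \<cdot>\<^bsub>B\<^esub> \<eta>" n] H_map(4)[of "\<theta> \<cdot>\<^bsub>B\<^esub> \<eta>" n z] H_map(1-3)[OF e(1), of n] H_map(1-3)[OF e(2), of n] e F z Z_Ar[OF F(1) z] by simp
  qed (use e H_map[of _ n] in simp_all)
qed (use H_map B.category_axioms in simp_all)

lemma HF_simps [simp]:
  "F \<in> Ob B \<Longrightarrow> on_ob (HF n) F = H n F" "\<eta> \<in> Ar B \<Longrightarrow> on_ar (HF n) \<eta> = H_map n \<eta>"
  by (simp_all add: HF_def)

lemma HF_additive: "is_additive_functor B A (HF n)"
  unfolding is_additive_functor_def
proof (intro conjI allI ballI)
  show "is_functor B A (HF n)" by (rule HF_functor)
  fix F G \<eta> \<theta> assume h: "\<eta> \<in> Hom B F G" "\<theta> \<in> Hom B F G"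
  note P = Plus_B[of \<eta> \<theta>]
  have F: "F \<in> Ob B" "G \<in> Ob B" using h by auto
  have p: "Plus B \<eta> \<theta> \<in> Ar B" "Dom B (Plus B \<eta> \<theta>) = F" "Cod B (Plus B \<eta> \<theta>) = G" using P h by auto
  have X: "on_ar (X (Suc n)) (Plus B \<eta> \<theta>) = on_ar (X (Suc n)) \<eta> \<boxplus> on_ar (X (Suc n)) \<theta>"
    using X_additive[of "Suc n"] h unfolding is_additive_functor_def by blast
  have "H_map n (Plus B \<eta> \<theta>) = H_map n \<eta> \<boxplus> H_map n \<theta>"
  proof (rule H_ext[OF F(1)])
    fix z assume z: "Z n F z"
    have x: "Z n G (on_ar (X (Suc n)) \<eta> \<cdot> z)" "Z n G (on_ar (X (Suc n)) \<theta> \<cdot> z)"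
      using Z_X[OF _ _ _ z] h by auto
    show "H_map n (Plus B \<eta> \<theta>) \<cdot> c n F z = (H_map n \<eta> \<boxplus> H_map n \<theta>) \<cdot> c n F z"
      using H_map(4)[OF p(1), of n z] H_map(4)[of \<eta> n z] H_map(4)[of \<theta> n z] H_map(1-3)[of \<eta> n] H_map(1-3)[of \<theta> n]
        c_Plus[OF F(2) x] z h p F X Z_Ar[OF F(1) z] by (simp add: Cmp_Plus)
  qed (use h p H_map[of _ n] F in simp_all)
  then show "on_ar (HF n) (Plus B \<eta> \<theta>) = on_ar (HF n) \<eta> \<boxplus> on_ar (HF n) \<theta>" using h p by simp
qed

end

section \<open>Connecting arrows and the long exact sequence\<close>

context exact_complex
begin

text \<open>The zig-zag of the snake lemma: \<open>w\<close> lifts the cycle \<open>z\<close> along \<open>g\<close>, and \<open>x\<close> lifts the boundary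
  of \<open>w\<close> along \<open>f\<close>.\<close>

definition bd_rel :: "nat \<Rightarrow> 'k \<Rightarrow> 'k \<Rightarrow> 'm \<Rightarrow> 'm \<Rightarrow> 'm \<Rightarrow> bool" where
  "bd_rel n f g z w x \<longleftrightarrow> Z (Suc n) (Cod B g) z \<and> w \<in> Ar A \<and> x \<in> Ar A \<and> Dom A w = Dom A z \<and> Dom A x = Dom A z \<and>
     Cod A w = on_ob (X (Suc (Suc n))) (Cod B f) \<and> Cod A x = on_ob (X (Suc n)) (Dom B f) \<and>
     on_ar (X (Suc (Suc n))) g \<cdot> w = z \<and> on_ar (X (Suc n)) f \<cdot> x = d (Suc n) (Cod B f) \<cdot> w"

definition bd :: "nat \<Rightarrow> 'k \<Rightarrow> 'k \<Rightarrow> 'm" where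
  "bd n f g = (SOME m. m \<in> Hom A (H (Suc n) (Cod B g)) (H n (Dom B f)) \<and>
     (\<forall>z w x. bd_rel n f g z w x \<longrightarrow> m \<cdot> c (Suc n) (Cod B g) z = c n (Dom B f) x))"

context
  fixes f g
  assumes se: "short_exact B f g"
begin

lemma short_exact_B: "f \<in> Ar B" "g \<in> Ar B" "Dom B g = Cod B f" "Dom B f \<in> Ob B" "Cod B f \<in> Ob B" "Cod B g \<in> Ob B"
proof -
  show "f \<in> Ar B" "g \<in> Ar B" "Dom B g = Cod B f" using se by (auto simp: short_exact_def is_kernel_def)
  then show "Dom B f \<in> Ob B" "Cod B f \<in> Ob B" "Cod B g \<in> Ob B" by auto
qed

private lemmas fg [simp] = short_exact_B

private lemma Xk: "is_kernel A (on_ar (X n) g) (on_ar (X n) f)" and Xc: "is_cokernel A (on_ar (X n) f) (on_ar (X n) g)"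
  using X_exact[OF se] by (auto simp: short_exact_def)

private lemma mono_f: "mono_ar A (on_ar (X n) f)" by (rule kernel_mono[OF Xk])
private lemma epi_g: "epi_ar A (on_ar (X n) g)" by (rule cokernel_epi[OF Xc])

private lemma lift_f:
  assumes "y \<in> Ar A" "Cod A y = on_ob (X n) (Cod B f)" "on_ar (X n) g \<cdot> y = Null A (Dom A y) (on_ob (X n) (Cod B g))"
  obtains x where "x \<in> Ar A" "Dom A x = Dom A y" "Cod A x = on_ob (X n) (Dom B f)" "on_ar (X n) f \<cdot> x = y"
  using lift_ar[OF Xk[of n], of y] assms by (metis X_simps(3) X_simps(4) fg(1) fg(2) fg(3))

private lemma lift_g:
  assumes "y \<in> Ar A" "Cod A y = on_ob (X n) (Cod B g)"
  obtains e x where "epi_ar A e" "e \<in> Ar A" "x \<in> Ar A" "Cod A e = Dom A y" "Dom A x = Dom A e"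
    "Cod A x = on_ob (X n) (Cod B f)" "on_ar (X n) g \<cdot> x = y \<cdot> e"
  using epi_lift[OF epi_g[of n], of y] assms by (metis X_simps(3) X_simps(4) fg(2) fg(3))

private lemma gf: "on_ar (X n) g \<cdot> on_ar (X n) f = Null A (on_ob (X n) (Dom B f)) (on_ob (X n) (Cod B g))"
  using kernel_Ar(4)[OF Xk[of n]] by simp

private lemma gf_Cmp: "\<lbrakk>t \<in> Ar A; Cod A t = on_ob (X n) (Dom B f)\<rbrakk> \<Longrightarrow>
    on_ar (X n) g \<cdot> (on_ar (X n) f \<cdot> t) = Null A (Dom A t) (on_ob (X n) (Cod B g))"
  using Cmp_extend[OF gf, of t n] by simp

private lemma f_Null: "\<lbrakk>t \<in> Ar A; Cod A t = on_ob (X n) (Dom B f); Dom A t = w;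
    on_ar (X n) f \<cdot> t = Null A w (on_ob (X n) (Cod B f))\<rbrakk> \<Longrightarrow> t = Null A w (on_ob (X n) (Dom B f))"
  using mono_Null[OF mono_f[of n], of t] by simp

text \<open>\<open>f\<close> is monic on chains, so it suffices that
  \<open>f d x = d f x = d d w = 0\<close>.\<close>

lemma bd_rel_Z:
  assumes "bd_rel n f g z w x"
  shows "Z n (Dom B f) x"
proof -
  note r = assms[unfolded bd_rel_def]
  have "on_ar (X n) f \<cdot> (d n (Dom B f) \<cdot> x) = d n (Cod B f) \<cdot> (on_ar (X (Suc n)) f \<cdot> x)"
    using d_X[of f _ _ x n] r by simp
  also have "\<dots> = d n (Cod B f) \<cdot> (d (Suc n) (Cod B f) \<cdot> w)" using r by simp
  also have "\<dots> = Null A (Dom A x) (on_ob (X n) (Cod B f))" using d_d_Cmp[of "Cod B f" w n] r by simp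
  finally show ?thesis using f_Null[of "d n (Dom B f) \<cdot> x" n "Dom A x"] r by (simp add: Z_iff)
qed

lemma ex_bd_rel:
  assumes "Z (Suc n) (Cod B g) z"
  obtains e w x where "epi_ar A e" "e \<in> Ar A" "Cod A e = Dom A z" "bd_rel n f g (z \<cdot> e) w x"
proof -
  note z = Z_Ar[OF fg(6) assms]
  obtain e w where w: "epi_ar A e" "e \<in> Ar A" "w \<in> Ar A" "Cod A e = Dom A z" "Dom A w = Dom A e"
    "Cod A w = on_ob (X (Suc (Suc n))) (Cod B f)" "on_ar (X (Suc (Suc n))) g \<cdot> w = z \<cdot> e"
    using lift_g[OF z] by blast
  have ze: "Z (Suc n) (Cod B g) (z \<cdot> e)" using Z_Cmp[OF fg(6) assms] w by simp
  have "on_ar (X (Suc n)) g \<cdot> (d (Suc n) (Cod B f) \<cdot> w) = d (Suc n) (Cod B g) \<cdot> (z \<cdot> e)"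
    using d_X[of g _ _ w "Suc n"] w by simp
  also have "\<dots> = Null A (Dom A w) (on_ob (X (Suc n)) (Cod B g))" using ze w z by (simp add: Z_iff)
  finally obtain x where "x \<in> Ar A" "Dom A x = Dom A w" "Cod A x = on_ob (X (Suc n)) (Dom B f)"
    "on_ar (X (Suc n)) f \<cdot> x = d (Suc n) (Cod B f) \<cdot> w"
    using lift_f[of "d (Suc n) (Cod B f) \<cdot> w" "Suc n"] w by auto
  then show ?thesis using that[of e w x] w ze z by (simp add: bd_rel_def)
qed

lemma bd_rel_Cmp:
  assumes "bd_rel n f g z w x" "t \<in> Ar A" "Cod A t = Dom A z"
  shows "bd_rel n f g (z \<cdot> t) (w \<cdot> t) (x \<cdot> t)"
proof -
  note r = assms(1)[unfolded bd_rel_def]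
  show ?thesis
    using r Z_Cmp[OF fg(6), of "Suc n" z t] assms(2,3) Z_Ar[OF fg(6), of "Suc n" z]
      Cmp_extend[of "on_ar (X (Suc (Suc n))) g" w z t] Cmp_extend[of "on_ar (X (Suc n)) f" x "d (Suc n) (Cod B f) \<cdot> w" t]
    unfolding bd_rel_def by simp
qed

lemma bd_rel_dif:
  assumes "bd_rel n f g z w x" "bd_rel n f g z' w' x'" "Dom A z = Dom A z'"
  shows "bd_rel n f g (z \<boxminus> z') (w \<boxminus> w') (x \<boxminus> x')"
  using assms Z_dif[OF fg(6), of "Suc n" z z'] Z_Ar[OF fg(6), of "Suc n" z] Z_Ar[OF fg(6), of "Suc n" z']
  unfolding bd_rel_def by (simp add: Cmp_dif)

text \<open>Independence of all choices in the zig-zag. Where \<open>z\<close> is the boundary of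
  \<open>z2\<close>, lift \<open>z2\<close> along \<open>g\<close> to \<open>w2\<close>; then
  \<open>w - d w2\<close> is killed by \<open>g\<close>, hence is the image of some
  \<open>x2\<close>, and \<open>d x2 = x\<close> because \<open>f\<close> is monic.\<close>

lemma bd_rel_Null:
  assumes r: "bd_rel n f g z w x" and z0: "c (Suc n) (Cod B g) z = Null A (Dom A z) (H (Suc n) (Cod B g))"
  shows "c n (Dom B f) x = Null A (Dom A z) (H n (Dom B f))"
proof -
  note rr = r[unfolded bd_rel_def]
  have z: "Z (Suc n) (Cod B g) z" using rr by simp
  note za = Z_Ar[OF fg(6) z]
  obtain e z2 where e: "epi_ar A e" "e \<in> Ar A" "z2 \<in> Ar A" "Cod A e = Dom A z" "Dom A z2 = Dom A e"
    "Cod A z2 = Dom A (d (Suc (Suc n)) (Cod B g))" "d (Suc (Suc n)) (Cod B g) \<cdot> z2 = z \<cdot> e"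
    using c_NullD[OF fg(6) z z0] by blast
  obtain e' w2 where e': "epi_ar A e'" "e' \<in> Ar A" "w2 \<in> Ar A" "Cod A e' = Dom A z2" "Dom A w2 = Dom A e'"
    "Cod A w2 = on_ob (X (Suc (Suc (Suc n)))) (Cod B f)" "on_ar (X (Suc (Suc (Suc n)))) g \<cdot> w2 = z2 \<cdot> e'"
    using lift_g[of z2 "Suc (Suc (Suc n))"] e by auto
  define t where "t = e \<cdot> e'"
  have t: "epi_ar A t" "t \<in> Ar A" "Cod A t = Dom A z" "Dom A t = Dom A w2"
    using e e' epi_Cmp[OF e'(1) e(1)] by (simp_all add: t_def)
  define y where "y = w \<cdot> t \<boxminus> d (Suc (Suc n)) (Cod B f) \<cdot> w2"
  have y: "y \<in> Ar A" "Dom A y = Dom A w2" "Cod A y = on_ob (X (Suc (Suc n))) (Cod B f)"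
    using rr t e' by (simp_all add: y_def)
  have "on_ar (X (Suc (Suc n))) g \<cdot> (d (Suc (Suc n)) (Cod B f) \<cdot> w2) = d (Suc (Suc n)) (Cod B g) \<cdot> (z2 \<cdot> e')"
    using d_X[of g _ _ w2 "Suc (Suc n)"] e' by simp
  also have "\<dots> = z \<cdot> t" using Cmp_extend[OF e(7), of e'] e(2-6) e' za by (simp add: t_def)
  finally have "on_ar (X (Suc (Suc n))) g \<cdot> y = Null A (Dom A y) (on_ob (X (Suc (Suc n))) (Cod B g))"
    using Cmp_extend[of "on_ar (X (Suc (Suc n))) g" w z t] rr t e' za by (simp add: y_def Cmp_dif)
  then obtain x2 where x2: "x2 \<in> Ar A" "Dom A x2 = Dom A y" "Cod A x2 = on_ob (X (Suc (Suc n))) (Dom B f)"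
    "on_ar (X (Suc (Suc n))) f \<cdot> x2 = y"
    using lift_f[of y "Suc (Suc n)"] y by blast
  have "on_ar (X (Suc n)) f \<cdot> (d (Suc n) (Dom B f) \<cdot> x2) = d (Suc n) (Cod B f) \<cdot> y"
    using d_X[of f _ _ x2 "Suc n"] x2 by simp
  also have "\<dots> = d (Suc n) (Cod B f) \<cdot> w \<cdot> t"
    using rr t e' d_d_Cmp[of "Cod B f" w2 "Suc n"] by (simp add: y_def Cmp_dif)
  also have "\<dots> = on_ar (X (Suc n)) f \<cdot> (x \<cdot> t)"
    using Cmp_extend[of "on_ar (X (Suc n)) f" x "d (Suc n) (Cod B f) \<cdot> w" t] rr t by simp
  finally have "d (Suc n) (Dom B f) \<cdot> x2 = x \<cdot> t"
    using mono_cancel[OF mono_f[of "Suc n"], of "d (Suc n) (Dom B f) \<cdot> x2" "x \<cdot> t"] x2 rr t y by simp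
  then show ?thesis using c_NullI[OF fg(4) bd_rel_Z[OF r] t(1), of x2] rr t x2 y by simp
qed

lemma ex_bd:
  "\<exists>m. m \<in> Hom A (H (Suc n) (Cod B g)) (H n (Dom B f)) \<and>
     (\<forall>z w x. bd_rel n f g z w x \<longrightarrow> m \<cdot> c (Suc n) (Cod B g) z = c n (Dom B f) x)"
proof -
  let ?R = "\<lambda>a y. \<exists>z w x. bd_rel n f g z w x \<and> a = c (Suc n) (Cod B g) z \<and> y = c n (Dom B f) x"
  have ra: "Z (Suc n) (Cod B g) z \<and> Z n (Dom B f) x \<and> Dom A x = Dom A z \<and> x \<in> Ar A \<and> z \<in> Ar A" if "bd_rel n f g z w x" for z w x
    using that bd_rel_Z[OF that] Z_Ar[OF fg(6), of "Suc n" z] by (simp add: bd_rel_def)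
  have "Idn A (H (Suc n) (Cod B g)) \<in> Ar A" "Cod A (Idn A (H (Suc n) (Cod B g))) = H (Suc n) (Cod B g)"
    by simp_all
  from c_surj[OF fg(6) this] obtain e z where ez: "epi_ar A e" "e \<in> Ar A" "Z (Suc n) (Cod B g) z"
    "Cod A e = H (Suc n) (Cod B g)" "Dom A z = Dom A e" "c (Suc n) (Cod B g) z = e"
    using fg(6) by (metis Cmp_Idn(2) H_Ob Idn_Ar(2))
  obtain e' w x where e': "epi_ar A e'" "e' \<in> Ar A" "Cod A e' = Dom A z" "bd_rel n f g (z \<cdot> e') w x"
    using ex_bd_rel[OF ez(3)] by blast
  have "\<exists>m. m \<in> Hom A (H (Suc n) (Cod B g)) (H n (Dom B f)) \<and> (\<forall>a y. ?R a y \<longrightarrow> m \<cdot> a = y)"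
  proof (rule descend_relation)
    show "H (Suc n) (Cod B g) \<in> Ob A" "H n (Dom B f) \<in> Ob A" by simp_all
    show "a \<in> Ar A \<and> y \<in> Ar A \<and> Dom A y = Dom A a \<and> Cod A a = H (Suc n) (Cod B g) \<and> Cod A y = H n (Dom B f)"
      if "?R a y" for a y using that ra by fastforce
    show "?R (a \<cdot> t) (y \<cdot> t)" if R: "?R a y" and t: "t \<in> Ar A" "Cod A t = Dom A a" for a y t
    proof -
      obtain z w x where z: "bd_rel n f g z w x" "a = c (Suc n) (Cod B g) z" "y = c n (Dom B f) x" using R by blast
      have t': "Cod A t = Dom A z" using t z ra[OF z(1)] by simp
      show ?thesis
        using bd_rel_Cmp[OF z(1) t(1) t'] z(2,3) t' t(1) ra[OF z(1)]
          c_Cmp[OF fg(6), of "Suc n" z t] c_Cmp[OF fg(4), of n x t] by metis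
    qed
    show "?R (a \<boxminus> a') (y \<boxminus> y')" if R: "?R a y" "?R a' y'" and D: "Dom A a = Dom A a'" for a y a' y'
    proof -
      obtain z w x where z: "bd_rel n f g z w x" "a = c (Suc n) (Cod B g) z" "y = c n (Dom B f) x" using R by blast
      obtain z' w' x' where z': "bd_rel n f g z' w' x'" "a' = c (Suc n) (Cod B g) z'" "y' = c n (Dom B f) x'" using R by blast
      have D': "Dom A z = Dom A z'" using D z z' ra[OF z(1)] ra[OF z'(1)] by simp
      show ?thesis
        using bd_rel_dif[OF z(1) z'(1) D'] z(2,3) z'(2,3) ra[OF z(1)] ra[OF z'(1)] D'
          c_dif[OF fg(6), of "Suc n" z z'] c_dif[OF fg(4), of n x x'] by metis
    qed
    show "y = Null A v (H n (Dom B f))" if R: "?R (Null A v (H (Suc n) (Cod B g))) y" and v: "v \<in> Ob A" for v y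
    proof -
      obtain z w x where z: "bd_rel n f g z w x" "Null A v (H (Suc n) (Cod B g)) = c (Suc n) (Cod B g) z" "y = c n (Dom B f) x"
        using R by blast
      have "Dom A z = v" using z(2) c_Ar(2)[OF fg(6), of "Suc n" z] ra[OF z(1)] v by (metis H_Ob Null_Ar(2) fg(6))
      then show ?thesis using bd_rel_Null[OF z(1)] z(2,3) by metis
    qed
    show "epi_ar A (e \<cdot> e')" using epi_Cmp[OF e'(1) ez(1)] ez e' by simp
    show "?R (e \<cdot> e') (c n (Dom B f) x)" using e' ez c_Cmp[OF fg(6) ez(3) e'(2,3)] by metis
  qed
  then show ?thesis by blast
qed

lemma bd:
  "bd n f g \<in> Ar A" "Dom A (bd n f g) = H (Suc n) (Cod B g)" "Cod A (bd n f g) = H n (Dom B f)"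
  "bd_rel n f g z w x \<Longrightarrow> bd n f g \<cdot> c (Suc n) (Cod B g) z = c n (Dom B f) x"
  using someI_ex[OF ex_bd, of n] unfolding bd_def[symmetric] by auto

text \<open>If the class of \<open>g w\<close> vanishes, correct \<open>w\<close> by the boundary of
  a lift \<open>w2\<close> of the bounding chain. The class of \<open>w\<close> is unchanged, and
  the corrected cycle \<open>v\<close> is killed by \<open>g\<close>, hence comes from a cycle of
  \<open>Dom B f\<close>.\<close>

lemma H_exact_middle: "exact_at A (H_map n f) (H_map n g)"
proof (rule exact_atI)
  note hf = H_map(1-3)[OF fg(1), of n] and hg = H_map(1-3)[OF fg(2), of n]
  show "H_map n f \<in> Ar A" "H_map n g \<in> Ar A" "Cod A (H_map n f) = Dom A (H_map n g)" using hf hg by simp_all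
  have "H_map n g \<cdot> H_map n f = Null A (H n (Dom B f)) (H n (Cod B g))"
  proof (rule H_ext[OF fg(4)])
    fix z assume z: "Z n (Dom B f) z"
    show "(H_map n g \<cdot> H_map n f) \<cdot> c n (Dom B f) z = Null A (H n (Dom B f)) (H n (Cod B g)) \<cdot> c n (Dom B f) z"
      using H_map(4)[OF fg(1) z] H_map(4)[OF fg(2), of n "on_ar (X (Suc n)) f \<cdot> z"] Z_X[OF fg(1) refl refl z] hf hg z
        gf_Cmp[of z "Suc n"] Z_Ar[OF fg(4) z] c_Null[OF fg(6), of "Dom A z" n] by simp
  qed (use hf hg in simp_all)
  then show "H_map n g \<cdot> H_map n f = Null A (Dom A (H_map n f)) (Cod A (H_map n g))" using hf hg by simp
  fix y assume y: "y \<in> Ar A" "Cod A y = Dom A (H_map n g)" "H_map n g \<cdot> y = Null A (Dom A y) (Cod A (H_map n g))"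
  obtain e w where e: "epi_ar A e" "e \<in> Ar A" "Z n (Cod B f) w" "Cod A e = Dom A y" "Dom A w = Dom A e" "c n (Cod B f) w = y \<cdot> e"
    using c_surj[OF fg(5), of y n] y hg by auto
  note wa = Z_Ar[OF fg(5) e(3)]
  note gw = Z_X[OF fg(2) _ refl e(3)]
  have "c n (Cod B g) (on_ar (X (Suc n)) g \<cdot> w) = H_map n g \<cdot> (y \<cdot> e)"
    using H_map(4)[OF fg(2), of n w] e(3,6) by simp
  also have "\<dots> = Null A (Dom A e) (H n (Cod B g))" using Cmp_extend_Null(1)[of "H_map n g" y e] y hg e(2,4) by simp
  finally obtain e2 z2 where e2: "epi_ar A e2" "e2 \<in> Ar A" "z2 \<in> Ar A" "Cod A e2 = Dom A w" "Dom A z2 = Dom A e2"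
    "Cod A z2 = on_ob (X (Suc (Suc n))) (Cod B g)" "d (Suc n) (Cod B g) \<cdot> z2 = (on_ar (X (Suc n)) g \<cdot> w) \<cdot> e2"
    using c_NullD[OF fg(6) gw[OF fg(3)]] wa e(5) by auto
  obtain e3 w2 where e3: "epi_ar A e3" "e3 \<in> Ar A" "w2 \<in> Ar A" "Cod A e3 = Dom A z2" "Dom A w2 = Dom A e3"
    "Cod A w2 = on_ob (X (Suc (Suc n))) (Cod B f)" "on_ar (X (Suc (Suc n))) g \<cdot> w2 = z2 \<cdot> e3"
    using lift_g[of z2 "Suc (Suc n)"] e2 by auto
  define t where "t = e2 \<cdot> e3"
  have t: "epi_ar A t" "t \<in> Ar A" "Cod A t = Dom A w" "Dom A t = Dom A w2"
    using e2 e3 epi_Cmp[OF e3(1) e2(1)] by (simp_all add: t_def)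
  define v where "v = w \<cdot> t \<boxminus> d (Suc n) (Cod B f) \<cdot> w2"
  have wt: "Z n (Cod B f) (w \<cdot> t)" using Z_Cmp[OF fg(5) e(3)] t by simp
  have w2: "Z n (Cod B f) (d (Suc n) (Cod B f) \<cdot> w2)"
    "c n (Cod B f) (d (Suc n) (Cod B f) \<cdot> w2) = Null A (Dom A w2) (H n (Cod B f))"
    using c_boundary[OF fg(5), of w2 n] e3 by simp_all
  have v: "Z n (Cod B f) v" unfolding v_def by (rule Z_dif[OF fg(5) wt w2(1)]) (use t e3 wa in simp)
  have va: "v \<in> Ar A" "Dom A v = Dom A w2" "Cod A v = on_ob (X (Suc n)) (Cod B f)"
    using t e3 wa by (simp_all add: v_def)
  have "on_ar (X (Suc n)) g \<cdot> (d (Suc n) (Cod B f) \<cdot> w2) = d (Suc n) (Cod B g) \<cdot> (z2 \<cdot> e3)"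
    using d_X[of g _ _ w2 "Suc n"] e3 by simp
  also have "\<dots> = on_ar (X (Suc n)) g \<cdot> w \<cdot> t" using Cmp_extend[OF e2(7), of e3] e2(2-6) e3 wa by (simp add: t_def)
  finally have "on_ar (X (Suc n)) g \<cdot> v = Null A (Dom A v) (on_ob (X (Suc n)) (Cod B g))"
    using t e3 wa by (simp add: v_def Cmp_dif)
  then obtain x where x: "x \<in> Ar A" "Dom A x = Dom A v" "Cod A x = on_ob (X (Suc n)) (Dom B f)" "on_ar (X (Suc n)) f \<cdot> x = v"
    using lift_f[of v "Suc n"] va by blast
  have "on_ar (X n) f \<cdot> (d n (Dom B f) \<cdot> x) = Null A (Dom A x) (on_ob (X n) (Cod B f))"
    using d_X[of f _ _ x n] x v va by (simp add: Z_iff)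
  then have xz: "Z n (Dom B f) x" using f_Null[of "d n (Dom B f) \<cdot> x" n "Dom A x"] x by (simp add: Z_iff)
  have "H_map n f \<cdot> c n (Dom B f) x = c n (Cod B f) v" using H_map(4)[OF fg(1) xz] x by simp
  also have "\<dots> = c n (Cod B f) w \<cdot> t"
    unfolding v_def using c_dif[OF fg(5) wt w2(1)] w2(2) c_Cmp[OF fg(5) e(3) t(2,3)] t e3 wa e y(1,2) hg by simp
  also have "\<dots> = y \<cdot> (e \<cdot> t)" unfolding e(6) using e t y by simp
  finally show "\<exists>e x. epi_ar A e \<and> x \<in> Ar A \<and> Cod A e = Dom A y \<and> Dom A x = Dom A e \<and> Cod A x = Dom A (H_map n f) \<and>
      H_map n f \<cdot> x = y \<cdot> e"
    using epi_Cmp[OF t(1) e(1)] e t xz x va hf by (intro exI[of _ "e \<cdot> t"] exI[of _ "c n (Dom B f) x"]) simp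
qed

lemma H_exact_bd_left: "exact_at A (H_map (Suc n) g) (bd n f g)"
proof (rule exact_atI)
  note hg = H_map(1-3)[OF fg(2), of "Suc n"] and b = bd(1-3)[of n]
  show "H_map (Suc n) g \<in> Ar A" "bd n f g \<in> Ar A" "Cod A (H_map (Suc n) g) = Dom A (bd n f g)" using hg b by simp_all
  have "bd n f g \<cdot> H_map (Suc n) g = Null A (H (Suc n) (Cod B f)) (H n (Dom B f))"
  proof (rule H_ext[OF fg(5)])
    fix w assume w: "Z (Suc n) (Cod B f) w"
    note wa = Z_Ar[OF fg(5) w]
    \<comment> \<open>A cycle \<open>w\<close> is a lift of its own image and has boundary zero, so
      this zig-zag ends in zero.\<close>
    have "bd_rel n f g (on_ar (X (Suc (Suc n))) g \<cdot> w) w (Null A (Dom A w) (on_ob (X (Suc n)) (Dom B f)))"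
      using w wa Z_X[OF fg(2) _ refl w] by (simp add: bd_rel_def Z_iff)
    from bd(4)[OF this] show "(bd n f g \<cdot> H_map (Suc n) g) \<cdot> c (Suc n) (Cod B f) w
        = Null A (H (Suc n) (Cod B f)) (H n (Dom B f)) \<cdot> c (Suc n) (Cod B f) w"
      using H_map(4)[OF fg(2), of "Suc n" w] c_Null[OF fg(4), of "Dom A w" n] hg b w wa by simp
  qed (use hg b in simp_all)
  then show "bd n f g \<cdot> H_map (Suc n) g = Null A (Dom A (H_map (Suc n) g)) (Cod A (bd n f g))" using hg b by simp
  fix y assume y: "y \<in> Ar A" "Cod A y = Dom A (bd n f g)" "bd n f g \<cdot> y = Null A (Dom A y) (Cod A (bd n f g))"
  obtain e z where e: "epi_ar A e" "e \<in> Ar A" "Z (Suc n) (Cod B g) z" "Cod A e = Dom A y" "Dom A z = Dom A e"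
    "c (Suc n) (Cod B g) z = y \<cdot> e"
    using c_surj[OF fg(6), of y "Suc n"] y b by auto
  note za = Z_Ar[OF fg(6) e(3)]
  obtain e2 w x where r: "epi_ar A e2" "e2 \<in> Ar A" "Cod A e2 = Dom A z" "bd_rel n f g (z \<cdot> e2) w x"
    using ex_bd_rel[OF e(3)] by blast
  note rr = r(4)[unfolded bd_rel_def]
  have cz: "c (Suc n) (Cod B g) (z \<cdot> e2) = y \<cdot> (e \<cdot> e2)"
    using c_Cmp[OF fg(6) e(3) r(2,3)] e r(2,3) y b by simp
  have "c n (Dom B f) x = bd n f g \<cdot> (y \<cdot> (e \<cdot> e2))" using bd(4)[OF r(4)] cz by simp
  also have "\<dots> = Null A (Dom A x) (H n (Dom B f))"
    using Cmp_extend_Null(1)[OF y(3), of "e \<cdot> e2"] y b e r(2,3) rr za by simp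
  finally obtain e3 x2 where e3: "epi_ar A e3" "e3 \<in> Ar A" "x2 \<in> Ar A" "Cod A e3 = Dom A x" "Dom A x2 = Dom A e3"
    "Cod A x2 = on_ob (X (Suc (Suc n))) (Dom B f)" "d (Suc n) (Dom B f) \<cdot> x2 = x \<cdot> e3"
    using c_NullD[OF fg(4) bd_rel_Z[OF r(4)]] by auto
  \<comment> \<open>On a cover the zig-zag ends in the boundary of \<open>x2\<close>, so subtracting
    \<open>f x2\<close> turns the lift \<open>w\<close> into a cycle with the same image under
    \<open>g\<close>.\<close>
  define v where "v = w \<cdot> e3 \<boxminus> on_ar (X (Suc (Suc n))) f \<cdot> x2"
  have va: "v \<in> Ar A" "Dom A v = Dom A e3" "Cod A v = on_ob (X (Suc (Suc n))) (Cod B f)"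
    using rr e3 r za by (simp_all add: v_def)
  have "d (Suc n) (Cod B f) \<cdot> (on_ar (X (Suc (Suc n))) f \<cdot> x2) = on_ar (X (Suc n)) f \<cdot> (x \<cdot> e3)"
    using d_X[of f _ _ x2 "Suc n"] e3 by simp
  also have "\<dots> = d (Suc n) (Cod B f) \<cdot> (w \<cdot> e3)"
    using Cmp_extend[of "on_ar (X (Suc n)) f" x "d (Suc n) (Cod B f) \<cdot> w" e3] rr e3 r za by simp
  finally have v: "Z (Suc n) (Cod B f) v" using va rr e3 r za by (simp add: Z_iff v_def Cmp_dif)
  have "on_ar (X (Suc (Suc n))) g \<cdot> v = (z \<cdot> e2) \<cdot> e3"
    using Cmp_extend[of "on_ar (X (Suc (Suc n))) g" w "z \<cdot> e2" e3] rr e3 r za gf_Cmp[of x2 "Suc (Suc n)"]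
    by (simp add: v_def Cmp_dif)
  then have "H_map (Suc n) g \<cdot> c (Suc n) (Cod B f) v = c (Suc n) (Cod B g) ((z \<cdot> e2) \<cdot> e3)"
    using H_map(4)[OF fg(2), of "Suc n" v] v by simp
  also have "\<dots> = y \<cdot> ((e \<cdot> e2) \<cdot> e3)"
    using c_Cmp[OF fg(6), of "Suc n" "z \<cdot> e2" e3] cz rr e3 e r(2,3) y b za by simp
  finally show "\<exists>e x. epi_ar A e \<and> x \<in> Ar A \<and> Cod A e = Dom A y \<and> Dom A x = Dom A e \<and>
      Cod A x = Dom A (H_map (Suc n) g) \<and> H_map (Suc n) g \<cdot> x = y \<cdot> e"
    using epi_Cmp[OF e3(1) epi_Cmp[OF r(1) e(1)]] e e3 r(1-3) rr v va hg za
    by (intro exI[of _ "(e \<cdot> e2) \<cdot> e3"] exI[of _ "c (Suc n) (Cod B f) v"]) simp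
qed

text \<open>A cycle \<open>x\<close> whose image in the middle term is the boundary of
  \<open>w\<close> is the end of the zig-zag through \<open>w\<close> that starts at
  \<open>g w\<close>.\<close>

lemma H_exact_bd_right: "exact_at A (bd n f g) (H_map n f)"
proof (rule exact_atI)
  note hf = H_map(1-3)[OF fg(1), of n] and b = bd(1-3)[of n]
  show "H_map n f \<in> Ar A" "bd n f g \<in> Ar A" "Cod A (bd n f g) = Dom A (H_map n f)" using hf b by simp_all
  have "H_map n f \<cdot> bd n f g = Null A (H (Suc n) (Cod B g)) (H n (Cod B f))"
  proof (rule H_ext[OF fg(6)])
    fix z assume z: "Z (Suc n) (Cod B g) z"
    note za = Z_Ar[OF fg(6) z]
    obtain e w x where r: "epi_ar A e" "e \<in> Ar A" "Cod A e = Dom A z" "bd_rel n f g (z \<cdot> e) w x"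
      using ex_bd_rel[OF z] by blast
    note rr = r(4)[unfolded bd_rel_def]
    have "((H_map n f \<cdot> bd n f g) \<cdot> c (Suc n) (Cod B g) z) \<cdot> e = H_map n f \<cdot> (bd n f g \<cdot> c (Suc n) (Cod B g) (z \<cdot> e))"
      using c_Cmp[OF fg(6) z r(2,3)] hf b z r(2,3) by simp
    also have "\<dots> = c n (Cod B f) (d (Suc n) (Cod B f) \<cdot> w)"
      using bd(4)[OF r(4)] H_map(4)[OF fg(1) bd_rel_Z[OF r(4)]] rr by simp
    also have "\<dots> = Null A (Dom A e) (H n (Cod B f))" using c_boundary(2)[OF fg(5), of w n] rr r za by simp
    finally show "(H_map n f \<cdot> bd n f g) \<cdot> c (Suc n) (Cod B g) z
        = Null A (H (Suc n) (Cod B g)) (H n (Cod B f)) \<cdot> c (Suc n) (Cod B g) z"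
      using epi_Null[OF r(1), of "(H_map n f \<cdot> bd n f g) \<cdot> c (Suc n) (Cod B g) z"] hf b z r(2,3) by simp
  qed (use hf b in simp_all)
  then show "H_map n f \<cdot> bd n f g = Null A (Dom A (bd n f g)) (Cod A (H_map n f))" using hf b by simp
  fix y assume y: "y \<in> Ar A" "Cod A y = Dom A (H_map n f)" "H_map n f \<cdot> y = Null A (Dom A y) (Cod A (H_map n f))"
  obtain e x where e: "epi_ar A e" "e \<in> Ar A" "Z n (Dom B f) x" "Cod A e = Dom A y" "Dom A x = Dom A e" "c n (Dom B f) x = y \<cdot> e"
    using c_surj[OF fg(4), of y n] y hf by auto
  note xa = Z_Ar[OF fg(4) e(3)]
  have fx: "Z n (Cod B f) (on_ar (X (Suc n)) f \<cdot> x)" using Z_X[OF fg(1) refl refl e(3)] .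
  have "c n (Cod B f) (on_ar (X (Suc n)) f \<cdot> x) = H_map n f \<cdot> (y \<cdot> e)"
    using H_map(4)[OF fg(1), of n x] e(3,6) by simp
  also have "\<dots> = Null A (Dom A e) (H n (Cod B f))" using Cmp_extend_Null(1)[of "H_map n f" y e] y hf e(2,4) by simp
  finally obtain e2 w where e2: "epi_ar A e2" "e2 \<in> Ar A" "w \<in> Ar A" "Cod A e2 = Dom A x" "Dom A w = Dom A e2"
    "Cod A w = on_ob (X (Suc (Suc n))) (Cod B f)" "d (Suc n) (Cod B f) \<cdot> w = (on_ar (X (Suc n)) f \<cdot> x) \<cdot> e2"
    using c_NullD[OF fg(5) fx] xa e(5) by auto
  let ?z = "on_ar (X (Suc (Suc n))) g \<cdot> w"
  have "d (Suc n) (Cod B g) \<cdot> ?z = on_ar (X (Suc n)) g \<cdot> (on_ar (X (Suc n)) f \<cdot> (x \<cdot> e2))"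
    using d_X[of g _ _ w "Suc n"] e2 xa by simp
  then have "bd_rel n f g ?z w (x \<cdot> e2)"
    using e2 xa gf_Cmp[of "x \<cdot> e2" "Suc n"] by (simp add: bd_rel_def Z_iff)
  from bd(4)[OF this] have "bd n f g \<cdot> c (Suc n) (Cod B g) ?z = y \<cdot> (e \<cdot> e2)"
    using c_Cmp[OF fg(4) e(3) e2(2,4)] e e2(2,4) y hf by simp
  moreover have "Z (Suc n) (Cod B g) ?z" using \<open>bd_rel n f g ?z w (x \<cdot> e2)\<close> by (simp add: bd_rel_def)
  ultimately show "\<exists>e x. epi_ar A e \<and> x \<in> Ar A \<and> Cod A e = Dom A y \<and> Dom A x = Dom A e \<and> Cod A x = Dom A (bd n f g) \<and>
      bd n f g \<cdot> x = y \<cdot> e"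
    using epi_Cmp[OF e2(1) e(1)] e e2 xa b by (intro exI[of _ "e \<cdot> e2"] exI[of _ "c (Suc n) (Cod B g) ?z"]) simp
qed

lemma H_epi: "epi_ar A (H_map 0 g)"
proof -
  have "Idn A (H 0 (Cod B g)) \<in> Ar A" "Cod A (Idn A (H 0 (Cod B g))) = H 0 (Cod B g)" by simp_all
  from c_surj[OF fg(6) this] obtain e z where ez: "epi_ar A e" "e \<in> Ar A" "Z 0 (Cod B g) z"
    "Cod A e = H 0 (Cod B g)" "Dom A z = Dom A e" "c 0 (Cod B g) z = e"
    using fg(6) by (metis Cmp_Idn(2) H_Ob Idn_Ar(2))
  note za = Z_Ar[OF fg(6) ez(3)]
  obtain e2 w where e2: "epi_ar A e2" "e2 \<in> Ar A" "w \<in> Ar A" "Cod A e2 = Dom A z" "Dom A w = Dom A e2"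
    "Cod A w = on_ob (X (Suc 0)) (Cod B f)" "on_ar (X (Suc 0)) g \<cdot> w = z \<cdot> e2"
    using lift_g[of z "Suc 0"] za by auto
  \<comment> \<open>In degree zero the differential lands in the zero object, so every lift
    \<open>w\<close> of a cycle is a cycle.\<close>
  have "d 0 (Cod B f) \<cdot> w \<in> Hom A (Dom A w) (on_ob (X 0) (Cod B f))"
    "Null A (Dom A w) (on_ob (X 0) (Cod B f)) \<in> Hom A (Dom A w) (on_ob (X 0) (Cod B f))"
    using e2 by simp_all
  then have "d 0 (Cod B f) \<cdot> w = Null A (Dom A w) (on_ob (X 0) (Cod B f))"
    using X_0[OF fg(5)] e2(3) unfolding is_zero_ob_def by (metis Dom_Cod_Ob(1))
  then have w: "Z 0 (Cod B f) w" using e2 by (simp add: Z_iff)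
  have "H_map 0 g \<cdot> c 0 (Cod B f) w = e \<cdot> e2"
    using H_map(4)[OF fg(2), of 0 w] w e2 c_Cmp[OF fg(6) ez(3) e2(2,4)] ez by simp
  then show ?thesis
    using epi_cancel_right[of "H_map 0 g" "c 0 (Cod B f) w"] epi_Cmp[OF e2(1) ez(1)] e2 ez w H_map(1-3)[OF fg(2), of 0]
    by simp
qed

end

text \<open>The vertical arrows carry a zig-zag for \<open>(f, g)\<close> to one for
  \<open>(f', g')\<close>. Both composites are compared on classes, after the cover on which the
  zig-zag exists.\<close>

lemma bd_natural:
  assumes se: "short_exact B f g" "short_exact B f' g'"
    and abc: "a \<in> Hom B (Dom B f) (Dom B f')" "b \<in> Hom B (Cod B f) (Cod B f')" "k \<in> Hom B (Cod B g) (Cod B g')"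
    and sq: "b \<cdot>\<^bsub>B\<^esub> f = f' \<cdot>\<^bsub>B\<^esub> a" "k \<cdot>\<^bsub>B\<^esub> g = g' \<cdot>\<^bsub>B\<^esub> b"
  shows "H_map n a \<cdot> bd n f g = bd n f' g' \<cdot> H_map (Suc n) k"
proof -
  have fg: "f \<in> Ar B" "g \<in> Ar B" "Dom B g = Cod B f" "Dom B f \<in> Ob B" "Cod B f \<in> Ob B" "Cod B g \<in> Ob B"
    by (rule short_exact_B[OF se(1)])+
  have fg': "f' \<in> Ar B" "g' \<in> Ar B" "Dom B g' = Cod B f'" "Dom B f' \<in> Ob B" "Cod B f' \<in> Ob B" "Cod B g' \<in> Ob B"
    by (rule short_exact_B[OF se(2)])+
  have k: "k \<in> Ar B" "Dom B k = Cod B g" "Cod B k = Cod B g'" using abc by auto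
  have a: "a \<in> Ar B" "Dom B a = Dom B f" "Cod B a = Dom B f'" using abc by auto
  have b: "b \<in> Ar B" "Dom B b = Cod B f" "Cod B b = Cod B f'" using abc by auto
  note ha = H_map(1-3)[OF a(1), of n] and hk = H_map(1-3)[OF k(1), of "Suc n"]
  note bd1 = bd(1-3)[OF se(1), of n] and bd2 = bd(1-3)[OF se(2), of n]
  show ?thesis
  proof (rule H_ext[OF fg(6)])
    fix z assume z: "Z (Suc n) (Cod B g) z"
    note za = Z_Ar[OF fg(6) z]
    obtain e w x where r: "epi_ar A e" "e \<in> Ar A" "Cod A e = Dom A z" "bd_rel n f g (z \<cdot> e) w x"
      using ex_bd_rel[OF se(1) z] by blast
    note rr = r(4)[unfolded bd_rel_def]
    have kg: "on_ar (X m) k \<cdot> on_ar (X m) g = on_ar (X m) g' \<cdot> on_ar (X m) b" for m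
      using arg_cong[OF sq(2), of "on_ar (X m)"] fg fg' k b by simp
    have bf: "on_ar (X m) b \<cdot> on_ar (X m) f = on_ar (X m) f' \<cdot> on_ar (X m) a" for m
      using arg_cong[OF sq(1), of "on_ar (X m)"] fg fg' a b by simp
    have 1: "on_ar (X (Suc (Suc n))) g' \<cdot> (on_ar (X (Suc (Suc n))) b \<cdot> w) = on_ar (X (Suc (Suc n))) k \<cdot> (z \<cdot> e)"
      using Cmp_extend[OF kg[of "Suc (Suc n)"], of w] rr fg fg' k b by simp
    have "on_ar (X (Suc n)) f' \<cdot> (on_ar (X (Suc n)) a \<cdot> x) = on_ar (X (Suc n)) b \<cdot> (d (Suc n) (Cod B f) \<cdot> w)"
      using Cmp_extend[OF bf[of "Suc n"], of x] rr fg fg' a b by simp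
    then have 2: "on_ar (X (Suc n)) f' \<cdot> (on_ar (X (Suc n)) a \<cdot> x) = d (Suc n) (Cod B f') \<cdot> (on_ar (X (Suc (Suc n))) b \<cdot> w)"
      using d_X[OF b, of w "Suc n"] rr fg b by simp
    have ze: "Z (Suc n) (Cod B g) (z \<cdot> e)" using rr by simp
    have r': "bd_rel n f' g' (on_ar (X (Suc (Suc n))) k \<cdot> (z \<cdot> e)) (on_ar (X (Suc (Suc n))) b \<cdot> w) (on_ar (X (Suc n)) a \<cdot> x)"
      using 1 2 Z_X[OF k ze] rr a b k fg fg' za r by (simp add: bd_rel_def)
    have "((H_map n a \<cdot> bd n f g) \<cdot> c (Suc n) (Cod B g) z) \<cdot> e = H_map n a \<cdot> (bd n f g \<cdot> c (Suc n) (Cod B g) (z \<cdot> e))"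
      using c_Cmp[OF fg(6) z r(2,3)] ha bd1 z r(2,3) a fg by simp
    also have "\<dots> = c n (Dom B f') (on_ar (X (Suc n)) a \<cdot> x)"
      using bd(4)[OF se(1) r(4)] H_map(4)[OF a(1), of n x] bd_rel_Z[OF se(1) r(4)] a by simp
    also have "\<dots> = bd n f' g' \<cdot> (H_map (Suc n) k \<cdot> c (Suc n) (Cod B g) (z \<cdot> e))"
      using bd(4)[OF se(2) r'] H_map(4)[OF k(1), of "Suc n" "z \<cdot> e"] ze k by simp
    also have "\<dots> = ((bd n f' g' \<cdot> H_map (Suc n) k) \<cdot> c (Suc n) (Cod B g) z) \<cdot> e"
      using c_Cmp[OF fg(6) z r(2,3)] hk bd2 z r(2,3) k fg fg' by simp
    finally show "(H_map n a \<cdot> bd n f g) \<cdot> c (Suc n) (Cod B g) z = (bd n f' g' \<cdot> H_map (Suc n) k) \<cdot> c (Suc n) (Cod B g) z"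
      by (rule epi_cancel[OF r(1), rotated -1]) (use ha hk bd1 bd2 a k fg fg' z r(3) in simp_all)
  qed (use ha hk bd1 bd2 a k fg fg' in simp_all)
qed

theorem homological_delta_functor_HF: "homological_delta_functor B A HF bd"
  unfolding homological_delta_functor_def
proof (intro conjI allI impI; (elim conjE)?)
  fix n f g assume se: "short_exact B f g"
  then have fg: "f \<in> Ar B" "g \<in> Ar B" "Dom B f \<in> Ob B" "Cod B g \<in> Ob B"
    by (auto dest: short_exact_B)
  show "bd n f g \<in> Hom A (on_ob (HF (Suc n)) (Cod B g)) (on_ob (HF n) (Dom B f))" using bd(1-3)[OF se] fg by simp
  show "exact_at A (on_ar (HF n) f) (on_ar (HF n) g)" using H_exact_middle[OF se] fg by simp
  show "exact_at A (on_ar (HF (Suc n)) g) (bd n f g)" using H_exact_bd_left[OF se] fg by simp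
  show "exact_at A (bd n f g) (on_ar (HF n) f)" using H_exact_bd_right[OF se] fg by simp
  show "epi_ar A (on_ar (HF 0) g)" using H_epi[OF se] fg by simp
next
  fix n f g f' g' a b k
  assume h: "short_exact B f g" "short_exact B f' g'" "a \<in> Hom B (Dom B f) (Dom B f')" "b \<in> Hom B (Cod B f) (Cod B f')"
    "k \<in> Hom B (Cod B g) (Cod B g')" "b \<cdot>\<^bsub>B\<^esub> f = f' \<cdot>\<^bsub>B\<^esub> a" "k \<cdot>\<^bsub>B\<^esub> g = g' \<cdot>\<^bsub>B\<^esub> b"
  then show "on_ar (HF n) a \<cdot> bd n f g = bd n f' g' \<cdot> on_ar (HF (Suc n)) k" using bd_natural[OF h] by simp
qed (rule HF_additive)

end

section \<open>Arrows of the cube category as face words\<close>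

text \<open>A word of length \<open>n\<close> encodes an injective arrow into \<open>cube n\<close>: the letter \<open>Some b\<close> is a constant
  coordinate, \<open>None\<close> a free one.\<close>

type_synonym face_word = "bool option list"

definition stars :: "face_word \<Rightarrow> nat" where
  "stars w = length (filter (\<lambda>c. c = None) w)"

lemma stars_simps [simp]:
  "stars [] = 0" "stars (None # w) = Suc (stars w)" "stars (Some b # w) = stars w" "stars (u @ v) = stars u + stars v"
  "stars (replicate n None) = n"
  by (simp_all add: stars_def)

text \<open>Meant for lists \<open>x\<close> of length \<open>stars w\<close>; \<open>hd\<close> and
  \<open>tl\<close> make the function total.\<close>

fun fill :: "face_word \<Rightarrow> bool list \<Rightarrow> bool list" where
  "fill [] x = []"
| "fill (Some b # w) x = b # fill w x"
| "fill (None # w) x = hd x # fill w (tl x)"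

definition fill_ar :: "face_word \<Rightarrow> box_ar" where
  "fill_ar w = (stars w, length w, \<lambda>x \<in> cube (stars w). fill w x)"

text \<open>Free letters are counted from 0, whereas faces and degeneracies are numbered from 1;
  hence \<open>face (stars w) (Suc i) b\<close> corresponds to \<open>sub i b w\<close>.\<close>

fun sub :: "nat \<Rightarrow> bool \<Rightarrow> face_word \<Rightarrow> face_word" where
  "sub i b [] = []"
| "sub i b (Some c # w) = Some c # sub i b w"
| "sub 0 b (None # w) = Some b # w"
| "sub (Suc i) b (None # w) = None # sub i b w"

lemma length_fill [simp]: "length (fill w x) = length w"
  by (induction w x rule: fill.induct) auto

lemma length_sub [simp]: "length (sub i b w) = length w"
  by (induction i b w rule: sub.induct) auto

lemma stars_sub [simp]: "i < stars w \<Longrightarrow> stars (sub i b w) = stars w - 1"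
  by (induction i b w rule: sub.induct) auto

lemma fill_append: "stars u \<le> length x \<Longrightarrow> fill (u @ v) x = fill u (take (stars u) x) @ fill v (drop (stars u) x)"
proof (induction u x rule: fill.induct)
  case (3 w x)
  then show ?case by (cases x) auto
qed auto

lemma fill_None: "length x = n \<Longrightarrow> fill (replicate n None) x = x"
  by (induction n arbitrary: x) (auto simp: length_Suc_conv)

lemma fill_sub:
  "\<lbrakk>i < stars w; Suc (length x) = stars w\<rbrakk> \<Longrightarrow> fill w (take i x @ b # drop i x) = fill (sub i b w) x"
proof (induction i b w arbitrary: x rule: sub.induct)
  case (4 i b w)
  then show ?case by (cases x) simp_all
qed simp_all

lemma fill_inject: "\<lbrakk>length x = stars w; length y = stars w; fill w x = fill w y\<rbrakk> \<Longrightarrow> x = y"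
proof (induction w arbitrary: x y)
  case (Cons c w)
  show ?case
  proof (cases c)
    case None
    with Cons.prems obtain a x' b y' where xy: "x = a # x'" "y = b # y'" by (cases x; cases y) auto
    have "x' = y'" by (rule Cons.IH) (use None Cons.prems xy in simp_all)
    then show ?thesis using None Cons.prems xy by simp
  next
    case (Some b)
    show ?thesis by (rule Cons.IH) (use Some Cons.prems in simp_all)
  qed
qed auto

lemma fill_word_inject:
  "\<lbrakk>length w = length v; stars w = stars v; \<And>x. length x = stars w \<Longrightarrow> fill w x = fill v x\<rbrakk> \<Longrightarrow> w = v"
proof (induction w v rule: list_induct2')
  case (4 c w d v)
  have h: "fill (c # w) x = fill (d # v) x" if "length x = stars (c # w)" for x using 4(4) that by blast
  have len: "length w = length v" using 4(2) by simp
  show ?case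
  proof (cases c; cases d)
    assume "c = None" "d = None"
    moreover have "fill w x = fill v x" if "length x = stars w" for x
      using h[of "True # x"] that calculation by simp
    ultimately show ?thesis using 4(1)[OF len] 4(3) by simp
  next
    \<comment> \<open>A free first coordinate can take the value opposite to the constant
      \<open>b\<close>, and this input distinguishes the two words.\<close>
    fix b assume b: "c = None" "d = Some b"
    then show ?thesis using h[of "(\<not> b) # replicate (stars w) False"] by simp
  next
    fix b assume b: "c = Some b" "d = None"
    then show ?thesis using h[of "(\<not> b) # replicate (stars v) False"] 4(3) by simp
  next
    fix a b assume ab: "c = Some a" "d = Some b"
    then have "a = b" using h[of "replicate (stars w) False"] by simp
    moreover have "fill w x = fill v x" if "length x = stars w" for x using h[of x] that ab by simp
    ultimately show ?thesis using 4(1)[OF len] 4(3) ab by simp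
  qed
qed auto

text \<open>Allows the word of a nondegenerate arrow to be recovered by a definite
  description.\<close>

lemma fill_ar_inject: "fill_ar w = fill_ar v \<Longrightarrow> w = v"
proof -
  assume e: "fill_ar w = fill_ar v"
  then have s: "stars w = stars v" "length w = length v" by (auto simp: fill_ar_def)
  have "fill w x = fill v x" if "length x = stars w" for x
    using fun_cong[OF arg_cong[OF e, of "\<lambda>f. snd (snd f)"], of x] that s by (simp add: fill_ar_def cube_def)
  then show ?thesis using fill_word_inject[OF s(2,1)] by blast
qed

lemma box_ar_eqI:
  assumes "f \<in> box_arrows" "g \<in> box_arrows" "fst f = fst g" "fst (snd f) = fst (snd g)"
    "\<And>x. length x = fst f \<Longrightarrow> snd (snd f) x = snd (snd g) x"
  shows "f = g"
proof -
  have "snd (snd f) = snd (snd g)"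
    using box_arrows_funcset[OF assms(1)] box_arrows_funcset[OF assms(2)] assms(3-5)
    by (intro extensionalityI[of _ "cube (fst f)"]) (auto simp: PiE_def cube_def)
  then show ?thesis using assms by (simp add: prod_eq_iff)
qed

lemma box_cmp_sel [simp]:
  "fst (box_cmp g f) = fst f" "fst (snd (box_cmp g f)) = fst (snd g)"
  "length x = fst f \<Longrightarrow> snd (snd (box_cmp g f)) x = snd (snd g) (snd (snd f) x)"
  by (auto simp: box_cmp_def compose_def cube_def)

lemma box_id_sel [simp]:
  "fst (box_id n) = n" "fst (snd (box_id n)) = n" "length x = n \<Longrightarrow> snd (snd (box_id n)) x = x"
  by (auto simp: box_id_def cube_def)

lemma face_sel [simp]:
  "fst (face k i b) = k - 1" "fst (snd (face k i b)) = k"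
  "length x = k - 1 \<Longrightarrow> snd (snd (face k i b)) x = take (i - 1) x @ b # drop (i - 1) x"
  by (auto simp: face_def cube_def)

lemma degen_sel [simp]:
  "fst (degen k i) = k" "fst (snd (degen k i)) = k - 1"
  "length x = k \<Longrightarrow> snd (snd (degen k i)) x = take (i - 1) x @ drop i x"
  by (auto simp: degen_def cube_def)

lemma fill_ar_sel [simp]:
  "fst (fill_ar w) = stars w" "fst (snd (fill_ar w)) = length w"
  "length x = stars w \<Longrightarrow> snd (snd (fill_ar w)) x = fill w x"
  by (auto simp: fill_ar_def cube_def)

declare box_arrows.box_id [simp] box_arrows.face [simp] box_arrows.degen [simp] box_arrows.cmp [simp]

lemma length_box_ar: "\<lbrakk>f \<in> box_arrows; length x = fst f\<rbrakk> \<Longrightarrow> length (snd (snd f) x) = fst (snd f)"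
  using box_arrows_funcset[of f] by (auto simp: cube_def PiE_def Pi_def)

lemma fill_ar_None: "fill_ar (replicate n None) = box_id n"
  by (auto simp: fill_ar_def box_id_def fill_None cube_def fun_eq_iff)

lemma face_fill:
  assumes "length u = i - 1" "1 \<le> i"
  shows "fill_ar (u @ Some b # v) = box_cmp (face (Suc (length (u @ v))) i b) (fill_ar (u @ v))"
  using assms
  by (auto simp: fill_ar_def box_cmp_def face_def compose_def cube_def fun_eq_iff fill_append)

text \<open>A constant letter can be split off as a face, and a word of free letters only is an
  identity; so induction on the length applies.\<close>

lemma fill_ar_box [simp]: "fill_ar w \<in> box_arrows"
proof (induction "length w" arbitrary: w)
  case (Suc n)
  show ?case
  proof (cases "\<exists>b. Some b \<in> set w")
    case True
    then obtain u b v where w: "w = u @ Some b # v" by (meson split_list)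
    then have "fill_ar (u @ v) \<in> box_arrows" using Suc by simp
    then show ?thesis unfolding w by (subst face_fill[of u "Suc (length u)"]) auto
  next
    case False
    then have "w = replicate (length w) None" by (intro replicate_eqI) (auto intro: option.exhaust)
    then show ?thesis by (metis fill_ar_None box_arrows.box_id)
  qed
qed (simp add: fill_ar_None[of 0, simplified])

lemma fill_face:
  assumes "i < stars w"
  shows "box_cmp (fill_ar w) (face (stars w) (Suc i) b) = fill_ar (sub i b w)"
  using assms by (intro box_ar_eqI) (auto simp: fill_sub)

section \<open>Cubical identities\<close>

lemma degen_face_same: "\<lbrakk>1 \<le> i; i \<le> k\<rbrakk> \<Longrightarrow> box_cmp (degen k i) (face k i b) = box_id (k - 1)"
  by (rule box_ar_eqI) auto

lemma split_list_at: "i < length x \<Longrightarrow> \<exists>a e c. x = a @ e # c \<and> length a = i"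
  by (metis id_take_nth_drop length_take min.strict_order_iff min.commute)

lemma degen_face_less:
  assumes "1 \<le> i" "i < j" "j \<le> k"
  shows "box_cmp (degen k j) (face k i b) = box_cmp (face (k - 1) i b) (degen (k - 1) (j - 1))"
proof (rule box_ar_eqI)
  fix x :: "bool list" assume x: "length x = fst (box_cmp (degen k j) (face k i b))"
  \<comment> \<open>\<open>degen k j\<close> deletes the entry of index \<open>j - 2\<close> of
    \<open>x\<close>: it counts from 1, and the face has inserted an entry further left. Cutting
    \<open>x\<close> at these two places reduces both sides to concatenations.\<close>
  then have "j - 2 < length x" using assms by (simp; linarith?)
  then obtain y e d where y: "x = y @ e # d" "length y = j - 2" using split_list_at[of "j - 2" x] by blast
  define a c where "a = take (i - 1) y" "c = drop (i - 1) y"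
  have "y = a @ c" "length a = i - 1" using y assms by (auto simp: a_c_def)
  then have e: "x = a @ c @ e # d" "i = Suc (length a)" "j = Suc (Suc (length a + length c))"
    "k = Suc (Suc (length a + length c + length d))" using x y assms by auto
  show "snd (snd (box_cmp (degen k j) (face k i b))) x = snd (snd (box_cmp (face (k - 1) i b) (degen (k - 1) (j - 1)))) x"
    unfolding e by simp
qed (use assms in auto)

lemma degen_face_greater:
  assumes "1 \<le> j" "j < i" "i \<le> k"
  shows "box_cmp (degen k j) (face k i b) = box_cmp (face (k - 1) (i - 1) b) (degen (k - 1) j)"
proof (rule box_ar_eqI)
  fix x :: "bool list" assume x: "length x = fst (box_cmp (degen k j) (face k i b))"
  then have "j - 1 < length x" using assms by (simp; linarith?)
  then obtain a e y where y: "x = a @ e # y" "length a = j - 1" using split_list_at[of "j - 1" x] by blast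
  define c d where "c = take (i - j - 1) y" "d = drop (i - j - 1) y"
  have c: "y = c @ d" "length c = i - j - 1" using x y assms by (auto simp: c_d_def)
  then have e: "x = a @ e # c @ d" "j = Suc (length a)" "i = Suc (Suc (length a + length c))"
    "k = Suc (Suc (length a + length c + length d))" using x y assms by auto
  show "snd (snd (box_cmp (degen k j) (face k i b))) x = snd (snd (box_cmp (face (k - 1) (i - 1) b) (degen (k - 1) j))) x"
    unfolding e by simp
qed (use assms in auto)

lemma degen_degen:
  assumes "1 \<le> i" "i < j" "j \<le> k"
  shows "box_cmp (degen (k - 1) (j - 1)) (degen k i) = box_cmp (degen (k - 1) i) (degen k j)"
proof (rule box_ar_eqI)
  fix x :: "bool list" assume x: "length x = fst (box_cmp (degen (k - 1) (j - 1)) (degen k i))"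
  then have "i - 1 < length x" using assms by (simp; linarith?)
  then obtain a e y where y: "x = a @ e # y" "length a = i - 1" using split_list_at[of "i - 1" x] by blast
  have "j - i - 1 < length y" using x y assms by (simp; linarith?)
  then obtain c f d where c: "y = c @ f # d" "length c = j - i - 1" using split_list_at[of "j - i - 1" y] by blast
  then have e: "x = a @ e # c @ f # d" "i = Suc (length a)" "j = Suc (Suc (length a + length c))"
    "k = Suc (Suc (length a + length c + length d))" using x y assms by auto
  show "snd (snd (box_cmp (degen (k - 1) (j - 1)) (degen k i))) x = snd (snd (box_cmp (degen (k - 1) i) (degen k j))) x"
    unfolding e by simp
qed (use assms in auto)

text \<open>Factoring through a degeneracy of the source cube. A cubical object is contravariant, so
  it sends such an arrow into the degenerate part, which the normalized projection kills.\<close>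

definition degenerate :: "box_ar \<Rightarrow> bool" where
  "degenerate f \<longleftrightarrow> (\<exists>g i. g \<in> box_arrows \<and> 1 \<le> i \<and> i \<le> fst f \<and> fst g = fst f - 1 \<and> f = box_cmp g (degen (fst f) i))"

lemma box_cmp_assoc:
  "\<lbrakk>f \<in> box_arrows; g \<in> box_arrows; h \<in> box_arrows; fst (snd f) = fst g; fst (snd g) = fst h\<rbrakk> \<Longrightarrow>
    box_cmp (box_cmp h g) f = box_cmp h (box_cmp g f)"
  by (intro box_ar_eqI) (auto simp: length_box_ar)

lemma degenerate_cmp:
  assumes "degenerate f" "g \<in> box_arrows" "fst (snd f) = fst g"
  shows "degenerate (box_cmp g f)"
proof -
  obtain h i where h: "h \<in> box_arrows" "1 \<le> i" "i \<le> fst f" "fst h = fst f - 1" "f = box_cmp h (degen (fst f) i)"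
    using assms(1) by (auto simp: degenerate_def)
  have c: "fst (snd h) = fst g" using h(5) assms(3) by (metis box_cmp_sel(2))
  have "box_cmp g f = box_cmp g (box_cmp h (degen (fst f) i))" using h(5) by simp
  also have "\<dots> = box_cmp (box_cmp g h) (degen (fst f) i)"
    by (rule box_cmp_assoc[symmetric]) (use h(1-4) assms(2) c in auto)
  finally have "box_cmp g f = box_cmp (box_cmp g h) (degen (fst f) i)" .
  then show ?thesis using h(1-4) assms(2) c unfolding degenerate_def
    by (intro exI[of _ "box_cmp g h"] exI[of _ i]) simp
qed

text \<open>Deleting a constant letter leaves a face word. Deleting a free letter forgets one input,
  the one whose number is the count of free letters up to it; this is a degeneracy of the
  source.\<close>

lemma degen_fill:
  assumes "w = u @ c # v" "i = Suc (length u)"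
  shows "case c of Some b \<Rightarrow> box_cmp (degen (length w) i) (fill_ar w) = fill_ar (u @ v)
    | None \<Rightarrow> box_cmp (degen (length w) i) (fill_ar w) = box_cmp (fill_ar (u @ v)) (degen (stars w) (Suc (stars u)))"
proof (cases c)
  case (Some b)
  then show ?thesis using assms by (auto intro!: box_ar_eqI simp: fill_append)
next
  case None
  have "box_cmp (degen (length w) i) (fill_ar w) = box_cmp (fill_ar (u @ v)) (degen (stars w) (Suc (stars u)))"
    by (rule box_ar_eqI) (use None assms in \<open>auto simp: fill_append min_def drop_Suc tl_drop\<close>)
  then show ?thesis using None by simp
qed

text \<open>Induction over the generation of arrows. Faces insert a letter and degeneracies delete
  one, while a degenerate arrow stays degenerate after any further composition; so face words are
  preserved up to degenerate arrows. Applied to the identity word this classifies all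
  arrows.\<close>

lemma nondegenerate_cmp_fill:
  "\<lbrakk>g \<in> box_arrows; length w = fst g\<rbrakk> \<Longrightarrow> degenerate (box_cmp g (fill_ar w)) \<or> (\<exists>v. box_cmp g (fill_ar w) = fill_ar v)"
proof (induction arbitrary: w rule: box_arrows.induct)
  case (box_id n)
  then have "box_cmp (box_id n) (fill_ar w) = fill_ar w" by (intro box_ar_eqI) auto
  then show ?case by blast
next
  case (face i k b)
  then have "box_cmp (face k i b) (fill_ar w) = fill_ar (take (i - 1) w @ Some b # drop (i - 1) w)"
    using face_fill[of "take (i - 1) w" i b "drop (i - 1) w"] by simp
  then show ?case by blast
next
  case (degen i k)
  have k: "length w = k" using degen by simp
  have w: "w = take (i - 1) w @ w ! (i - 1) # drop i w" using degen id_take_nth_drop[of "i - 1" w] by simp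
  let ?u = "take (i - 1) w" and ?v = "drop i w"
  have n: "i = Suc (length ?u)" using degen by simp
  show ?case
  proof (cases "w ! (i - 1)")
    case (Some b)
    then show ?thesis using degen_fill[OF w n] k by auto
  next
    case None
    then have e: "box_cmp (degen k i) (fill_ar w) = box_cmp (fill_ar (?u @ ?v)) (degen (stars w) (Suc (stars ?u)))"
      using degen_fill[OF w n] k by auto
    have s: "stars w = Suc (stars (?u @ ?v))" using arg_cong[OF w, of stars] None by simp
    then have "degenerate (box_cmp (degen k i) (fill_ar w))" unfolding e degenerate_def
      by (intro exI[of _ "fill_ar (?u @ ?v)"] exI[of _ "Suc (stars ?u)"]) auto
    then show ?thesis by blast
  qed
next
  case (cmp f g)
  have a: "box_cmp (box_cmp g f) (fill_ar w) = box_cmp g (box_cmp f (fill_ar w))"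
    by (rule box_cmp_assoc) (use cmp in auto)
  have "degenerate (box_cmp f (fill_ar w)) \<or> (\<exists>v. box_cmp f (fill_ar w) = fill_ar v)" using cmp by simp
  then show ?case
  proof
    assume "degenerate (box_cmp f (fill_ar w))"
    then show ?thesis unfolding a using degenerate_cmp cmp by simp
  next
    assume "\<exists>v. box_cmp f (fill_ar w) = fill_ar v"
    then obtain v where v: "box_cmp f (fill_ar w) = fill_ar v" by blast
    then have "length v = fst g" using cmp by (metis box_cmp_sel(2) fill_ar_sel(2))
    then show ?thesis unfolding a v using cmp by blast
  qed
qed

lemma degenerate_or_fill:
  assumes "f \<in> box_arrows"
  shows "degenerate f \<or> (\<exists>w. f = fill_ar w)"
proof -
  have "box_cmp f (fill_ar (replicate (fst f) None)) = f"
    unfolding fill_ar_None by (rule box_ar_eqI) (use assms in auto)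
  then show ?thesis using nondegenerate_cmp_fill[OF assms, of "replicate (fst f) None"] by auto
qed

text \<open>A degenerate arrow does not see its \<open>i\<close>-th input, whereas
  \<open>fill w\<close> is injective.\<close>

lemma not_degenerate_fill: "\<not> degenerate (fill_ar w)"
proof
  assume "degenerate (fill_ar w)"
  then obtain g i where g: "1 \<le> i" "i \<le> stars w" "fill_ar w = box_cmp g (degen (stars w) i)"
    by (auto simp: degenerate_def)
  let ?x = "replicate (stars w) False" and ?y = "(replicate (stars w) False)[i - 1 := True]"
  have "fill w ?x = snd (snd (box_cmp g (degen (stars w) i))) ?x" unfolding g(3)[symmetric] by simp
  also have "\<dots> = snd (snd (box_cmp g (degen (stars w) i))) ?y" using g by simp
  also have "\<dots> = fill w ?y" unfolding g(3)[symmetric] by simp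
  finally have "?x = ?y" using fill_inject[of ?x w ?y] by simp
  then have "?x ! (i - 1) = ?y ! (i - 1)" by simp
  then show False using g by simp
qed

text \<open>The index type of the coproducts is only known to be infinite; countability is what lets
  families over arrows of the cube category be indexed by it.\<close>

lemma countable_box_arrows: "countable box_arrows"
proof (rule countable_subset)
  show "box_arrows \<subseteq> (\<Union>m. \<Union>n. {m} \<times> {n} \<times> (cube m \<rightarrow>\<^sub>E cube n))"
    using box_arrows_funcset by (auto simp: mem_Times_iff)
  have "finite (cube n)" for n
    using finite_lists_length_eq[of "UNIV :: bool set" n] by (simp add: cube_def)
  then have "finite ({m} \<times> {n} \<times> (cube m \<rightarrow>\<^sub>E cube n))" for m n
    by (intro finite_cartesian_product finite_PiE) simp_all
  then show "countable (\<Union>m. \<Union>n. {m} \<times> {n} \<times> (cube m \<rightarrow>\<^sub>E cube n))"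
    using countable_finite by (intro countable_UN[OF countableI_type]) blast
qed

text \<open>In \<open>dW\<close> the sign of the \<open>i\<close>-th face is produced by the minus sign picked up at each free
  coordinate. The contraction \<open>hW\<close> replaces a \<open>True\<close> to the left of every free coordinate by a free
  coordinate and everything before it by \<open>False\<close>; the new free coordinate is always the first one, so no
  further signs occur.\<close>

abbreviation fcons :: "bool option \<Rightarrow> (face_word \<Rightarrow>\<^sub>0 int) \<Rightarrow> (face_word \<Rightarrow>\<^sub>0 int)" where
  "fcons c \<equiv> frag_extend (\<lambda>w. frag_of (c # w))"

fun dW :: "face_word \<Rightarrow> (face_word \<Rightarrow>\<^sub>0 int)" where
  "dW [] = 0"
| "dW (Some b # w) = fcons (Some b) (dW w)"
| "dW (None # w) = frag_of (Some True # w) - frag_of (Some False # w) - fcons None (dW w)"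

fun hW :: "face_word \<Rightarrow> (face_word \<Rightarrow>\<^sub>0 int)" where
  "hW [] = 0"
| "hW (Some True # w) = frag_of (None # w) + fcons (Some False) (hW w)"
| "hW (Some False # w) = fcons (Some False) (hW w)"
| "hW (None # w) = 0"

lemma frag_induct [case_names zero one diff]:
  assumes "P 0" "\<And>x. P (frag_of x)" "\<And>a b. P a \<Longrightarrow> P b \<Longrightarrow> P (a - b)"
  shows "P c"
  using assms by (intro frag_induction[of c UNIV P]) auto

lemma frag_extend_zero [simp]: "frag_extend (\<lambda>_. 0) c = 0"
  by (simp add: frag_extend_def)

lemma frag_extend_fcons: "frag_extend f (fcons b c) = frag_extend (\<lambda>w. f (b # w)) c"
  by (induction c rule: frag_induct) (auto simp: frag_extend_diff)

lemma fcons_frag_extend: "fcons b (frag_extend f c) = frag_extend (\<lambda>w. fcons b (f w)) c"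
  by (induction c rule: frag_induct) (auto simp: frag_extend_diff)

lemma frag_extend_minus_fun: "frag_extend (\<lambda>w. f w - g w) c = frag_extend f c - frag_extend g c"
  by (induction c rule: frag_induct) (auto simp: frag_extend_diff)

lemma frag_extend_add_fun: "frag_extend (\<lambda>w. f w + g w) c = frag_extend f c + frag_extend g c"
  by (induction c rule: frag_induct) (auto simp: frag_extend_diff)

text \<open>With a leading free letter, the faces in that letter meet the boundary of the tail in
  both orders, and the minus sign in \<open>dW\<close> makes the two contributions cancel.\<close>

lemma dW_dW: "frag_extend dW (dW w) = 0"
proof (induction w rule: dW.induct)
  case (2 b w)
  then show ?case by (simp add: frag_extend_fcons flip: fcons_frag_extend)
next
  case (3 w)
  then show ?case
    by (simp add: frag_extend_fcons frag_extend_diff frag_extend_minus_fun flip: fcons_frag_extend)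
qed auto

text \<open>If the word begins with a free letter, the contractions of its two faces in that letter
  differ by the word itself. If it begins with a constant, the identity for the tail is prefixed
  with \<open>False\<close>, and a leading \<open>True\<close> adds the difference between
  \<open>True\<close> and \<open>False\<close> in front of the tail. For a word without free letters
  the vertex of all \<open>False\<close> would be left over, so degree zero is excluded.\<close>

lemma dW_hW: "0 < stars w \<Longrightarrow> frag_extend dW (hW w) + frag_extend hW (dW w) = frag_of w"
proof (induction w rule: hW.induct)
  case (2 w)
  then have "fcons (Some False) (frag_extend dW (hW w)) = frag_of (Some False # w) - fcons (Some False) (frag_extend hW (dW w))"
    by (simp add: eq_diff_eq flip: frag_extend_add)
  then show ?case
    by (simp add: frag_extend_fcons frag_extend_add frag_extend_diff frag_extend_add_fun flip: fcons_frag_extend)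
next
  case (3 w)
  then have "fcons (Some False) (frag_extend dW (hW w)) = frag_of (Some False # w) - fcons (Some False) (frag_extend hW (dW w))"
    by (simp add: eq_diff_eq flip: frag_extend_add)
  then show ?case
    by (simp add: frag_extend_fcons frag_extend_add frag_extend_diff flip: fcons_frag_extend)
next
  case (4 w)
  then show ?case by (simp add: frag_extend_fcons frag_extend_diff)
qed auto

text \<open>The recursive minus signs accumulate to \<open>(-1) ^ Suc i\<close>, which is the sign
  that \<open>cube_diff\<close> gives to the face numbered \<open>Suc i\<close>.\<close>

lemma dW_eq_sum:
  "dW w = (\<Sum>i<stars w. frag_cmul ((-1) ^ Suc i) (frag_of (sub i False w) - frag_of (sub i True w)))"
proof (induction w rule: dW.induct)
  case (2 b w)
  show ?case unfolding dW.simps 2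
    by (simp add: frag_extend_sum frag_extend_cmul frag_extend_diff o_def)
next
  case (3 w)
  show ?case unfolding dW.simps 3 stars_simps
    by (subst sum.lessThan_Suc_shift) (simp add: frag_extend_sum frag_extend_cmul frag_extend_diff o_def sum_negf[symmetric])
qed auto

lemma keys_fcons: "Poly_Mapping.keys (fcons b c) \<subseteq> (#) b ` Poly_Mapping.keys c"
  using keys_frag_extend[of "\<lambda>w. frag_of (b # w)" c] by auto

text \<open>Support bounds of this kind keep formal sums inside the free groups on
  \<open>words n l\<close>, on which \<open>rho\<close> is known to be a homomorphism.\<close>

lemma keys_dW: "Poly_Mapping.keys (dW w) \<subseteq> {v. length v = length w \<and> Suc (stars v) = stars w}"
proof (induction w rule: dW.induct)
  case (2 b w)
  then show ?case using keys_fcons[of "Some b" "dW w"] by fastforce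
next
  case (3 w)
  have "Poly_Mapping.keys (dW (None # w)) \<subseteq> {Some True # w, Some False # w} \<union> Poly_Mapping.keys (fcons None (dW w))"
    unfolding dW.simps by (rule order_trans[OF keys_diff]) (use keys_diff[of "frag_of (Some True # w)" "frag_of (Some False # w)"] in auto)
  then show ?case using 3 keys_fcons[of None "dW w"] by fastforce
qed auto

lemma keys_hW: "Poly_Mapping.keys (hW w) \<subseteq> {v. length v = length w \<and> stars v = Suc (stars w)}"
proof (induction w rule: hW.induct)
  case (2 w)
  have "Poly_Mapping.keys (hW (Some True # w)) \<subseteq> {None # w} \<union> Poly_Mapping.keys (fcons (Some False) (hW w))"
    unfolding hW.simps by (rule order_trans[OF keys_add]) auto
  then show ?case using 2 keys_fcons[of "Some False" "hW w"] by fastforce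
next
  case (3 w)
  then show ?case using keys_fcons[of "Some False" "hW w"] by fastforce
qed auto

section \<open>The normalized complex\<close>

lemma hom_finprod:
  assumes "comm_group G" "comm_group K" "h \<in> hom G K" "finite I" "f \<in> I \<rightarrow> carrier G"
  shows "h (finprod G f I) = finprod K (\<lambda>i. h (f i)) I"
proof -
  interpret G: comm_group G by fact
  interpret K: comm_group K by fact
  show ?thesis using assms(4,5)
  proof (induction I rule: finite_induct)
    case empty
    then show ?case using hom_one[OF assms(3)] G.is_group K.is_group by simp
  next
    case (insert i I)
    then have "(\<lambda>i. h (f i)) \<in> I \<rightarrow> carrier K" "h (f i) \<in> carrier K" using hom_in_carrier[OF assms(3)] by auto
    with insert show ?case using hom_mult[OF assms(3)] by auto
  qed
qed

section \<open>Formal sums acting on hom-groups, and coproducts\<close>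

context preadditive_category
begin

lemma comp_hom:
  assumes "m \<in> Ar A"
  shows "x \<in> Ob A \<Longrightarrow> (\<lambda>f. m \<cdot> f) \<in> hom (hom_grp A x (Dom A m)) (hom_grp A x (Cod A m))"
    "y \<in> Ob A \<Longrightarrow> (\<lambda>f. f \<cdot> m) \<in> hom (hom_grp A (Cod A m) y) (hom_grp A (Dom A m) y)"
  using assms by (auto intro!: homI simp: Cmp_Plus)

lemma inv_hom_grp: "\<lbrakk>f \<in> Ar A; Dom A f = x; Cod A f = y\<rbrakk> \<Longrightarrow> inv\<^bsub>hom_grp A x y\<^esub> f = neg f"
  by (simp add: neg_def)

lemma hom_free_diff:
  assumes "h \<in> hom (free_Abelian_group W) (hom_grp A x y)" "x \<in> Ob A" "y \<in> Ob A"
    "Poly_Mapping.keys a \<subseteq> W" "Poly_Mapping.keys b \<subseteq> W"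
  shows "h (a - b) = h a \<boxminus> h b"
proof -
  interpret G: comm_group "hom_grp A x y" using hom_grp_comm_group assms by blast
  interpret h: group_hom "free_Abelian_group W" "hom_grp A x y" h
    using assms(1) G.is_group by (simp add: group_hom_def group_hom_axioms_def)
  have b: "h b \<in> Hom A x y" using h.hom_closed[of b] assms by simp
  have "h (- b) = neg (h b)" using h.hom_inv[of b] assms b by (simp add: inv_hom_grp)
  moreover have "h (a + - b) = h a \<boxplus> h (- b)" using h.hom_mult[of a "- b"] assms by simp
  ultimately show ?thesis by (simp add: dif_def)
qed

lemma hom_free_closed:
  assumes "h \<in> hom (free_Abelian_group W) (hom_grp A x y)" "Poly_Mapping.keys a \<subseteq> W"
  shows "h a \<in> Ar A" "Dom A (h a) = x" "Cod A (h a) = y"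
  using hom_in_carrier[OF assms(1), of a] assms(2) by auto

lemma hom_free_zero:
  assumes "h \<in> hom (free_Abelian_group W) (hom_grp A x y)" "x \<in> Ob A" "y \<in> Ob A"
  shows "h 0 = Null A x y"
proof -
  interpret G: comm_group "hom_grp A x y" using hom_grp_comm_group assms by blast
  show ?thesis using hom_one[OF assms(1) group_free_Abelian_group G.is_group] by simp
qed

lemma hom_free_add:
  assumes "h \<in> hom (free_Abelian_group W) (hom_grp A x y)"
    "Poly_Mapping.keys a \<subseteq> W" "Poly_Mapping.keys b \<subseteq> W"
  shows "h (a + b) = h a \<boxplus> h b"
  using hom_mult[OF assms(1), of a b] assms(2,3) by simp

text \<open>Reduces identities on formal sums to single words. The supports are carried along
  because \<open>h1\<close> and \<open>h2\<close> are homomorphisms only on sums supported in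
  \<open>W\<close> and \<open>V\<close>.\<close>

lemma free_hom_ext:
  assumes W: "Poly_Mapping.keys c \<subseteq> W" and xy: "x \<in> Ob A" "y \<in> Ob A" "z \<in> Ob A"
    and h1: "h1 \<in> hom (free_Abelian_group W) (hom_grp A x y)"
    and h2: "h2 \<in> hom (free_Abelian_group V) (hom_grp A x z)"
    and m: "m \<in> Hom A y z"
    and T: "\<And>w. w \<in> W \<Longrightarrow> Poly_Mapping.keys (T w) \<subseteq> V \<and> m \<cdot> h1 (frag_of w) = h2 (T w)"
  shows "m \<cdot> h1 c = h2 (frag_extend T c)"
  using W
proof (induction c rule: free_Abelian_group_induct[consumes 1, case_names zero diff one])
  case zero
  then show ?case using hom_free_zero[OF h1] hom_free_zero[OF h2] xy m by simp
next
  case (diff a b)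
  have k: "Poly_Mapping.keys (frag_extend T a) \<subseteq> V" if "Poly_Mapping.keys a \<subseteq> W" for a
    using keys_frag_extend[of T a] that T by blast
  note k = k[OF diff(1)] k[OF diff(2)]
  have "m \<cdot> h1 (a - b) = m \<cdot> h1 a \<boxminus> m \<cdot> h1 b"
    using hom_free_diff[OF h1 xy(1,2) diff(1,2)] hom_free_closed[OF h1 diff(1)] hom_free_closed[OF h1 diff(2)] m
    by (simp add: Cmp_dif)
  also have "\<dots> = h2 (frag_extend T (a - b))"
    unfolding diff(3,4) frag_extend_diff using hom_free_diff[OF h2 xy(1,3) k] by simp
  finally show ?case .
next
  case (one w)
  then show ?case using T by simp
qed

lemma coproduct_Ar:
  assumes "is_coproduct A I X c \<iota>"
  shows "c \<in> Ob A" "i \<in> I \<Longrightarrow> \<iota> i \<in> Ar A" "i \<in> I \<Longrightarrow> Dom A (\<iota> i) = X i" "i \<in> I \<Longrightarrow> Cod A (\<iota> i) = c"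
  using assms unfolding is_coproduct_def by auto

lemma coproduct_ex1:
  assumes "is_coproduct A I X c \<iota>" "y \<in> Ob A" "\<And>i. i \<in> I \<Longrightarrow> g i \<in> Hom A (X i) y"
  shows "\<exists>!h. h \<in> Hom A c y \<and> (\<forall>i \<in> I. h \<cdot> \<iota> i = g i)"
  using assms unfolding is_coproduct_def by blast

lemma coproduct_ext:
  assumes "is_coproduct A I X c \<iota>" "h \<in> Hom A c y" "h' \<in> Hom A c y" "\<And>i. i \<in> I \<Longrightarrow> h \<cdot> \<iota> i = h' \<cdot> \<iota> i"
  shows "h = h'"
proof -
  have "\<exists>!k. k \<in> Hom A c y \<and> (\<forall>i \<in> I. k \<cdot> \<iota> i = h \<cdot> \<iota> i)"
    using assms coproduct_Ar[OF assms(1)] by (intro coproduct_ex1[OF assms(1)]) auto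
  then show ?thesis using assms(2-4) by (metis (full_types))
qed

end

lemma op_Box_sel [simp]:
  "Ob (op_cat Box) = UNIV" "Ar (op_cat Box) = box_arrows" "Dom (op_cat Box) f = fst (snd f)"
  "Cod (op_cat Box) f = fst f" "Idn (op_cat Box) = box_id" "g \<cdot>\<^bsub>op_cat Box\<^esub> f = box_cmp f g"
  by (simp_all add: op_cat_def Box_def)

lemma box_cmp_id:
  "f \<in> box_arrows \<Longrightarrow> fst (snd f) = n \<Longrightarrow> box_cmp (box_id n) f = f"
  "f \<in> box_arrows \<Longrightarrow> fst f = n \<Longrightarrow> box_cmp f (box_id n) = f"
  by (rule box_ar_eqI; simp add: length_box_ar)+

lemma category_op_Box: "category (op_cat Box)"
proof
  show "\<And>f w x g y h z. \<lbrakk>f \<in> Hom (op_cat Box) w x; g \<in> Hom (op_cat Box) x y; h \<in> Hom (op_cat Box) y z\<rbrakk>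
    \<Longrightarrow> (h \<cdot>\<^bsub>op_cat Box\<^esub> g) \<cdot>\<^bsub>op_cat Box\<^esub> f = h \<cdot>\<^bsub>op_cat Box\<^esub> g \<cdot>\<^bsub>op_cat Box\<^esub> f"
    by (auto simp: box_cmp_assoc)
qed (auto simp: box_cmp_id)

text \<open>\<open>degen_sum\<close> picks a coproduct over the index set \<open>{1..k}\<close> of
  naturals, so finite coproducts are asked for over that index type.\<close>

locale cubical_category = functor_category A "op_cat Box"
  for A :: "('o, 'm, 'y) addcat_scheme" (structure) +
  assumes finite_coproduct: "\<And>(I :: nat set) X. \<lbrakk>finite I; X ` I \<subseteq> Ob A\<rbrakk> \<Longrightarrow> \<exists>c \<iota>. is_coproduct A I X c \<iota>"
begin

abbreviation "cub \<equiv> is_functor (op_cat Box) A"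

lemma cub_simps [simp]:
  assumes "cub F"
  shows "on_ob F n \<in> Ob A" "f \<in> box_arrows \<Longrightarrow> on_ar F f \<in> Ar A"
    "f \<in> box_arrows \<Longrightarrow> Dom A (on_ar F f) = on_ob F (fst (snd f))"
    "f \<in> box_arrows \<Longrightarrow> Cod A (on_ar F f) = on_ob F (fst f)"
    "on_ar F (box_id n) = Idn A (on_ob F n)"
  using functor_simps[OF assms] by auto

lemma cub_cmp:
  "\<lbrakk>cub F; f \<in> box_arrows; g \<in> box_arrows; fst (snd f) = fst g\<rbrakk> \<Longrightarrow> on_ar F (box_cmp g f) = on_ar F f \<cdot> on_ar F g"
  using functor_simps(6)[of "op_cat Box" A F g f] by simp

lemma nt_simps [simp]:
  assumes "is_ntrans (op_cat Box) A \<eta>"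
  shows "nt_at \<eta> n \<in> Ar A" "Dom A (nt_at \<eta> n) = on_ob (nt_dom \<eta>) n" "Cod A (nt_at \<eta> n) = on_ob (nt_cod \<eta>) n"
  using assms by simp_all

lemma nt_natural:
  assumes "is_ntrans (op_cat Box) A \<eta>" "f \<in> box_arrows"
  shows "nt_at \<eta> (fst f) \<cdot> on_ar (nt_dom \<eta>) f = on_ar (nt_cod \<eta>) f \<cdot> nt_at \<eta> (fst (snd f))"
  using ntrans_natural[OF assms(1), of f] assms(2) by simp

abbreviation "p \<equiv> norm_proj A"
abbreviation "N \<equiv> norm_ob A"

context
  fixes F
  assumes F [simp]: "cub F"
begin

lemma degen_sum: "is_coproduct A {1..k} (\<lambda>i. on_ob F (k - 1)) (fst (degen_sum A F k)) (snd (degen_sum A F k))"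
proof -
  have "\<exists>c \<iota>. is_coproduct A {1..k} (\<lambda>i. on_ob F (k - 1)) c \<iota>" by (rule finite_coproduct) auto
  then have "\<exists>x. case x of (c, \<iota>) \<Rightarrow> is_coproduct A {1..k} (\<lambda>i. on_ob F (k - 1)) c \<iota>" by auto
  then have "case degen_sum A F k of (c, \<iota>) \<Rightarrow> is_coproduct A {1..k} (\<lambda>i. on_ob F (k - 1)) c \<iota>"
    unfolding degen_sum_def by (rule someI_ex)
  then show ?thesis by (cases "degen_sum A F k") simp
qed

lemma degen_ar:
  "degen_ar A F k \<in> Hom A (fst (degen_sum A F k)) (on_ob F k)"
  "i \<in> {1..k} \<Longrightarrow> degen_ar A F k \<cdot> snd (degen_sum A F k) i = on_ar F (degen k i)"
proof -
  have "\<exists>!h. h \<in> Hom A (fst (degen_sum A F k)) (on_ob F k) \<and>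
      (\<forall>i \<in> {1..k}. h \<cdot> snd (degen_sum A F k) i = on_ar F (degen k i))"
    by (rule coproduct_ex1[OF degen_sum]) auto
  from theI'[OF this] show "degen_ar A F k \<in> Hom A (fst (degen_sum A F k)) (on_ob F k)"
    "i \<in> {1..k} \<Longrightarrow> degen_ar A F k \<cdot> snd (degen_sum A F k) i = on_ar F (degen k i)"
    unfolding degen_ar_def by blast+
qed

lemma p_cokernel: "is_cokernel A (degen_ar A F k) (p F k)"
  unfolding norm_proj_def using coker_ar degen_ar(1) by simp

lemma p_Ar [simp]:
  "p F k \<in> Ar A" "Dom A (p F k) = on_ob F k" "Cod A (p F k) = N F k" "N F k \<in> Ob A"
proof -
  show a: "p F k \<in> Ar A" "Dom A (p F k) = on_ob F k" using cokernel_Ar[OF p_cokernel, of k] degen_ar(1)[of k] by simp_all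
  show "Cod A (p F k) = N F k" by (simp add: norm_ob_def)
  then show "N F k \<in> Ob A" using Dom_Cod_Ob(2)[OF a(1)] by simp
qed

lemma p_epi: "epi_ar A (p F k)"
  by (rule cokernel_epi[OF p_cokernel])

lemma p_degen:
  assumes "1 \<le> i" "i \<le> k"
  shows "p F k \<cdot> on_ar F (degen k i) = Null A (on_ob F (k - 1)) (N F k)"
proof -
  note d = degen_ar(1)[of k, unfolded Hom_iff] and c = coproduct_Ar(2-4)[OF degen_sum[of k], of i]
  have "p F k \<cdot> (degen_ar A F k \<cdot> snd (degen_sum A F k) i) = Null A (on_ob F (k - 1)) (N F k)"
    using Cmp_extend_Null(1)[OF cokernel_Ar(4)[OF p_cokernel[of k]], of "snd (degen_sum A F k) i"] d c assms by simp
  then show ?thesis using degen_ar(2)[of i k] assms by simp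
qed

lemma p_degenerate:
  assumes "f \<in> box_arrows" "degenerate f"
  shows "p F (fst f) \<cdot> on_ar F f = Null A (on_ob F (fst (snd f))) (N F (fst f))"
proof -
  obtain g i where g: "g \<in> box_arrows" "1 \<le> i" "i \<le> fst f" "fst g = fst f - 1" "f = box_cmp g (degen (fst f) i)"
    using assms(2) by (auto simp: degenerate_def)
  have "on_ar F (box_cmp g (degen (fst f) i)) = on_ar F (degen (fst f) i) \<cdot> on_ar F g"
    by (rule cub_cmp[OF F]) (use g(1-4) in simp_all)
  with arg_cong[OF g(5), of "on_ar F"] have e: "on_ar F f = on_ar F (degen (fst f) i) \<cdot> on_ar F g" by (rule trans)
  have s: "fst (snd f) = fst (snd g)" using g(5) by (metis box_cmp_sel(2))
  show ?thesis unfolding e s using Cmp_extend[OF p_degen[OF g(2,3)], of "on_ar F g"] g(1-4) by simp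
qed

lemma p_desc:
  assumes "h \<in> Ar A" "Dom A h = on_ob F k"
    and "\<And>i. \<lbrakk>1 \<le> i; i \<le> k\<rbrakk> \<Longrightarrow> h \<cdot> on_ar F (degen k i) = Null A (on_ob F (k - 1)) (Cod A h)"
  shows "desc_ar A (p F k) h \<in> Ar A" "Dom A (desc_ar A (p F k) h) = N F k"
    "Cod A (desc_ar A (p F k) h) = Cod A h" "desc_ar A (p F k) h \<cdot> p F k = h"
proof -
  note d = degen_ar(1)[of k, unfolded Hom_iff] and s = coproduct_Ar[OF degen_sum[of k]]
  have "h \<cdot> degen_ar A F k = Null A (fst (degen_sum A F k)) (Cod A h)"
  proof (rule coproduct_ext[OF degen_sum[of k]])
    fix i assume i: "i \<in> {1..k}"
    show "(h \<cdot> degen_ar A F k) \<cdot> snd (degen_sum A F k) i = Null A (fst (degen_sum A F k)) (Cod A h) \<cdot> snd (degen_sum A F k) i"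
      using assms s(2-4)[OF i] degen_ar(2)[OF i] d s(1) i by simp
  qed (use assms d s in simp_all)
  then show "desc_ar A (p F k) h \<in> Ar A" "Dom A (desc_ar A (p F k) h) = N F k"
    "Cod A (desc_ar A (p F k) h) = Cod A h" "desc_ar A (p F k) h \<cdot> p F k = h"
    using desc_ar[OF p_cokernel[of k], of h] assms(1,2) d by simp_all
qed

end

text \<open>\<open>proj_nd F k m\<close> is the product of the commuting idempotents \<open>1 - F(\<delta>\<^sub>i \<sigma>\<^sub>i)\<close> for \<open>i \<le> m\<close>. For \<open>m = k\<close>
  it splits the projection onto the normalized object, naturally in \<open>F\<close>.\<close>

fun proj_nd :: "(nat, box_ar, 'o, 'm) fctr \<Rightarrow> nat \<Rightarrow> nat \<Rightarrow> 'm" where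
  "proj_nd F k 0 = Idn A (on_ob F k)"
| "proj_nd F k (Suc m) = proj_nd F k m \<boxminus> proj_nd F k m \<cdot> on_ar F (box_cmp (face k (Suc m) False) (degen k (Suc m)))"

lemma proj_nd_Ar [simp]:
  assumes "cub F"
  shows "m \<le> k \<Longrightarrow> proj_nd F k m \<in> Ar A \<and> Dom A (proj_nd F k m) = on_ob F k \<and> Cod A (proj_nd F k m) = on_ob F k"
  by (induction m) (use assms in auto)

text \<open>Each factor differs from the identity by an arrow that passes through a degeneracy, and
  the projection kills this arrow.\<close>

lemma p_proj_nd:
  assumes "cub F"
  shows "m \<le> k \<Longrightarrow> p F k \<cdot> proj_nd F k m = p F k"
proof (induction m)
  case (Suc m)
  let ?e = "box_cmp (face k (Suc m) False) (degen k (Suc m))"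
  have e: "?e \<in> box_arrows" using Suc by simp
  have "degenerate ?e" unfolding degenerate_def
    by (rule exI[of _ "face k (Suc m) False"], rule exI[of _ "Suc m"]) (use Suc in auto)
  then have "p F k \<cdot> on_ar F ?e = Null A (on_ob F k) (N F k)"
    using p_degenerate[OF assms e] by simp
  then show ?case using Suc e assms Cmp_extend[of "p F k" "proj_nd F k m" "p F k" "on_ar F ?e"] by (simp add: Cmp_dif)
qed (use assms in simp)

text \<open>The last factor annihilates its own degeneracy because a degeneracy after the matching
  face is the identity. For \<open>j \<le> m\<close> the idempotent with number \<open>Suc m\<close>
  passes through the \<open>j\<close>-th degeneracy, becoming the one with number \<open>m\<close>
  in dimension \<open>k - 1\<close>, so the vanishing already achieved by the earlier factors
  persists.\<close>

lemma proj_nd_degen: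
  assumes "cub F"
  shows "\<lbrakk>m \<le> k; 1 \<le> j; j \<le> m\<rbrakk> \<Longrightarrow> proj_nd F k m \<cdot> on_ar F (degen k j) = Null A (on_ob F (k - 1)) (on_ob F k)"
proof (induction m)
  case (Suc m)
  let ?e = "box_cmp (face k (Suc m) False) (degen k (Suc m))"
  have e: "?e \<in> box_arrows" using Suc by simp
  have ee: "on_ar F ?e \<cdot> on_ar F (degen k j) = on_ar F (box_cmp (degen k j) ?e)"
    using cub_cmp[OF assms, of ?e "degen k j"] Suc.prems by simp
  have a: "box_cmp (degen k j) ?e = box_cmp (box_cmp (degen k j) (face k (Suc m) False)) (degen k (Suc m))"
    by (rule box_cmp_assoc[symmetric]) (use Suc.prems in auto)
  show ?case
  proof (cases "j = Suc m")
    case True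
    have "box_cmp (degen k j) ?e = degen k j"
      unfolding a using True degen_face_same[of "Suc m" k False] Suc.prems box_cmp_id(1)[of "degen k (Suc m)"] by simp
    then show ?thesis using Suc.prems e ee assms True by (simp add: Cmp_dif)
  next
    case False
    then have j: "j < Suc m" using Suc.prems by simp
    let ?e' = "box_cmp (face (k - 1) m False) (degen (k - 1) m)"
    have m: "1 \<le> m" "m \<le> k - 1" using j Suc.prems by auto
    have "box_cmp (degen k j) ?e = box_cmp (box_cmp (face (k - 1) m False) (degen (k - 1) j)) (degen k (Suc m))"
      unfolding a using degen_face_greater[of j "Suc m" k False] j Suc.prems by simp
    also have "\<dots> = box_cmp (face (k - 1) m False) (box_cmp (degen (k - 1) j) (degen k (Suc m)))"
      by (rule box_cmp_assoc) (use j m Suc.prems in auto)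
    also have "\<dots> = box_cmp (face (k - 1) m False) (box_cmp (degen (k - 1) m) (degen k j))"
      using degen_degen[of j "Suc m" k] j Suc.prems by simp
    also have "\<dots> = box_cmp ?e' (degen k j)"
      by (rule box_cmp_assoc[symmetric]) (use j m Suc.prems in auto)
    finally have "on_ar F ?e \<cdot> on_ar F (degen k j) = on_ar F (degen k j) \<cdot> on_ar F ?e'"
      using ee cub_cmp[OF assms, of "degen k j" ?e'] m j Suc.prems by simp
    moreover have 0: "proj_nd F k m \<cdot> on_ar F (degen k j) = Null A (on_ob F (k - 1)) (on_ob F k)"
      using Suc j by simp
    ultimately show ?thesis
      using Suc.prems e assms m j Cmp_extend[OF 0, of "on_ar F ?e'"] by (simp add: Cmp_dif)
  qed
qed simp

text \<open>The section of the projection induced by the idempotent \<open>proj_nd F k k\<close>; it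
  exhibits the normalized object as a retract of \<open>F(cube k)\<close>.\<close>

definition incl :: "(nat, box_ar, 'o, 'm) fctr \<Rightarrow> nat \<Rightarrow> 'm" where
  "incl F k = desc_ar A (p F k) (proj_nd F k k)"

lemma incl:
  assumes "cub F"
  shows "incl F k \<in> Ar A" "Dom A (incl F k) = N F k" "Cod A (incl F k) = on_ob F k"
    "incl F k \<cdot> p F k = proj_nd F k k" "p F k \<cdot> incl F k = Idn A (N F k)"
proof -
  show i: "incl F k \<in> Ar A" "Dom A (incl F k) = N F k" "Cod A (incl F k) = on_ob F k"
    "incl F k \<cdot> p F k = proj_nd F k k"
    using p_desc[OF assms, of "proj_nd F k k" k] proj_nd_degen[OF assms, of k k] assms
    by (simp_all add: incl_def)
  have "(p F k \<cdot> incl F k) \<cdot> p F k = Idn A (N F k) \<cdot> p F k"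
    using i assms p_proj_nd[OF assms, of k k] by simp
  then show "p F k \<cdot> incl F k = Idn A (N F k)"
    using epi_cancel[OF p_epi[OF assms, of k], of "p F k \<cdot> incl F k" "Idn A (N F k)"] i assms by simp
qed

definition N_map :: "nat \<Rightarrow> (nat, box_ar, 'o, 'm) ntrans \<Rightarrow> 'm" where
  "N_map k \<eta> = desc_ar A (p (nt_dom \<eta>) k) (p (nt_cod \<eta>) k \<cdot> nt_at \<eta> k)"

lemma N_map:
  assumes "is_ntrans (op_cat Box) A \<eta>"
  shows "N_map k \<eta> \<in> Ar A" "Dom A (N_map k \<eta>) = N (nt_dom \<eta>) k" "Cod A (N_map k \<eta>) = N (nt_cod \<eta>) k"
    "N_map k \<eta> \<cdot> p (nt_dom \<eta>) k = p (nt_cod \<eta>) k \<cdot> nt_at \<eta> k"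
proof -
  have F: "cub (nt_dom \<eta>)" "cub (nt_cod \<eta>)" using assms by simp_all
  have "(p (nt_cod \<eta>) k \<cdot> nt_at \<eta> k) \<cdot> on_ar (nt_dom \<eta>) (degen k i) = Null A (on_ob (nt_dom \<eta>) (k - 1)) (N (nt_cod \<eta>) k)"
    if "1 \<le> i" "i \<le> k" for i
    using nt_natural[OF assms, of "degen k i"] that F assms
      Cmp_extend[OF p_degen[OF F(2) that], of "nt_at \<eta> (k - 1)"] by simp
  then show "N_map k \<eta> \<in> Ar A" "Dom A (N_map k \<eta>) = N (nt_dom \<eta>) k" "Cod A (N_map k \<eta>) = N (nt_cod \<eta>) k"
    "N_map k \<eta> \<cdot> p (nt_dom \<eta>) k = p (nt_cod \<eta>) k \<cdot> nt_at \<eta> k"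
    using p_desc[OF F(1), of "p (nt_cod \<eta>) k \<cdot> nt_at \<eta> k" k] F assms by (simp_all add: N_map_def)
qed

lemma proj_nd_natural:
  assumes "is_ntrans (op_cat Box) A \<eta>"
  shows "m \<le> k \<Longrightarrow> nt_at \<eta> k \<cdot> proj_nd (nt_dom \<eta>) k m = proj_nd (nt_cod \<eta>) k m \<cdot> nt_at \<eta> k"
proof (induction m)
  case (Suc m)
  have F: "cub (nt_dom \<eta>)" "cub (nt_cod \<eta>)" using assms by simp_all
  let ?e = "box_cmp (face k (Suc m) False) (degen k (Suc m))"
  have e: "?e \<in> box_arrows" using Suc by simp
  note IH = Suc.IH[OF Suc_leD[OF Suc.prems]]
  have "nt_at \<eta> k \<cdot> (proj_nd (nt_dom \<eta>) k m \<cdot> on_ar (nt_dom \<eta>) ?e) = proj_nd (nt_cod \<eta>) k m \<cdot> (nt_at \<eta> k \<cdot> on_ar (nt_dom \<eta>) ?e)"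
    using Cmp_extend[OF IH, of "on_ar (nt_dom \<eta>) ?e"] e Suc.prems F assms by simp
  also have "\<dots> = proj_nd (nt_cod \<eta>) k m \<cdot> (on_ar (nt_cod \<eta>) ?e \<cdot> nt_at \<eta> k)"
    using nt_natural[OF assms e] Suc.prems by simp
  finally show ?case using IH Suc.prems e F assms by (simp add: Cmp_dif)
qed (use assms in simp)

lemma incl_natural:
  assumes "is_ntrans (op_cat Box) A \<eta>"
  shows "incl (nt_cod \<eta>) k \<cdot> N_map k \<eta> = nt_at \<eta> k \<cdot> incl (nt_dom \<eta>) k"
proof -
  have F: "cub (nt_dom \<eta>)" "cub (nt_cod \<eta>)" using assms by simp_all
  note i = incl[OF F(1), of k] incl[OF F(2), of k] and n = N_map[OF assms, of k]
  have "(incl (nt_cod \<eta>) k \<cdot> N_map k \<eta>) \<cdot> p (nt_dom \<eta>) k = (incl (nt_cod \<eta>) k \<cdot> p (nt_cod \<eta>) k) \<cdot> nt_at \<eta> k"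
    using i(6,7,8) n F assms by simp
  also have "\<dots> = (nt_at \<eta> k \<cdot> incl (nt_dom \<eta>) k) \<cdot> p (nt_dom \<eta>) k"
    unfolding i(9) using i(1-4) F assms proj_nd_natural[OF assms, of k k] by simp
  finally show ?thesis
    by (rule epi_cancel[OF p_epi[OF F(1)], rotated -1]) (use i n F assms in simp_all)
qed

lemma N_map_ext:
  assumes "cub F" "u \<in> Ar A" "v \<in> Ar A" "Dom A u = N F k" "Dom A v = N F k" "Cod A u = Cod A v" "u \<cdot> p F k = v \<cdot> p F k"
  shows "u = v"
  using epi_cancel[OF p_epi[OF assms(1)], of u v k] assms by simp

definition NF :: "nat \<Rightarrow> ((nat, box_ar, 'o, 'm) fctr, (nat, box_ar, 'o, 'm) ntrans, 'o, 'm) fctr" where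
  "NF k = Fctr (\<lambda>F\<in>Ob B. N F k) (restrict (N_map k) (Ar B))"

lemma NF_additive: "is_additive_functor B A (NF k)"
  unfolding is_additive_functor_def
proof (intro conjI allI ballI)
  show "is_functor B A (NF k)" unfolding NF_def
  proof (rule is_functorI[OF B.category_axioms])
    fix F assume F: "F \<in> Ob B"
    then show "N_map k (Idn B F) = Idn A (N F k)"
      by - (rule N_map_ext[of F _ _ k], use F N_map[of "Idn B F" k] in simp_all)
  next
    fix \<eta> \<theta> assume "\<eta> \<in> Ar B" "\<theta> \<in> Ar B" "Cod B \<eta> = Dom B \<theta>"
    then have e: "is_ntrans (op_cat Box) A \<eta>" "is_ntrans (op_cat Box) A \<theta>" "nt_dom \<theta> = nt_cod \<eta>" by simp_all
    have F: "cub (nt_dom \<eta>)" "cub (nt_cod \<eta>)" "cub (nt_cod \<theta>)" using e by simp_all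
    note n = N_map[OF e(1), of k] N_map[OF e(2), of k, unfolded e(3)] N_map[OF B_Cmp[OF e(1,2) e(3)[symmetric]], of k]
    show "N_map k (\<theta> \<cdot>\<^bsub>B\<^esub> \<eta>) = N_map k \<theta> \<cdot> N_map k \<eta>"
      by (rule N_map_ext[of "nt_dom \<eta>" _ _ k]) (use n e F Cmp_extend[OF n(8), of "nt_at \<eta> k"] in simp_all)
  qed (use N_map in simp_all)
next
  fix F G \<eta> \<theta> assume "\<eta> \<in> Hom B F G" "\<theta> \<in> Hom B F G"
  then have e: "is_ntrans (op_cat Box) A \<eta>" "is_ntrans (op_cat Box) A \<theta>" "nt_dom \<eta> = F" "nt_cod \<eta> = G" "nt_dom \<theta> = F" "nt_cod \<theta> = G"
    by simp_all
  have F: "cub F" "cub G" using e by auto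
  have P: "is_ntrans (op_cat Box) A (Plus B \<eta> \<theta>)" using e by simp
  note n = N_map[OF e(1), of k] N_map[OF e(2), of k] N_map[OF P, of k]
  have "N_map k (Plus B \<eta> \<theta>) = N_map k \<eta> \<boxplus> N_map k \<theta>"
    by (rule N_map_ext[of F _ _ k]) (use n e F in \<open>simp_all add: Cmp_Plus\<close>)
  then show "on_ar (NF k) (Plus B \<eta> \<theta>) = on_ar (NF k) \<eta> \<boxplus> on_ar (NF k) \<theta>" using e P by (simp add: NF_def)
qed

lemma NF_simps [simp]:
  "cub F \<Longrightarrow> on_ob (NF k) F = N F k" "is_ntrans (op_cat Box) A \<eta> \<Longrightarrow> on_ar (NF k) \<eta> = N_map k \<eta>"
  by (simp_all add: NF_def)

text \<open>A natural retract of an exact functor is exact: \<open>incl\<close> moves a chase from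
  the normalized objects to the evaluation at \<open>cube k\<close>, where the sequence is exact,
  and \<open>p\<close> moves the result back.\<close>

lemma NF_exact:
  assumes "short_exact B f g"
  shows "short_exact A (on_ar (NF k) f) (on_ar (NF k) g)"
proof -
  have fg: "is_ntrans (op_cat Box) A f" "is_ntrans (op_cat Box) A g" "nt_dom g = nt_cod f"
    and se: "short_exact A (nt_at f k) (nt_at g k)"
    using assms by (auto simp: short_exact_pointwise)
  have F: "cub (nt_dom f)" "cub (nt_cod f)" "cub (nt_cod g)" using fg by simp_all
  have K: "is_kernel A (nt_at g k) (nt_at f k)" and C: "is_cokernel A (nt_at f k) (nt_at g k)"
    using se by (auto simp: short_exact_def)
  note n = N_map[OF fg(1), of k] N_map[OF fg(2), of k, unfolded fg(3)]
  note i = incl[OF F(1), of k] incl[OF F(2), of k] incl[OF F(3), of k]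
  note inat = incl_natural[OF fg(1), of k] incl_natural[OF fg(2), of k, unfolded fg(3)]
  have gf: "nt_at g k \<cdot> nt_at f k = Null A (on_ob (nt_dom f) k) (on_ob (nt_cod g) k)"
    using kernel_Ar(4)[OF K] fg by simp
  have mono: "mono_ar A (N_map k f)"
  proof (rule mono_arI)
    fix t assume t: "t \<in> Ar A" "Cod A t = Dom A (N_map k f)" "N_map k f \<cdot> t = Null A (Dom A t) (Cod A (N_map k f))"
    have "nt_at f k \<cdot> (incl (nt_dom f) k \<cdot> t) = incl (nt_cod f) k \<cdot> (N_map k f \<cdot> t)"
      using Cmp_extend[OF inat(1), of t] t(1,2) n(1-3) i(1-3,6-8) fg by simp
    also have "\<dots> = Null A (Dom A t) (on_ob (nt_cod f) k)" unfolding t(3) using t(1) n(1-3) i(6-8) F by simp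
    finally have "incl (nt_dom f) k \<cdot> t = Null A (Dom A t) (on_ob (nt_dom f) k)"
      using mono_Null[OF kernel_mono[OF K], of "incl (nt_dom f) k \<cdot> t"] t(1,2) n(1-3) i(1-3) fg by simp
    then have "p (nt_dom f) k \<cdot> (incl (nt_dom f) k \<cdot> t) = Null A (Dom A t) (N (nt_dom f) k)" using F t(1) by simp
    then show "t = Null A (Dom A t) (Dom A (N_map k f))"
      using Cmp_extend[OF i(5), of t] t(1,2) n(1-3) i(1-3) F by simp
  qed (rule n)
  have epi: "epi_ar A (N_map k g)"
    using epi_cancel_right[of "N_map k g" "p (nt_cod f) k"] epi_Cmp[OF cokernel_epi[OF C] p_epi[OF F(3), of k]] n(5-8) F fg
    by simp
  have comp: "N_map k g \<cdot> N_map k f = Null A (N (nt_dom f) k) (N (nt_cod g) k)"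
    by (rule N_map_ext[OF F(1), of _ _ k]) (use n F fg Cmp_extend[OF n(8), of "nt_at f k"] gf in simp_all)
  have lift: "\<exists>u. u \<in> Hom A (Dom A h) (Dom A (N_map k f)) \<and> N_map k f \<cdot> u = h"
    if h: "h \<in> Ar A" "Cod A h = N (nt_cod f) k" "N_map k g \<cdot> h = Null A (Dom A h) (N (nt_cod g) k)" for h
  proof -
    have "nt_at g k \<cdot> (incl (nt_cod f) k \<cdot> h) = incl (nt_cod g) k \<cdot> (N_map k g \<cdot> h)"
      using Cmp_extend[OF inat(2), of h] h(1,2) n(5-7) i(6-8,11-13) fg by simp
    also have "\<dots> = Null A (Dom A h) (on_ob (nt_cod g) k)" unfolding h(3) using h(1) i(11-13) F by simp
    finally have z: "nt_at g k \<cdot> (incl (nt_cod f) k \<cdot> h) = Null A (Dom A h) (on_ob (nt_cod g) k)" .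
    define u where "u = lift_ar A (nt_at f k) (incl (nt_cod f) k \<cdot> h)"
    have u: "u \<in> Ar A" "Dom A u = Dom A h" "Cod A u = on_ob (nt_dom f) k" "nt_at f k \<cdot> u = incl (nt_cod f) k \<cdot> h"
      using lift_ar[OF K, of "incl (nt_cod f) k \<cdot> h"] z h i(6-8) fg by (simp_all add: u_def)
    have "N_map k f \<cdot> (p (nt_dom f) k \<cdot> u) = p (nt_cod f) k \<cdot> (nt_at f k \<cdot> u)"
      using Cmp_extend[OF n(4), of u] u(1-3) n(1-3) F fg by simp
    also have "\<dots> = h" unfolding u(4) using Cmp_extend[OF i(10), of h] h i(6-8) F by simp
    finally show ?thesis using u n F by (intro exI[of _ "p (nt_dom f) k \<cdot> u"]) simp
  qed
  have K': "is_kernel A (N_map k g) (N_map k f)"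
    by (rule is_kernelI[OF n(5) mono]) (use n comp lift in simp_all)
  with epi_cokernel_of_kernel[OF epi K'] show ?thesis using fg by (simp add: short_exact_def)
qed

end

context abelian_category
begin

lemma zero_ob_Hom:
  assumes "is_zero_ob A z" "f \<in> Ar A" "g \<in> Ar A" "Dom A f = Dom A g" "Cod A f = Cod A g" "Dom A f = z \<or> Cod A f = z"
  shows "f = g"
proof -
  have x: "Dom A g \<in> Ob A" "Cod A g \<in> Ob A" using assms(3) by simp_all
  show ?thesis using assms(6)
  proof
    assume "Dom A f = z"
    then have "\<exists>!h. h \<in> Hom A (Dom A g) (Cod A g)" using assms(1,4) x unfolding is_zero_ob_def by metis
    then show ?thesis using assms(2-5) unfolding Hom_iff by blast
  next
    assume "Cod A f = z"
    then have "\<exists>!h. h \<in> Hom A (Dom A g) (Cod A g)" using assms(1,5) x unfolding is_zero_ob_def by metis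
    then show ?thesis using assms(2-5) unfolding Hom_iff by blast
  qed
qed

text \<open>Serves degree -1 of the complex, where every value is the zero object.\<close>

lemma short_exact_zero_ob:
  assumes "is_zero_ob A z"
  shows "short_exact A (Idn A z) (Idn A z)"
proof -
  have z: "z \<in> Ob A" using assms by (simp add: is_zero_ob_def)
  note e = zero_ob_Hom[OF assms]
  have i: "Idn A z = Null A z z" using e[of "Idn A z" "Null A z z"] z by simp
  have "mono_ar A (Idn A z)" by (rule mono_arI) (use z in simp_all)
  then have "is_kernel A (Idn A z) (Idn A z)"
  proof (rule is_kernelI[rotated])
    fix h assume "h \<in> Ar A" "Cod A h = Dom A (Idn A z)"
    then show "\<exists>u. u \<in> Hom A (Dom A h) (Dom A (Idn A z)) \<and> Idn A z \<cdot> u = h"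
      using z by (intro exI[of _ h]) simp
  next
    show "Idn A z \<cdot> Idn A z = Null A (Dom A (Idn A z)) (Cod A (Idn A z))" using i z by simp
  qed (use z in simp_all)
  then show ?thesis using epi_cokernel_of_kernel[of "Idn A z" "Idn A z"] z by (simp add: short_exact_def)
qed

end

definition words :: "nat \<Rightarrow> nat \<Rightarrow> face_word set" where
  "words n l = {w. length w = n \<and> stars w = l}"

section \<open>The normalized differential and its action on face words\<close>

context cubical_category
begin

text \<open>Composition on both sides is a homomorphism of hom-groups. Keeping both outer factors
  \<open>m\<close> and \<open>t\<close> lets descent to the quotient, naturality and the boundary of
  a word all be read off from one sum formula.\<close>

lemma cube_diff_comp:
  assumes F: "cub F" and t: "t \<in> Ar A" "Cod A t = on_ob F (Suc k)" and m: "m \<in> Ar A" "Dom A m = on_ob F k"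
  shows "cube_diff A F (Suc k) \<in> Hom A (on_ob F (Suc k)) (on_ob F k)"
    "m \<cdot> (cube_diff A F (Suc k) \<cdot> t) = finprod (hom_grp A (Dom A t) (Cod A m))
      (\<lambda>i. (m \<cdot> (on_ar F (face (Suc k) i False) \<cdot> t) \<boxminus> m \<cdot> (on_ar F (face (Suc k) i True) \<cdot> t))
        [^]\<^bsub>hom_grp A (Dom A t) (Cod A m)\<^esub> ((-1) ^ i :: int)) {1..Suc k}"
proof -
  let ?G = "hom_grp A (on_ob F (Suc k)) (on_ob F k)" and ?K = "hom_grp A (Dom A t) (Cod A m)"
  interpret G: comm_group ?G using hom_grp_comm_group F by simp
  interpret K: comm_group ?K using hom_grp_comm_group m t by simp
  let ?s = "\<lambda>i. on_ar F (face (Suc k) i False) \<boxminus> on_ar F (face (Suc k) i True)"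
  let ?t = "\<lambda>i. ?s i [^]\<^bsub>?G\<^esub> ((-1) ^ i :: int)"
  have s: "?s i \<in> carrier ?G" if "i \<in> {1..Suc k}" for i using that F by simp
  have "cube_diff A F (Suc k) = finprod ?G (\<lambda>i. (on_ar F (face (Suc k) i False) \<otimes>\<^bsub>?G\<^esub>
      inv\<^bsub>?G\<^esub> on_ar F (face (Suc k) i True)) [^]\<^bsub>?G\<^esub> ((-1) ^ i :: int)) {1..Suc k}"
    by (simp add: cube_diff_def Let_def)
  also have "\<dots> = finprod ?G ?t {1..Suc k}"
    by (rule G.finprod_cong') (use F s G.int_pow_closed in \<open>auto simp: inv_hom_grp dif_def\<close>)
  finally have e: "cube_diff A F (Suc k) = finprod ?G ?t {1..Suc k}" .
  have t': "?t \<in> {1..Suc k} \<rightarrow> carrier ?G" using s G.int_pow_closed by blast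
  then have "finprod ?G ?t {1..Suc k} \<in> carrier ?G" by (rule G.finprod_closed)
  then show c: "cube_diff A F (Suc k) \<in> Hom A (on_ob F (Suc k)) (on_ob F k)" unfolding e by simp
  have h: "(\<lambda>x. m \<cdot> (x \<cdot> t)) \<in> hom ?G ?K"
    by (rule homI) (use t m in \<open>auto simp: Cmp_Plus\<close>)
  have "m \<cdot> (cube_diff A F (Suc k) \<cdot> t) = finprod ?K (\<lambda>i. m \<cdot> (?t i \<cdot> t)) {1..Suc k}"
    unfolding e by (rule hom_finprod[OF G.comm_group_axioms K.comm_group_axioms h _ t']) simp
  also have "\<dots> = finprod ?K (\<lambda>i. (m \<cdot> (on_ar F (face (Suc k) i False) \<cdot> t) \<boxminus> m \<cdot> (on_ar F (face (Suc k) i True) \<cdot> t))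
        [^]\<^bsub>?K\<^esub> ((-1) ^ i :: int)) {1..Suc k}"
  proof (rule K.finprod_cong')
    fix i assume i: "i \<in> {1..Suc k}"
    have "m \<cdot> (?s i \<cdot> t) = m \<cdot> (on_ar F (face (Suc k) i False) \<cdot> t) \<boxminus> m \<cdot> (on_ar F (face (Suc k) i True) \<cdot> t)"
      using i F t m by (simp add: Cmp_dif)
    then show "m \<cdot> (?t i \<cdot> t) = (m \<cdot> (on_ar F (face (Suc k) i False) \<cdot> t) \<boxminus> m \<cdot> (on_ar F (face (Suc k) i True) \<cdot> t))
        [^]\<^bsub>?K\<^esub> ((-1) ^ i :: int)"
      using hom_int_pow[OF h s[OF i] G.is_group K.is_group] by simp
  next
    have "m \<cdot> (on_ar F (face (Suc k) i False) \<cdot> t) \<boxminus> m \<cdot> (on_ar F (face (Suc k) i True) \<cdot> t) \<in> carrier ?K"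
      if "i \<in> {1..Suc k}" for i using that F t m by simp
    then show "(\<lambda>i. (m \<cdot> (on_ar F (face (Suc k) i False) \<cdot> t) \<boxminus> m \<cdot> (on_ar F (face (Suc k) i True) \<cdot> t))
        [^]\<^bsub>?K\<^esub> ((-1) ^ i :: int)) \<in> {1..Suc k} \<rightarrow> carrier ?K"
      using K.int_pow_closed by blast
  qed simp
  finally show "m \<cdot> (cube_diff A F (Suc k) \<cdot> t) = finprod ?K
      (\<lambda>i. (m \<cdot> (on_ar F (face (Suc k) i False) \<cdot> t) \<boxminus> m \<cdot> (on_ar F (face (Suc k) i True) \<cdot> t))
        [^]\<^bsub>?K\<^esub> ((-1) ^ i :: int)) {1..Suc k}" .
qed

lemma cube_diff_Ar [simp]:
  assumes "cub F"
  shows "cube_diff A F (Suc k) \<in> Ar A" "Dom A (cube_diff A F (Suc k)) = on_ob F (Suc k)"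
    "Cod A (cube_diff A F (Suc k)) = on_ob F k"
  using cube_diff_comp(1)[OF assms, of "Idn A (on_ob F (Suc k))" k "Idn A (on_ob F k)"] assms by simp_all

text \<open>This is what makes the differential descend. For \<open>i = j\<close> both faces give
  the identity and cancel each other; for \<open>i \<noteq> j\<close> the cubical identities rewrite
  the composite as a degenerate arrow, which the projection kills.\<close>

lemma p_cube_diff_degen:
  assumes F: "cub F" and j: "1 \<le> j" "j \<le> Suc k"
  shows "p F k \<cdot> (cube_diff A F (Suc k) \<cdot> on_ar F (degen (Suc k) j)) = Null A (on_ob F k) (N F k)"
proof -
  let ?t = "on_ar F (degen (Suc k) j)" and ?K = "hom_grp A (on_ob F k) (N F k)"
  interpret K: comm_group ?K using hom_grp_comm_group F by simp
  have c: "on_ar F (face (Suc k) i b) \<cdot> ?t = on_ar F (box_cmp (degen (Suc k) j) (face (Suc k) i b))"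
    if "i \<in> {1..Suc k}" for i b
    by (rule cub_cmp[OF F, symmetric]) (use that j in simp_all)
  have z: "p F k \<cdot> on_ar F (box_cmp (face k i' b) (degen k j')) = Null A (on_ob F k) (N F k)"
    if "1 \<le> i'" "i' \<le> k" "1 \<le> j'" "j' \<le> k" for i' j' b
  proof -
    have "degenerate (box_cmp (face k i' b) (degen k j'))" unfolding degenerate_def
      using that by (intro exI[of _ "face k i' b"] exI[of _ j']) auto
    then show ?thesis using p_degenerate[OF F, of "box_cmp (face k i' b) (degen k j')"] that by simp
  qed
  have eq: "p F k \<cdot> (on_ar F (face (Suc k) i False) \<cdot> ?t) = p F k \<cdot> (on_ar F (face (Suc k) i True) \<cdot> ?t)"
    if i: "i \<in> {1..Suc k}" for i
  proof -
    consider "i = j" | "i < j" | "j < i" by linarith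
    then show ?thesis unfolding c[OF i]
    proof cases
      case 1
      then show "p F k \<cdot> on_ar F (box_cmp (degen (Suc k) j) (face (Suc k) i False)) =
          p F k \<cdot> on_ar F (box_cmp (degen (Suc k) j) (face (Suc k) i True))"
        using i by (simp add: degen_face_same)
    next
      case 2
      have "box_cmp (degen (Suc k) j) (face (Suc k) i b) = box_cmp (face k i b) (degen k (j - 1))" for b
        using degen_face_less[of i j "Suc k" b] 2 i j by simp
      then show "p F k \<cdot> on_ar F (box_cmp (degen (Suc k) j) (face (Suc k) i False)) =
          p F k \<cdot> on_ar F (box_cmp (degen (Suc k) j) (face (Suc k) i True))"
        using z[of i "j - 1"] 2 i j by auto
    next
      case 3
      have "box_cmp (degen (Suc k) j) (face (Suc k) i b) = box_cmp (face k (i - 1) b) (degen k j)" for b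
        using degen_face_greater[of j i "Suc k" b] 3 i j by simp
      then show "p F k \<cdot> on_ar F (box_cmp (degen (Suc k) j) (face (Suc k) i False)) =
          p F k \<cdot> on_ar F (box_cmp (degen (Suc k) j) (face (Suc k) i True))"
        using z[of "i - 1" j] 3 i j by auto
    qed
  qed
  have "(p F k \<cdot> (on_ar F (face (Suc k) i False) \<cdot> ?t) \<boxminus> p F k \<cdot> (on_ar F (face (Suc k) i True) \<cdot> ?t))
      [^]\<^bsub>?K\<^esub> ((-1) ^ i :: int) = \<one>\<^bsub>?K\<^esub>" if "i \<in> {1..Suc k}" for i
  proof -
    have "p F k \<cdot> (on_ar F (face (Suc k) i True) \<cdot> ?t) \<boxminus> p F k \<cdot> (on_ar F (face (Suc k) i True) \<cdot> ?t) = \<one>\<^bsub>?K\<^esub>"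
      using that F j by simp
    then show ?thesis using eq[OF that] K.int_pow_one by metis
  qed
  then have "finprod ?K (\<lambda>i. (p F k \<cdot> (on_ar F (face (Suc k) i False) \<cdot> ?t) \<boxminus> p F k \<cdot> (on_ar F (face (Suc k) i True) \<cdot> ?t))
      [^]\<^bsub>?K\<^esub> ((-1) ^ i :: int)) {1..Suc k} = \<one>\<^bsub>?K\<^esub>"
    by (intro K.finprod_one_eqI) blast
  then show ?thesis using cube_diff_comp(2)[OF F, of ?t k "p F k"] F j by simp
qed

abbreviation "D \<equiv> norm_diff A"

lemma norm_diff_Suc:
  assumes "cub F"
  shows "D F (Suc k) \<in> Ar A" "Dom A (D F (Suc k)) = N F (Suc k)" "Cod A (D F (Suc k)) = N F k"
    "D F (Suc k) \<cdot> p F (Suc k) = p F k \<cdot> cube_diff A F (Suc k)"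
proof -
  have e: "D F (Suc k) = desc_ar A (p F (Suc k)) (p F k \<cdot> cube_diff A F (Suc k))"
    unfolding norm_diff_def desc_ar_def using assms by simp
  show "D F (Suc k) \<in> Ar A" "Dom A (D F (Suc k)) = N F (Suc k)" "Cod A (D F (Suc k)) = N F k"
    "D F (Suc k) \<cdot> p F (Suc k) = p F k \<cdot> cube_diff A F (Suc k)"
    unfolding e using p_desc[OF assms, of "p F k \<cdot> cube_diff A F (Suc k)" "Suc k"] p_cube_diff_degen[OF assms, of _ k] assms
    by simp_all
qed

lemma cube_diff_natural:
  assumes "is_ntrans (op_cat Box) A \<eta>"
  shows "nt_at \<eta> k \<cdot> cube_diff A (nt_dom \<eta>) (Suc k) = cube_diff A (nt_cod \<eta>) (Suc k) \<cdot> nt_at \<eta> (Suc k)"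
proof -
  have F: "cub (nt_dom \<eta>)" "cub (nt_cod \<eta>)" using assms by simp_all
  let ?K = "hom_grp A (on_ob (nt_dom \<eta>) (Suc k)) (on_ob (nt_cod \<eta>) k)"
  interpret K: comm_group ?K using hom_grp_comm_group F by simp
  have n: "nt_at \<eta> k \<cdot> on_ar (nt_dom \<eta>) (face (Suc k) i b) = on_ar (nt_cod \<eta>) (face (Suc k) i b) \<cdot> nt_at \<eta> (Suc k)"
    if "i \<in> {1..Suc k}" for i b using nt_natural[OF assms, of "face (Suc k) i b"] that by simp
  let ?l = "\<lambda>i. (nt_at \<eta> k \<cdot> on_ar (nt_dom \<eta>) (face (Suc k) i False) \<boxminus> nt_at \<eta> k \<cdot> on_ar (nt_dom \<eta>) (face (Suc k) i True))
      [^]\<^bsub>?K\<^esub> ((-1) ^ i :: int)"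
  let ?r = "\<lambda>i. (on_ar (nt_cod \<eta>) (face (Suc k) i False) \<cdot> nt_at \<eta> (Suc k) \<boxminus> on_ar (nt_cod \<eta>) (face (Suc k) i True) \<cdot> nt_at \<eta> (Suc k))
      [^]\<^bsub>?K\<^esub> ((-1) ^ i :: int)"
  have c: "?r \<in> {1..Suc k} \<rightarrow> carrier ?K" using F assms by (auto intro!: K.int_pow_closed[simplified])
  \<comment> \<open>Identities are inserted so that both sides take the form treated by
    \<open>cube_diff_comp\<close>.\<close>
  have "nt_at \<eta> k \<cdot> cube_diff A (nt_dom \<eta>) (Suc k)
      = nt_at \<eta> k \<cdot> (cube_diff A (nt_dom \<eta>) (Suc k) \<cdot> Idn A (on_ob (nt_dom \<eta>) (Suc k)))" using F by simp
  also have "\<dots> = finprod ?K (\<lambda>i. (nt_at \<eta> k \<cdot> (on_ar (nt_dom \<eta>) (face (Suc k) i False) \<cdot> Idn A (on_ob (nt_dom \<eta>) (Suc k)))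
      \<boxminus> nt_at \<eta> k \<cdot> (on_ar (nt_dom \<eta>) (face (Suc k) i True) \<cdot> Idn A (on_ob (nt_dom \<eta>) (Suc k))))
      [^]\<^bsub>?K\<^esub> ((-1) ^ i :: int)) {1..Suc k}"
    using cube_diff_comp(2)[OF F(1), of "Idn A (on_ob (nt_dom \<eta>) (Suc k))" k "nt_at \<eta> k"] F assms by simp
  also have "\<dots> = finprod ?K ?r {1..Suc k}"
    by (rule K.finprod_cong'[OF refl c]) (use n F in simp)
  also have "\<dots> = finprod ?K (\<lambda>i. (Idn A (on_ob (nt_cod \<eta>) k) \<cdot> (on_ar (nt_cod \<eta>) (face (Suc k) i False) \<cdot> nt_at \<eta> (Suc k))
      \<boxminus> Idn A (on_ob (nt_cod \<eta>) k) \<cdot> (on_ar (nt_cod \<eta>) (face (Suc k) i True) \<cdot> nt_at \<eta> (Suc k)))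
      [^]\<^bsub>?K\<^esub> ((-1) ^ i :: int)) {1..Suc k}"
    by (rule K.finprod_cong'[OF refl c, symmetric]) (use F assms in simp)
  also have "\<dots> = Idn A (on_ob (nt_cod \<eta>) k) \<cdot> (cube_diff A (nt_cod \<eta>) (Suc k) \<cdot> nt_at \<eta> (Suc k))"
    using cube_diff_comp(2)[OF F(2), of "nt_at \<eta> (Suc k)" k "Idn A (on_ob (nt_cod \<eta>) k)", symmetric] F assms
    by (simp del: Cmp_Idn)
  finally show ?thesis using F assms by simp
qed

lemma norm_diff_natural:
  assumes "is_ntrans (op_cat Box) A \<eta>"
  shows "D (nt_cod \<eta>) (Suc k) \<cdot> N_map (Suc k) \<eta> = N_map k \<eta> \<cdot> D (nt_dom \<eta>) (Suc k)"
proof -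
  have F: "cub (nt_dom \<eta>)" "cub (nt_cod \<eta>)" using assms by simp_all
  note d1 = norm_diff_Suc[OF F(1), of k] and d2 = norm_diff_Suc[OF F(2), of k]
    and n1 = N_map[OF assms, of "Suc k"] and n0 = N_map[OF assms, of k]
  have "(D (nt_cod \<eta>) (Suc k) \<cdot> N_map (Suc k) \<eta>) \<cdot> p (nt_dom \<eta>) (Suc k)
      = p (nt_cod \<eta>) k \<cdot> cube_diff A (nt_cod \<eta>) (Suc k) \<cdot> nt_at \<eta> (Suc k)"
    using n1 d2(1-3) Cmp_extend[OF d2(4), of "nt_at \<eta> (Suc k)"] F assms by simp
  also have "\<dots> = (p (nt_cod \<eta>) k \<cdot> nt_at \<eta> k) \<cdot> cube_diff A (nt_dom \<eta>) (Suc k)"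
    unfolding cube_diff_natural[OF assms, symmetric] using F assms by simp
  also have "\<dots> = (N_map k \<eta> \<cdot> D (nt_dom \<eta>) (Suc k)) \<cdot> p (nt_dom \<eta>) (Suc k)"
    unfolding n0(4)[symmetric] using n0(1-3) d1 F assms by simp
  finally show ?thesis
    by (rule N_map_ext[OF F(1), rotated -1]) (use d1 d2 n1 n0 in simp_all)
qed

text \<open>\<open>rho F n l\<close> extends \<open>w \<mapsto> p F l \<cdot> F(fill_ar w)\<close> additively to formal sums of words, which transports
  identities between formal sums to the normalized complex.\<close>

definition rho :: "(nat, box_ar, 'o, 'm) fctr \<Rightarrow> nat \<Rightarrow> nat \<Rightarrow> (face_word \<Rightarrow>\<^sub>0 int) \<Rightarrow> 'm" where
  "rho F n l = (SOME h. h \<in> hom (free_Abelian_group (words n l)) (hom_grp A (on_ob F n) (N F l)) \<and>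
     (\<forall>w \<in> words n l. h (frag_of w) = p F l \<cdot> on_ar F (fill_ar w)))"

lemma rho:
  assumes "cub F"
  shows "rho F n l \<in> hom (free_Abelian_group (words n l)) (hom_grp A (on_ob F n) (N F l))"
    "w \<in> words n l \<Longrightarrow> rho F n l (frag_of w) = p F l \<cdot> on_ar F (fill_ar w)"
proof -
  interpret K: comm_group "hom_grp A (on_ob F n) (N F l)" using hom_grp_comm_group assms by simp
  have "(\<lambda>w. p F l \<cdot> on_ar F (fill_ar w)) ` words n l \<subseteq> carrier (hom_grp A (on_ob F n) (N F l))"
    using assms by (auto simp: words_def)
  from K.free_Abelian_group_universal[OF this]
  have "\<exists>h. h \<in> hom (free_Abelian_group (words n l)) (hom_grp A (on_ob F n) (N F l)) \<and>
     (\<forall>w \<in> words n l. h (frag_of w) = p F l \<cdot> on_ar F (fill_ar w))" by metis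
  from someI_ex[OF this] show "rho F n l \<in> hom (free_Abelian_group (words n l)) (hom_grp A (on_ob F n) (N F l))"
    "w \<in> words n l \<Longrightarrow> rho F n l (frag_of w) = p F l \<cdot> on_ar F (fill_ar w)"
    unfolding rho_def[symmetric] by blast+
qed

lemma dW_words: "w \<in> words n (Suc l) \<Longrightarrow> Poly_Mapping.keys (dW w) \<subseteq> words n l"
  using keys_dW[of w] by (auto simp: words_def)

text \<open>By contravariance, the \<open>i\<close>-th face of \<open>F(fill_ar w)\<close> is
  \<open>F\<close> of the word in which the \<open>i\<close>-th free letter has become constant; the
  alternating sum of these words is \<open>dW w\<close>.\<close>

lemma norm_diff_rho:
  assumes F: "cub F" and w: "w \<in> words n (Suc l)"
  shows "D F (Suc l) \<cdot> rho F n (Suc l) (frag_of w) = rho F n l (dW w)"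
proof -
  have w': "length w = n" "stars w = Suc l" using w by (auto simp: words_def)
  let ?K = "hom_grp A (on_ob F n) (N F l)" and ?t = "on_ar F (fill_ar w)" and ?W = "words n l"
  let ?FW = "free_Abelian_group ?W"
  interpret K: comm_group ?K using hom_grp_comm_group F by simp
  interpret W: comm_group ?FW by (rule abelian_free_Abelian_group)
  note r = rho(1)[OF F, of n l] and d = norm_diff_Suc[OF F, of l]
  define u where "u i = frag_of (sub (i - 1) False w) - frag_of (sub (i - 1) True w)" for i
  have subw: "sub (i - 1) b w \<in> ?W" if "i \<in> {1..Suc l}" for i b
  proof -
    have "i - 1 < stars w" using that w' by auto
    then show ?thesis using w' by (simp add: words_def)
  qed
  have u: "Poly_Mapping.keys (u i) \<subseteq> ?W" if "i \<in> {1..Suc l}" for i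
    unfolding u_def using subw[OF that] by (intro order_trans[OF keys_diff]) auto
  have uc: "frag_cmul c (u i) \<in> carrier ?FW" if "i \<in> {1..Suc l}" for i c
    using order_trans[OF keys_cmul u[OF that]] by simp
  have tm: "p F l \<cdot> (on_ar F (face (Suc l) i b) \<cdot> ?t) = rho F n l (frag_of (sub (i - 1) b w))" if i: "i \<in> {1..Suc l}" for i b
  proof -
    have "on_ar F (face (Suc l) i b) \<cdot> ?t = on_ar F (box_cmp (fill_ar w) (face (Suc l) i b))"
      by (rule cub_cmp[OF F, symmetric]) (use i w' in simp_all)
    also have "box_cmp (fill_ar w) (face (Suc l) i b) = fill_ar (sub (i - 1) b w)"
    proof -
      have "i - 1 < stars w" using i w' by auto
      then show ?thesis using fill_face[of "i - 1" w b] i w' by simp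
    qed
    finally show ?thesis using rho(2)[OF F subw[OF i]] by simp
  qed
  have hu: "rho F n l (u i) = p F l \<cdot> (on_ar F (face (Suc l) i False) \<cdot> ?t) \<boxminus> p F l \<cdot> (on_ar F (face (Suc l) i True) \<cdot> ?t)"
    if i: "i \<in> {1..Suc l}" for i
    unfolding u_def tm[OF i] by (rule hom_free_diff[OF r]) (use F subw[OF i] in auto)
  \<comment> \<open>The reindexing passes from free letters counted from 0 to faces numbered from
    1.\<close>
  have "dW w = (\<Sum>i\<in>{1..Suc l}. frag_cmul ((-1) ^ i) (u i))"
    unfolding dW_eq_sum w'(2) by (rule sum.reindex_bij_witness[of _ "\<lambda>i. i - 1" Suc]) (auto simp: u_def)
  also have "\<dots> = finprod ?FW (\<lambda>i. frag_cmul ((-1) ^ i) (u i)) {1..Suc l}"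
  proof -
    have "(\<Sum>i\<in>I. frag_cmul ((-1) ^ i) (u i)) = finprod ?FW (\<lambda>i. frag_cmul ((-1) ^ i) (u i)) I"
      if "finite I" "I \<subseteq> {1..Suc l}" for I
      using that
    proof (induction I rule: finite_induct)
      case (insert i I)
      have "(\<lambda>i. frag_cmul ((-1) ^ i) (u i)) \<in> I \<rightarrow> carrier ?FW" "frag_cmul ((-1) ^ i) (u i) \<in> carrier ?FW"
        using insert.prems uc by blast+
      then show ?case using insert by simp
    qed simp
    then show ?thesis by blast
  qed
  finally have dw: "dW w = finprod ?FW (\<lambda>i. frag_cmul ((-1) ^ i) (u i)) {1..Suc l}" .
  have "rho F n l (dW w) = finprod ?K (\<lambda>i. rho F n l (frag_cmul ((-1) ^ i) (u i))) {1..Suc l}"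
    unfolding dw
    by (rule hom_finprod[OF abelian_free_Abelian_group K.comm_group_axioms r]) (use uc in blast)+
  also have "\<dots> = finprod ?K (\<lambda>i. (p F l \<cdot> (on_ar F (face (Suc l) i False) \<cdot> ?t)
      \<boxminus> p F l \<cdot> (on_ar F (face (Suc l) i True) \<cdot> ?t)) [^]\<^bsub>?K\<^esub> ((-1) ^ i :: int)) {1..Suc l}"
  proof (rule K.finprod_cong')
    fix i assume i: "i \<in> {1..Suc l}"
    have "rho F n l (frag_cmul ((-1) ^ i) (u i)) = rho F n l (u i [^]\<^bsub>?FW\<^esub> ((-1) ^ i :: int))"
      using int_pow_free_Abelian_group[OF u[OF i]] by simp
    also have "\<dots> = rho F n l (u i) [^]\<^bsub>?K\<^esub> ((-1) ^ i :: int)"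
      by (rule hom_int_pow[OF r]) (use u[OF i] K.is_group in simp_all)
    finally show "rho F n l (frag_cmul ((-1) ^ i) (u i)) = (p F l \<cdot> (on_ar F (face (Suc l) i False) \<cdot> ?t)
      \<boxminus> p F l \<cdot> (on_ar F (face (Suc l) i True) \<cdot> ?t)) [^]\<^bsub>?K\<^esub> ((-1) ^ i :: int)" using hu[OF i] by simp
  next
    have "rho F n l (u i) \<in> carrier ?K" if "i \<in> {1..Suc l}" for i
      using hom_in_carrier[OF r, of "u i"] u[OF that] by simp
    then show "(\<lambda>i. (p F l \<cdot> (on_ar F (face (Suc l) i False) \<cdot> ?t)
      \<boxminus> p F l \<cdot> (on_ar F (face (Suc l) i True) \<cdot> ?t)) [^]\<^bsub>?K\<^esub> ((-1) ^ i :: int)) \<in> {1..Suc l} \<rightarrow> carrier ?K"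
      using hu K.int_pow_closed by (metis (no_types, lifting) Pi_I')
  qed simp
  also have "\<dots> = p F l \<cdot> (cube_diff A F (Suc l) \<cdot> ?t)"
    using cube_diff_comp(2)[OF F, of ?t l "p F l"] F w' by simp
  also have "\<dots> = D F (Suc l) \<cdot> (p F (Suc l) \<cdot> ?t)"
    using Cmp_extend[OF d(4), of ?t] d(1-3) F w' by simp
  finally show ?thesis using rho(2)[OF F w] by simp
qed

lemma norm_diff_rho_ext:
  assumes "cub F" "Poly_Mapping.keys c \<subseteq> words n (Suc l)"
  shows "D F (Suc l) \<cdot> rho F n (Suc l) c = rho F n l (frag_extend dW c)"
  by (rule free_hom_ext[OF assms(2) _ _ _ rho(1)[OF assms(1)] rho(1)[OF assms(1)]])
    (use assms(1) norm_diff_Suc[OF assms(1), of l] dW_words norm_diff_rho[OF assms(1)] in simp_all)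

text \<open>The identity of \<open>cube (l + 2)\<close> is the word with free letters only, and
  \<open>rho\<close> sends it to the projection itself. Applying the differential twice to this
  universal element gives \<open>dW\<close> twice.\<close>

lemma norm_diff_norm_diff:
  assumes F: "cub F"
  shows "D F (Suc l) \<cdot> D F (Suc (Suc l)) = Null A (N F (Suc (Suc l))) (N F l)"
proof -
  let ?n = "Suc (Suc l)"
  let ?w = "replicate ?n None :: face_word"
  have w: "?w \<in> words ?n ?n" using stars_simps(5)[of ?n] by (simp add: words_def del: stars_simps(5))
  note d1 = norm_diff_Suc[OF F, of l] and d2 = norm_diff_Suc[OF F, of "Suc l"]
  have r: "rho F ?n ?n (frag_of ?w) = p F ?n"
    using rho(2)[OF F w] F unfolding fill_ar_None by simp
  have "(D F (Suc l) \<cdot> D F ?n) \<cdot> p F ?n = D F (Suc l) \<cdot> (D F ?n \<cdot> rho F ?n ?n (frag_of ?w))"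
    unfolding r using d1 d2 F by simp
  also have "\<dots> = rho F ?n l (frag_extend dW (dW ?w))"
    using norm_diff_rho[OF F w] norm_diff_rho_ext[OF F dW_words[OF w]] by simp
  also have "\<dots> = Null A (on_ob F ?n) (N F l)"
    unfolding dW_dW using hom_free_zero[OF rho(1)[OF F]] F by simp
  finally show ?thesis
    using d1 d2 F by (intro N_map_ext[OF F, of "D F (Suc l) \<cdot> D F ?n" "Null A (N F ?n) (N F l)" ?n]) simp_all
qed

text \<open>The same choice as in \<open>norm_diff\<close> for \<open>k = 0\<close>, so that the
  differential out of degree zero ends in the value of \<open>X 0\<close>.\<close>

definition zero_ob :: 'o where
  "zero_ob = (SOME z. is_zero_ob A z)"

lemma zero_ob: "is_zero_ob A zero_ob" "zero_ob \<in> Ob A"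
proof -
  show "is_zero_ob A zero_ob" unfolding zero_ob_def using ex_zero_ob by (rule someI_ex)
  then show "zero_ob \<in> Ob A" by (simp add: is_zero_ob_def)
qed

definition X :: "nat \<Rightarrow> ((nat, box_ar, 'o, 'm) fctr, (nat, box_ar, 'o, 'm) ntrans, 'o, 'm) fctr" where
  "X n = (case n of 0 \<Rightarrow> Fctr (\<lambda>F\<in>Ob B. zero_ob) (\<lambda>\<eta>\<in>Ar B. Idn A zero_ob) | Suc k \<Rightarrow> NF k)"

lemma norm_diff_0: "D F 0 = Null A (N F 0) zero_ob"
  by (simp add: norm_diff_def zero_ob_def)

sublocale CN: exact_complex A B X "\<lambda>n F. norm_diff A F n"
proof
  show "is_additive_functor B A (X n)" for n
  proof (cases n)
    case 0
    have "is_functor B A (X 0)" unfolding X_def nat.case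
      by (rule is_functorI[OF B.category_axioms]) (use zero_ob in simp_all)
    moreover have "Idn A zero_ob \<boxplus> Idn A zero_ob = Idn A zero_ob"
      by (rule zero_ob_Hom[OF zero_ob(1)]) (use zero_ob(2) in simp_all)
    ultimately show ?thesis unfolding is_additive_functor_def 0 by (simp add: X_def)
  next
    case (Suc k)
    then show ?thesis using NF_additive by (simp add: X_def)
  qed
  show "short_exact A (on_ar (X n) f) (on_ar (X n) g)" if "short_exact B f g" for n f g
  proof (cases n)
    case 0
    then show ?thesis using short_exact_zero_ob[OF zero_ob(1)] that by (simp add: X_def short_exact_pointwise)
  next
    case (Suc k)
    then show ?thesis using NF_exact[OF that] by (simp add: X_def)
  qed
  show "D F n \<in> Hom A (on_ob (X (Suc n)) F) (on_ob (X n) F)" if "F \<in> Ob B" for n F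
    using that norm_diff_Suc zero_ob by (cases n) (simp_all add: X_def norm_diff_0)
  show "D (Cod B \<eta>) n \<cdot> on_ar (X (Suc n)) \<eta> = on_ar (X n) \<eta> \<cdot> D (Dom B \<eta>) n" if "\<eta> \<in> Ar B" for n \<eta>
  proof (cases n)
    case 0
    have e: "is_ntrans (op_cat Box) A \<eta>" using that by simp
    show ?thesis unfolding 0 using e zero_ob N_map[OF e, of 0] by (simp add: X_def norm_diff_0)
  next
    case (Suc k)
    then show ?thesis using norm_diff_natural that by (simp add: X_def)
  qed
  show "D F n \<cdot> D F (Suc n) = Null A (on_ob (X (Suc (Suc n))) F) (on_ob (X n) F)" if "F \<in> Ob B" for n F
    using that norm_diff_norm_diff norm_diff_Suc zero_ob by (cases n) (simp_all add: X_def norm_diff_0)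
  show "Plus B f g \<in> Hom B (Dom B g) (Cod B g)"
    if "f \<in> Ar B" "g \<in> Ar B" "Dom B f = Dom B g" "Cod B f = Cod B g" for f g
    using that by simp
  show "is_zero_ob A (on_ob (X 0) F)" if "F \<in> Ob B" for F
    using that zero_ob by (simp add: X_def)
qed

lemma X_Suc [simp]: "cub F \<Longrightarrow> on_ob (X (Suc k)) F = N F k" "is_ntrans (op_cat Box) A \<eta> \<Longrightarrow> on_ar (X (Suc k)) \<eta> = N_map k \<eta>"
  by (simp_all add: X_def)

lemma H_eq_norm_homology: "CN.H n F = norm_homology A F n"
  by (simp add: norm_homology_def)

end

section \<open>Acyclic covers by free cubical objects\<close>

locale cubical_cover = cubical_category A for A :: "('o, 'm, 'y) addcat_scheme" (structure) +
  assumes box_coproduct: "\<And>(I :: box_ar set) X. \<lbrakk>I \<subseteq> box_arrows; X ` I \<subseteq> Ob A\<rbrakk> \<Longrightarrow> \<exists>c \<iota>. is_coproduct A I X c \<iota>"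
begin

definition box_from :: "nat \<Rightarrow> box_ar set" where
  "box_from k = {f \<in> box_arrows. fst f = k}"

text \<open>As \<open>k\<close> varies, these coproducts form the left Kan extension, to the
  opposite cube category, of \<open>F\<close> restricted to objects: each target
  \<open>cube n\<close> contributes the copower of \<open>F(cube n)\<close> by the set of arrows
  from \<open>cube k\<close> to \<open>cube n\<close>.\<close>

definition free_coproduct :: "(nat, box_ar, 'o, 'm) fctr \<Rightarrow> nat \<Rightarrow> 'o \<times> (box_ar \<Rightarrow> 'm)" where
  "free_coproduct F k = (SOME (c, \<iota>). is_coproduct A (box_from k) (\<lambda>f. on_ob F (fst (snd f))) c \<iota>)"

abbreviation "P_ob F k \<equiv> fst (free_coproduct F k)"
abbreviation "inc F k \<equiv> snd (free_coproduct F k)"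

definition cotuple :: "(nat, box_ar, 'o, 'm) fctr \<Rightarrow> nat \<Rightarrow> 'o \<Rightarrow> (box_ar \<Rightarrow> 'm) \<Rightarrow> 'm" where
  "cotuple F k y g = (THE h. h \<in> Hom A (P_ob F k) y \<and> (\<forall>f \<in> box_from k. h \<cdot> inc F k f = g f))"

lemma box_from [simp]: "f \<in> box_from k \<longleftrightarrow> f \<in> box_arrows \<and> fst f = k"
  by (simp add: box_from_def)

lemma free_coproduct:
  assumes "cub F"
  shows "is_coproduct A (box_from k) (\<lambda>f. on_ob F (fst (snd f))) (P_ob F k) (inc F k)"
proof -
  have "\<exists>c \<iota>. is_coproduct A (box_from k) (\<lambda>f. on_ob F (fst (snd f))) c \<iota>"
    using assms by (intro box_coproduct) auto
  then have "\<exists>x. case x of (c, \<iota>) \<Rightarrow> is_coproduct A (box_from k) (\<lambda>f. on_ob F (fst (snd f))) c \<iota>" by auto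
  then have "case free_coproduct F k of (c, \<iota>) \<Rightarrow> is_coproduct A (box_from k) (\<lambda>f. on_ob F (fst (snd f))) c \<iota>"
    unfolding free_coproduct_def by (rule someI_ex)
  then show ?thesis by (cases "free_coproduct F k") simp
qed

lemma inc_Ar [simp]:
  assumes "cub F"
  shows "P_ob F k \<in> Ob A" "\<lbrakk>f \<in> box_arrows; fst f = k\<rbrakk> \<Longrightarrow> inc F k f \<in> Ar A"
    "\<lbrakk>f \<in> box_arrows; fst f = k\<rbrakk> \<Longrightarrow> Dom A (inc F k f) = on_ob F (fst (snd f))"
    "\<lbrakk>f \<in> box_arrows; fst f = k\<rbrakk> \<Longrightarrow> Cod A (inc F k f) = P_ob F k"
  using coproduct_Ar[OF free_coproduct[OF assms, of k]] by simp_all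

lemma cotuple:
  assumes "cub F" "y \<in> Ob A"
    and "\<And>f. \<lbrakk>f \<in> box_arrows; fst f = k\<rbrakk> \<Longrightarrow> g f \<in> Ar A \<and> Dom A (g f) = on_ob F (fst (snd f)) \<and> Cod A (g f) = y"
  shows "cotuple F k y g \<in> Ar A" "Dom A (cotuple F k y g) = P_ob F k" "Cod A (cotuple F k y g) = y"
    "\<lbrakk>f \<in> box_arrows; fst f = k\<rbrakk> \<Longrightarrow> cotuple F k y g \<cdot> inc F k f = g f"
proof -
  have "\<exists>!h. h \<in> Hom A (P_ob F k) y \<and> (\<forall>f \<in> box_from k. h \<cdot> inc F k f = g f)"
    by (rule coproduct_ex1[OF free_coproduct[OF assms(1)] assms(2)]) (use assms(3) in simp)
  from theI'[OF this] show "cotuple F k y g \<in> Ar A" "Dom A (cotuple F k y g) = P_ob F k" "Cod A (cotuple F k y g) = y"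
    "\<lbrakk>f \<in> box_arrows; fst f = k\<rbrakk> \<Longrightarrow> cotuple F k y g \<cdot> inc F k f = g f"
    unfolding cotuple_def[symmetric] by auto
qed

lemma P_ext:
  assumes "cub F" "u \<in> Ar A" "v \<in> Ar A" "Dom A u = P_ob F k" "Dom A v = P_ob F k" "Cod A u = Cod A v"
    and "\<And>f. \<lbrakk>f \<in> box_arrows; fst f = k\<rbrakk> \<Longrightarrow> u \<cdot> inc F k f = v \<cdot> inc F k f"
  shows "u = v"
  by (rule coproduct_ext[OF free_coproduct[OF assms(1), of k], of u "Cod A v" v]) (use assms in simp_all)

text \<open>Precomposition with \<open>g\<close> permutes labels only: the summand of
  \<open>f\<close> is carried identically onto the summand of \<open>box_cmp f g\<close>, and its
  coefficient object is the same because the target of \<open>f\<close> is.\<close>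

definition P_ar :: "(nat, box_ar, 'o, 'm) fctr \<Rightarrow> box_ar \<Rightarrow> 'm" where
  "P_ar F g = cotuple F (fst (snd g)) (P_ob F (fst g)) (\<lambda>f. inc F (fst g) (box_cmp f g))"

lemma P_ar:
  assumes "cub F" "g \<in> box_arrows"
  shows "P_ar F g \<in> Ar A" "Dom A (P_ar F g) = P_ob F (fst (snd g))" "Cod A (P_ar F g) = P_ob F (fst g)"
    "\<lbrakk>f \<in> box_arrows; fst f = fst (snd g)\<rbrakk> \<Longrightarrow> P_ar F g \<cdot> inc F (fst (snd g)) f = inc F (fst g) (box_cmp f g)"
  using cotuple[OF assms(1), of "P_ob F (fst g)" "fst (snd g)" "\<lambda>f. inc F (fst g) (box_cmp f g)"] assms
  by (simp_all add: P_ar_def)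

definition PF :: "(nat, box_ar, 'o, 'm) fctr \<Rightarrow> (nat, box_ar, 'o, 'm) fctr" where
  "PF F = Fctr (\<lambda>k\<in>Ob (op_cat Box). P_ob F k) (\<lambda>g\<in>Ar (op_cat Box). P_ar F g)"

lemma PF_sel [simp]: "on_ob (PF F) k = P_ob F k" "g \<in> box_arrows \<Longrightarrow> on_ar (PF F) g = P_ar F g"
  by (simp_all add: PF_def)

lemma PF_cub [simp]:
  assumes F: "cub F"
  shows "cub (PF F)"
  unfolding PF_def
proof (rule is_functorI[OF category_op_Box])
  fix k assume "k \<in> Ob (op_cat Box)"
  show "P_ar F (Idn (op_cat Box) k) = Idn A (P_ob F k)"
    by (rule P_ext[OF F, of _ _ k])
      (use P_ar[OF F, of "box_id k"] F in \<open>simp_all add: box_cmp_id\<close>)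
next
  fix f g assume "f \<in> Ar (op_cat Box)" "g \<in> Ar (op_cat Box)" "Cod (op_cat Box) f = Dom (op_cat Box) g"
  then have fg: "f \<in> box_arrows" "g \<in> box_arrows" "fst (snd g) = fst f" by simp_all
  note a = P_ar[OF F fg(1)] P_ar[OF F fg(2), unfolded fg(3)] P_ar[OF F, of "box_cmp f g"]
  show "P_ar F (g \<cdot>\<^bsub>op_cat Box\<^esub> f) = P_ar F g \<cdot> P_ar F f"
  proof (rule P_ext[OF F, of _ _ "fst (snd f)"])
    fix h assume h: "h \<in> box_arrows" "fst h = fst (snd f)"
    have "P_ar F g \<cdot> (P_ar F f \<cdot> inc F (fst (snd f)) h) = inc F (fst g) (box_cmp (box_cmp h f) g)"
      using a(4)[OF h] a(8)[of "box_cmp h f"] h fg by simp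
    also have "\<dots> = inc F (fst g) (box_cmp h (box_cmp f g))"
      using box_cmp_assoc[of g f h] h fg by simp
    finally show "P_ar F (g \<cdot>\<^bsub>op_cat Box\<^esub> f) \<cdot> inc F (fst (snd f)) h = (P_ar F g \<cdot> P_ar F f) \<cdot> inc F (fst (snd f)) h"
      using a h fg F by simp
  qed (use a fg in simp_all)
qed (use F P_ar in simp_all)

definition counit :: "(nat, box_ar, 'o, 'm) fctr \<Rightarrow> (nat, box_ar, 'o, 'm) ntrans" where
  "counit F = NTrans (PF F) F (\<lambda>k\<in>Ob (op_cat Box). cotuple F k (on_ob F k) (on_ar F))"

lemma counit_at:
  assumes "cub F"
  shows "nt_at (counit F) k \<in> Ar A" "Dom A (nt_at (counit F) k) = P_ob F k" "Cod A (nt_at (counit F) k) = on_ob F k"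
    "\<lbrakk>f \<in> box_arrows; fst f = k\<rbrakk> \<Longrightarrow> nt_at (counit F) k \<cdot> inc F k f = on_ar F f"
  using cotuple[OF assms, of "on_ob F k" k "on_ar F"] assms by (simp_all add: counit_def)

lemma counit_sel [simp]: "nt_dom (counit F) = PF F" "nt_cod (counit F) = F"
  by (simp_all add: counit_def)

lemma counit [simp]:
  assumes F: "cub F"
  shows "is_ntrans (op_cat Box) A (counit F)"
  unfolding counit_def
proof (rule is_ntransI[OF category_op_Box])
  have e: "cotuple F k (on_ob F k) (on_ar F) = nt_at (counit F) k" for k by (simp add: counit_def)
  note c = counit_at[OF F]
  fix f assume "f \<in> Ar (op_cat Box)"
  then have f: "f \<in> box_arrows" by simp
  note a = P_ar[OF F f]
  have "nt_at (counit F) (fst f) \<cdot> P_ar F f = on_ar F f \<cdot> nt_at (counit F) (fst (snd f))"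
  proof (rule P_ext[OF F, of _ _ "fst (snd f)"])
    fix h assume h: "h \<in> box_arrows" "fst h = fst (snd f)"
    have "nt_at (counit F) (fst f) \<cdot> P_ar F f \<cdot> inc F (fst (snd f)) h = on_ar F f \<cdot> on_ar F h"
      using a(4)[OF h] c(4)[of "box_cmp h f" "fst f"] cub_cmp[OF F f h(1)] h f by simp
    then show "(nt_at (counit F) (fst f) \<cdot> P_ar F f) \<cdot> inc F (fst (snd f)) h
        = (on_ar F f \<cdot> nt_at (counit F) (fst (snd f))) \<cdot> inc F (fst (snd f)) h"
      using a c h f F by simp
  qed (use a c f F in simp_all)
  then show "cotuple F (Cod (op_cat Box) f) (on_ob F (Cod (op_cat Box) f)) (on_ar F) \<cdot> on_ar (PF F) f
      = on_ar F f \<cdot> cotuple F (Dom (op_cat Box) f) (on_ob F (Dom (op_cat Box) f)) (on_ar F)"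
    using f by (simp add: e)
qed (use F cotuple[OF F] in simp_all)

text \<open>Already the summand of the identity arrow is mapped identically onto
  \<open>F(cube k)\<close>.\<close>

lemma counit_epi:
  assumes F: "cub F"
  shows "epi_ar A (nt_at (counit F) k)"
  using epi_cancel_right[of "nt_at (counit F) k" "inc F k (box_id k)"] counit_at(1-3)[OF F, of k] counit_at(4)[OF F, of "box_id k" k] F
  by simp

definition P_map :: "(nat, box_ar, 'o, 'm) ntrans \<Rightarrow> (nat, box_ar, 'o, 'm) ntrans" where
  "P_map \<eta> = NTrans (PF (nt_dom \<eta>)) (PF (nt_cod \<eta>)) (\<lambda>k\<in>Ob (op_cat Box).
     cotuple (nt_dom \<eta>) k (P_ob (nt_cod \<eta>) k) (\<lambda>f. inc (nt_cod \<eta>) k f \<cdot> nt_at \<eta> (fst (snd f))))"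

lemma P_map_at:
  assumes "is_ntrans (op_cat Box) A \<eta>"
  shows "nt_at (P_map \<eta>) k \<in> Ar A" "Dom A (nt_at (P_map \<eta>) k) = P_ob (nt_dom \<eta>) k"
    "Cod A (nt_at (P_map \<eta>) k) = P_ob (nt_cod \<eta>) k"
    "\<lbrakk>f \<in> box_arrows; fst f = k\<rbrakk> \<Longrightarrow> nt_at (P_map \<eta>) k \<cdot> inc (nt_dom \<eta>) k f = inc (nt_cod \<eta>) k f \<cdot> nt_at \<eta> (fst (snd f))"
proof -
  have F: "cub (nt_dom \<eta>)" "cub (nt_cod \<eta>)" using assms by simp_all
  show "nt_at (P_map \<eta>) k \<in> Ar A" "Dom A (nt_at (P_map \<eta>) k) = P_ob (nt_dom \<eta>) k"
    "Cod A (nt_at (P_map \<eta>) k) = P_ob (nt_cod \<eta>) k"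
    "\<lbrakk>f \<in> box_arrows; fst f = k\<rbrakk> \<Longrightarrow> nt_at (P_map \<eta>) k \<cdot> inc (nt_dom \<eta>) k f = inc (nt_cod \<eta>) k f \<cdot> nt_at \<eta> (fst (snd f))"
    using cotuple[OF F(1), of "P_ob (nt_cod \<eta>) k" k "\<lambda>f. inc (nt_cod \<eta>) k f \<cdot> nt_at \<eta> (fst (snd f))"] F assms
    by (simp_all add: P_map_def)
qed

lemma P_map_sel [simp]: "nt_dom (P_map \<eta>) = PF (nt_dom \<eta>)" "nt_cod (P_map \<eta>) = PF (nt_cod \<eta>)"
  by (simp_all add: P_map_def)

lemma P_map [simp]:
  assumes e: "is_ntrans (op_cat Box) A \<eta>"
  shows "is_ntrans (op_cat Box) A (P_map \<eta>)"
proof -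
  have F: "cub (nt_dom \<eta>)" "cub (nt_cod \<eta>)" using assms by simp_all
  note m = P_map_at[OF e]
  have "is_ntrans (op_cat Box) A (NTrans (PF (nt_dom \<eta>)) (PF (nt_cod \<eta>)) (\<lambda>k\<in>Ob (op_cat Box). nt_at (P_map \<eta>) k))"
  proof (rule is_ntransI[OF category_op_Box])
    fix f assume "f \<in> Ar (op_cat Box)"
    then have f: "f \<in> box_arrows" by simp
    note a = P_ar[OF F(1) f] P_ar[OF F(2) f]
    have "nt_at (P_map \<eta>) (fst f) \<cdot> P_ar (nt_dom \<eta>) f = P_ar (nt_cod \<eta>) f \<cdot> nt_at (P_map \<eta>) (fst (snd f))"
    proof (rule P_ext[OF F(1), of _ _ "fst (snd f)"])
      fix h assume h: "h \<in> box_arrows" "fst h = fst (snd f)"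
      have "nt_at (P_map \<eta>) (fst f) \<cdot> P_ar (nt_dom \<eta>) f \<cdot> inc (nt_dom \<eta>) (fst (snd f)) h
          = inc (nt_cod \<eta>) (fst f) (box_cmp h f) \<cdot> nt_at \<eta> (fst (snd h))"
        using a(4)[OF h] m(4)[of "box_cmp h f" "fst f"] h f by simp
      also have "\<dots> = P_ar (nt_cod \<eta>) f \<cdot> (nt_at (P_map \<eta>) (fst (snd f)) \<cdot> inc (nt_dom \<eta>) (fst (snd f)) h)"
        using Cmp_extend[OF a(8)[OF h], of "nt_at \<eta> (fst (snd h))"] m(4)[OF h] a(5-7) h f e F by simp
      finally show "(nt_at (P_map \<eta>) (fst f) \<cdot> P_ar (nt_dom \<eta>) f) \<cdot> inc (nt_dom \<eta>) (fst (snd f)) h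
          = (P_ar (nt_cod \<eta>) f \<cdot> nt_at (P_map \<eta>) (fst (snd f))) \<cdot> inc (nt_dom \<eta>) (fst (snd f)) h"
        using a m h f F by simp
    qed (use a m f F in simp_all)
    then show "nt_at (P_map \<eta>) (Cod (op_cat Box) f) \<cdot> on_ar (PF (nt_dom \<eta>)) f
      = on_ar (PF (nt_cod \<eta>)) f \<cdot> nt_at (P_map \<eta>) (Dom (op_cat Box) f)" using f by simp
  qed (use F m in simp_all)
  moreover have "NTrans (PF (nt_dom \<eta>)) (PF (nt_cod \<eta>)) (\<lambda>k\<in>Ob (op_cat Box). nt_at (P_map \<eta>) k) = P_map \<eta>"
    by (simp add: P_map_def)
  ultimately show ?thesis by simp
qed

lemma counit_natural:
  assumes e: "is_ntrans (op_cat Box) A \<eta>"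
  shows "counit (nt_cod \<eta>) \<cdot>\<^bsub>B\<^esub> P_map \<eta> = \<eta> \<cdot>\<^bsub>B\<^esub> counit (nt_dom \<eta>)"
proof (rule ntrans_eqI)
  have F: "cub (nt_dom \<eta>)" "cub (nt_cod \<eta>)" using assms by simp_all
  show "is_ntrans (op_cat Box) A (counit (nt_cod \<eta>) \<cdot>\<^bsub>B\<^esub> P_map \<eta>)" "is_ntrans (op_cat Box) A (\<eta> \<cdot>\<^bsub>B\<^esub> counit (nt_dom \<eta>))"
    using e F by simp_all
  fix k
  note c = counit_at[OF F(1), where k = k] counit_at[OF F(2), where k = k]
  have m: "nt_at (P_map \<eta>) k \<in> Ar A" "Dom A (nt_at (P_map \<eta>) k) = P_ob (nt_dom \<eta>) k"
    "Cod A (nt_at (P_map \<eta>) k) = P_ob (nt_cod \<eta>) k" using P_map_at[OF e] by simp_all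
  have "nt_at (counit (nt_cod \<eta>)) k \<cdot> nt_at (P_map \<eta>) k = nt_at \<eta> k \<cdot> nt_at (counit (nt_dom \<eta>)) k"
  proof (rule P_ext[OF F(1), of _ _ k])
    fix h assume h: "h \<in> box_arrows" "fst h = k"
    have "nt_at (counit (nt_cod \<eta>)) k \<cdot> (nt_at (P_map \<eta>) k \<cdot> inc (nt_dom \<eta>) k h) = on_ar (nt_cod \<eta>) h \<cdot> nt_at \<eta> (fst (snd h))"
      unfolding P_map_at(4)[OF e h] using Cmp_extend[OF c(8)[OF h], of "nt_at \<eta> (fst (snd h))"] c(5-7) h e F by simp
    also have "\<dots> = nt_at \<eta> k \<cdot> (nt_at (counit (nt_dom \<eta>)) k \<cdot> inc (nt_dom \<eta>) k h)"
      unfolding c(4)[OF h] using nt_natural[OF e h(1)] h by simp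
    finally show "(nt_at (counit (nt_cod \<eta>)) k \<cdot> nt_at (P_map \<eta>) k) \<cdot> inc (nt_dom \<eta>) k h
        = (nt_at \<eta> k \<cdot> nt_at (counit (nt_dom \<eta>)) k) \<cdot> inc (nt_dom \<eta>) k h"
      using m c(1-3,5-7) h e F by simp
  qed (use m c e F in simp_all)
  then show "nt_at (counit (nt_cod \<eta>) \<cdot>\<^bsub>B\<^esub> P_map \<eta>) k = nt_at (\<eta> \<cdot>\<^bsub>B\<^esub> counit (nt_dom \<eta>)) k" by simp
qed simp_all

context
  fixes F
  assumes F [simp]: "cub F"
begin

text \<open>The generic element of target \<open>cube n\<close>: by \<open>inc_eq_gen\<close>, every
  inclusion with that target arises from it through the cubical structure of
  \<open>PF F\<close>.\<close>

definition gen :: "nat \<Rightarrow> 'm" where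
  "gen n = inc F n (box_id n)"

lemma gen [simp]: "gen n \<in> Ar A" "Dom A (gen n) = on_ob F n" "Cod A (gen n) = P_ob F n"
  by (simp_all add: gen_def)

lemma inc_eq_gen: "f \<in> box_arrows \<Longrightarrow> inc F (fst f) f = P_ar F f \<cdot> gen (fst (snd f))"
  using P_ar(4)[OF F, of f "box_id (fst (snd f))"] by (simp add: gen_def box_cmp_id)

text \<open>Evaluating \<open>rho\<close> at the generator turns formal sums of faces of the
  \<open>n\<close>-cube into normalized chains of \<open>PF F\<close> with coefficients in
  \<open>F(cube n)\<close>; boundary and contraction then act on words alone.\<close>

definition rg :: "nat \<Rightarrow> nat \<Rightarrow> (face_word \<Rightarrow>\<^sub>0 int) \<Rightarrow> 'm" where
  "rg n l c = rho (PF F) n l c \<cdot> gen n"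

lemma rg: "rg n l \<in> hom (free_Abelian_group (words n l)) (hom_grp A (on_ob F n) (N (PF F) l))"
proof -
  have "(\<lambda>f. f \<cdot> gen n) \<in> hom (hom_grp A (P_ob F n) (N (PF F) l)) (hom_grp A (on_ob F n) (N (PF F) l))"
    using comp_hom(2)[of "gen n" "N (PF F) l"] by simp
  from hom_compose[OF rho(1)[OF PF_cub[OF F], of n l, simplified] this] show ?thesis
    unfolding rg_def[abs_def] comp_def by simp
qed

lemma rg_word: "w \<in> words n l \<Longrightarrow> rg n l (frag_of w) = p (PF F) l \<cdot> inc F l (fill_ar w)"
  using rho(2)[OF PF_cub[OF F], of w n l] inc_eq_gen[of "fill_ar w"] P_ar(1-3)[OF F, of "fill_ar w"]
  by (simp add: rg_def words_def)

lemma rg_Ar: "Poly_Mapping.keys c \<subseteq> words n l \<Longrightarrow> rg n l c \<in> Ar A"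
  "Poly_Mapping.keys c \<subseteq> words n l \<Longrightarrow> Dom A (rg n l c) = on_ob F n"
  "Poly_Mapping.keys c \<subseteq> words n l \<Longrightarrow> Cod A (rg n l c) = N (PF F) l"
  using hom_free_closed[OF rg, of c n l] by simp_all

lemma norm_diff_rg:
  assumes "Poly_Mapping.keys c \<subseteq> words n (Suc l)"
  shows "D (PF F) (Suc l) \<cdot> rg n (Suc l) c = rg n l (frag_extend dW c)"
proof -
  note r = hom_free_closed[OF rho(1)[OF PF_cub[OF F]] assms] and d = norm_diff_Suc(1-3)[OF PF_cub[OF F], of l]
  have "D (PF F) (Suc l) \<cdot> rg n (Suc l) c = (D (PF F) (Suc l) \<cdot> rho (PF F) n (Suc l) c) \<cdot> gen n"
    unfolding rg_def using r d by simp
  then show ?thesis unfolding rg_def norm_diff_rho_ext[OF PF_cub[OF F] assms] .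
qed

lemma hW_words: "w \<in> words n l \<Longrightarrow> Poly_Mapping.keys (hW w) \<subseteq> words n (Suc l)"
  using keys_hW[of w] by (auto simp: words_def)

text \<open>Zero on degenerate summands, so that the arrow descends to the normalized object. On the
  summand of a face word it applies \<open>hW\<close>, which leaves the target
  \<open>cube n\<close>, and with it the coefficients, unchanged.\<close>

definition contr0 :: "nat \<Rightarrow> 'm" where
  "contr0 l = cotuple F l (N (PF F) (Suc l)) (\<lambda>f. if degenerate f then Null A (on_ob F (fst (snd f))) (N (PF F) (Suc l))
     else rg (fst (snd f)) (Suc l) (hW (THE w. f = fill_ar w)))"

lemma fill_ar_The [simp]: "(THE w. fill_ar v = fill_ar w) = v"
  by (rule the_equality) (use fill_ar_inject in \<open>auto dest: sym\<close>)

lemma contr0: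
  "contr0 l \<in> Ar A" "Dom A (contr0 l) = P_ob F l" "Cod A (contr0 l) = N (PF F) (Suc l)"
  "\<lbrakk>f \<in> box_arrows; fst f = l; degenerate f\<rbrakk> \<Longrightarrow> contr0 l \<cdot> inc F l f = Null A (on_ob F (fst (snd f))) (N (PF F) (Suc l))"
  "w \<in> words n l \<Longrightarrow> contr0 l \<cdot> inc F l (fill_ar w) = rg n (Suc l) (hW w)"
proof -
  let ?g = "\<lambda>f. if degenerate f then Null A (on_ob F (fst (snd f))) (N (PF F) (Suc l))
     else rg (fst (snd f)) (Suc l) (hW (THE w. f = fill_ar w))"
  have g: "?g f \<in> Ar A \<and> Dom A (?g f) = on_ob F (fst (snd f)) \<and> Cod A (?g f) = N (PF F) (Suc l)"
    if f: "f \<in> box_arrows" "fst f = l" for f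
  proof (cases "degenerate f")
    case False
    then obtain w where w: "f = fill_ar w" using degenerate_or_fill[OF f(1)] by blast
    then have "Poly_Mapping.keys (hW w) \<subseteq> words (length w) (Suc l)"
      using hW_words[of w "length w" l] f by (simp add: words_def)
    then show ?thesis using rg_Ar False w by simp
  qed simp
  have N: "N (PF F) (Suc l) \<in> Ob A" by simp
  show "contr0 l \<in> Ar A" "Dom A (contr0 l) = P_ob F l" "Cod A (contr0 l) = N (PF F) (Suc l)"
    unfolding contr0_def by (rule cotuple[OF F N]; use g in blast)+
  have c4: "contr0 l \<cdot> inc F l f = ?g f" if "f \<in> box_arrows" "fst f = l" for f
    unfolding contr0_def by (rule cotuple(4)[OF F N]) (use g that in blast)+
  show "\<lbrakk>f \<in> box_arrows; fst f = l; degenerate f\<rbrakk> \<Longrightarrow> contr0 l \<cdot> inc F l f = Null A (on_ob F (fst (snd f))) (N (PF F) (Suc l))"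
    using c4[of f] by simp
  show "w \<in> words n l \<Longrightarrow> contr0 l \<cdot> inc F l (fill_ar w) = rg n (Suc l) (hW w)"
    using c4[of "fill_ar w"] not_degenerate_fill[of w] by (simp add: words_def)
qed

definition contr :: "nat \<Rightarrow> 'm" where
  "contr l = desc_ar A (p (PF F) l) (contr0 l)"

lemma contr:
  "contr l \<in> Ar A" "Dom A (contr l) = N (PF F) l" "Cod A (contr l) = N (PF F) (Suc l)" "contr l \<cdot> p (PF F) l = contr0 l"
proof -
  have "contr0 l \<cdot> on_ar (PF F) (degen l i) = Null A (on_ob (PF F) (l - 1)) (Cod A (contr0 l))" if i: "1 \<le> i" "i \<le> l" for i
  proof (rule P_ext[OF F, of _ _ "l - 1"])
    note a = P_ar[OF F, of "degen l i", simplified]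
    fix f assume f: "f \<in> box_arrows" "fst f = l - 1"
    have "degenerate (box_cmp f (degen l i))" unfolding degenerate_def
      using f i by (intro exI[of _ f] exI[of _ i]) simp
    then have "contr0 l \<cdot> (P_ar F (degen l i) \<cdot> inc F (l - 1) f) = Null A (on_ob F (fst (snd f))) (N (PF F) (Suc l))"
      using a(4)[of f] contr0(4)[of "box_cmp f (degen l i)" l] f i by simp
    then show "(contr0 l \<cdot> on_ar (PF F) (degen l i)) \<cdot> inc F (l - 1) f
        = Null A (on_ob (PF F) (l - 1)) (Cod A (contr0 l)) \<cdot> inc F (l - 1) f"
      using contr0(1-3)[of l] a(1-3) f i by simp
  qed (use P_ar(1-3)[OF F, of "degen l i", simplified] contr0(1-3)[of l] i in simp_all)
  then show "contr l \<in> Ar A" "Dom A (contr l) = N (PF F) l" "Cod A (contr l) = N (PF F) (Suc l)" "contr l \<cdot> p (PF F) l = contr0 l"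
    unfolding contr_def using p_desc[OF PF_cub[OF F], of "contr0 l" l] contr0(1-3)[of l] by simp_all
qed

lemma contr_rg:
  assumes "Poly_Mapping.keys c \<subseteq> words n l"
  shows "contr l \<cdot> rg n l c = rg n (Suc l) (frag_extend hW c)"
proof (rule free_hom_ext[OF assms _ _ _ rg rg])
  fix w assume w: "w \<in> words n l"
  have "contr l \<cdot> rg n l (frag_of w) = contr0 l \<cdot> inc F l (fill_ar w)"
    unfolding rg_word[OF w] using Cmp_extend[OF contr(4)[of l], of "inc F l (fill_ar w)"] contr(1-3)[of l] w
    by (simp add: words_def)
  then show "Poly_Mapping.keys (hW w) \<subseteq> words n (Suc l) \<and> contr l \<cdot> rg n l (frag_of w) = rg n (Suc l) (hW w)"
    using contr0(5)[OF w] hW_words[OF w] by simp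
qed (use contr in simp_all)

text \<open>On face words this is \<open>dW_hW\<close>, whose requirement of a free letter holds
  because the degree \<open>Suc l\<close> is positive; on degenerate summands both sides
  vanish.\<close>

lemma contr_homotopy:
  "D (PF F) (Suc (Suc l)) \<cdot> contr (Suc l) \<boxplus> contr l \<cdot> D (PF F) (Suc l) = Idn A (N (PF F) (Suc l))"
  (is "?h = _")
proof (rule N_map_ext[OF PF_cub[OF F], of _ _ "Suc l"])
  note d1 = norm_diff_Suc(1-3)[OF PF_cub[OF F], of l] and d2 = norm_diff_Suc(1-3)[OF PF_cub[OF F], of "Suc l"]
    and c1 = contr(1-3)[of l] and c2 = contr(1-3)[of "Suc l"]
  show h: "?h \<in> Ar A" "Dom A ?h = N (PF F) (Suc l)" using d1 d2 c1 c2 by simp_all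
  have h3: "Cod A ?h = N (PF F) (Suc l)" using d1 d2 c1 c2 by simp
  then show "Cod A ?h = Cod A (Idn A (N (PF F) (Suc l)))" by simp
  show "?h \<cdot> p (PF F) (Suc l) = Idn A (N (PF F) (Suc l)) \<cdot> p (PF F) (Suc l)"
  proof (rule P_ext[OF F, of _ _ "Suc l"])
    fix f assume f: "f \<in> box_arrows" "fst f = Suc l"
    have "?h \<cdot> (p (PF F) (Suc l) \<cdot> inc F (Suc l) f) = p (PF F) (Suc l) \<cdot> inc F (Suc l) f"
    proof (cases "degenerate f")
      case True
      have "p (PF F) (Suc l) \<cdot> P_ar F f = Null A (P_ob F (fst (snd f))) (N (PF F) (Suc l))"
        using p_degenerate[OF PF_cub[OF F] f(1) True] f by simp
      then have "p (PF F) (Suc l) \<cdot> inc F (Suc l) f = Null A (on_ob F (fst (snd f))) (N (PF F) (Suc l))"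
        using inc_eq_gen[OF f(1)] Cmp_extend[of "p (PF F) (Suc l)" "P_ar F f" _ "gen (fst (snd f))"] P_ar(1-3)[OF F f(1)] f
        by simp
      then show ?thesis using h h3 by simp
    next
      case False
      then obtain w where w: "f = fill_ar w" using degenerate_or_fill f by blast
      let ?n = "length w"
      have W: "w \<in> words ?n (Suc l)" using w f by (simp add: words_def)
      have k: "Poly_Mapping.keys (frag_of w) \<subseteq> words ?n (Suc l)" using W by simp
      have e1: "Poly_Mapping.keys (frag_extend dW (hW w)) \<subseteq> words ?n (Suc l)"
        using keys_frag_extend[of dW "hW w"] hW_words[OF W] dW_words[of _ ?n "Suc l"] by blast
      have e2: "Poly_Mapping.keys (frag_extend hW (dW w)) \<subseteq> words ?n (Suc l)"
        using keys_frag_extend[of hW "dW w"] dW_words[OF W] hW_words[of _ ?n l] by blast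
      have "?h \<cdot> rg ?n (Suc l) (frag_of w) = D (PF F) (Suc (Suc l)) \<cdot> (contr (Suc l) \<cdot> rg ?n (Suc l) (frag_of w))
          \<boxplus> contr l \<cdot> (D (PF F) (Suc l) \<cdot> rg ?n (Suc l) (frag_of w))"
        using d1 d2 c1 c2 rg_Ar[OF k] by (simp add: Cmp_Plus)
      also have "\<dots> = rg ?n (Suc l) (frag_extend dW (hW w)) \<boxplus> rg ?n (Suc l) (frag_extend hW (dW w))"
        unfolding contr_rg[OF k] norm_diff_rg[OF k] frag_extend_of
          norm_diff_rg[OF hW_words[OF W]] contr_rg[OF dW_words[OF W]] ..
      also have "\<dots> = rg ?n (Suc l) (frag_of w)"
        using hom_free_add[OF rg e1 e2] dW_hW[of w] f w by simp
      finally show ?thesis unfolding rg_word[OF W] w .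
    qed
    then show "(?h \<cdot> p (PF F) (Suc l)) \<cdot> inc F (Suc l) f = (Idn A (N (PF F) (Suc l)) \<cdot> p (PF F) (Suc l)) \<cdot> inc F (Suc l) f"
      using h h3 f by simp
  qed (use h h3 in simp_all)
qed simp_all

text \<open>By the homotopy, a cycle \<open>z\<close> is the boundary of its image under
  \<open>contr\<close>. The vanishing of the homology object is expressed through its identity
  arrow, the form in which effaceability uses it.\<close>

lemma PF_acyclic: "Idn A (CN.H (Suc l) (PF F)) = Null A (CN.H (Suc l) (PF F)) (CN.H (Suc l) (PF F))"
proof -
  have G: "PF F \<in> Ob B" by simp
  note d1 = norm_diff_Suc(1-3)[OF PF_cub[OF F], of l] and d2 = norm_diff_Suc(1-3)[OF PF_cub[OF F], of "Suc l"]
    and c1 = contr(1-3)[of l] and c2 = contr(1-3)[of "Suc l"]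
  show ?thesis
  proof (rule CN.H_ext[OF G])
    fix z assume z: "CN.Z (Suc l) (PF F) z"
    have za: "z \<in> Ar A" "Cod A z = N (PF F) (Suc l)" "D (PF F) (Suc l) \<cdot> z = Null A (Dom A z) (N (PF F) l)"
      using z G by (simp_all add: CN.Z_iff)
    have "(D (PF F) (Suc (Suc l)) \<cdot> contr (Suc l) \<boxplus> contr l \<cdot> D (PF F) (Suc l)) \<cdot> z = z"
      unfolding contr_homotopy using za by simp
    then have "D (PF F) (Suc (Suc l)) \<cdot> (contr (Suc l) \<cdot> z) = z"
      using za d1 d2 c1 c2 by (simp add: Cmp_Plus)
    then have "CN.c (Suc l) (PF F) z = Null A (Dom A z) (CN.H (Suc l) (PF F))"
      using CN.c_boundary(2)[OF G, of "contr (Suc l) \<cdot> z" "Suc l"] za c2 by simp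
    then show "Idn A (CN.H (Suc l) (PF F)) \<cdot> CN.c (Suc l) (PF F) z
        = Null A (CN.H (Suc l) (PF F)) (CN.H (Suc l) (PF F)) \<cdot> CN.c (Suc l) (PF F) z"
      using z G za by simp
  qed (use G in simp_all)
qed

end

end

section \<open>Degree zero\<close>

context functor_category
begin

lemma colimit_functor_map:
  assumes "is_colimit_functor S A L" "is_colimit_functor S A L'"
    and \<iota>: "\<And>F. is_functor S A F \<Longrightarrow> is_colimit S A F (on_ob L F) (\<iota> F)"
      "\<And>\<eta> x. \<lbrakk>is_ntrans S A \<eta>; x \<in> Ob S\<rbrakk> \<Longrightarrow> on_ar L \<eta> \<cdot> \<iota> (nt_dom \<eta>) x = \<iota> (nt_cod \<eta>) x \<cdot> nt_at \<eta> x"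
    and \<iota>': "\<And>F. is_functor S A F \<Longrightarrow> is_colimit S A F (on_ob L' F) (\<iota>' F)"
      "\<And>\<eta> x. \<lbrakk>is_ntrans S A \<eta>; x \<in> Ob S\<rbrakk> \<Longrightarrow> on_ar L' \<eta> \<cdot> \<iota>' (nt_dom \<eta>) x = \<iota>' (nt_cod \<eta>) x \<cdot> nt_at \<eta> x"
  obtains \<phi> where "\<phi> \<in> Hom (fun_cat B A) L L'"
    "\<And>F x. \<lbrakk>is_functor S A F; x \<in> Ob S\<rbrakk> \<Longrightarrow> nt_at \<phi> F \<cdot> \<iota> F x = \<iota>' F x"
proof -
  have L: "is_functor B A L" "is_functor B A L'" using assms(1,2) by (simp_all add: is_colimit_functor_def)
  note LS = functor_simps[OF L(1)] functor_simps[OF L(2)]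
  have c: "is_cocone S A F (on_ob L F) (\<iota> F)" "is_cocone S A F (on_ob L' F) (\<iota>' F)" if "is_functor S A F" for F
    using \<iota>(1)[OF that] \<iota>'(1)[OF that] by (simp_all add: is_colimit_def)
  have ca: "\<iota> F x \<in> Ar A" "Dom A (\<iota> F x) = on_ob F x" "Cod A (\<iota> F x) = on_ob L F"
    "\<iota>' F x \<in> Ar A" "Dom A (\<iota>' F x) = on_ob F x" "Cod A (\<iota>' F x) = on_ob L' F" if "is_functor S A F" "x \<in> Ob S" for F x
    using c[OF that(1)] that(2) by (simp_all add: is_cocone_def)
  define h where "h F = (THE h. h \<in> Hom A (on_ob L F) (on_ob L' F) \<and> (\<forall>x\<in>Ob S. h \<cdot> \<iota> F x = \<iota>' F x))" for F
  have h: "h F \<in> Ar A" "Dom A (h F) = on_ob L F" "Cod A (h F) = on_ob L' F" "\<And>x. x \<in> Ob S \<Longrightarrow> h F \<cdot> \<iota> F x = \<iota>' F x"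
    if F: "is_functor S A F" for F
  proof -
    have "\<exists>!h. h \<in> Hom A (on_ob L F) (on_ob L' F) \<and> (\<forall>x\<in>Ob S. h \<cdot> \<iota> F x = \<iota>' F x)"
      using \<iota>(1)[OF F] c(2)[OF F] unfolding is_colimit_def by blast
    from theI'[OF this] show "h F \<in> Ar A" "Dom A (h F) = on_ob L F" "Cod A (h F) = on_ob L' F"
      "\<And>x. x \<in> Ob S \<Longrightarrow> h F \<cdot> \<iota> F x = \<iota>' F x" unfolding h_def[symmetric] by auto
  qed
  have ext: "u = v" if F: "is_functor S A F" and uv: "u \<in> Hom A (on_ob L F) y" "v \<in> Hom A (on_ob L F) y"
    and e: "\<And>x. x \<in> Ob S \<Longrightarrow> u \<cdot> \<iota> F x = v \<cdot> \<iota> F x" for u v y F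
  proof -
    have y: "y \<in> Ob A" using uv by auto
    have "is_cocone S A F y (\<lambda>x. v \<cdot> \<iota> F x)"
      using c(1)[OF F] ca[OF F] uv(2) y F by (simp add: is_cocone_def)
    then have "\<exists>!h. h \<in> Hom A (on_ob L F) y \<and> (\<forall>x\<in>Ob S. h \<cdot> \<iota> F x = v \<cdot> \<iota> F x)"
      using \<iota>(1)[OF F] unfolding is_colimit_def by blast
    then show ?thesis using uv e by metis
  qed
  define \<phi> where "\<phi> = NTrans L L' (restrict h (Ob B))"
  have "is_ntrans B A \<phi>" unfolding \<phi>_def
  proof (rule is_ntransI[OF B.category_axioms L])
    fix \<eta> assume "\<eta> \<in> Ar B"
    then have e: "is_ntrans S A \<eta>" by simp
    then have F: "is_functor S A (nt_dom \<eta>)" "is_functor S A (nt_cod \<eta>)" by simp_all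
    have l: "on_ar L \<eta> \<in> Ar A" "Dom A (on_ar L \<eta>) = on_ob L (nt_dom \<eta>)" "Cod A (on_ar L \<eta>) = on_ob L (nt_cod \<eta>)"
      "on_ar L' \<eta> \<in> Ar A" "Dom A (on_ar L' \<eta>) = on_ob L' (nt_dom \<eta>)" "Cod A (on_ar L' \<eta>) = on_ob L' (nt_cod \<eta>)"
      using LS e by simp_all
    have "h (nt_cod \<eta>) \<cdot> on_ar L \<eta> = on_ar L' \<eta> \<cdot> h (nt_dom \<eta>)"
    proof (rule ext[OF F(1), of _ "on_ob L' (nt_cod \<eta>)"])
      fix x assume x: "x \<in> Ob S"
      have "h (nt_cod \<eta>) \<cdot> (on_ar L \<eta> \<cdot> \<iota> (nt_dom \<eta>) x) = \<iota>' (nt_cod \<eta>) x \<cdot> nt_at \<eta> x"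
        unfolding \<iota>(2)[OF e x] using Cmp_extend[OF h(4)[OF F(2) x], of "nt_at \<eta> x"] h(1-3)[OF F(2)] ca[OF F(2) x] e x by simp
      also have "\<dots> = on_ar L' \<eta> \<cdot> (h (nt_dom \<eta>) \<cdot> \<iota> (nt_dom \<eta>) x)"
        unfolding h(4)[OF F(1) x] \<iota>'(2)[OF e x] ..
      finally show "(h (nt_cod \<eta>) \<cdot> on_ar L \<eta>) \<cdot> \<iota> (nt_dom \<eta>) x = (on_ar L' \<eta> \<cdot> h (nt_dom \<eta>)) \<cdot> \<iota> (nt_dom \<eta>) x"
        using l h(1-3)[OF F(1)] h(1-3)[OF F(2)] ca[OF F(1) x] by simp
    qed (use l h(1-3)[OF F(1)] h(1-3)[OF F(2)] in simp_all)
    then show "h (Cod B \<eta>) \<cdot> on_ar L \<eta> = on_ar L' \<eta> \<cdot> h (Dom B \<eta>)" by simp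
  qed (use h in simp_all)
  then have "\<phi> \<in> Hom (fun_cat B A) L L'" by (simp add: \<phi>_def)
  moreover have "nt_at \<phi> F \<cdot> \<iota> F x = \<iota>' F x" if "is_functor S A F" "x \<in> Ob S" for F x
    using h(4)[OF that] that by (simp add: \<phi>_def)
  ultimately show ?thesis using that by blast
qed

text \<open>Both comparison arrows respect the legs of the colimit cocones, so each composite is an
  endomorphism of a colimit that fixes all legs, hence the identity.\<close>

lemma colimit_functor_unique:
  assumes L: "is_colimit_functor S A L" and L': "is_colimit_functor S A L'"
  obtains \<phi> \<psi> where "\<phi> \<in> Hom (fun_cat B A) L L'" "\<psi> \<in> Hom (fun_cat B A) L' L"
    "\<And>F. is_functor S A F \<Longrightarrow> nt_at \<psi> F \<cdot> nt_at \<phi> F = Idn A (on_ob L F)"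
    "\<And>F. is_functor S A F \<Longrightarrow> nt_at \<phi> F \<cdot> nt_at \<psi> F = Idn A (on_ob L' F)"
proof -
  obtain \<iota> where \<iota>: "\<And>F. is_functor S A F \<Longrightarrow> is_colimit S A F (on_ob L F) (\<iota> F)"
      "\<And>\<eta> x. \<lbrakk>is_ntrans S A \<eta>; x \<in> Ob S\<rbrakk> \<Longrightarrow> on_ar L \<eta> \<cdot> \<iota> (nt_dom \<eta>) x = \<iota> (nt_cod \<eta>) x \<cdot> nt_at \<eta> x"
    using L unfolding is_colimit_functor_def by blast
  obtain \<iota>' where \<iota>': "\<And>F. is_functor S A F \<Longrightarrow> is_colimit S A F (on_ob L' F) (\<iota>' F)"
      "\<And>\<eta> x. \<lbrakk>is_ntrans S A \<eta>; x \<in> Ob S\<rbrakk> \<Longrightarrow> on_ar L' \<eta> \<cdot> \<iota>' (nt_dom \<eta>) x = \<iota>' (nt_cod \<eta>) x \<cdot> nt_at \<eta> x"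
    using L' unfolding is_colimit_functor_def by blast
  obtain \<phi> where \<phi>: "\<phi> \<in> Hom (fun_cat B A) L L'"
    "\<And>F x. \<lbrakk>is_functor S A F; x \<in> Ob S\<rbrakk> \<Longrightarrow> nt_at \<phi> F \<cdot> \<iota> F x = \<iota>' F x"
    using colimit_functor_map[OF L L' \<iota> \<iota>'] by blast
  obtain \<psi> where \<psi>: "\<psi> \<in> Hom (fun_cat B A) L' L"
    "\<And>F x. \<lbrakk>is_functor S A F; x \<in> Ob S\<rbrakk> \<Longrightarrow> nt_at \<psi> F \<cdot> \<iota>' F x = \<iota> F x"
    using colimit_functor_map[OF L' L \<iota>' \<iota>] by blast
  have iso: "v \<cdot> u = Idn A c" if F: "is_functor S A F" and C: "is_colimit S A F c i" "is_colimit S A F c' i'"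
    and uv: "u \<in> Hom A c c'" "v \<in> Hom A c' c" "\<And>x. x \<in> Ob S \<Longrightarrow> u \<cdot> i x = i' x" "\<And>x. x \<in> Ob S \<Longrightarrow> v \<cdot> i' x = i x"
    for F c i c' i' u v
  proof -
    have cc: "is_cocone S A F c i" using C(1) by (simp add: is_colimit_def)
    then have i: "c \<in> Ob A" "\<And>x. x \<in> Ob S \<Longrightarrow> i x \<in> Ar A \<and> Cod A (i x) = c" by (simp_all add: is_cocone_def)
    have "\<exists>!h. h \<in> Hom A c c \<and> (\<forall>x\<in>Ob S. h \<cdot> i x = i x)"
      using C(1) cc unfolding is_colimit_def by blast
    moreover have "v \<cdot> u \<in> Hom A c c \<and> (\<forall>x\<in>Ob S. (v \<cdot> u) \<cdot> i x = i x)" using uv i by simp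
    moreover have "Idn A c \<in> Hom A c c \<and> (\<forall>x\<in>Ob S. Idn A c \<cdot> i x = i x)" using i by simp
    ultimately show ?thesis by blast
  qed
  have t: "nt_at \<phi> F \<in> Hom A (on_ob L F) (on_ob L' F)" "nt_at \<psi> F \<in> Hom A (on_ob L' F) (on_ob L F)"
    if "is_functor S A F" for F
  proof -
    have "is_ntrans B A \<phi>" "nt_dom \<phi> = L" "nt_cod \<phi> = L'" "is_ntrans B A \<psi>" "nt_dom \<psi> = L'" "nt_cod \<psi> = L"
      using \<phi>(1) \<psi>(1) by simp_all
    then show "nt_at \<phi> F \<in> Hom A (on_ob L F) (on_ob L' F)" "nt_at \<psi> F \<in> Hom A (on_ob L' F) (on_ob L F)"
      using ntrans_simps(3-5)[of B A \<phi> F] ntrans_simps(3-5)[of B A \<psi> F] that by simp_all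
  qed
  show ?thesis
    by (rule that[OF \<phi>(1) \<psi>(1)]; rule iso[OF _ \<iota>(1) \<iota>'(1)] iso[OF _ \<iota>'(1) \<iota>(1)]; (use t \<phi>(2) \<psi>(2) in blast)?; simp?)
qed

end

context cubical_category
begin

text \<open>The vertex with all coordinates \<open>False\<close>, serving as a base point: the legs
  of the colimit cocone are restrictions along it followed by \<open>aug\<close>.\<close>

definition vtx :: "nat \<Rightarrow> box_ar" where
  "vtx n = fill_ar (replicate n (Some False))"

lemma stars_Some [simp]: "stars (replicate n (Some b)) = 0"
  by (simp add: stars_def)

lemma vtx [simp]: "vtx n \<in> box_arrows" "fst (vtx n) = 0" "fst (snd (vtx n)) = n"
  by (simp_all add: vtx_def)

lemma sub_append: "stars u = 0 \<Longrightarrow> sub i b (u @ v) = u @ sub i b v"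
proof (induction u)
  case (Cons c u)
  then show ?case by (cases c) auto
qed simp

text \<open>The quotient map from \<open>F(cube 0)\<close> to the zeroth homology, written as the
  class of the tautological chain \<open>p F 0\<close>.\<close>

definition aug :: "(nat, box_ar, 'o, 'm) fctr \<Rightarrow> 'm" where
  "aug F = CN.c 0 F (p F 0)"

context
  fixes F
  assumes F [simp]: "cub F"
begin

lemma F_Ob: "F \<in> Ob B" by simp

lemma Z_0: "\<lbrakk>z \<in> Ar A; Cod A z = N F 0\<rbrakk> \<Longrightarrow> CN.Z 0 F z"
  using zero_ob by (simp add: cyc_def norm_diff_0)

lemma aug_Ar [simp]: "aug F \<in> Ar A" "Dom A (aug F) = on_ob F 0" "Cod A (aug F) = CN.H 0 F"
  using Z_0[of "p F 0"] F_Ob by (simp_all add: aug_def)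

lemma aug_Cmp: "\<lbrakk>t \<in> Ar A; Cod A t = on_ob F 0\<rbrakk> \<Longrightarrow> aug F \<cdot> t = CN.c 0 F (p F 0 \<cdot> t)"
  using CN.c_Cmp[OF F_Ob Z_0[of "p F 0"], of t] by (simp add: aug_def)

lemma aug_epi: "epi_ar A (aug F)"
proof -
  have "Idn A (CN.H 0 F) \<in> Ar A" "Cod A (Idn A (CN.H 0 F)) = CN.H 0 F" using F_Ob by simp_all
  from CN.c_surj[OF F_Ob this] obtain e z where ez: "epi_ar A e" "e \<in> Ar A" "CN.Z 0 F z"
    "Cod A e = CN.H 0 F" "Dom A z = Dom A e" "CN.c 0 F z = e"
    using F_Ob by (metis Cmp_Idn(2) CN.H_Ob Idn_Ar(2))
  have z: "z \<in> Ar A" "Cod A z = N F 0" using CN.Z_Ar[OF F_Ob ez(3)] by simp_all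
  obtain e2 x where e2: "epi_ar A e2" "e2 \<in> Ar A" "x \<in> Ar A" "Cod A e2 = Dom A z" "Dom A x = Dom A e2"
    "Cod A x = on_ob F 0" "p F 0 \<cdot> x = z \<cdot> e2"
    using epi_lift[OF p_epi[OF F, of 0] z(1)] z by auto
  have "aug F \<cdot> x = e \<cdot> e2" using aug_Cmp[of x] CN.c_Cmp[OF F_Ob ez(3) e2(2,4)] e2 ez by simp
  then show ?thesis using epi_cancel_right[of "aug F" x] epi_Cmp[OF e2(1) ez(1)] e2 ez by simp
qed

text \<open>In degree one the alternating sum has the single term \<open>i = 1\<close>, with sign
  -1, and a negative vanishes exactly when its argument does.\<close>

lemma comp_cube_diff_1:
  assumes "m \<in> Ar A" "Dom A m = on_ob F 0" "t \<in> Ar A" "Cod A t = on_ob F 1"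
  shows "m \<cdot> (cube_diff A F (Suc 0) \<cdot> t) = Null A (Dom A t) (Cod A m) \<longleftrightarrow>
    m \<cdot> (on_ar F (face 1 1 False) \<cdot> t) = m \<cdot> (on_ar F (face 1 1 True) \<cdot> t)"
proof -
  let ?K = "hom_grp A (Dom A t) (Cod A m)"
  interpret K: comm_group ?K using hom_grp_comm_group assms by simp
  let ?x = "m \<cdot> (on_ar F (face 1 1 False) \<cdot> t)" and ?y = "m \<cdot> (on_ar F (face 1 1 True) \<cdot> t)"
  have xy: "?x \<boxminus> ?y \<in> carrier ?K" using assms by simp
  let ?s = "\<lambda>i. (m \<cdot> (on_ar F (face (Suc 0) i False) \<cdot> t) \<boxminus> m \<cdot> (on_ar F (face (Suc 0) i True) \<cdot> t))
    [^]\<^bsub>?K\<^esub> ((-1) ^ i :: int)"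
  have "?s 1 \<in> carrier ?K" using xy K.int_pow_closed by simp
  then have "finprod ?K ?s {1..Suc 0} = ?s 1" by (simp del: hom_grp_sel)
  then have "m \<cdot> (cube_diff A F (Suc 0) \<cdot> t) = (?x \<boxminus> ?y) [^]\<^bsub>?K\<^esub> (-1 :: int)"
    using cube_diff_comp(2)[OF F, of t 0 m] assms by simp
  also have "\<dots> = inv\<^bsub>?K\<^esub> (?x \<boxminus> ?y)" using xy K.int_pow_neg[of "?x \<boxminus> ?y" 1] K.int_pow_1 by simp
  finally have "m \<cdot> (cube_diff A F (Suc 0) \<cdot> t) = \<one>\<^bsub>?K\<^esub> \<longleftrightarrow> ?x \<boxminus> ?y = \<one>\<^bsub>?K\<^esub>"
    using xy by (metis K.inv_one K.inv_inv)
  then show ?thesis using assms by simp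
qed

lemma aug_face: "aug F \<cdot> on_ar F (face 1 1 False) = aug F \<cdot> on_ar F (face 1 1 True)"
proof -
  note d = norm_diff_Suc[OF F, of 0]
  have "aug F \<cdot> cube_diff A F (Suc 0) = CN.c 0 F (D F (Suc 0) \<cdot> p F (Suc 0))"
    using aug_Cmp[of "cube_diff A F (Suc 0)"] d by simp
  also have "\<dots> = Null A (on_ob F 1) (CN.H 0 F)" using CN.c_boundary(2)[OF F_Ob, of "p F (Suc 0)" 0] by simp
  finally show ?thesis using comp_cube_diff_1[of "aug F" "Idn A (on_ob F 1)"] by simp
qed

text \<open>Whatever \<open>aug\<close> kills is, on a cover, a boundary under
  \<open>cube_diff\<close>, and \<open>g\<close> kills boundaries because it agrees on the two faces
  of the edge.\<close>

lemma aug_universal: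
  assumes g: "g \<in> Ar A" "Dom A g = on_ob F 0"
    and e: "g \<cdot> on_ar F (face 1 1 False) = g \<cdot> on_ar F (face 1 1 True)"
  obtains u where "u \<in> Ar A" "Dom A u = CN.H 0 F" "Cod A u = Cod A g" "u \<cdot> aug F = g"
proof (rule epi_desc[OF aug_epi, of g])
  fix t assume t: "t \<in> Ar A" "Cod A t = Dom A (aug F)" "aug F \<cdot> t = Null A (Dom A t) (Cod A (aug F))"
  have t2: "Cod A t = on_ob F 0" using t by simp
  have Zt: "CN.Z 0 F (p F 0 \<cdot> t)" using Z_0[of "p F 0 \<cdot> t"] t t2 by simp
  have "CN.c 0 F (p F 0 \<cdot> t) = Null A (Dom A (p F 0 \<cdot> t)) (CN.H 0 F)" using aug_Cmp[of t] t t2 by simp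
  then obtain e1 y where y: "epi_ar A e1" "e1 \<in> Ar A" "y \<in> Ar A" "Cod A e1 = Dom A t" "Dom A y = Dom A e1"
    "Cod A y = N F (Suc 0)" "D F (Suc 0) \<cdot> y = (p F 0 \<cdot> t) \<cdot> e1"
    using CN.c_NullD[OF F_Ob Zt] t t2 by (auto simp del: norm_diff_Suc)
  obtain e2 x where x: "epi_ar A e2" "e2 \<in> Ar A" "x \<in> Ar A" "Cod A e2 = Dom A y" "Dom A x = Dom A e2"
    "Cod A x = on_ob F (Suc 0)" "p F (Suc 0) \<cdot> x = y \<cdot> e2"
    using epi_lift[OF p_epi[OF F, of "Suc 0"] y(3)] y by auto
  note d = norm_diff_Suc[OF F, of 0]
  \<comment> \<open>The idempotent \<open>proj_nd F 0 0\<close> is an empty product, so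
    \<open>incl F 0\<close> inverts the projection and chains of degree zero may be lifted back to
    \<open>F(cube 0)\<close>.\<close>
  have ip: "incl F 0 \<cdot> p F 0 = Idn A (on_ob F 0)" using incl(4)[OF F, of 0] by simp
  have "p F 0 \<cdot> (cube_diff A F (Suc 0) \<cdot> x) = D F (Suc 0) \<cdot> (p F (Suc 0) \<cdot> x)"
    using Cmp_extend[OF d(4), of x] d(1-3) x by simp
  also have "\<dots> = p F 0 \<cdot> (t \<cdot> e1 \<cdot> e2)"
    unfolding x(7) using Cmp_extend[OF y(7), of e2] y(1-6) x(1-6) d(1-3) t t2 by simp
  finally have q: "incl F 0 \<cdot> (p F 0 \<cdot> (cube_diff A F (Suc 0) \<cdot> x)) = incl F 0 \<cdot> (p F 0 \<cdot> (t \<cdot> e1 \<cdot> e2))" by simp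
  have "cube_diff A F (Suc 0) \<cdot> x = t \<cdot> e1 \<cdot> e2"
    using q Cmp_extend[OF ip, of "cube_diff A F (Suc 0) \<cdot> x"] Cmp_extend[OF ip, of "t \<cdot> e1 \<cdot> e2"] incl(1-3)[OF F, of 0] x y t t2
    by simp
  moreover have "g \<cdot> (cube_diff A F (Suc 0) \<cdot> x) = Null A (Dom A x) (Cod A g)"
    using comp_cube_diff_1[of g x] Cmp_extend[OF e, of x] g x by simp
  ultimately have "(g \<cdot> t) \<cdot> (e1 \<cdot> e2) = Null A (Dom A e2) (Cod A g)" using g t t2 y x by simp
  then show "g \<cdot> t = Null A (Dom A t) (Cod A g)"
    using epi_Null[OF epi_Cmp[OF x(1) y(1)], of "g \<cdot> t"] g t t2 y x by simp
qed (use g that in auto)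

text \<open>The constants are changed to \<open>False\<close> one at a time from the left. Each
  change moves along the edge obtained by freeing that coordinate, and \<open>aug\<close> identifies
  the two ends of an edge.\<close>

lemma aug_vertices: "stars v = 0 \<Longrightarrow>
    aug F \<cdot> on_ar F (fill_ar (replicate m (Some False) @ v)) = aug F \<cdot> on_ar F (fill_ar (replicate (m + length v) (Some False)))"
proof (induction v arbitrary: m)
  case (Cons c v)
  then obtain b where c: "c = Some b" and v: "stars v = 0" by (cases c) auto
  let ?u = "replicate m (Some False) :: face_word"
  let ?e = "fill_ar (?u @ None # v)"
  have e: "?e \<in> box_arrows" "fst ?e = 1" using v by simp_all
  have f: "on_ar F (fill_ar (?u @ Some b # v)) = on_ar F (face 1 1 b) \<cdot> on_ar F ?e" for b
  proof -
    have "box_cmp ?e (face 1 1 b) = fill_ar (?u @ Some b # v)"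
      using fill_face[of 0 "?u @ None # v" b] v by (simp add: sub_append)
    then show ?thesis using cub_cmp[OF F, of "face 1 1 b" ?e] e by simp
  qed
  have "aug F \<cdot> on_ar F (fill_ar (?u @ Some b # v)) = aug F \<cdot> on_ar F (fill_ar (?u @ Some False # v))"
    using Cmp_extend[OF aug_face, of "on_ar F ?e"] e f[of b] f[of False] f[of True] by (cases b) simp_all
  also have "?u @ Some False # v = replicate (Suc m) (Some False) @ v" by (simp add: replicate_app_Cons_same)
  finally show ?case using Cons.IH[OF v, of "Suc m"] c by simp
qed simp

lemma aug_vertex:
  assumes "f \<in> box_arrows" "fst f = 0"
  shows "aug F \<cdot> on_ar F f = aug F \<cdot> on_ar F (vtx (fst (snd f)))"
proof -
  \<comment> \<open>\<open>cube 0\<close> has no coordinate to forget, so \<open>f\<close> is a face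
    word, consisting of constants only.\<close>
  have "\<not> degenerate f" using assms(2) by (auto simp: degenerate_def)
  then obtain w where w: "f = fill_ar w" using degenerate_or_fill[OF assms(1)] by blast
  then show ?thesis using aug_vertices[of w 0] assms by (simp add: vtx_def)
qed

text \<open>The leg at \<open>cube n\<close> restricts to a vertex, and after \<open>aug\<close> the
  choice of vertex does not matter; this gives the cocone. Conversely, the component of a cocone at
  \<open>cube 0\<close> agrees on the two faces of the edge and determines all other
  components.\<close>

lemma H_0_colimit: "is_colimit (op_cat Box) A F (CN.H 0 F) (\<lambda>n. aug F \<cdot> on_ar F (vtx n))"
  unfolding is_colimit_def
proof (intro conjI allI impI)
  show "is_cocone (op_cat Box) A F (CN.H 0 F) (\<lambda>n. aug F \<cdot> on_ar F (vtx n))"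
    unfolding is_cocone_def
  proof (intro conjI ballI)
    fix f assume "f \<in> Ar (op_cat Box)"
    then have f: "f \<in> box_arrows" by simp
    have "on_ar F (vtx (fst f)) \<cdot> on_ar F f = on_ar F (box_cmp f (vtx (fst f)))"
      by (rule cub_cmp[OF F, symmetric]) (use f in simp_all)
    then show "(aug F \<cdot> on_ar F (vtx (Cod (op_cat Box) f))) \<cdot> on_ar F f = aug F \<cdot> on_ar F (vtx (Dom (op_cat Box) f))"
      using aug_vertex[of "box_cmp f (vtx (fst f))"] f by simp
  qed (use F_Ob in simp_all)
  fix y g assume c: "is_cocone (op_cat Box) A F y g"
  have g: "g n \<in> Ar A" "Dom A (g n) = on_ob F n" "Cod A (g n) = y" for n using c by (simp_all add: is_cocone_def)
  have gf: "g (fst f) \<cdot> on_ar F f = g (fst (snd f))" if "f \<in> box_arrows" for f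
    using c that by (simp add: is_cocone_def)
  have "g 0 \<cdot> on_ar F (face 1 1 False) = g 0 \<cdot> on_ar F (face 1 1 True)"
    using gf[of "face 1 1 False"] gf[of "face 1 1 True"] by simp
  then obtain u where u: "u \<in> Ar A" "Dom A u = CN.H 0 F" "Cod A u = y" "u \<cdot> aug F = g 0"
    using aug_universal[of "g 0"] g by auto
  show "\<exists>!h. h \<in> Hom A (CN.H 0 F) y \<and> (\<forall>x\<in>Ob (op_cat Box). h \<cdot> (aug F \<cdot> on_ar F (vtx x)) = g x)"
  proof (rule ex1I[of _ u])
    have "u \<cdot> (aug F \<cdot> on_ar F (vtx n)) = g n" for n
      using Cmp_extend[OF u(4), of "on_ar F (vtx n)"] u(1-3) gf[of "vtx n"] by simp
    then show "u \<in> Hom A (CN.H 0 F) y \<and> (\<forall>x\<in>Ob (op_cat Box). u \<cdot> (aug F \<cdot> on_ar F (vtx x)) = g x)" using u by simp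
    fix v assume v: "v \<in> Hom A (CN.H 0 F) y \<and> (\<forall>x\<in>Ob (op_cat Box). v \<cdot> (aug F \<cdot> on_ar F (vtx x)) = g x)"
    \<comment> \<open>At \<open>cube 0\<close> the leg is \<open>aug\<close> itself, an epimorphism,
      which gives uniqueness.\<close>
    have "vtx 0 = box_id 0" using fill_ar_None[of 0] by (simp add: vtx_def)
    moreover have "v \<cdot> (aug F \<cdot> on_ar F (vtx 0)) = g 0" using v by simp
    ultimately have "v \<cdot> aug F = u \<cdot> aug F" using u by simp
    then show "v = u" using epi_cancel[OF aug_epi, of v u] v u by simp
  qed
qed

end

lemma HF_0_colimit_functor: "is_colimit_functor (op_cat Box) A (CN.HF 0)"
  unfolding is_colimit_functor_def
proof (intro conjI exI[of _ "\<lambda>F n. aug F \<cdot> on_ar F (vtx n)"] allI impI ballI)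
  show "is_functor B A (CN.HF 0)" by (rule CN.HF_functor)
  show "is_colimit (op_cat Box) A F (on_ob (CN.HF 0) F) (\<lambda>n. aug F \<cdot> on_ar F (vtx n))" if "cub F" for F
    using H_0_colimit[OF that] that by simp
  fix \<eta> x assume e: "is_ntrans (op_cat Box) A \<eta>"
  then have F: "cub (nt_dom \<eta>)" "cub (nt_cod \<eta>)" by simp_all
  have eB: "\<eta> \<in> Ar B" using e by simp
  note h = CN.H_map[OF eB, of 0] and n = N_map[OF e, of 0]
  have "CN.H_map 0 \<eta> \<cdot> aug (nt_dom \<eta>) = CN.c 0 (nt_cod \<eta>) (N_map 0 \<eta> \<cdot> p (nt_dom \<eta>) 0)"
    using h(4)[of "p (nt_dom \<eta>) 0"] Z_0[OF F(1), of "p (nt_dom \<eta>) 0"] F e by (simp add: aug_def)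
  also have "\<dots> = aug (nt_cod \<eta>) \<cdot> nt_at \<eta> 0"
    unfolding n(4) using aug_Cmp[OF F(2), of "nt_at \<eta> 0"] e by simp
  finally have a: "CN.H_map 0 \<eta> \<cdot> aug (nt_dom \<eta>) = aug (nt_cod \<eta>) \<cdot> nt_at \<eta> 0" .
  have "CN.H_map 0 \<eta> \<cdot> (aug (nt_dom \<eta>) \<cdot> on_ar (nt_dom \<eta>) (vtx x)) = aug (nt_cod \<eta>) \<cdot> (nt_at \<eta> 0 \<cdot> on_ar (nt_dom \<eta>) (vtx x))"
    using Cmp_extend[OF a, of "on_ar (nt_dom \<eta>) (vtx x)"] h(1-3) F e by simp
  also have "\<dots> = (aug (nt_cod \<eta>) \<cdot> on_ar (nt_cod \<eta>) (vtx x)) \<cdot> nt_at \<eta> x"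
    using nt_natural[OF e, of "vtx x"] F e by simp
  finally show "on_ar (CN.HF 0) \<eta> \<cdot> (aug (nt_dom \<eta>) \<cdot> on_ar (nt_dom \<eta>) (vtx x))
      = (aug (nt_cod \<eta>) \<cdot> on_ar (nt_cod \<eta>) (vtx x)) \<cdot> nt_at \<eta> x" using eB by simp
qed

end

section \<open>Comparison of delta functors\<close>

lemma delta_functor_additive: "homological_delta_functor B A T bd \<Longrightarrow> is_functor B A (T n)"
  by (simp add: homological_delta_functor_def is_additive_functor_def)

lemma delta_functor_bd:
  assumes "homological_delta_functor B A T bd" "short_exact B f g"
  shows "bd n f g \<in> Ar A" "Dom A (bd n f g) = on_ob (T (Suc n)) (Cod B g)" "Cod A (bd n f g) = on_ob (T n) (Dom B f)"
  using assms unfolding homological_delta_functor_def by auto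

lemma delta_functor_exact:
  assumes "homological_delta_functor B A T bd" "short_exact B f g"
  shows "exact_at A (on_ar (T (Suc n)) g) (bd n f g)" "exact_at A (bd n f g) (on_ar (T n) f)"
  using assms unfolding homological_delta_functor_def by blast+

lemma delta_functor_natural:
  assumes "homological_delta_functor B A T bd" "short_exact B f g" "short_exact B f' g'"
    "a \<in> Hom B (Dom B f) (Dom B f')" "b \<in> Hom B (Cod B f) (Cod B f')" "c \<in> Hom B (Cod B g) (Cod B g')"
    "b \<cdot>\<^bsub>B\<^esub> f = f' \<cdot>\<^bsub>B\<^esub> a" "c \<cdot>\<^bsub>B\<^esub> g = g' \<cdot>\<^bsub>B\<^esub> b"
  shows "on_ar (T n) a \<cdot>\<^bsub>A\<^esub> bd n f g = bd n f' g' \<cdot>\<^bsub>A\<^esub> on_ar (T (Suc n)) c"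
  using assms unfolding homological_delta_functor_def by blast

lemma short_exact_Ar:
  fixes C :: "('o, 'm, 'x) addcat_scheme" (structure)
  assumes "category C" "short_exact C f g"
  shows "f \<in> Ar C" "g \<in> Ar C" "Dom C g = Cod C f" "Dom C f \<in> Ob C" "Cod C f \<in> Ob C" "Cod C g \<in> Ob C"
    "g \<cdot> f = Null C (Dom C f) (Cod C g)"
proof -
  interpret category C by fact
  show 1: "f \<in> Ar C" "g \<in> Ar C" "Dom C g = Cod C f" "g \<cdot> f = Null C (Dom C f) (Cod C g)"
    using assms(2) unfolding short_exact_def is_kernel_def by metis+
  then show "Dom C f \<in> Ob C" "Cod C f \<in> Ob C" "Cod C g \<in> Ob C" by simp_all
qed

text \<open>Exactness lifts \<open>y\<close> along \<open>f\<close> only after an epimorphism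
  \<open>s\<close>. As \<open>f\<close> is monic, this lift kills whatever \<open>s\<close> kills,
  and hence descends.\<close>

lemma (in abelian_category) exact_mono_kernel:
  assumes "exact_at A f g" "mono_ar A f"
  shows "is_kernel A g f"
proof (rule is_kernelI)
  note e = exact_atD(1-4)[OF assms(1)]
  fix y assume y: "y \<in> Ar A" "Cod A y = Dom A g" "g \<cdot> y = Null A (Dom A y) (Cod A g)"
  obtain s x where s: "epi_ar A s" "s \<in> Ar A" "x \<in> Ar A" "Cod A s = Dom A y" "Dom A x = Dom A s"
    "Cod A x = Dom A f" "f \<cdot> x = y \<cdot> s" using exact_lift[OF assms(1) y] by blast
  have key: "x \<cdot> t = Null A (Dom A t) (Cod A x)"
    if t: "t \<in> Ar A" "Cod A t = Dom A s" "s \<cdot> t = Null A (Dom A t) (Cod A s)" for t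
  proof -
    have "f \<cdot> (x \<cdot> t) = Null A (Dom A t) (Cod A f)"
      using Cmp_extend[OF s(7), of t] t s(2-6) y(1,2) e by simp
    then show ?thesis using mono_Null[OF assms(2), of "x \<cdot> t"] t s by simp
  qed
  obtain u where u: "u \<in> Ar A" "Dom A u = Cod A s" "Cod A u = Cod A x" "u \<cdot> s = x"
    using epi_desc[OF s(1) s(3) s(5) key] by blast
  have "(f \<cdot> u) \<cdot> s = y \<cdot> s" using u s e by simp
  then have "f \<cdot> u = y"
    by (rule epi_cancel[OF s(1), rotated -1]) (use u(1-3) s(2-6) e(1-3) y(1,2) in simp_all)
  then show "\<exists>u. u \<in> Hom A (Dom A y) (Dom A f) \<and> f \<cdot> u = y" using u(1-3) s(4,6) by (intro exI[of _ u]) simp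
qed (use exact_atD(1-4)[OF assms(1)] assms(2) in simp_all)

lemma ex1_unique_eq: "\<lbrakk>\<exists>!x. P x; P a; P b\<rbrakk> \<Longrightarrow> a = b"
  by blast

text \<open>\<open>cover_map\<close> stands in for projectivity: arrows lift between the chosen
  covers, though not necessarily along arbitrary epimorphisms. \<open>cover_comp\<close> provides a
  kernel for the composite of a quotient map with the cover of its source. \<open>acyclic\<close>
  expresses, through identity arrows, that positive degrees vanish on covers.\<close>

locale effaceable_delta_functor = abelian_category A + B: category B
  for A :: "('o, 'm, 'y) addcat_scheme" (structure) and B :: "('c, 'k, 'z) addcat_scheme" +
  fixes S bdS and \<kappa> \<epsilon> :: "'c \<Rightarrow> 'k"
  assumes S: "homological_delta_functor B A S bdS"
    and B_Null: "\<And>f x. \<lbrakk>f \<in> Ar B; x \<in> Ob B\<rbrakk> \<Longrightarrow> f \<cdot>\<^bsub>B\<^esub> Null B x (Dom B f) = Null B x (Cod B f)"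
    and cover: "\<And>F. F \<in> Ob B \<Longrightarrow> short_exact B (\<kappa> F) (\<epsilon> F)" "\<And>F. F \<in> Ob B \<Longrightarrow> Cod B (\<epsilon> F) = F"
    and cover_map: "\<And>f. f \<in> Ar B \<Longrightarrow> \<exists>b. b \<in> Hom B (Dom B (\<epsilon> (Dom B f))) (Dom B (\<epsilon> (Cod B f))) \<and>
      \<epsilon> (Cod B f) \<cdot>\<^bsub>B\<^esub> b = f \<cdot>\<^bsub>B\<^esub> \<epsilon> (Dom B f)"
    and cover_comp: "\<And>f g. short_exact B f g \<Longrightarrow> \<exists>k. short_exact B k (g \<cdot>\<^bsub>B\<^esub> \<epsilon> (Dom B g))"
    and acyclic: "\<And>F n. F \<in> Ob B \<Longrightarrow> Idn A (on_ob (S (Suc n)) (Dom B (\<epsilon> F)))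
      = Null A (on_ob (S (Suc n)) (Dom B (\<epsilon> F))) (on_ob (S (Suc n)) (Dom B (\<epsilon> F)))"
begin

lemmas S_simps [simp] = functor_simps[OF delta_functor_additive[OF S]]

lemma \<epsilon>_Ar [simp]:
  assumes "F \<in> Ob B"
  shows "\<epsilon> F \<in> Ar B" "\<kappa> F \<in> Ar B" "Cod B (\<epsilon> F) = F" "Dom B (\<epsilon> F) = Cod B (\<kappa> F)"
  using short_exact_Ar[OF B.category_axioms cover(1)[OF assms]] cover(2)[OF assms] by simp_all

text \<open>In the long exact sequence the connecting arrow is preceded by \<open>S (Suc n)\<close>
  of a cover, which vanishes. Any \<open>e\<close> starting at a cover is allowed, since composites
  of a cover with a further quotient map occur besides the covers themselves.\<close>

lemma bdS_mono:
  assumes F: "F \<in> Ob B" and se: "short_exact B k e" and De: "Dom B e = Dom B (\<epsilon> F)"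
  shows "mono_ar A (bdS n k e)" "is_kernel A (on_ar (S n) k) (bdS n k e)"
proof -
  note b = delta_functor_bd[OF S se, of n] and ex = delta_functor_exact[OF S se, of n] and ke = short_exact_Ar[OF B.category_axioms se]
  show m: "mono_ar A (bdS n k e)"
  proof (rule mono_arI)
    fix y assume y: "y \<in> Ar A" "Cod A y = Dom A (bdS n k e)" "bdS n k e \<cdot> y = Null A (Dom A y) (Cod A (bdS n k e))"
    obtain s x where s: "epi_ar A s" "s \<in> Ar A" "x \<in> Ar A" "Cod A s = Dom A y" "Dom A x = Dom A s"
      "Cod A x = Dom A (on_ar (S (Suc n)) e)" "on_ar (S (Suc n)) e \<cdot> x = y \<cdot> s" using exact_lift[OF ex(1) y] by blast
    have cx: "Cod A x = on_ob (S (Suc n)) (Dom B (\<epsilon> F))" using s(6) ke De by simp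
    have "x = Idn A (on_ob (S (Suc n)) (Dom B (\<epsilon> F))) \<cdot> x" using cx s(3) by simp
    also have "\<dots> = Null A (Dom A s) (on_ob (S (Suc n)) (Dom B (\<epsilon> F)))"
      unfolding acyclic[OF F] using cx s(3,5) F by simp
    finally have x0: "x = Null A (Dom A s) (on_ob (S (Suc n)) (Dom B (\<epsilon> F)))" .
    have "y \<cdot> s = Null A (Dom A s) (Cod A y)" using s(2,7) x0 De ke b y(2) F by simp
    then show "y = Null A (Dom A y) (Dom A (bdS n k e))" using epi_Null[OF s(1), of y] s(4) y(1,2) by simp
  qed (use b in simp)
  show "is_kernel A (on_ar (S n) k) (bdS n k e)" by (rule exact_mono_kernel[OF ex(2) m])
qed

lemma kernel_lift:
  assumes "short_exact B k e" "b \<in> Ar B" "Cod B b = Dom B e" "e \<cdot>\<^bsub>B\<^esub> b = Null B (Dom B b) (Cod B e)"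
  obtains a where "a \<in> Ar B" "Dom B a = Dom B b" "Cod B a = Dom B k" "k \<cdot>\<^bsub>B\<^esub> a = b"
proof -
  have "is_kernel B e k" using assms(1) by (simp add: short_exact_def)
  from ex1_implies_ex[OF is_kernelD[OF this assms(2-4)]] show ?thesis using that by auto
qed

text \<open>The step of the construction of the morphism from \<open>T\<close> to \<open>S\<close>: since \<open>S (Suc n)\<close> vanishes on covers, its
  value at \<open>F\<close> is the kernel of \<open>S n (\<kappa> F)\<close>. Compatibility with a sequence \<open>(f, g)\<close> cannot be
  read off from the cover of the quotient directly, as covers are not projective; it passes through the sequence
  with middle term the cover of \<open>Cod f\<close> and the same quotient.\<close>

lemma extend_transformation:
  assumes T: "homological_delta_functor B A T bdT" and \<psi>: "\<psi> \<in> Hom (fun_cat B A) (T n) (S n)"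
  obtains \<psi>' where "\<psi>' \<in> Hom (fun_cat B A) (T (Suc n)) (S (Suc n))"
    "\<And>f g. short_exact B f g \<Longrightarrow> nt_at \<psi> (Dom B f) \<cdot> bdT n f g = bdS n f g \<cdot> nt_at \<psi>' (Cod B g)"
proof -
  note TF = delta_functor_additive[OF T] and SF = delta_functor_additive[OF S]
  note T_simps [simp] = functor_simps[OF TF]
  have p: "is_ntrans B A \<psi>" "nt_dom \<psi> = T n" "nt_cod \<psi> = S n" using \<psi> by simp_all
  have pa: "nt_at \<psi> F \<in> Ar A" "Dom A (nt_at \<psi> F) = on_ob (T n) F" "Cod A (nt_at \<psi> F) = on_ob (S n) F"
    if "F \<in> Ob B" for F using ntrans_simps(3-5)[OF p(1) that] p by simp_all
  have pn: "nt_at \<psi> (Cod B f) \<cdot> on_ar (T n) f = on_ar (S n) f \<cdot> nt_at \<psi> (Dom B f)" if "f \<in> Ar B" for f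
    using ntrans_natural[OF p(1) that refl refl] p by simp
  have z: "on_ar (S n) f \<cdot> (nt_at \<psi> (Dom B f) \<cdot> bdT n f g) = Null A (on_ob (T (Suc n)) (Cod B g)) (on_ob (S n) (Cod B f))"
    if se: "short_exact B f g" for f g
  proof -
    note fg = short_exact_Ar[OF B.category_axioms se] and bT = delta_functor_bd[OF T se, of n]
    have "on_ar (T n) f \<cdot> bdT n f g = Null A (on_ob (T (Suc n)) (Cod B g)) (on_ob (T n) (Cod B f))"
      using exact_atD(4)[OF delta_functor_exact(2)[OF T se, of n]] bT fg by simp
    then show ?thesis
      using Cmp_extend[OF pn[OF fg(1), symmetric], of "bdT n f g"] bT fg pa[OF fg(4)] pa[OF fg(5)] by simp
  qed
  \<comment> \<open>By \<open>z\<close>, the composite of \<open>bdT\<close> with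
    \<open>\<psi>\<close> is killed by \<open>S n (\<kappa> F)\<close>, and the connecting arrow of
    \<open>S\<close> is a kernel of the latter.\<close>
  define h where "h F = lift_ar A (bdS n (\<kappa> F) (\<epsilon> F)) (nt_at \<psi> (Dom B (\<kappa> F)) \<cdot> bdT n (\<kappa> F) (\<epsilon> F))" for F
  have h: "h F \<in> Ar A" "Dom A (h F) = on_ob (T (Suc n)) F" "Cod A (h F) = on_ob (S (Suc n)) F"
    "bdS n (\<kappa> F) (\<epsilon> F) \<cdot> h F = nt_at \<psi> (Dom B (\<kappa> F)) \<cdot> bdT n (\<kappa> F) (\<epsilon> F)" if F: "F \<in> Ob B" for F
  proof -
    note se = cover(1)[OF F]
    note fg = short_exact_Ar[OF B.category_axioms se] and bT = delta_functor_bd[OF T se, of n] and bS = delta_functor_bd[OF S se, of n]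
    have K: "is_kernel A (on_ar (S n) (\<kappa> F)) (bdS n (\<kappa> F) (\<epsilon> F))" by (rule bdS_mono(2)[OF F se refl])
    show "h F \<in> Ar A" "Dom A (h F) = on_ob (T (Suc n)) F" "Cod A (h F) = on_ob (S (Suc n)) F"
      "bdS n (\<kappa> F) (\<epsilon> F) \<cdot> h F = nt_at \<psi> (Dom B (\<kappa> F)) \<cdot> bdT n (\<kappa> F) (\<epsilon> F)"
      using lift_ar[OF K, of "nt_at \<psi> (Dom B (\<kappa> F)) \<cdot> bdT n (\<kappa> F) (\<epsilon> F)"] z[OF se] bT bS fg pa[OF fg(4)] F
      by (simp_all add: h_def)
  qed
  have hn: "h (Cod B \<eta>) \<cdot> on_ar (T (Suc n)) \<eta> = on_ar (S (Suc n)) \<eta> \<cdot> h (Dom B \<eta>)" if e: "\<eta> \<in> Ar B" for \<eta>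
  proof -
    let ?F = "Dom B \<eta>" and ?G = "Cod B \<eta>"
    have F: "?F \<in> Ob B" "?G \<in> Ob B" using e by simp_all
    note se = cover(1)[OF F(1)] cover(1)[OF F(2)]
    note kF = short_exact_Ar[OF B.category_axioms se(1)] and kG = short_exact_Ar[OF B.category_axioms se(2)]
    \<comment> \<open>A lift \<open>b\<close> of \<open>\<eta>\<close> to the covers induces
      \<open>a\<close> on the kernels. Naturality of \<open>h\<close> is then tested after the monic
      connecting arrow at the target.\<close>
    obtain b where b: "b \<in> Ar B" "Dom B b = Dom B (\<epsilon> ?F)" "Cod B b = Dom B (\<epsilon> ?G)" "\<epsilon> ?G \<cdot>\<^bsub>B\<^esub> b = \<eta> \<cdot>\<^bsub>B\<^esub> \<epsilon> ?F"
      using cover_map[OF e] by auto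
    have "\<epsilon> ?G \<cdot>\<^bsub>B\<^esub> (b \<cdot>\<^bsub>B\<^esub> \<kappa> ?F) = Null B (Dom B (\<kappa> ?F)) ?G"
      using B.Cmp_extend[OF b(4), of "\<kappa> ?F"] b(1-3) kF F e B_Null[OF e kF(4)] by simp
    then obtain a where a: "a \<in> Ar B" "Dom B a = Dom B (\<kappa> ?F)" "Cod B a = Dom B (\<kappa> ?G)" "\<kappa> ?G \<cdot>\<^bsub>B\<^esub> a = b \<cdot>\<^bsub>B\<^esub> \<kappa> ?F"
      using kernel_lift[OF se(2), of "b \<cdot>\<^bsub>B\<^esub> \<kappa> ?F"] b(1-3) F kF by auto
    have sq: "a \<in> Hom B (Dom B (\<kappa> ?F)) (Dom B (\<kappa> ?G))" "b \<in> Hom B (Cod B (\<kappa> ?F)) (Cod B (\<kappa> ?G))"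
      "\<eta> \<in> Hom B (Cod B (\<epsilon> ?F)) (Cod B (\<epsilon> ?G))" "b \<cdot>\<^bsub>B\<^esub> \<kappa> ?F = \<kappa> ?G \<cdot>\<^bsub>B\<^esub> a" "\<eta> \<cdot>\<^bsub>B\<^esub> \<epsilon> ?F = \<epsilon> ?G \<cdot>\<^bsub>B\<^esub> b"
      using a b F e by simp_all
    note nT = delta_functor_natural[OF T se sq, of n] and nS = delta_functor_natural[OF S se sq, of n]
    note bT = delta_functor_bd[OF T se(1), of n] delta_functor_bd[OF T se(2), of n]
    note bS = delta_functor_bd[OF S se(1), of n] delta_functor_bd[OF S se(2), of n]
    note h1 = h[OF F(1)] and h2 = h[OF F(2)] and p1 = pa[OF kF(4)] and p2 = pa[OF kG(4)]
    have "bdS n (\<kappa> ?G) (\<epsilon> ?G) \<cdot> (h ?G \<cdot> on_ar (T (Suc n)) \<eta>) = nt_at \<psi> (Dom B (\<kappa> ?G)) \<cdot> (bdT n (\<kappa> ?G) (\<epsilon> ?G) \<cdot> on_ar (T (Suc n)) \<eta>)"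
      using Cmp_extend[OF h2(4), of "on_ar (T (Suc n)) \<eta>"] h2(1-3) bS bT p2 F e by simp
    also have "\<dots> = (nt_at \<psi> (Dom B (\<kappa> ?G)) \<cdot> on_ar (T n) a) \<cdot> bdT n (\<kappa> ?F) (\<epsilon> ?F)"
      unfolding nT[symmetric] using a bT p2 F by simp
    also have "\<dots> = on_ar (S n) a \<cdot> (nt_at \<psi> (Dom B (\<kappa> ?F)) \<cdot> bdT n (\<kappa> ?F) (\<epsilon> ?F))"
      using pn[OF a(1)] a bT p1 F by simp
    also have "\<dots> = (on_ar (S n) a \<cdot> bdS n (\<kappa> ?F) (\<epsilon> ?F)) \<cdot> h ?F"
      unfolding h1(4)[symmetric] using a bS h1(1-3) F by simp
    also have "\<dots> = bdS n (\<kappa> ?G) (\<epsilon> ?G) \<cdot> (on_ar (S (Suc n)) \<eta> \<cdot> h ?F)"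
      unfolding nS using a bS h1(1-3) F e by simp
    finally show ?thesis
      by (rule mono_cancel[OF bdS_mono(1)[OF F(2) se(2) refl], rotated -1]) (use bS h1 h2 F e in simp_all)
  qed
  define \<psi>' where "\<psi>' = NTrans (T (Suc n)) (S (Suc n)) (restrict h (Ob B))"
  have "is_ntrans B A \<psi>'" unfolding \<psi>'_def
    by (rule is_ntransI[OF B.category_axioms TF SF]) (use h hn in simp_all)
  then have "\<psi>' \<in> Hom (fun_cat B A) (T (Suc n)) (S (Suc n))" by (simp add: \<psi>'_def)
  moreover have "nt_at \<psi> (Dom B f) \<cdot> bdT n f g = bdS n f g \<cdot> nt_at \<psi>' (Cod B g)" if se: "short_exact B f g" for f g
  proof -
    let ?F = "Cod B f" and ?G = "Cod B g"
    note fg = short_exact_Ar[OF B.category_axioms se]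
    note seG = cover(1)[OF fg(6)] and kG = short_exact_Ar[OF B.category_axioms cover(1)[OF fg(6)]]
    let ?e = "g \<cdot>\<^bsub>B\<^esub> \<epsilon> ?F"
    obtain k where sk: "short_exact B k ?e" using cover_comp[OF se] fg by auto
    note k = short_exact_Ar[OF B.category_axioms sk]
    have e: "Cod B ?e = ?G" "Dom B ?e = Dom B (\<epsilon> ?F)" "Cod B k = Dom B (\<epsilon> ?F)" using fg k(3) by simp_all
    have "g \<cdot>\<^bsub>B\<^esub> (\<epsilon> ?F \<cdot>\<^bsub>B\<^esub> k) = Null B (Dom B k) ?G" using k fg e by simp
    then obtain a where a: "a \<in> Ar B" "Dom B a = Dom B k" "Cod B a = Dom B f" "f \<cdot>\<^bsub>B\<^esub> a = \<epsilon> ?F \<cdot>\<^bsub>B\<^esub> k"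
      using kernel_lift[OF se, of "\<epsilon> ?F \<cdot>\<^bsub>B\<^esub> k"] k fg e by auto
    obtain b where b: "b \<in> Ar B" "Dom B b = Dom B (\<epsilon> ?F)" "Cod B b = Dom B (\<epsilon> ?G)" "\<epsilon> ?G \<cdot>\<^bsub>B\<^esub> b = ?e"
      using cover_map[OF fg(2)] fg by auto
    have "\<epsilon> ?G \<cdot>\<^bsub>B\<^esub> (b \<cdot>\<^bsub>B\<^esub> k) = Null B (Dom B k) ?G"
      using B.Cmp_extend[OF b(4), of k] b(1-3) k fg e by simp
    then obtain c where c: "c \<in> Ar B" "Dom B c = Dom B k" "Cod B c = Dom B (\<kappa> ?G)" "\<kappa> ?G \<cdot>\<^bsub>B\<^esub> c = b \<cdot>\<^bsub>B\<^esub> k"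
      using kernel_lift[OF seG, of "b \<cdot>\<^bsub>B\<^esub> k"] b(1-3) fg k e by auto
    have sq1: "a \<in> Hom B (Dom B k) (Dom B f)" "\<epsilon> ?F \<in> Hom B (Cod B k) (Cod B f)"
      "Idn B ?G \<in> Hom B (Cod B ?e) (Cod B g)" "\<epsilon> ?F \<cdot>\<^bsub>B\<^esub> k = f \<cdot>\<^bsub>B\<^esub> a" "Idn B ?G \<cdot>\<^bsub>B\<^esub> ?e = g \<cdot>\<^bsub>B\<^esub> \<epsilon> ?F"
      using a fg k e by simp_all
    have sq2: "c \<in> Hom B (Dom B k) (Dom B (\<kappa> ?G))" "b \<in> Hom B (Cod B k) (Cod B (\<kappa> ?G))"
      "Idn B ?G \<in> Hom B (Cod B ?e) (Cod B (\<epsilon> ?G))" "b \<cdot>\<^bsub>B\<^esub> k = \<kappa> ?G \<cdot>\<^bsub>B\<^esub> c" "Idn B ?G \<cdot>\<^bsub>B\<^esub> ?e = \<epsilon> ?G \<cdot>\<^bsub>B\<^esub> b"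
      using b c fg k e by simp_all
    note bT = delta_functor_bd[OF T se, of n] delta_functor_bd[OF T sk, of n, unfolded e(1)] delta_functor_bd[OF T seG, of n]
    note bS = delta_functor_bd[OF S se, of n] delta_functor_bd[OF S sk, of n, unfolded e(1)] delta_functor_bd[OF S seG, of n]
    have T1: "on_ar (T n) a \<cdot> bdT n k ?e = bdT n f g"
      using delta_functor_natural[OF T sk se sq1, of n] bT fg by simp
    have S1: "on_ar (S n) a \<cdot> bdS n k ?e = bdS n f g"
      using delta_functor_natural[OF S sk se sq1, of n] bS fg by simp
    have T2: "on_ar (T n) c \<cdot> bdT n k ?e = bdT n (\<kappa> ?G) (\<epsilon> ?G)"
      using delta_functor_natural[OF T sk seG sq2, of n] bT fg by simp
    have S2: "on_ar (S n) c \<cdot> bdS n k ?e = bdS n (\<kappa> ?G) (\<epsilon> ?G)"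
      using delta_functor_natural[OF S sk seG sq2, of n] bS fg by simp
    note pk = pa[OF k(4)] and hG = h[OF fg(6)]
    have K: "is_kernel A (on_ar (S n) k) (bdS n k ?e)" by (rule bdS_mono(2)[OF fg(5) sk e(2)])
    \<comment> \<open>\<open>v\<close> is the component at the quotient as computed from the
      intermediate sequence. Comparison with the cover of the quotient along \<open>c\<close> shows
      that it equals \<open>h\<close>; comparison with \<open>(f, g)\<close> along \<open>a\<close>
      then gives the claim.\<close>
    define v where "v = lift_ar A (bdS n k ?e) (nt_at \<psi> (Dom B k) \<cdot> bdT n k ?e)"
    have v: "v \<in> Ar A" "Dom A v = on_ob (T (Suc n)) ?G" "Cod A v = on_ob (S (Suc n)) ?G"
      "bdS n k ?e \<cdot> v = nt_at \<psi> (Dom B k) \<cdot> bdT n k ?e"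
      using lift_ar[OF K, of "nt_at \<psi> (Dom B k) \<cdot> bdT n k ?e"] z[OF sk] bT bS pk k e(1) by (simp_all add: v_def)
    have "bdS n (\<kappa> ?G) (\<epsilon> ?G) \<cdot> v = on_ar (S n) c \<cdot> (nt_at \<psi> (Dom B k) \<cdot> bdT n k ?e)"
      unfolding S2[symmetric] v(4)[symmetric] using v(1-3) bS c k by simp
    also have "\<dots> = nt_at \<psi> (Dom B (\<kappa> ?G)) \<cdot> (on_ar (T n) c \<cdot> bdT n k ?e)"
      using Cmp_extend[OF pn[OF c(1)], of "bdT n k ?e"] pk pa[OF kG(4)] bT c k by simp
    also have "\<dots> = bdS n (\<kappa> ?G) (\<epsilon> ?G) \<cdot> h ?G" unfolding T2 hG(4) ..
    finally have vh: "v = h ?G"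
      by (rule mono_cancel[OF bdS_mono(1)[OF fg(6) seG refl], rotated -1]) (use v hG bS fg in simp_all)
    have "nt_at \<psi> (Dom B f) \<cdot> bdT n f g = nt_at \<psi> (Dom B f) \<cdot> (on_ar (T n) a \<cdot> bdT n k ?e)" unfolding T1 ..
    also have "\<dots> = on_ar (S n) a \<cdot> (nt_at \<psi> (Dom B k) \<cdot> bdT n k ?e)"
      using Cmp_extend[OF pn[OF a(1)], of "bdT n k ?e"] pk pa[OF fg(4)] bT a k by simp
    also have "\<dots> = bdS n f g \<cdot> h ?G"
      unfolding S1[symmetric] v(4)[symmetric] vh using hG(1-3) bS a k by simp
    finally show ?thesis using fg by (simp add: \<psi>'_def)
  qed
  ultimately show ?thesis using that by blast
qed

theorem universal_delta_functor_isomorphic: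
  assumes T: "universal_delta_functor B A T bdT"
    and \<phi>0: "\<phi>0 \<in> Hom (fun_cat B A) (S 0) (T 0)" and \<psi>0: "\<psi>0 \<in> Hom (fun_cat B A) (T 0) (S 0)"
    and inv: "\<And>F. F \<in> Ob B \<Longrightarrow> nt_at \<psi>0 F \<cdot> nt_at \<phi>0 F = Idn A (on_ob (S 0) F)"
      "\<And>F. F \<in> Ob B \<Longrightarrow> nt_at \<phi>0 F \<cdot> nt_at \<psi>0 F = Idn A (on_ob (T 0) F)"
    and F: "F \<in> Ob B"
  shows "isomorphic A (on_ob (S n) F) (on_ob (T n) F)"
proof -
  have Th: "homological_delta_functor B A T bdT" using T by (simp add: universal_delta_functor_def)
  note TF = delta_functor_additive[OF Th] and SF = delta_functor_additive[OF S]
  note T_simps [simp] = functor_simps[OF TF]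
  interpret FB: functor_category A B by unfold_locales
  obtain \<phi> where \<phi>: "\<phi> 0 = \<phi>0" "delta_morphism B A S bdS T bdT \<phi>"
    using T S \<phi>0 unfolding universal_delta_functor_def by blast
  \<comment> \<open>The components are chosen successively, since
    \<open>extend_transformation\<close> produces each one from its predecessor.\<close>
  have "\<exists>\<psi>. \<forall>n. (\<psi> n \<in> Hom (fun_cat B A) (T n) (S n) \<and> (n = 0 \<longrightarrow> \<psi> n = \<psi>0)) \<and>
    (\<forall>f g. short_exact B f g \<longrightarrow> nt_at (\<psi> n) (Dom B f) \<cdot> bdT n f g = bdS n f g \<cdot> nt_at (\<psi> (Suc n)) (Cod B g))"
  proof (rule dependent_nat_choice)
    show "\<exists>x. x \<in> Hom (fun_cat B A) (T 0) (S 0) \<and> (0 = (0::nat) \<longrightarrow> x = \<psi>0)" using \<psi>0 by blast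
    fix x n assume "x \<in> Hom (fun_cat B A) (T n) (S n) \<and> (n = 0 \<longrightarrow> x = \<psi>0)"
    then have x: "x \<in> Hom (fun_cat B A) (T n) (S n)" by blast
    show "\<exists>y. (y \<in> Hom (fun_cat B A) (T (Suc n)) (S (Suc n)) \<and> (Suc n = 0 \<longrightarrow> y = \<psi>0)) \<and>
      (\<forall>f g. short_exact B f g \<longrightarrow> nt_at x (Dom B f) \<cdot> bdT n f g = bdS n f g \<cdot> nt_at y (Cod B g))"
      using extend_transformation[OF Th x] by (metis Suc_not_Zero)
  qed
  then obtain \<psi> where \<psi>: "\<And>n. \<psi> n \<in> Hom (fun_cat B A) (T n) (S n)" "\<psi> 0 = \<psi>0"
    and \<psi>b: "\<And>n f g. short_exact B f g \<Longrightarrow> nt_at (\<psi> n) (Dom B f) \<cdot> bdT n f g = bdS n f g \<cdot> nt_at (\<psi> (Suc n)) (Cod B g)"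
    by blast
  have \<phi>n: "\<phi> n \<in> Hom (fun_cat B A) (S n) (T n)" for n using \<phi>(2) unfolding delta_morphism_def by blast
  have \<phi>b: "nt_at (\<phi> n) (Dom B f) \<cdot> bdS n f g = bdT n f g \<cdot> nt_at (\<phi> (Suc n)) (Cod B g)" if "short_exact B f g" for n f g
    using \<phi>(2) that unfolding delta_morphism_def by blast
  have pa: "nt_at (\<psi> n) G \<in> Ar A" "Dom A (nt_at (\<psi> n) G) = on_ob (T n) G" "Cod A (nt_at (\<psi> n) G) = on_ob (S n) G"
    "nt_at (\<phi> n) G \<in> Ar A" "Dom A (nt_at (\<phi> n) G) = on_ob (S n) G" "Cod A (nt_at (\<phi> n) G) = on_ob (T n) G"
    if "G \<in> Ob B" for n G
    using \<psi>(1)[of n] \<phi>n[of n] ntrans_simps(3-5)[of B A "\<psi> n" G] ntrans_simps(3-5)[of B A "\<phi> n" G] that by auto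
  \<comment> \<open>This composite is an endomorphism of the universal functor that is the identity
    in degree zero, so uniqueness makes it the identity in all degrees.\<close>
  define \<chi> where "\<chi> n = \<phi> n \<cdot>\<^bsub>fun_cat B A\<^esub> \<psi> n" for n
  have c0: "\<chi> 0 = Idn (fun_cat B A) (T 0)"
    using \<psi>(1)[of 0] \<phi>n[of 0] TF[of 0] inv(2)
    by (intro ntrans_eqI[of B A]) (simp_all add: \<chi>_def \<phi>(1) \<psi>(2))
  have c1: "delta_morphism B A T bdT T bdT \<chi>"
    unfolding delta_morphism_def
  proof (intro conjI allI impI)
    show "\<chi> n \<in> Hom (fun_cat B A) (T n) (T n)" for n using \<psi>(1)[of n] \<phi>n[of n] by (simp add: \<chi>_def)
    fix n f g assume se: "short_exact B f g"
    note fg = short_exact_Ar[OF B.category_axioms se] and b = delta_functor_bd[OF Th se, of n] delta_functor_bd[OF S se, of n]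
    have "nt_at (\<phi> n) (Dom B f) \<cdot> (nt_at (\<psi> n) (Dom B f) \<cdot> bdT n f g) = bdT n f g \<cdot> (nt_at (\<phi> (Suc n)) (Cod B g) \<cdot> nt_at (\<psi> (Suc n)) (Cod B g))"
      unfolding \<psi>b[OF se] using Cmp_extend[OF \<phi>b[OF se, of n], of "nt_at (\<psi> (Suc n)) (Cod B g)"] b pa[OF fg(4)] pa[OF fg(6)] by simp
    then show "nt_at (\<chi> n) (Dom B f) \<cdot> bdT n f g = bdT n f g \<cdot> nt_at (\<chi> (Suc n)) (Cod B g)"
      using fg b pa[OF fg(4)] by (simp add: \<chi>_def)
  qed
  have i1: "delta_morphism B A T bdT T bdT (\<lambda>n. Idn (fun_cat B A) (T n))"
    unfolding delta_morphism_def
  proof (intro conjI allI impI)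
    show "Idn (fun_cat B A) (T n) \<in> Hom (fun_cat B A) (T n) (T n)" for n using TF[of n] by simp
    fix n f g assume se: "short_exact B f g"
    show "nt_at (Idn (fun_cat B A) (T n)) (Dom B f) \<cdot> bdT n f g = bdT n f g \<cdot> nt_at (Idn (fun_cat B A) (T (Suc n))) (Cod B g)"
      using short_exact_Ar[OF B.category_axioms se] delta_functor_bd[OF Th se, of n] by simp
  qed
  have ex: "\<exists>!\<xi>. \<xi> 0 = Idn (fun_cat B A) (T 0) \<and> delta_morphism B A T bdT T bdT \<xi>"
  proof -
    have "Idn (fun_cat B A) (T 0) \<in> Hom (fun_cat B A) (T 0) (T 0)" using TF[of 0] by simp
    then show ?thesis
      by (rule bspec[OF mp[OF spec[OF spec[OF conjunct2[OF T[unfolded universal_delta_functor_def]]]] Th]])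
  qed
  have "\<chi> = (\<lambda>n. Idn (fun_cat B A) (T n))"
    by (rule ex1_unique_eq[where P = "\<lambda>\<xi>. \<xi> 0 = Idn (fun_cat B A) (T 0) \<and> delta_morphism B A T bdT T bdT \<xi>", OF ex])
      (use c0 c1 i1 in blast)+
  from fun_cong[OF this, of n] have "\<chi> n = Idn (fun_cat B A) (T n)" by simp
  from arg_cong[OF this, of "\<lambda>t. nt_at t F"] have 1: "nt_at (\<phi> n) F \<cdot> nt_at (\<psi> n) F = Idn A (on_ob (T n) F)"
    using F by (simp add: \<chi>_def)
  \<comment> \<open>For \<open>S\<close> no uniqueness statement is at hand; the other composite is
    treated by induction on the degree, cancelling the monic connecting arrow of the covering
    sequence.\<close>
  have 2: "nt_at (\<psi> n) G \<cdot> nt_at (\<phi> n) G = Idn A (on_ob (S n) G)" if "G \<in> Ob B" for G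
    using that
  proof (induction n arbitrary: G)
    case 0
    then show ?case using inv(1) by (simp add: \<phi>(1) \<psi>(2))
  next
    case (Suc n)
    note G = Suc.prems and se = cover(1)[OF Suc.prems]
    note k = short_exact_Ar[OF B.category_axioms se] and b = delta_functor_bd[OF Th se, of n] delta_functor_bd[OF S se, of n]
    let ?k = "\<kappa> G" and ?e = "\<epsilon> G"
    have s: "nt_at (\<phi> n) (Dom B ?k) \<cdot> bdS n ?k ?e = bdT n ?k ?e \<cdot> nt_at (\<phi> (Suc n)) G"
      "nt_at (\<psi> n) (Dom B ?k) \<cdot> bdT n ?k ?e = bdS n ?k ?e \<cdot> nt_at (\<psi> (Suc n)) G"
      using \<phi>b[OF se, of n] \<psi>b[OF se, of n] G by simp_all
    have "bdS n ?k ?e \<cdot> (nt_at (\<psi> (Suc n)) G \<cdot> nt_at (\<phi> (Suc n)) G) = nt_at (\<psi> n) (Dom B ?k) \<cdot> (bdT n ?k ?e \<cdot> nt_at (\<phi> (Suc n)) G)"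
      using Cmp_extend[OF s(2), of "nt_at (\<phi> (Suc n)) G"] b pa[OF k(4)] pa[OF G] G by simp
    also have "\<dots> = bdS n ?k ?e"
      unfolding s(1)[symmetric] using Cmp_extend[OF Suc.IH[OF k(4)], of "bdS n ?k ?e"] b pa[OF k(4)] G by simp
    finally show ?case
      using mono_cancel[OF bdS_mono(1)[OF G se refl], of "nt_at (\<psi> (Suc n)) G \<cdot> nt_at (\<phi> (Suc n)) G" "Idn A (on_ob (S (Suc n)) G)" n]
        b pa[OF G] G by simp
  qed
  show ?thesis unfolding isomorphic_def using 1 2[OF F] pa[OF F] by (intro bexI[of _ "nt_at (\<phi> n) F"] bexI[of _ "nt_at (\<psi> n) F"]) simp_all
qed

end

section \<open>Application to normalized homology\<close>

context functor_category
begin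

lemma short_exact_ker_nt:
  assumes "is_ntrans S A e" "\<And>x. x \<in> Ob S \<Longrightarrow> epi_ar A (nt_at e x)"
  shows "short_exact B (ker_nt e) e"
  unfolding short_exact_pointwise
  using assms ker_nt[OF assms(1)] epi_cokernel_of_kernel[OF assms(2)] by (simp add: short_exact_def)

end

context cubical_cover
begin

lemma effaceable_norm_homology: "effaceable_delta_functor A B CN.HF CN.bd (\<lambda>F. ker_nt (counit F)) counit"
proof
  show "homological_delta_functor B A CN.HF CN.bd" by (rule CN.homological_delta_functor_HF)
  show "f \<cdot>\<^bsub>B\<^esub> Null B x (Dom B f) = Null B x (Cod B f)" if "f \<in> Ar B" "x \<in> Ob B" for f x
    by (rule ntrans_eqI[of "op_cat Box" A]) (use that in simp_all)
  show "short_exact B (ker_nt (counit F)) (counit F)" if "F \<in> Ob B" for F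
    by (rule short_exact_ker_nt) (use that counit_epi in simp_all)
  show "Cod B (counit F) = F" for F by simp
  show "\<exists>b. b \<in> Hom B (Dom B (counit (Dom B f))) (Dom B (counit (Cod B f))) \<and>
      counit (Cod B f) \<cdot>\<^bsub>B\<^esub> b = f \<cdot>\<^bsub>B\<^esub> counit (Dom B f)" if "f \<in> Ar B" for f
    using that counit_natural[of f] by (intro exI[of _ "P_map f"]) simp
  show "\<exists>k. short_exact B k (g \<cdot>\<^bsub>B\<^esub> counit (Dom B g))" if se: "short_exact B f g" for f g
  proof -
    have g: "is_ntrans (op_cat Box) A g" and c: "\<And>x. is_cokernel A (nt_at f x) (nt_at g x)"
      using se unfolding short_exact_pointwise by (simp_all add: short_exact_def)
    have F: "cub (nt_dom g)" using g by simp
    have "epi_ar A (nt_at (g \<cdot>\<^bsub>B\<^esub> counit (nt_dom g)) x)" for x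
      using epi_Cmp[OF counit_epi[OF F, of x] cokernel_epi[OF c, of x]] counit_at(3)[OF F, of x] g by simp
    then have "short_exact B (ker_nt (g \<cdot>\<^bsub>B\<^esub> counit (nt_dom g))) (g \<cdot>\<^bsub>B\<^esub> counit (nt_dom g))"
      using g F by (intro short_exact_ker_nt) simp_all
    then show ?thesis by auto
  qed
  show "Idn A (on_ob (CN.HF (Suc n)) (Dom B (counit F)))
      = Null A (on_ob (CN.HF (Suc n)) (Dom B (counit F))) (on_ob (CN.HF (Suc n)) (Dom B (counit F)))"
    if "F \<in> Ob B" for F n
    using PF_acyclic[of F n] that by simp
qed

theorem norm_homology_isomorphic_satellite:
  assumes "left_satellites_of_colimit (op_cat Box) A T bd" "cub F"
  shows "isomorphic A (norm_homology A F k) (on_ob (T k) F)"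
proof -
  interpret E: effaceable_delta_functor A B CN.HF CN.bd "\<lambda>F. ker_nt (counit F)" counit
    by (rule effaceable_norm_homology)
  have T: "is_colimit_functor (op_cat Box) A (T 0)" "universal_delta_functor B A T bd"
    using assms(1) by (auto simp: left_satellites_of_colimit_def)
  obtain \<phi> \<psi> where "\<phi> \<in> Hom (fun_cat B A) (CN.HF 0) (T 0)" "\<psi> \<in> Hom (fun_cat B A) (T 0) (CN.HF 0)"
    "\<And>F. cub F \<Longrightarrow> nt_at \<psi> F \<cdot> nt_at \<phi> F = Idn A (on_ob (CN.HF 0) F)"
    "\<And>F. cub F \<Longrightarrow> nt_at \<phi> F \<cdot> nt_at \<psi> F = Idn A (on_ob (T 0) F)"
    using colimit_functor_unique[OF HF_0_colimit_functor T(1)] by blast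
  then have "isomorphic A (on_ob (CN.HF k) F) (on_ob (T k) F)"
    by (intro E.universal_delta_functor_isomorphic[OF T(2), of \<phi> \<psi>]) (use assms(2) in simp_all)
  then show ?thesis using assms(2) H_eq_norm_homology by simp
qed

end

lemma coproduct_reindex:
  assumes g: "inj_on g J" and c: "is_coproduct A (g ` J) (\<lambda>i. X (inv_into J g i)) c \<iota>"
  shows "is_coproduct A J X c (\<lambda>j. \<iota> (g j))"
  unfolding is_coproduct_def
proof (intro conjI ballI allI impI)
  show "c \<in> Ob A" using c by (simp add: is_coproduct_def)
  show "\<iota> (g j) \<in> Hom A (X j) c" if "j \<in> J" for j
  proof -
    have "\<iota> (g j) \<in> Hom A (X (inv_into J g (g j))) c" using c that unfolding is_coproduct_def by blast
    then show ?thesis unfolding inv_into_f_f[OF g that] .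
  qed
  fix y h assume y: "y \<in> Ob A" and h: "\<forall>j\<in>J. h j \<in> Hom A (X j) y"
  have "\<forall>i\<in>g ` J. h (inv_into J g i) \<in> Hom A (X (inv_into J g i)) y"
    using h inv_into_into[of _ g J] by blast
  from mp[OF spec[OF bspec[OF conjunct2[OF conjunct2[OF c[unfolded is_coproduct_def]]] y], of "\<lambda>i. h (inv_into J g i)"] this]
  have "\<exists>!u. u \<in> Hom A c y \<and> (\<forall>i\<in>g ` J. u \<cdot>\<^bsub>A\<^esub> \<iota> i = h (inv_into J g i))" .
  moreover have "(\<forall>i\<in>g ` J. u \<cdot>\<^bsub>A\<^esub> \<iota> i = h (inv_into J g i)) \<longleftrightarrow> (\<forall>j\<in>J. u \<cdot>\<^bsub>A\<^esub> \<iota> (g j) = h j)" for u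
    using inv_into_f_f[OF g] by simp
  ultimately show "\<exists>!u. u \<in> Hom A c y \<and> (\<forall>j\<in>J. u \<cdot>\<^bsub>A\<^esub> \<iota> (g j) = h j)" by simp
qed

text \<open>The index set \<open>J\<close> need not live in the type \<open>'i\<close>. As
  \<open>J\<close> is countable and \<open>'i\<close> infinite, \<open>J\<close> embeds into
  \<open>'i\<close>, and the coproduct over its image is reindexed back.\<close>

lemma AB4_countable_coproduct:
  assumes "infinite (UNIV :: 'i set)" "AB4_category A TYPE('i)" "countable J" "X ` J \<subseteq> Ob A"
  shows "\<exists>c \<iota>. is_coproduct A J X c \<iota>"
proof -
  obtain e :: "nat \<Rightarrow> 'i" where e: "inj e" using infinite_countable_subset[OF assms(1)] by blast
  define g where "g = e \<circ> to_nat_on J"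
  have g: "inj_on g J"
    unfolding g_def using comp_inj_on[OF inj_on_to_nat_on[OF assms(3)]] e by (meson inj_on_subset subset_UNIV)
  have "(\<lambda>i. X (inv_into J g i)) ` g ` J \<subseteq> Ob A" using assms(4) inv_into_f_f[OF g] by auto
  then obtain c \<iota> where "is_coproduct A (g ` J) (\<lambda>i. X (inv_into J g i)) c \<iota>"
    using assms(2) unfolding AB4_category_def by meson
  from coproduct_reindex[OF g this] show ?thesis by blast
qed

theorem theorem4p5:
  fixes A :: "('o, 'm) addcat"
    and F :: "(nat, box_ar, 'o, 'm) fctr"
    and T :: "nat \<Rightarrow> ((nat, box_ar, 'o, 'm) fctr, (nat, box_ar, 'o, 'm) ntrans, 'o, 'm) fctr"
    and bd :: "nat \<Rightarrow> (nat, box_ar, 'o, 'm) ntrans \<Rightarrow> (nat, box_ar, 'o, 'm) ntrans \<Rightarrow> 'm"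
  assumes "infinite (UNIV :: 'i set)"
    and "AB4_category A TYPE('i)"
    and "left_satellites_of_colimit (op_cat Box) A T bd"
    and "is_functor (op_cat Box) A F"
  shows "\<forall>k. isomorphic A (norm_homology A F k) (on_ob (T k) F)"
proof -
  interpret abelian_category A using assms(2) by (simp add: AB4_category_def)
  interpret op: category "op_cat Box" by (rule category_op_Box)
  interpret cubical_cover A
  proof unfold_locales
    show "\<exists>c \<iota>. is_coproduct A I X c \<iota>" if "finite I" "X ` I \<subseteq> Ob A" for I :: "nat set" and X
      by (rule AB4_countable_coproduct[OF assms(1,2)]) (use that in \<open>simp_all add: countable_finite\<close>)
    show "\<exists>c \<iota>. is_coproduct A I X c \<iota>" if "I \<subseteq> box_arrows" "X ` I \<subseteq> Ob A" for I :: "box_ar set" and X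
      by (rule AB4_countable_coproduct[OF assms(1,2) countable_subset[OF that(1) countable_box_arrows] that(2)])
  qed
  show ?thesis using norm_homology_isomorphic_satellite[OF assms(3,4)] by blast
qed

end
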